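(* Let $\Psi$ be a complement map on a lattice $N$, let $\mu_0^\Psi$ denote the Pommersheim–Thomas (nonequivariant) cycle Todd class coefficients attached to $\Psi$, and let $\mu^\Psi$ be the Garoufalidis–Pommersheim SI-interpolator attached to $\Psi$. Let $\sigma$ be a ($\Psi$-generic) cone in $N$ and let $\check\sigma$ be its dual cone in $M$. Then $$\mu_0^\Psi(\sigma)=\mu^\Psi(\check\sigma)(0).$$
   Context: Setting. $N$ is a lattice, $M=\mathrm{Hom}(N,\mathbb Z)$, $\langle\ ,\ \rangle$ is the natural pairing, and a subscript $\mathbb Q$ denotes $\otimes\,\mathbb Q$. Cones in $N$ are rational, strongly convex polyhedral cones, and fans are finite. For a cone $\sigma$, $N_\sigma=N\cap\mathrm{span}(\sigma)$, $N(\sigma)=N/N_\sigma$, $M(\sigma)=M\cap\sigma^\perp$ and $M_\sigma=M/M(\sigma)=\mathrm{Hom}(N_\sigma,\mathbb Z)$. $\tau\to\sigma$ means $\sigma$ is a codimension one face of $\tau$; then $n_{\tau,\sigma}\in N(\sigma)$ is the primitive generator of the image of $\tau$ in $N(\sigma)$. A cone is nonsingular if it is generated by part of a basis of $N$; a fan is nonsingular if all its cones are. Complement maps. Let $\mathcal L$ be a set of $\mathbb Q$-subspaces of $N_{\mathbb Q}$ containing $N_{\mathbb Q}$. A complement map $\Psi$ assigns to each pair $L_1\subset L_2$ in $\mathcal L$ a linear section $i^\Psi:L_1^*\to L_2^*$ of the restriction map $L_2^*\to L_1^*$, transitively with respect to chains $L_1\subset L_2\subset L_3$. A fan is $\Psi$-generic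 if $N_{\sigma,\mathbb Q}\in\mathcal L$ for all its cones $\sigma$; a cone is $\Psi$-generic if the fan of all its faces is. For $d\in M_{\sigma,\mathbb Q}$, $d^\Psi\in M_{\mathbb Q}$ is its image under $i^\Psi:M_{\sigma,\mathbb Q}\to M_{\mathbb Q}$. Standing assumption: $\Psi$-generic cones and fans admit subdivisions into nonsingular $\Psi$-generic cones (resp. a refinement by a nonsingular $\Psi$-generic fan). If $\sigma$ is $\Psi$-generic, $\overline\Psi$ denotes the induced complement map on $N_\sigma$ (restrict to those $L\in\mathcal L$ with $L\subset N_{\sigma,\mathbb Q}$). Definition of $\mu_0^\Psi$. For a nonsingular $\Psi$-generic fan $\Sigma$ with rays $\rho_1,\dots,\rho_s$ and primitive generators $n_1,\dots,n_s$, let $Z$ be the $\mathbb Q$-vector space with basis $V(\sigma)$, $\sigma\in\Sigma$. For each $i$ and $\sigma\in\Sigma$ let $d_\sigma\in M_\sigma$ be determined by $\langle d_\sigma,n_j\rangle=\delta_{ij}$ for all $n_j\in\sigma$, and let $D_i$ act on $Z$ by $D_i\odot V(\sigma)=\sum_{\tau\to\sigma}\langle d_\tau-d_\sigma^\Psi,n_{\tau,\sigma}\rangle V(\tau)$ ($d_\tau-d_\sigma^\Psi$ being regarded as an element of $M(\sigma)_{\mathbb Q}$ modulo $M(\tau)_{\mathbb Q}$). These nilpotent operators commute, and $\mu_0^\Psi(\sigma)\in\mathbb Q$ is defined by $\prod_{i=1}^s\frac{D_i}{1-e^{-D_i}}\odot V(\{0\})=\sum_{\sigma\in\Sigma}\mu_0^\Psi(\sigma)V(\sigma)$;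 it depends only on $\sigma$ and $\Psi$. For an arbitrary $\Psi$-generic cone, $\mu_0^\Psi(\sigma)=\sum_i\mu_0^\Psi(\sigma_i)$ for any subdivision of $\sigma$ into $\Psi$-generic nonsingular cones $\sigma_i$ of the same dimension intersecting only along boundaries (the sum does not depend on the subdivision). Exponential sums and integrals. For a rational polyhedron $P$ in $M_{\mathbb R}$, $S(P)$ and $I(P)$ are meromorphic functions on $N\otimes\mathbb C$: both are $0$ if $P$ contains a line; otherwise they are the meromorphic continuations of $S(P)(\xi)=\sum_{x\in P\cap M}e^{\langle\xi,x\rangle}$ and $I(P)(\xi)=\int_Pe^{\langle\xi,x\rangle}dx$ from the nonempty open set of $\xi$ where these converge absolutely. Here $dx$ is Lebesgue measure on the affine span of $P$, normalized by the lattice of integer points of the parallel linear subspace. Definition of $\mu^\Psi$ (restricted to dual cones $\check\sigma=\{m\in M_{\mathbb R}:\langle m,v\rangle\ge0\ \forall v\in\sigma\}$ with $\sigma$ $\Psi$-generic). It is the unique assignment, for all lattices with complement map, of meromorphic functions on $N\otimes\mathbb C$ such that: (i) (SI-interpolation) if $\sigma$ is full-dimensional in $N$ and $K=\check\sigma$, then $S(K)=\sum_{\tau}\mu^\Psi(\check\tau)\,I(K\cap\tau^\perp)$, the sum being over all faces $\tau$ of $\sigma$ (including $\{0\}$ and $\sigma$); (ii) ($\Psi$-hereditary) if $\sigma_0$ denotes $\sigma$ viewed as a cone in $N_\sigma$ and $\check\sigma_0\subset M_{\sigma,\mathbb R}$ its dual, then $\mu^\Psi(\check\sigma)=i^\Psi(\mu^{\overline\Psi}(\check\sigma_0))$,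 where $i^\Psi$ transports functions on $N_\sigma\otimes\mathbb C$ to functions on $N\otimes\mathbb C$ by composition with the projection $N_{\mathbb Q}\to N_{\sigma,\mathbb Q}$ dual to $i^\Psi:M_{\sigma,\mathbb Q}\to M_{\mathbb Q}$. (These conditions determine $\mu^\Psi$ recursively on $\dim\sigma$.) These functions are regular at $0$. *)

theory Defs
  imports
    "HOL-Analysis.Analysis"
    "HOL-Library.Function_Algebras"
    "HOL-Computational_Algebra.Formal_Power_Series"
begin

section \<open>Lattices and their duals\<close>

text \<open>
  Linear functionals are plain functions.  The pointwise vector space structure makes
  \<^const>\<open>span\<close>, \<^const>\<open>independent\<close> etc. available for sets of functionals.
\<close>

instantiation "fun" :: (type, real_vector) real_vector
begin

definition scaleR_fun :: "real \<Rightarrow> ('a \<Rightarrow> 'b) \<Rightarrow> 'a \<Rightarrow> 'b"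
  where "scaleR_fun c f = (\<lambda>x. c *\<^sub>R f x)"

instance
  by standard (auto simp: scaleR_fun_def fun_eq_iff algebra_simps)

end

definition lattice_basis :: "'v::real_vector set \<Rightarrow> 'v set \<Rightarrow> bool"
  where "lattice_basis B N \<longleftrightarrow>
    finite B \<and> independent B \<and> N = range (\<lambda>c :: 'v \<Rightarrow> int. \<Sum>b\<in>B. of_int (c b) *\<^sub>R b)"

text \<open>
  A lattice is a subgroup \<open>N\<close> of some ambient real vector space that is generated by finitely
  many linearly independent vectors; its rank may be smaller than the ambient dimension.
  Every free abelian group of finite rank arises in this way.  The ambient space only serves
  to realise \<open>N\<close> and its sublattices \<open>N\<^sub>\<sigma>\<close> inside one type; neither its inner product nor
  vectors outside \<open>span N\<close> play any role.
\<close>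

definition is_lattice :: "'v::real_vector set \<Rightarrow> bool"
  where "is_lattice N \<longleftrightarrow> (\<exists>B. lattice_basis B N)"

text \<open>The base changes of \<open>N\<close> to \<open>\<rat>\<close>, \<open>\<real>\<close> (as subsets of the ambient space) and to \<open>\<complex>\<close>,
  where a pair \<open>(a, b)\<close> stands for \<open>a + \<i>b\<close>.\<close>

definition lat_Q :: "'v::real_vector set \<Rightarrow> 'v set"
  where "lat_Q N = {of_rat q *\<^sub>R x | q x. x \<in> N}"

abbreviation lat_R :: "'v::real_vector set \<Rightarrow> 'v set"
  where "lat_R N \<equiv> span N"

definition lat_C :: "'v::real_vector set \<Rightarrow> ('v \<times> 'v) set"
  where "lat_C N = lat_R N \<times> lat_R N"

text \<open>
  Functionals on a subspace are extended by \<open>0\<close> outside of it, so that each functional is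
  represented by exactly one function.  \<open>rat_dual L\<close> is \<open>Hom\<^sub>\<rat>(L, \<rat>)\<close> for a \<open>\<rat>\<close>-subspace \<open>L\<close>,
  \<open>real_dual W\<close> is \<open>Hom\<^sub>\<real>(W, \<real>)\<close> for a real subspace \<open>W\<close>.
\<close>

definition rat_subspace :: "'v::real_vector set \<Rightarrow> bool"
  where "rat_subspace L \<longleftrightarrow>
    0 \<in> L \<and> (\<forall>x\<in>L. \<forall>y\<in>L. x + y \<in> L) \<and> (\<forall>q::rat. \<forall>x\<in>L. of_rat q *\<^sub>R x \<in> L)"

definition rat_dual :: "'v::real_vector set \<Rightarrow> ('v \<Rightarrow> rat) set"
  where "rat_dual L = {f.
    (\<forall>x\<in>L. \<forall>y\<in>L. f (x + y) = f x + f y) \<and>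
    (\<forall>q. \<forall>x\<in>L. f (of_rat q *\<^sub>R x) = q * f x) \<and>
    (\<forall>x. x \<notin> L \<longrightarrow> f x = 0)}"

definition real_dual :: "'v::real_vector set \<Rightarrow> ('v \<Rightarrow> real) set"
  where "real_dual W = {f.
    (\<forall>x\<in>W. \<forall>y\<in>W. f (x + y) = f x + f y) \<and>
    (\<forall>c. \<forall>x\<in>W. f (c *\<^sub>R x) = c * f x) \<and>
    (\<forall>x. x \<notin> W \<longrightarrow> f x = 0)}"

text \<open>
  \<open>M = Hom(N, \<int>)\<close>, once inside \<open>M\<^sub>\<rat>\<close> (needed for the rational cycle calculus) and once
  inside \<open>M\<^sub>\<real>\<close> (needed for polyhedra, sums and integrals).
\<close>

definition dual_lat_in_Q :: "'v::real_vector set \<Rightarrow> ('v \<Rightarrow> rat) set"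
  where "dual_lat_in_Q N = {m \<in> rat_dual (lat_Q N). \<forall>x\<in>N. m x \<in> \<int>}"

definition dual_lat :: "'v::real_vector set \<Rightarrow> ('v \<Rightarrow> real) set"
  where "dual_lat N = {m \<in> real_dual (lat_R N). \<forall>x\<in>N. m x \<in> \<int>}"


section \<open>Cones and fans\<close>

definition sublat :: "'v::real_vector set \<Rightarrow> 'v set \<Rightarrow> 'v set"
  where "sublat N \<sigma> = N \<inter> span \<sigma>"

definition is_cone :: "'v::real_vector set \<Rightarrow> 'v set \<Rightarrow> bool"
  where "is_cone N \<sigma> \<longleftrightarrow>
    (\<exists>G. finite G \<and> G \<subseteq> N \<and> \<sigma> = convex_cone hull G) \<and> (\<forall>x. x \<in> \<sigma> \<and> - x \<in> \<sigma> \<longrightarrow> x = 0)"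

definition nonsingular_cone :: "'v::real_vector set \<Rightarrow> 'v set \<Rightarrow> bool"
  where "nonsingular_cone N \<sigma> \<longleftrightarrow> (\<exists>B G. lattice_basis B N \<and> G \<subseteq> B \<and> \<sigma> = convex_cone hull G)"

text \<open>The library's \<open>face_of\<close> admits the empty face, which is not a cone.\<close>

definition cone_faces :: "'v::real_vector set \<Rightarrow> 'v set set"
  where "cone_faces \<sigma> = {\<tau>. \<tau> face_of \<sigma> \<and> \<tau> \<noteq> {}}"

definition is_fan :: "'v::real_vector set \<Rightarrow> 'v set set \<Rightarrow> bool"
  where "is_fan N \<Sigma> \<longleftrightarrow>
    finite \<Sigma> \<and> \<Sigma> \<noteq> {} \<and>
    (\<forall>\<sigma>\<in>\<Sigma>. is_cone N \<sigma>) \<and>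
    (\<forall>\<sigma>\<in>\<Sigma>. cone_faces \<sigma> \<subseteq> \<Sigma>) \<and>
    (\<forall>\<sigma>\<in>\<Sigma>. \<forall>\<tau>\<in>\<Sigma>. \<sigma> \<inter> \<tau> \<in> cone_faces \<sigma> \<and> \<sigma> \<inter> \<tau> \<in> cone_faces \<tau>)"

text \<open>\<open>facet_of_cone \<sigma> \<tau>\<close> is \<open>\<tau> \<rightarrow> \<sigma>\<close>: the cone \<open>\<sigma>\<close> is a codimension one face of \<open>\<tau>\<close>.\<close>

definition facet_of_cone :: "'v::real_vector set \<Rightarrow> 'v set \<Rightarrow> bool"
  where "facet_of_cone \<sigma> \<tau> \<longleftrightarrow> \<sigma> \<in> cone_faces \<tau> \<and> dim \<tau> = dim \<sigma> + 1"

text \<open>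
  \<open>v \<in> N\<close> represents the primitive generator \<open>n\<^bsub>\<tau>,\<sigma>\<^esub>\<close> of the image of \<open>\<tau>\<close> in
  \<open>N(\<sigma>) = N / N\<^sub>\<sigma>\<close>: its class lies in the image of \<open>\<tau>\<close>, and it is primitive in \<open>N(\<sigma>)\<close>, i.e. only a
  \<open>\<plusminus>1\<close>-multiple of elements of \<open>N(\<sigma>)\<close> (the case \<open>k = 0\<close> says that the class is nonzero).
\<close>

definition primitive_rep :: "'v::real_vector set \<Rightarrow> 'v set \<Rightarrow> 'v set \<Rightarrow> 'v \<Rightarrow> bool"
  where "primitive_rep N \<tau> \<sigma> v \<longleftrightarrow>
    v \<in> N \<and> (\<exists>x\<in>\<tau>. v - x \<in> span \<sigma>) \<and>
    (\<forall>w\<in>N. \<forall>k::int. v - of_int k *\<^sub>R w \<in> span \<sigma> \<longrightarrow> \<bar>k\<bar> = 1)"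

definition prim_gen :: "'v::real_vector set \<Rightarrow> 'v set \<Rightarrow> 'v set \<Rightarrow> 'v"
  where "prim_gen N \<tau> \<sigma> = (SOME v. primitive_rep N \<tau> \<sigma> v)"

definition rays :: "'v::real_vector set set \<Rightarrow> 'v set set"
  where "rays \<Sigma> = {\<rho>\<in>\<Sigma>. dim \<rho> = 1}"

definition ray_gen :: "'v::real_vector set \<Rightarrow> 'v set \<Rightarrow> 'v"
  where "ray_gen N \<rho> = prim_gen N \<rho> {0}"


section \<open>Complement maps\<close>

text \<open>\<open>lift \<Psi> L\<^sub>1 L\<^sub>2\<close> is the map \<open>i\<^sup>\<Psi> : L\<^sub>1\<^sup>* \<rightarrow> L\<^sub>2\<^sup>*\<close>; it is only meaningful for
  \<open>L\<^sub>1 \<subseteq> L\<^sub>2\<close> in \<open>subspaces \<Psi>\<close> and on \<open>rat_dual L\<^sub>1\<close>.\<close>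

record 'v complement_map =
  subspaces :: "'v set set"
  lift :: "'v set \<Rightarrow> 'v set \<Rightarrow> ('v \<Rightarrow> rat) \<Rightarrow> 'v \<Rightarrow> rat"

definition is_complement_map :: "'v::real_vector set \<Rightarrow> 'v complement_map \<Rightarrow> bool"
  where "is_complement_map N \<Psi> \<longleftrightarrow>
    lat_Q N \<in> subspaces \<Psi> \<and>
    (\<forall>L\<in>subspaces \<Psi>. rat_subspace L \<and> L \<subseteq> lat_Q N) \<and>
    (\<forall>L1\<in>subspaces \<Psi>. \<forall>L2\<in>subspaces \<Psi>. L1 \<subseteq> L2 \<longrightarrow>
      (\<forall>f\<in>rat_dual L1. lift \<Psi> L1 L2 f \<in> rat_dual L2 \<and> (\<forall>x\<in>L1. lift \<Psi> L1 L2 f x = f x)) \<and>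
      (\<forall>f\<in>rat_dual L1. \<forall>g\<in>rat_dual L1.
        lift \<Psi> L1 L2 (\<lambda>x. f x + g x) = (\<lambda>x. lift \<Psi> L1 L2 f x + lift \<Psi> L1 L2 g x)) \<and>
      (\<forall>q. \<forall>f\<in>rat_dual L1. lift \<Psi> L1 L2 (\<lambda>x. q * f x) = (\<lambda>x. q * lift \<Psi> L1 L2 f x))) \<and>
    (\<forall>L1\<in>subspaces \<Psi>. \<forall>L2\<in>subspaces \<Psi>. \<forall>L3\<in>subspaces \<Psi>. L1 \<subseteq> L2 \<longrightarrow> L2 \<subseteq> L3 \<longrightarrow>
      (\<forall>f\<in>rat_dual L1. lift \<Psi> L2 L3 (lift \<Psi> L1 L2 f) = lift \<Psi> L1 L3 f))"

definition generic_fan :: "'v::real_vector set \<Rightarrow> 'v complement_map \<Rightarrow> 'v set set \<Rightarrow> bool"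
  where "generic_fan N \<Psi> \<Sigma> \<longleftrightarrow>
    is_fan N \<Sigma> \<and> (\<forall>\<sigma>\<in>\<Sigma>. lat_Q (sublat N \<sigma>) \<in> subspaces \<Psi>)"

definition generic_cone :: "'v::real_vector set \<Rightarrow> 'v complement_map \<Rightarrow> 'v set \<Rightarrow> bool"
  where "generic_cone N \<Psi> \<sigma> \<longleftrightarrow> is_cone N \<sigma> \<and> generic_fan N \<Psi> (cone_faces \<sigma>)"

definition nonsingular_generic_fan ::
    "'v::real_vector set \<Rightarrow> 'v complement_map \<Rightarrow> 'v set set \<Rightarrow> bool"
  where "nonsingular_generic_fan N \<Psi> \<Sigma> \<longleftrightarrow>
    generic_fan N \<Psi> \<Sigma> \<and> (\<forall>\<sigma>\<in>\<Sigma>. nonsingular_cone N \<sigma>)"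

definition nonsingular_generic_subdivision ::
    "'v::euclidean_space set \<Rightarrow> 'v complement_map \<Rightarrow> 'v set \<Rightarrow> 'v set set \<Rightarrow> bool"
  where "nonsingular_generic_subdivision N \<Psi> \<sigma> T \<longleftrightarrow>
    finite T \<and> \<Union>T = \<sigma> \<and>
    (\<forall>\<tau>\<in>T. generic_cone N \<Psi> \<tau> \<and> nonsingular_cone N \<tau> \<and> dim \<tau> = dim \<sigma>) \<and>
    (\<forall>\<tau>1\<in>T. \<forall>\<tau>2\<in>T. \<tau>1 \<noteq> \<tau>2 \<longrightarrow> \<tau>1 \<inter> \<tau>2 \<subseteq> rel_frontier \<tau>1 \<inter> rel_frontier \<tau>2)"

text \<open>The standing assumption on complement maps.\<close>

definition admits_subdivisions :: "'v::euclidean_space set \<Rightarrow> 'v complement_map \<Rightarrow> bool"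
  where "admits_subdivisions N \<Psi> \<longleftrightarrow>
    (\<forall>\<sigma>. generic_cone N \<Psi> \<sigma> \<longrightarrow> (\<exists>T. nonsingular_generic_subdivision N \<Psi> \<sigma> T)) \<and>
    (\<forall>\<Sigma>. generic_fan N \<Psi> \<Sigma> \<longrightarrow>
      (\<exists>\<Sigma>'. nonsingular_generic_fan N \<Psi> \<Sigma>' \<and> \<Union>\<Sigma>' = \<Union>\<Sigma> \<and> (\<forall>\<sigma>'\<in>\<Sigma>'. \<exists>\<sigma>\<in>\<Sigma>. \<sigma>' \<subseteq> \<sigma>)))"

definition induced_map :: "'v::real_vector set \<Rightarrow> 'v complement_map \<Rightarrow> 'v set \<Rightarrow> 'v complement_map"
  where "induced_map N \<Psi> \<sigma> = \<Psi>\<lparr>subspaces := {L \<in> subspaces \<Psi>. L \<subseteq> lat_Q (sublat N \<sigma>)}\<rparr>"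


section \<open>The cycle Todd coefficients \<open>\<mu>\<^sub>0\<close>\<close>

text \<open>
  Rays stand for the indices \<open>i\<close>, and an element of \<open>Z\<close> is the function \<open>z\<close> of its
  coefficients, \<open>\<Sum>\<^bsub>\<sigma>\<in>\<Sigma>\<^esub> z \<sigma> V(\<sigma>)\<close>.  \<open>ray_dual N \<Sigma> \<rho> \<sigma>\<close> is the functional \<open>d\<^sub>\<sigma>\<close> belonging to
  \<open>\<rho>\<close>, and \<open>coeff_D N \<Psi> \<Sigma> \<rho> \<sigma> \<tau>\<close> is \<open>\<langle>d\<^sub>\<tau> - d\<^sub>\<sigma>\<^sup>\<Psi>, n\<^bsub>\<tau>,\<sigma>\<^esub>\<rangle>\<close>.  The latter may be computed on the
  representative of \<open>n\<^bsub>\<tau>,\<sigma>\<^esub>\<close> in \<open>N\<^sub>\<tau>\<close>, because \<open>d\<^sub>\<tau>\<close> and \<open>d\<^sub>\<sigma>\<^sup>\<Psi>\<close> agree on \<open>N\<^sub>\<sigma>\<close>.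
\<close>

definition ray_dual :: "'v::real_vector set \<Rightarrow> 'v set set \<Rightarrow> 'v set \<Rightarrow> 'v set \<Rightarrow> 'v \<Rightarrow> rat"
  where "ray_dual N \<Sigma> \<rho> \<sigma> = (THE d. d \<in> dual_lat_in_Q (sublat N \<sigma>) \<and>
    (\<forall>\<rho>'\<in>rays \<Sigma>. ray_gen N \<rho>' \<in> \<sigma> \<longrightarrow> d (ray_gen N \<rho>') = (if \<rho>' = \<rho> then 1 else 0)))"

definition coeff_D ::
    "'v::real_vector set \<Rightarrow> 'v complement_map \<Rightarrow> 'v set set \<Rightarrow> 'v set \<Rightarrow> 'v set \<Rightarrow> 'v set \<Rightarrow> rat"
  where "coeff_D N \<Psi> \<Sigma> \<rho> \<sigma> \<tau> =
    ray_dual N \<Sigma> \<rho> \<tau> (prim_gen N \<tau> \<sigma>) -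
    lift \<Psi> (lat_Q (sublat N \<sigma>)) (lat_Q N) (ray_dual N \<Sigma> \<rho> \<sigma>) (prim_gen N \<tau> \<sigma>)"

definition div_op ::
    "'v::real_vector set \<Rightarrow> 'v complement_map \<Rightarrow> 'v set set \<Rightarrow> 'v set \<Rightarrow> ('v set \<Rightarrow> rat) \<Rightarrow> 'v set \<Rightarrow> rat"
  where "div_op N \<Psi> \<Sigma> \<rho> z = (\<lambda>\<tau>.
    if \<tau> \<in> \<Sigma> then \<Sum>\<sigma> | \<sigma> \<in> \<Sigma> \<and> facet_of_cone \<sigma> \<tau>. z \<sigma> * coeff_D N \<Psi> \<Sigma> \<rho> \<sigma> \<tau> else 0)"

definition todd_series :: "rat fps"
  where "todd_series = fps_X / (1 - fps_exp (-1))"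

lemma todd_series_mult: "todd_series * (1 - fps_exp (-1)) = fps_X"
proof -
  have "subdegree (1 - fps_exp (-1) :: rat fps) = 1"
    by (rule subdegreeI) auto
  then have "(1 - fps_exp (-1) :: rat fps) dvd fps_X"
    by (subst fps_dvd_iff) auto
  then show ?thesis
    unfolding todd_series_def by (rule dvd_div_mult_self)
qed

text \<open>A power series in a nilpotent operator; only finitely many summands are nonzero.\<close>

definition fps_apply :: "rat fps \<Rightarrow> (('s \<Rightarrow> rat) \<Rightarrow> 's \<Rightarrow> rat) \<Rightarrow> ('s \<Rightarrow> rat) \<Rightarrow> 's \<Rightarrow> rat"
  where "fps_apply F D z = (\<lambda>s. \<Sum>k | (D ^^ k) z s \<noteq> 0. fps_nth F k * (D ^^ k) z s)"

text \<open>The operators of different rays commute, so the order in the fold is irrelevant.\<close>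

definition mu0_fan :: "'v::real_vector set \<Rightarrow> 'v complement_map \<Rightarrow> 'v set set \<Rightarrow> 'v set \<Rightarrow> rat"
  where "mu0_fan N \<Psi> \<Sigma> =
    Finite_Set.fold (\<lambda>\<rho>. fps_apply todd_series (div_op N \<Psi> \<Sigma> \<rho>))
      (\<lambda>\<sigma>. if \<sigma> = {0} then 1 else 0) (rays \<Sigma>)"

definition mu0_nonsingular :: "'v::real_vector set \<Rightarrow> 'v complement_map \<Rightarrow> 'v set \<Rightarrow> rat"
  where "mu0_nonsingular N \<Psi> \<sigma> =
    (THE c. \<forall>\<Sigma>. nonsingular_generic_fan N \<Psi> \<Sigma> \<and> \<sigma> \<in> \<Sigma> \<longrightarrow> mu0_fan N \<Psi> \<Sigma> \<sigma> = c)"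

definition mu0 :: "'v::euclidean_space set \<Rightarrow> 'v complement_map \<Rightarrow> 'v set \<Rightarrow> rat"
  where "mu0 N \<Psi> \<sigma> =
    (THE c. \<forall>T. nonsingular_generic_subdivision N \<Psi> \<sigma> T \<longrightarrow>
      (\<Sum>\<tau>\<in>T. mu0_nonsingular N \<Psi> \<tau>) = c)"


section \<open>Meromorphic functions on \<open>N \<otimes> \<complex>\<close>\<close>

text \<open>
  In this section \<open>X\<close> is \<open>lat_C N\<close> and \<open>U\<close> is an open subset of \<open>X\<close>.  Holomorphy in several
  variables is complex Frechet differentiability, multiplication by \<open>\<i>\<close> on \<open>X\<close>
  being \<open>(a, b) \<mapsto> (- b, a)\<close>.
\<close>

definition times_i :: "'v::ab_group_add \<times> 'v \<Rightarrow> 'v \<times> 'v"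
  where "times_i \<xi> = (- snd \<xi>, fst \<xi>)"

definition holo_on ::
    "('v::real_normed_vector \<times> 'v) set \<Rightarrow> ('v \<times> 'v) set \<Rightarrow> ('v \<times> 'v \<Rightarrow> complex) \<Rightarrow> bool"
  where "holo_on X U F \<longleftrightarrow>
    (\<forall>\<xi>\<in>U. \<exists>F'. (F has_derivative F') (at \<xi> within X) \<and>
      (\<forall>\<eta>\<in>X. F' (times_i \<eta>) = \<i> * F' \<eta>))"

text \<open>
  A meromorphic function is represented by a total function which near every point is a
  quotient \<open>g / h\<close> of holomorphic functions wherever \<open>h \<noteq> 0\<close>.  Representatives of the same
  meromorphic function may differ on a nowhere dense set, so equality of meromorphic functions
  is \<open>mero_eq\<close>, and the value at a point of regularity is that of the holomorphic extension.
\<close>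

definition mero_on :: "('v::real_normed_vector \<times> 'v) set \<Rightarrow> ('v \<times> 'v \<Rightarrow> complex) \<Rightarrow> bool"
  where "mero_on X F \<longleftrightarrow>
    (\<forall>\<xi>\<in>X. \<exists>U g h. openin (top_of_set X) U \<and> \<xi> \<in> U \<and> holo_on X U g \<and> holo_on X U h \<and>
      U \<subseteq> closure {\<eta>\<in>U. h \<eta> \<noteq> 0} \<and> (\<forall>\<eta>\<in>U. h \<eta> \<noteq> 0 \<longrightarrow> F \<eta> = g \<eta> / h \<eta>))"

definition mero_eq ::
    "('v::real_normed_vector \<times> 'v) set \<Rightarrow> ('v \<times> 'v \<Rightarrow> complex) \<Rightarrow> ('v \<times> 'v \<Rightarrow> complex) \<Rightarrow> bool"
  where "mero_eq X F G \<longleftrightarrow>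
    (\<exists>D. openin (top_of_set X) D \<and> X \<subseteq> closure D \<and> (\<forall>\<xi>\<in>D. F \<xi> = G \<xi>))"

definition has_mero_value ::
    "('v::real_normed_vector \<times> 'v) set \<Rightarrow> ('v \<times> 'v \<Rightarrow> complex) \<Rightarrow> 'v \<times> 'v \<Rightarrow> complex \<Rightarrow> bool"
  where "has_mero_value X F \<xi> c \<longleftrightarrow>
    (\<exists>U g. openin (top_of_set X) U \<and> \<xi> \<in> U \<and> holo_on X U g \<and> mero_eq U F g \<and> g \<xi> = c)"

definition mero_regular_at ::
    "('v::real_normed_vector \<times> 'v) set \<Rightarrow> ('v \<times> 'v \<Rightarrow> complex) \<Rightarrow> 'v \<times> 'v \<Rightarrow> bool"
  where "mero_regular_at X F \<xi> \<longleftrightarrow> (\<exists>c. has_mero_value X F \<xi> c)"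

definition mero_value ::
    "('v::real_normed_vector \<times> 'v) set \<Rightarrow> ('v \<times> 'v \<Rightarrow> complex) \<Rightarrow> 'v \<times> 'v \<Rightarrow> complex"
  where "mero_value X F \<xi> = (THE c. has_mero_value X F \<xi> c)"


section \<open>Exponential sums and integrals\<close>

definition pairing :: "'v \<times> 'v \<Rightarrow> ('v \<Rightarrow> real) \<Rightarrow> complex"
  where "pairing \<xi> m = Complex (m (fst \<xi>)) (m (snd \<xi>))"

definition contains_line :: "'w::real_vector set \<Rightarrow> bool"
  where "contains_line P \<longleftrightarrow> (\<exists>p d. d \<noteq> 0 \<and> (\<forall>t. p + t *\<^sub>R d \<in> P))"

definition exp_sum ::
    "'v::real_normed_vector set \<Rightarrow> ('v \<Rightarrow> real) set \<Rightarrow> 'v \<times> 'v \<Rightarrow> complex"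
  where "exp_sum N P =
    (if contains_line P then (\<lambda>_. 0) else
      (SOME F. mero_on (lat_C N) F \<and>
        (\<forall>\<xi>\<in>lat_C N. (\<lambda>m. norm (exp (pairing \<xi> m))) summable_on (P \<inter> dual_lat N) \<longrightarrow>
          F \<xi> = (\<Sum>\<^sub>\<infinity>m\<in>P \<inter> dual_lat N. exp (pairing \<xi> m)))))"

text \<open>
  Integration over \<open>P\<close> with respect to the normalised Lebesgue measure on its affine span:
  if \<open>p\<close> lies in \<open>P\<close> and \<open>B\<close> is a basis of the lattice of integer points of the linear
  subspace parallel to \<open>P\<close>, the affine span is parametrised by
  \<open>t \<mapsto> p + \<Sum>\<^bsub>b\<in>B\<^esub> t b *\<^sub>R b\<close> with \<open>t\<close> in \<open>\<real>\<^sup>B\<close>.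
\<close>

definition par_point :: "('v \<Rightarrow> real) \<Rightarrow> ('v \<Rightarrow> real) set \<Rightarrow> (('v \<Rightarrow> real) \<Rightarrow> real) \<Rightarrow> 'v \<Rightarrow> real"
  where "par_point p B t = p + (\<Sum>b\<in>B. t b *\<^sub>R b)"

definition integrand ::
    "('v \<Rightarrow> real) set \<Rightarrow> ('v \<Rightarrow> real) \<Rightarrow> ('v \<Rightarrow> real) set \<Rightarrow> 'v \<times> 'v \<Rightarrow> (('v \<Rightarrow> real) \<Rightarrow> real) \<Rightarrow> complex"
  where "integrand P p B \<xi> t = indicator P (par_point p B t) * exp (pairing \<xi> (par_point p B t))"

definition parallel_lattice :: "'v::real_vector set \<Rightarrow> ('v \<Rightarrow> real) set \<Rightarrow> ('v \<Rightarrow> real) set"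
  where "parallel_lattice N P = dual_lat N \<inter> span {p - q | p q. p \<in> P \<and> q \<in> P}"

definition exp_integral ::
    "'v::real_normed_vector set \<Rightarrow> ('v \<Rightarrow> real) set \<Rightarrow> 'v \<times> 'v \<Rightarrow> complex"
  where "exp_integral N P =
    (if contains_line P then (\<lambda>_. 0) else
      (let p = (SOME p. p \<in> P); B = (SOME B. lattice_basis B (parallel_lattice N P)) in
        (SOME F. mero_on (lat_C N) F \<and>
          (\<forall>\<xi>\<in>lat_C N. integrable (\<Pi>\<^sub>M b\<in>B. lborel) (integrand P p B \<xi>) \<longrightarrow>
            F \<xi> = (\<integral>t. integrand P p B \<xi> t \<partial>(\<Pi>\<^sub>M b\<in>B. lborel))))))"


section \<open>The SI-interpolator \<open>\<mu>\<close>\<close>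

definition dual_cone :: "'v::real_vector set \<Rightarrow> 'v set \<Rightarrow> ('v \<Rightarrow> real) set"
  where "dual_cone N \<sigma> = {m \<in> real_dual (lat_R N). \<forall>v\<in>\<sigma>. 0 \<le> m v}"

definition perp :: "'v::real_vector set \<Rightarrow> 'v set \<Rightarrow> ('v \<Rightarrow> real) set"
  where "perp N \<tau> = {m \<in> real_dual (lat_R N). \<forall>v\<in>\<tau>. m v = 0}"

text \<open>
  The real-linear extension of the projection \<open>N\<^sub>\<rat> \<rightarrow> N\<^bsub>\<sigma>,\<rat>\<^esub>\<close> dual to
  \<open>i\<^sup>\<Psi> : M\<^bsub>\<sigma>,\<rat>\<^esub> \<rightarrow> M\<^sub>\<rat>\<close>; it is determined on \<open>lat_R N\<close>.  \<open>proj_C\<close> is its complexification.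
\<close>

definition proj_R :: "'v::real_vector set \<Rightarrow> 'v complement_map \<Rightarrow> 'v set \<Rightarrow> 'v \<Rightarrow> 'v"
  where "proj_R N \<Psi> \<sigma> = (SOME p. linear p \<and>
    (\<forall>x\<in>lat_Q N. p x \<in> lat_Q (sublat N \<sigma>) \<and>
      (\<forall>f\<in>rat_dual (lat_Q (sublat N \<sigma>)).
        f (p x) = lift \<Psi> (lat_Q (sublat N \<sigma>)) (lat_Q N) f x)))"

definition proj_C :: "'v::real_vector set \<Rightarrow> 'v complement_map \<Rightarrow> 'v set \<Rightarrow> 'v \<times> 'v \<Rightarrow> 'v \<times> 'v"
  where "proj_C N \<Psi> \<sigma> = map_prod (proj_R N \<Psi> \<sigma>) (proj_R N \<Psi> \<sigma>)"

text \<open>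
  \<open>\<mu> N \<Psi> \<sigma>\<close> is the function attached to the dual cone of \<open>\<sigma>\<close>.  The lattices range
  over all lattices in the ambient space, which include all \<open>N\<^sub>\<sigma>\<close>.
\<close>

definition is_SI_interpolator ::
    "('v::euclidean_space set \<Rightarrow> 'v complement_map \<Rightarrow> 'v set \<Rightarrow> 'v \<times> 'v \<Rightarrow> complex) \<Rightarrow> bool"
  where "is_SI_interpolator \<mu> \<longleftrightarrow>
    (\<forall>N \<Psi> \<sigma>. is_lattice N \<and> is_complement_map N \<Psi> \<and> generic_cone N \<Psi> \<sigma> \<longrightarrow>
      mero_on (lat_C N) (\<mu> N \<Psi> \<sigma>) \<and>
      (span \<sigma> = lat_R N \<longrightarrow>
        mero_eq (lat_C N) (exp_sum N (dual_cone N \<sigma>))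
          (\<lambda>\<xi>. \<Sum>\<tau>\<in>cone_faces \<sigma>. \<mu> N \<Psi> \<tau> \<xi> * exp_integral N (dual_cone N \<sigma> \<inter> perp N \<tau>) \<xi>)) \<and>
      mero_eq (lat_C N) (\<mu> N \<Psi> \<sigma>)
        (\<lambda>\<xi>. \<mu> (sublat N \<sigma>) (induced_map N \<Psi> \<sigma>) \<sigma> (proj_C N \<Psi> \<sigma> \<xi>)))"

text \<open>Determined up to \<open>mero_eq\<close> on all arguments that matter.\<close>

definition SI_interpolator ::
    "'v::euclidean_space set \<Rightarrow> 'v complement_map \<Rightarrow> 'v set \<Rightarrow> 'v \<times> 'v \<Rightarrow> complex"
  where "SI_interpolator = (SOME \<mu>. is_SI_interpolator \<mu>)"

end

theory Submission
 imports Defs "HOL-Complex_Analysis.Complex_Analysis"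
begin

text \<open>Both sides are additive under subdivision: for the interpolator this follows, by induction on the
 dimension, from the additivity of exponential sums and integrals modulo cones containing lines. So the
 cone may be taken to be generated by part \<open>G\<close> of a lattice basis. With \<open>z j\<close> the coordinate functions of
 the span of \<open>G\<close>, SI-interpolation then reads
 \<open>(\<Prod>j\<in>A. todd (- z j)) = (\<Sum>C\<in>Pow A. \<mu> C * (\<Prod>j\<in>C. - z j))\<close> on the span of every \<open>A \<subseteq> G\<close>,
 where \<open>\<mu> C\<close> factors through the projection given by the complement map, and this triangular system
 determines \<open>\<mu>\<close>. Such a decomposition of a function is transformed into one of its product with \<open>- z i\<close>
 by an operator whose effect on the values at 0 is the action of the divisor \<open>D\<^sub>i\<close>. Starting from the
 decomposition of the constant 1, the operators \<open>todd (- z i)\<close> therefore yield at 0 exactly the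
 Pommersheim-Thomas coefficients.\<close>

section \<open>Lattices and dual lattices\<close>

text \<open>Exponential sums, exponential integrals, projections and the interpolator are all chosen
  by \<open>SOME\<close>, so each needs a witness before anything is known about it. For the
  integral over a cone the witness comes from the lattice sum: on the domain of convergence the
  integral is the limit of rescaled sums, hence the leading homogeneous part of the numerator of the
  sum divided by a product of linear forms. Sums and integrals thus obey the same finite
  combinatorics, and a cone containing a line is killed by the difference operator that clears
  denominators. The obstacle in the additivity proof is that the coefficients of the relations
  between faces depend on the point of evaluation; a dense open set is therefore fixed first, and
  all relations are treated there at once. That the order of the rays, the ambient fan and the
  subdivision do not matter is read off from the uniqueness of the value of a meromorphic function
  at 0, since every choice produces that value of the interpolator.\<close>

lemma sum_fun_apply: "(\<Sum>i\<in>I. f i) x = (\<Sum>i\<in>I. f i x)"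
 by (induction I rule: infinite_finite_induct) (auto simp: zero_fun_def plus_fun_def)

lemma scaleR_fun_apply [simp]: "(c *\<^sub>R f) x = c *\<^sub>R f x"
 by (simp add: scaleR_fun_def)

lemma representation_sum_basis:
 assumes "finite B" "independent B" "b \<in> B"
 shows "representation B (\<Sum>b\<in>B. c b *\<^sub>R b) b = c b"
proof -
 have "representation B (\<Sum>b\<in>B. c b *\<^sub>R b) b = (\<Sum>a\<in>B. representation B (c a *\<^sub>R a) b)"
  using assms by (subst real_vector.representation_sum) (auto intro: span_base span_scale)
 also have "\<dots> = (\<Sum>a\<in>B. c a * (if b = a then 1 else 0))"
  using assms by (intro sum.cong) (auto simp: real_vector.representation_scale span_base real_vector.representation_basis)
 also have "\<dots> = c b" using assms by (simp add: if_distrib[of "(*) _"] cong: if_cong)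
 finally show ?thesis .
qed

lemma linear_on_representation:
 assumes "independent B" "x \<in> span B" "y \<in> span B"
 shows "representation B (x + y) b = representation B x b + representation B y b"
  "representation B (x - y) b = representation B x b - representation B y b"
  "representation B (c *\<^sub>R x) b = c * representation B x b"
 using assms by (auto simp: real_vector.representation_add real_vector.representation_diff real_vector.representation_scale)

lemma lattice_basisD:
 assumes "lattice_basis B N"
 shows "finite B" "independent B" "B \<subseteq> N" "span N = span B" "N \<subseteq> span B"
proof -
 show f: "finite B" and "independent B" using assms by (auto simp: lattice_basis_def)
 have N: "N = range (\<lambda>c :: 'a \<Rightarrow> int. \<Sum>b\<in>B. of_int (c b) *\<^sub>R b)" using assms by (auto simp: lattice_basis_def)
 show "B \<subseteq> N"
 proof
  fix b assume "b \<in> B"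
  then have "b = (\<Sum>a\<in>B. of_int (if a = b then 1 else 0) *\<^sub>R a)"
   using f by (simp add: if_distrib[of "\<lambda>x. x *\<^sub>R _"] if_distrib[of of_int] cong: if_cong)
  then show "b \<in> N" unfolding N by (rule range_eqI[where x="\<lambda>a. if a = b then 1 else 0"])
 qed
 show "N \<subseteq> span B" unfolding N by (auto intro!: span_sum span_scale intro: span_base)
 with \<open>B \<subseteq> N\<close> show "span N = span B"
  by (metis span_mono span_span subset_antisym)
qed

lemma lattice_mem_iff:
 assumes "lattice_basis B N"
 shows "x \<in> N \<longleftrightarrow> x \<in> span B \<and> (\<forall>b\<in>B. representation B x b \<in> \<int>)"
proof
 note D = lattice_basisD[OF assms]
 have N: "N = range (\<lambda>c :: 'a \<Rightarrow> int. \<Sum>b\<in>B. of_int (c b) *\<^sub>R b)" using assms by (auto simp: lattice_basis_def)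
 assume x: "x \<in> N"
 then obtain c :: "'a \<Rightarrow> int" where "x = (\<Sum>b\<in>B. of_int (c b) *\<^sub>R b)" unfolding N by auto
 then show "x \<in> span B \<and> (\<forall>b\<in>B. representation B x b \<in> \<int>)"
  using D x representation_sum_basis[OF D(1,2), of _ "\<lambda>b. of_int (c b)"] by auto
next
 note D = lattice_basisD[OF assms]
 have N: "N = range (\<lambda>c :: 'a \<Rightarrow> int. \<Sum>b\<in>B. of_int (c b) *\<^sub>R b)" using assms by (auto simp: lattice_basis_def)
 assume x: "x \<in> span B \<and> (\<forall>b\<in>B. representation B x b \<in> \<int>)"
 have "x = (\<Sum>b\<in>B. representation B x b *\<^sub>R b)"
  using real_vector.sum_representation_eq[OF D(2), of x B] x D(1) by auto
 also have "\<dots> = (\<Sum>b\<in>B. of_int \<lfloor>representation B x b\<rfloor> *\<^sub>R b)"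
  using x by (intro sum.cong) (auto elim!: Ints_cases)
 finally show "x \<in> N" unfolding N by (rule range_eqI[where x="\<lambda>b. \<lfloor>representation B x b\<rfloor>"])
qed

lemma lattice_basisI:
 assumes "finite B" "independent B" "B \<subseteq> N"
  and "\<And>x. x \<in> N \<Longrightarrow> x \<in> span B \<and> (\<forall>b\<in>B. representation B x b \<in> \<int>)"
  and "0 \<in> N" "\<And>x y. x \<in> N \<Longrightarrow> y \<in> N \<Longrightarrow> x + y \<in> N" "\<And>x. x \<in> N \<Longrightarrow> - x \<in> N"
 shows "lattice_basis B N"
proof -
 have nat: "of_nat k *\<^sub>R x \<in> N" if "x \<in> N" for x and k :: nat
  using that assms by (induction k) (auto simp: algebra_simps)
 have int: "of_int k *\<^sub>R x \<in> N" if "x \<in> N" for x and k :: int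
  using nat[OF that, of "nat k"] nat[OF assms(7)[OF that], of "nat (- k)"] by (cases "k \<ge> 0") auto
 have sum: "(\<Sum>b\<in>A. f b) \<in> N" if "\<And>b. b \<in> A \<Longrightarrow> f b \<in> N" for f :: "'a \<Rightarrow> 'a" and A
  using that by (induction A rule: infinite_finite_induct) (auto intro: assms)
 have "N = range (\<lambda>c :: 'a \<Rightarrow> int. \<Sum>b\<in>B. of_int (c b) *\<^sub>R b)"
 proof (intro set_eqI iffI)
  fix x assume "x \<in> N"
  note x = assms(4)[OF this]
  have "x = (\<Sum>b\<in>B. representation B x b *\<^sub>R b)"
   using real_vector.sum_representation_eq[OF assms(2), of x B] x assms(1) by auto
  also have "\<dots> = (\<Sum>b\<in>B. of_int \<lfloor>representation B x b\<rfloor> *\<^sub>R b)"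
   using x by (intro sum.cong) (auto elim!: Ints_cases)
  finally show "x \<in> range (\<lambda>c :: 'a \<Rightarrow> int. \<Sum>b\<in>B. of_int (c b) *\<^sub>R b)"
   by (rule range_eqI[where x="\<lambda>b. \<lfloor>representation B x b\<rfloor>"])
 qed (use assms in \<open>auto intro!: sum int\<close>)
 then show ?thesis using assms by (auto simp: lattice_basis_def)
qed

lemma is_lattice_closed:
 assumes "is_lattice N"
 shows "0 \<in> N" "x \<in> N \<Longrightarrow> y \<in> N \<Longrightarrow> x + y \<in> N" "x \<in> N \<Longrightarrow> - x \<in> N"
  "x \<in> N \<Longrightarrow> y \<in> N \<Longrightarrow> x - y \<in> N" "x \<in> N \<Longrightarrow> of_int k *\<^sub>R x \<in> N"
  "(\<And>i. i \<in> I \<Longrightarrow> f i \<in> N) \<Longrightarrow> sum f I \<in> N"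
proof -
 obtain B where B: "lattice_basis B N" using assms by (auto simp: is_lattice_def)
 note D = lattice_basisD[OF B] and m = lattice_mem_iff[OF B]
 show 0: "0 \<in> N" by (auto simp: m span_zero real_vector.representation_zero)
 show add: "x \<in> N \<Longrightarrow> y \<in> N \<Longrightarrow> x + y \<in> N" for x y
  by (auto simp: m span_add linear_on_representation[OF D(2)])
 show "x \<in> N \<Longrightarrow> y \<in> N \<Longrightarrow> x - y \<in> N"
  by (auto simp: m span_diff linear_on_representation[OF D(2)])
 show "x \<in> N \<Longrightarrow> - x \<in> N"
  by (auto simp: m span_neg real_vector.representation_neg[OF D(2)])
 show "x \<in> N \<Longrightarrow> of_int k *\<^sub>R x \<in> N"
  by (auto simp: m span_scale linear_on_representation[OF D(2)])
 show "(\<And>i. i \<in> I \<Longrightarrow> f i \<in> N) \<Longrightarrow> sum f I \<in> N"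
  by (induction I rule: infinite_finite_induct) (auto intro: 0 add)
qed

section \<open>Subgroups of the integers and of lattices\<close>

lemma int_subgroup_principal:
 fixes I :: "int set"
 assumes "0 \<in> I" "\<And>x y. x \<in> I \<Longrightarrow> y \<in> I \<Longrightarrow> x - y \<in> I"
 obtains d where "d \<in> I" "\<And>x. x \<in> I \<Longrightarrow> d dvd x"
proof (cases "I \<subseteq> {0}")
 case True then show ?thesis using that[of 0] assms by auto
next
 case False
 have neg: "- x \<in> I" if "x \<in> I" for x using assms(2)[OF assms(1) that] by simp
 have add: "x + y \<in> I" if "x \<in> I" "y \<in> I" for x y using assms(2)[OF that(1) neg[OF that(2)]] by simp
 have mul: "k * x \<in> I" if "x \<in> I" for x k
 proof -
  have n: "int n * x \<in> I" if "x \<in> I" for n x using that assms(1) by (induction n) (auto simp: algebra_simps intro: add)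
  show ?thesis using n[OF that, of "nat k"] n[OF neg[OF that], of "nat (-k)"] by (cases "k \<ge> 0") auto
 qed
 obtain x where "x \<in> I" "x \<noteq> 0" using False by auto
 then have ex: "\<exists>n. int n \<in> I \<and> n > 0"
  using neg by (intro exI[of _ "nat \<bar>x\<bar>"]) (auto simp: abs_if)
 define d where "d = (LEAST n. int n \<in> I \<and> n > 0)"
 have d: "int d \<in> I" "d > 0" using LeastI_ex[OF ex] by (auto simp: d_def)
 have "int d dvd x" if "x \<in> I" for x
 proof (rule ccontr)
  assume "\<not> int d dvd x"
  then have "x mod int d \<noteq> 0" by (simp add: dvd_eq_mod_eq_0)
  then have r: "x mod int d > 0" "x mod int d < int d" using d(2) pos_mod_sign[of "int d" x] pos_mod_bound[of "int d" x] by linarith+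
  have "x mod int d = x - (x div int d) * int d" by (simp add: minus_div_mult_eq_mod)
  then have rI: "int (nat (x mod int d)) \<in> I" using r assms(2)[OF that mul[OF d(1)]] by simp
  have "d \<le> nat (x mod int d)" by (subst d_def, rule Least_le) (use rI r in auto)
  then show False using r by linarith
 qed
 then show ?thesis using that d by blast
qed

text \<open>The elements with vanishing \<open>b\<close>-coordinate have a basis by induction, and
  the \<open>b\<close>-coordinates of all elements form a subgroup of the integers generated by some
  \<open>d\<close>. An element \<open>w\<close> with coordinate \<open>d\<close> completes the
  basis, unless \<open>d\<close> is 0 and all \<open>b\<close>-coordinates vanish.\<close>

lemma subgroup_has_basis:
 assumes "finite B" "independent B"
  and "0 \<in> S" "\<And>x y. x \<in> S \<Longrightarrow> y \<in> S \<Longrightarrow> x - y \<in> S"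
  and "\<And>x. x \<in> S \<Longrightarrow> x \<in> span B \<and> (\<forall>b\<in>B. representation B x b \<in> \<int>)"
 shows "is_lattice S"
 using assms
proof (induction B arbitrary: S rule: finite_induct)
 case empty
 then have "S = {0}" by auto
 then show ?case using real_vector.independent_empty by (auto simp: lattice_basis_def is_lattice_def)
next
 case (insert b B)
 note sub = insert.prems(3)
 have neg: "- x \<in> S" if "x \<in> S" for x using sub[OF insert.prems(2) that] by simp
 have add: "x + y \<in> S" if "x \<in> S" "y \<in> S" for x y using sub[OF that(1) neg[OF that(2)]] by simp
 define S0 where "S0 = {x\<in>S. representation (insert b B) x b = 0}"
 have iB: "independent B" using insert.prems(1) by (meson independent_mono subset_insertI)
 have sp: "x \<in> span (insert b B)" if "x \<in> S" for x using insert.prems(4) that by blast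
 have inB: "x \<in> span B" if "x \<in> span (insert b B)" "representation (insert b B) x b = 0" for x
 proof -
  have "x = (\<Sum>a\<in>insert b B. representation (insert b B) x a *\<^sub>R a)"
   using real_vector.sum_representation_eq[OF insert.prems(1) that(1), of "insert b B"] insert.hyps by auto
  also have "\<dots> = (\<Sum>a\<in>B. representation (insert b B) x a *\<^sub>R a)" using insert.hyps that by simp
  finally show ?thesis by (metis (no_types, lifting) span_base span_scale span_sum)
 qed
 have "is_lattice S0"
 proof (rule insert.IH)
  show "independent B" by fact
  show "0 \<in> S0" using insert.prems by (auto simp: S0_def real_vector.representation_zero)
  show "x - y \<in> S0" if "x \<in> S0" "y \<in> S0" for x y
   using that sub sp by (auto simp: S0_def linear_on_representation[OF insert.prems(1)])
  show "x \<in> span B \<and> (\<forall>b\<in>B. representation B x b \<in> \<int>)" if x: "x \<in> S0" for x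
  proof -
   have "x \<in> span B" using x inB sp by (auto simp: S0_def)
   then have "representation (insert b B) x = representation B x"
    using insert.prems(1) by (intro real_vector.representation_extend) auto
   then show ?thesis using \<open>x \<in> span B\<close> insert.prems(4)[of x] x by (auto simp: S0_def)
  qed
 qed
 then obtain B0 where B0: "lattice_basis B0 S0" by (auto simp: is_lattice_def)
 note D0 = lattice_basisD[OF B0] and m0 = lattice_mem_iff[OF B0]
 define I where "I = {k::int. \<exists>x\<in>S. representation (insert b B) x b = of_int k}"
 have "0 \<in> I" using insert.prems by (auto simp: I_def real_vector.representation_zero intro!: bexI[of _ 0])
 moreover have "k - l \<in> I" if "k \<in> I" "l \<in> I" for k l
 proof -
  obtain x y where "x \<in> S" "y \<in> S" "representation (insert b B) x b = of_int k" "representation (insert b B) y b = of_int l"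
   using \<open>k \<in> I\<close> \<open>l \<in> I\<close> by (auto simp: I_def)
  then show ?thesis using sub sp linear_on_representation(2)[OF insert.prems(1), of x y b] by (auto simp: I_def)
 qed
 ultimately obtain d where d: "d \<in> I" "\<And>x. x \<in> I \<Longrightarrow> d dvd x" by (rule int_subgroup_principal) auto
 obtain w where w: "w \<in> S" "representation (insert b B) w b = of_int d" using d by (auto simp: I_def)
 have dv: "\<exists>k::int. x - of_int k *\<^sub>R w \<in> S0" if x: "x \<in> S" for x
 proof -
  obtain j where j: "representation (insert b B) x b = of_int j"
   using insert.prems(4)[OF x] by (auto elim!: Ints_cases)
  then have "j \<in> I" using x by (auto simp: I_def)
  then obtain k where k: "j = d * k" using d by (auto simp: dvd_def)
  have nat: "of_nat k *\<^sub>R w \<in> S" for k :: nat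
   using w insert.prems(2) by (induction k) (auto simp: algebra_simps intro: add)
  have "of_int k *\<^sub>R w \<in> S"
   using nat[of "nat k"] neg[OF nat[of "nat (- k)"]] by (cases "k \<ge> 0") auto
  then show ?thesis using x sub sp[OF x] sp[OF w(1)] j k w(2) by (auto simp: S0_def linear_on_representation[OF insert.prems(1)] span_scale)
 qed
 show ?case
 proof (cases "d = 0")
  case True
  have "S0 = S"
  proof
   show "S \<subseteq> S0"
   proof
    fix x assume x: "x \<in> S"
    obtain j where j: "representation (insert b B) x b = of_int j"
     using insert.prems(4)[OF x] by (auto elim!: Ints_cases)
    then have "j = 0" using x d True by (auto simp: I_def)
    then show "x \<in> S0" using x j by (auto simp: S0_def)
   qed
  qed (auto simp: S0_def)
  then show ?thesis using \<open>is_lattice S0\<close> by simp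
 next
  case False
  have z: "representation (insert b B) x b = 0" if "x \<in> span B0" for x
  proof -
   have *: "span B0 \<subseteq> {x \<in> span (insert b B). representation (insert b B) x b = 0}"
   proof (rule span_minimal)
    show "B0 \<subseteq> {x \<in> span (insert b B). representation (insert b B) x b = 0}"
     using D0 sp by (auto simp: S0_def)
    show "subspace {x \<in> span (insert b B). representation (insert b B) x b = 0}"
     by (auto simp: subspace_def span_zero span_add span_scale real_vector.representation_zero linear_on_representation[OF insert.prems(1)])
   qed
   then show ?thesis using that by auto
  qed
  have wB0: "w \<notin> span B0" using z[of w] w False by auto
  then have wn: "w \<notin> B0" using span_base by blast
  have iw: "independent (insert w B0)" using wB0 D0(2) by (simp add: independent_insert wn)
  have "lattice_basis (insert w B0) S"
  proof (rule lattice_basisI)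
   show "finite (insert w B0)" using D0 by auto
   show "insert w B0 \<subseteq> S" using D0 w by (auto simp: S0_def)
   fix x assume x: "x \<in> S"
   obtain k :: int where k: "x - of_int k *\<^sub>R w \<in> S0" using dv[OF x] by auto
   define y where "y = x - of_int k *\<^sub>R w"
   have y: "y \<in> span B0" "\<forall>b\<in>B0. representation B0 y b \<in> \<int>" using k m0[of y] by (auto simp: y_def)
   have xe: "x = y + of_int k *\<^sub>R w" by (simp add: y_def)
   have y': "y \<in> span (insert w B0)" using y(1) span_mono[of B0 "insert w B0"] by auto
   have ry: "representation (insert w B0) y = representation B0 y"
    using iw y by (intro real_vector.representation_extend) auto
   have rw: "representation (insert w B0) w = (\<lambda>v. if v = w then 1 else 0)"
    using iw by (intro real_vector.representation_basis) auto
   have ws: "w \<in> span (insert w B0)" by (simp add: span_base)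
   show "x \<in> span (insert w B0) \<and> (\<forall>b\<in>insert w B0. representation (insert w B0) x b \<in> \<int>)" using real_vector.representation_ne_zero[of B0 y w] wn y y' ws
    by (fastforce simp: xe span_add span_scale linear_on_representation[OF iw] ry rw)
  qed (use iw insert.prems add neg in auto)
  then show ?thesis by (auto simp: is_lattice_def)
 qed
qed

lemma is_lattice_subgroup:
 assumes "is_lattice N" "S \<subseteq> N" "0 \<in> S" "\<And>x y. x \<in> S \<Longrightarrow> y \<in> S \<Longrightarrow> x - y \<in> S"
 shows "is_lattice S"
proof -
 obtain B where B: "lattice_basis B N" using assms by (auto simp: is_lattice_def)
 show ?thesis
  using subgroup_has_basis[of B S] lattice_basisD[OF B] lattice_mem_iff[OF B] assms by blast
qed

lemma is_lattice_Int_subspace: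
 assumes "is_lattice N" "subspace W"
 shows "is_lattice (N \<inter> W)"
 using is_lattice_closed[OF assms(1)] assms(2)
 by (intro is_lattice_subgroup[OF assms(1)]) (auto simp: subspace_0 subspace_diff)

lemma is_lattice_sublat: "is_lattice N \<Longrightarrow> is_lattice (sublat N sig)"
 unfolding sublat_def by (rule is_lattice_Int_subspace) auto

text \<open>Since \<^const>\<open>representation\<close> vanishes outside the span of the basis, the coordinate functions
 lie in \<^const>\<open>real_dual\<close>.\<close>

abbreviation crd :: "'v::real_vector set \<Rightarrow> 'v \<Rightarrow> 'v \<Rightarrow> real"
 where "crd B b \<equiv> (\<lambda>x. representation B x b)"

lemma crd_outside: "x \<notin> span B \<Longrightarrow> crd B b x = 0"
 by (simp add: real_vector.representation_def)

lemma crd_in_real_dual: "independent B \<Longrightarrow> crd B b \<in> real_dual (span B)"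
 by (auto simp: real_dual_def linear_on_representation crd_outside)

lemma crd_basis: "independent B \<Longrightarrow> a \<in> B \<Longrightarrow> crd B b a = (if b = a then 1 else 0)"
 by (simp add: real_vector.representation_basis)

lemma subspace_real_dual: "subspace (real_dual W)"
 by (auto simp: subspace_def real_dual_def algebra_simps zero_fun_def plus_fun_def)

lemma real_dualD:
 assumes "m \<in> real_dual W"
 shows "x \<in> W \<Longrightarrow> y \<in> W \<Longrightarrow> m (x + y) = m x + m y" "x \<in> W \<Longrightarrow> m (c *\<^sub>R x) = c * m x" "x \<notin> W \<Longrightarrow> m x = 0"
 using assms by (auto simp: real_dual_def)

lemma real_dual_0: assumes "m \<in> real_dual (span S)" shows "m 0 = 0"
 using real_dualD(2)[OF assms, of 0 0] by (auto simp: span_zero)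

lemma real_dual_diff:
 assumes "m \<in> real_dual (span S)" "x \<in> span S" "y \<in> span S"
 shows "m (x - y) = m x - m y"
 using real_dualD(1)[OF assms(1), of "x - y" y] assms by (auto simp: span_diff)

lemma real_dual_sum:
 assumes "m \<in> real_dual (span S)" "\<And>i. i \<in> I \<Longrightarrow> f i \<in> span S"
 shows "m (\<Sum>i\<in>I. f i) = (\<Sum>i\<in>I. m (f i))"
 using assms(2)
 by (induction I rule: infinite_finite_induct)
  (auto simp: real_dual_0[OF assms(1)] real_dualD(1)[OF assms(1)] span_sum)

text \<open>Elements of \<open>real_dual\<close> vanish outside their subspace and are therefore
  usually not linear on the ambient space; the extension makes the facts on linear maps applicable
  to them.\<close>

lemma real_dual_linear:
 assumes "m \<in> real_dual (span S)"
 obtains m' where "linear m'" "\<And>x. x \<in> span S \<Longrightarrow> m' x = m x"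
proof -
 obtain B where B: "independent B" "span B = span S"
  by (metis maximal_independent_subset span_mono span_span subset_antisym)
 obtain m' where m': "linear m'" "\<And>x. x \<in> B \<Longrightarrow> m' x = m x"
  using linear_independent_extend[OF B(1), of m] by auto
 have "span B \<subseteq> {x \<in> span S. m' x = m x}"
  using m' B span_superset[of B] real_dual_0[OF assms] real_dualD[OF assms]
  by (intro span_minimal) (auto simp: subspace_def span_zero span_add span_scale linear_0 linear_add linear_scale)
 then show ?thesis using that[OF m'(1)] B by auto
qed

lemma real_dual_expand:
 assumes "finite B" "independent B" "m \<in> real_dual (span B)"
 shows "m = (\<Sum>b\<in>B. m b *\<^sub>R crd B b)"
proof
 fix x
 show "m x = (\<Sum>b\<in>B. m b *\<^sub>R crd B b) x"
 proof (cases "x \<in> span B")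
  case True
  have "m x = m (\<Sum>b\<in>B. crd B b x *\<^sub>R b)"
   using real_vector.sum_representation_eq[OF assms(2) True assms(1) subset_refl] by simp
  also have "\<dots> = (\<Sum>b\<in>B. crd B b x * m b)"
   using assms by (subst real_dual_sum[OF assms(3)]) (auto simp: span_base span_scale real_dualD(2)[OF assms(3)])
  finally show ?thesis by (simp add: sum_fun_apply mult.commute)
 next
  case False then show ?thesis using assms by (simp add: sum_fun_apply crd_outside real_dualD(3)[OF assms(3)])
 qed
qed

lemma crd_inj: "independent B \<Longrightarrow> inj_on (crd B) B"
proof (rule inj_onI)
 fix a b assume "independent B" "a \<in> B" "b \<in> B" "crd B a = crd B b"
 then show "a = b" by (smt (verit) crd_basis)
qed

lemma crd_independent:
 assumes "finite B" "independent B"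
 shows "independent (crd B ` B)"
proof (rule independent_if_scalars_zero)
 show "finite (crd B ` B)" using assms by auto
 fix f x assume s: "(\<Sum>x\<in>crd B ` B. f x *\<^sub>R x) = 0" and "x \<in> crd B ` B"
 then obtain b where b: "b \<in> B" "x = crd B b" by auto
 have "0 = (\<Sum>x\<in>crd B ` B. f x *\<^sub>R x) b" using s by (simp add: zero_fun_def)
 also have "\<dots> = (\<Sum>a\<in>B. f (crd B a) * crd B a b)"
  using assms by (subst sum.reindex) (auto simp: crd_inj sum_fun_apply)
 also have "\<dots> = (\<Sum>a\<in>B. f (crd B a) * (if a = b then 1 else 0))"
  using assms b by (intro sum.cong) (auto simp: crd_basis)
 also have "\<dots> = f x" using b assms by (simp add: if_distrib[of "(*) _"] cong: if_cong)
 finally show "f x = 0" by simp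
qed

lemma dual_lat_alt:
 assumes "lattice_basis B N"
 shows "m \<in> dual_lat N \<longleftrightarrow> m \<in> real_dual (span N) \<and> (\<forall>b\<in>B. m b \<in> \<int>)"
proof
 note D = lattice_basisD[OF assms]
 assume m: "m \<in> real_dual (span N) \<and> (\<forall>b\<in>B. m b \<in> \<int>)"
 have "m x \<in> \<int>" if x: "x \<in> N" for x
 proof -
  have "m x = (\<Sum>b\<in>B. m b *\<^sub>R crd B b) x"
   using real_dual_expand[OF D(1,2), of m] m D(4) by simp
  also have "\<dots> = (\<Sum>b\<in>B. m b * crd B b x)" by (simp add: sum_fun_apply)
  also have "\<dots> \<in> \<int>" using m x lattice_mem_iff[OF assms] by (auto intro!: Ints_sum Ints_mult)
  finally show ?thesis .
 qed
 then show "m \<in> dual_lat N" using m by (auto simp: dual_lat_def)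
qed (use lattice_basisD[OF assms] in \<open>auto simp: dual_lat_def\<close>)

lemma dual_lat_basis:
 assumes "lattice_basis B N"
 shows "lattice_basis (crd B ` B) (dual_lat N)"
proof (rule lattice_basisI)
 note D = lattice_basisD[OF assms]
 show "finite (crd B ` B)" using D by auto
 show i: "independent (crd B ` B)" using crd_independent D by auto
 show "crd B ` B \<subseteq> dual_lat N"
  using D crd_in_real_dual[OF D(2)] by (auto simp: dual_lat_alt[OF assms] crd_basis)
 show "x \<in> span (crd B ` B) \<and> (\<forall>b\<in>crd B ` B. representation (crd B ` B) x b \<in> \<int>)" if x: "x \<in> dual_lat N" for x
 proof -
  have "x = (\<Sum>b\<in>B. x b *\<^sub>R crd B b)" using real_dual_expand[OF D(1,2), of x] x D(4) by (simp add: dual_lat_def)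
  also have "\<dots> = (\<Sum>c\<in>crd B ` B. x (inv_into B (crd B) c) *\<^sub>R c)"
   by (simp add: sum.reindex[OF crd_inj[OF D(2)]] inv_into_f_f[OF crd_inj[OF D(2)]])
  finally have e: "x = (\<Sum>c\<in>crd B ` B. x (inv_into B (crd B) c) *\<^sub>R c)" .
  have s: "x \<in> span (crd B ` B)" by (subst e) (auto intro!: span_sum span_scale intro: span_base)
  have "representation (crd B ` B) x b = x (inv_into B (crd B) b)" if "b \<in> crd B ` B" for b
   using representation_sum_basis[of "crd B ` B" b "\<lambda>c. x (inv_into B (crd B) c)"] e D i that by simp
  then show ?thesis using s x D by (auto simp: dual_lat_alt[OF assms] inv_into_into)
 qed
 show "0 \<in> dual_lat N" using subspace_0[OF subspace_real_dual] by (auto simp: dual_lat_def zero_fun_def)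
 show "x + y \<in> dual_lat N" if "x \<in> dual_lat N" "y \<in> dual_lat N" for x y
  using that subspace_add[OF subspace_real_dual] by (auto simp: dual_lat_def plus_fun_def)
 show "- x \<in> dual_lat N" if "x \<in> dual_lat N" for x
  using that subspace_neg[OF subspace_real_dual] by (auto simp: dual_lat_def fun_Compl_def)
qed

lemma is_lattice_dual_lat: "is_lattice N \<Longrightarrow> is_lattice (dual_lat N)"
 using dual_lat_basis by (auto simp: is_lattice_def)

lemma span_dual_lat:
 assumes "is_lattice N"
 shows "span (dual_lat N) = real_dual (span N)"
proof -
 obtain B where B: "lattice_basis B N" using assms by (auto simp: is_lattice_def)
 note D = lattice_basisD[OF B]
 have "real_dual (span N) \<subseteq> span (crd B ` B)"
 proof
  fix m assume "m \<in> real_dual (span N)"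
  then have "m = (\<Sum>b\<in>B. m b *\<^sub>R crd B b)" using real_dual_expand[OF D(1,2)] D by auto
  moreover have "(\<Sum>b\<in>B. m b *\<^sub>R crd B b) \<in> span (crd B ` B)" by (auto intro!: span_sum span_scale intro: span_base)
  ultimately show "m \<in> span (crd B ` B)" by simp
 qed
 moreover have "span (dual_lat N) \<subseteq> real_dual (span N)"
  by (rule span_minimal) (auto simp: dual_lat_def subspace_real_dual)
 ultimately show ?thesis using lattice_basisD(4)[OF dual_lat_basis[OF B]] by auto
qed

section \<open>Finitely generated cones and their duals\<close>

text \<open>Explicit coefficients instead of a hull, used for cones of vectors and of functionals
  alike. Sums over infinite sets are 0, so this is the generated cone for finite
  \<open>J\<close>.\<close>

definition fcone :: "'w::real_vector set \<Rightarrow> 'w set"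
 where "fcone J = {x. \<exists>c. (\<forall>h\<in>J. 0 \<le> c h) \<and> x = (\<Sum>h\<in>J. c h *\<^sub>R h)}"

lemma fconeI: "(\<And>h. h \<in> J \<Longrightarrow> 0 \<le> c h) \<Longrightarrow> (\<Sum>h\<in>J. c h *\<^sub>R h) \<in> fcone J"
 by (auto simp: fcone_def)

lemma fcone_0: "0 \<in> fcone J"
 using fconeI[of J "\<lambda>_. 0"] by simp

lemma fcone_add: assumes "x \<in> fcone J" "y \<in> fcone J" shows "x + y \<in> fcone J"
proof -
 obtain c d where "\<forall>h\<in>J. 0 \<le> c h" "\<forall>h\<in>J. 0 \<le> d h" "x = (\<Sum>h\<in>J. c h *\<^sub>R h)" "y = (\<Sum>h\<in>J. d h *\<^sub>R h)"
  using assms by (auto simp: fcone_def)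
 then show ?thesis using fconeI[of J "\<lambda>h. c h + d h"] by (simp add: algebra_simps sum.distrib)
qed

lemma fcone_scale: assumes "x \<in> fcone J" "0 \<le> a" shows "a *\<^sub>R x \<in> fcone J"
proof -
 obtain c where "\<forall>h\<in>J. 0 \<le> c h" "x = (\<Sum>h\<in>J. c h *\<^sub>R h)"
  using assms by (auto simp: fcone_def)
 then show ?thesis using fconeI[of J "\<lambda>h. a * c h"] assms by (simp add: scaleR_sum_right)
qed

lemma fcone_sum: "(\<And>i. i \<in> I \<Longrightarrow> f i \<in> fcone J) \<Longrightarrow> sum f I \<in> fcone J"
 by (induction I rule: infinite_finite_induct) (auto intro: fcone_0 fcone_add)

lemma fcone_base: "finite J \<Longrightarrow> h \<in> J \<Longrightarrow> h \<in> fcone J"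
 using fconeI[of J "\<lambda>x. if x = h then 1 else 0"]
 by (simp add: if_distrib[of "\<lambda>x. x *\<^sub>R _"] cong: if_cong)

lemma fcone_subset:
 assumes "\<And>h. h \<in> J \<Longrightarrow> h \<in> fcone J'"
 shows "fcone J \<subseteq> fcone J'"
 using assms by (auto simp: fcone_def[of J] intro!: fcone_sum fcone_scale)

lemma fcone_span: "fcone J \<subseteq> span J"
 by (auto simp: fcone_def intro!: span_sum span_scale intro: span_base)

lemma span_fcone: "finite J \<Longrightarrow> span (fcone J) = span J"
 by (meson fcone_base fcone_span span_mono span_minimal subspace_span subset_antisym subset_iff)

lemma fcone_minus_0: "finite J \<Longrightarrow> fcone (J - {0}) = fcone J"
proof
 assume "finite J"
 then show "fcone J \<subseteq> fcone (J - {0})"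
  by (intro fcone_subset) (metis DiffI emptyE fcone_0 fcone_base finite_Diff insertE)
 show "finite J \<Longrightarrow> fcone (J - {0}) \<subseteq> fcone J" by (intro fcone_subset) (auto intro: fcone_base)
qed

lemma convex_cone_hull_eq_fcone: "finite G \<Longrightarrow> convex_cone hull G = fcone G"
proof (rule hull_unique)
 assume G: "finite G"
 show "G \<subseteq> fcone G" using G by (auto intro: fcone_base)
 show "convex_cone (fcone G)" by (auto simp: convex_cone_iff fcone_0 fcone_add fcone_scale)
 fix T assume T: "G \<subseteq> T" "convex_cone T"
 have "sum f I \<in> T" if "\<And>i. i \<in> I \<Longrightarrow> f i \<in> T" for I :: "'a set" and f :: "'a \<Rightarrow> 'a"
  using that T(2) by (induction I rule: infinite_finite_induct) (auto simp: convex_cone_iff)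
 moreover have "c *\<^sub>R h \<in> T" if "h \<in> G" "0 \<le> c" for c h using that T by (auto simp: convex_cone_iff)
 ultimately show "fcone G \<subseteq> T" by (auto simp: fcone_def)
qed

text \<open>One step of Fourier-Motzkin elimination in terms of generators: those nonnegative at
  \<open>g\<close> are kept, and each pair of a positive and a negative one contributes its integral
  combination that vanishes at \<open>g\<close>.\<close>

lemma double_description_step:
 assumes N: "is_lattice N" and J: "finite J" "J \<subseteq> dual_lat N" and g: "g \<in> N"
 obtains J' where "finite J'" "J' \<subseteq> dual_lat N" "{m\<in>fcone J. 0 \<le> m g} = fcone J'"
proof -
 define J1 where "J1 = {h\<in>J. 0 \<le> h g}"
 define J2 where "J2 = (\<lambda>(h, h'). h g *\<^sub>R h' + (- h' g) *\<^sub>R h) ` ({h\<in>J. 0 < h g} \<times> {h\<in>J. h g < 0})"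
 have fin: "finite (J1 \<union> J2)" using J by (auto simp: J1_def J2_def)
 note M = is_lattice_closed[OF is_lattice_dual_lat[OF N]]
 have "J2 \<subseteq> dual_lat N"
 proof
  fix m assume "m \<in> J2"
  then obtain h h' where h: "h \<in> J" "h' \<in> J" "m = h g *\<^sub>R h' + (- h' g) *\<^sub>R h" by (auto simp: J2_def)
  obtain i j :: int where "h g = of_int i" "h' g = of_int j"
   using h J g by (auto simp: dual_lat_def subset_iff) (metis Ints_cases)
  then show "m \<in> dual_lat N" using h M(2)[OF M(5) M(5), of h' h i "-j"] J by auto
 qed
 moreover have "{m\<in>fcone J. 0 \<le> m g} = fcone (J1 \<union> J2)"
 proof
  show "fcone (J1 \<union> J2) \<subseteq> {m\<in>fcone J. 0 \<le> m g}"
  proof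
   fix m assume m: "m \<in> fcone (J1 \<union> J2)"
   have "fcone (J1 \<union> J2) \<subseteq> fcone J"
   proof (rule fcone_subset)
    fix h assume "h \<in> J1 \<union> J2"
    then consider "h \<in> J" | h1 h2 where "h1 \<in> J" "h2 \<in> J" "0 \<le> h1 g" "0 \<le> - h2 g" "h = h1 g *\<^sub>R h2 + (- h2 g) *\<^sub>R h1"
     by (auto simp: J1_def J2_def)
    then show "h \<in> fcone J" using fcone_base[OF J(1)] by (metis fcone_add fcone_scale)
   qed
   moreover have "0 \<le> h g" if "h \<in> J1 \<union> J2" for h using that by (auto simp: J1_def J2_def plus_fun_def)
   then have "0 \<le> m g" using m by (auto simp: fcone_def sum_fun_apply intro!: sum_nonneg)
   ultimately show "m \<in> {m\<in>fcone J. 0 \<le> m g}" using m by auto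
  qed
  show "{m\<in>fcone J. 0 \<le> m g} \<subseteq> fcone (J1 \<union> J2)"
  proof safe
   fix m assume "m \<in> fcone J" "0 \<le> m g"
   then obtain c where c: "\<And>h. h \<in> J \<Longrightarrow> 0 \<le> c h" and m: "m = (\<Sum>h\<in>J. c h *\<^sub>R h)" by (auto simp: fcone_def)
   define P where "P = {h\<in>J. 0 < h g}"
   define Q where "Q = {h\<in>J. h g < 0}"
   define Z where "Z = {h\<in>J. h g = 0}"
   have J3: "J = P \<union> Q \<union> Z" "finite P" "finite Q" "finite Z" "P \<inter> Q = {}" "(P \<union> Q) \<inter> Z = {}"
    using J by (auto simp: P_def Q_def Z_def)
   define a where "a = (\<Sum>h\<in>P. c h * h g)"
   define b where "b = (\<Sum>h\<in>Q. c h * (- h g))"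
   have a0: "a \<ge> 0" and b0: "b \<ge> 0" using c by (auto simp: a_def b_def P_def Q_def intro!: sum_nonneg mult_nonneg_nonpos)
   have split: "(\<Sum>h\<in>J. f h) = (\<Sum>h\<in>P. f h) + (\<Sum>h\<in>Q. f h) + (\<Sum>h\<in>Z. f h)" for f :: "_ \<Rightarrow> 'x::comm_monoid_add"
    unfolding J3(1) using J3 by (simp add: sum.union_disjoint)
   have "m g = (\<Sum>h\<in>J. c h * h g)" by (simp add: m sum_fun_apply)
   also have "\<dots> = a - b" by (subst split) (simp add: a_def b_def Z_def sum_negf)
   finally have ab: "b \<le> a" using \<open>0 \<le> m g\<close> by simp
   have mem: "h \<in> fcone (J1 \<union> J2)" if "h \<in> P \<union> Z" for h
    using that fin by (intro fcone_base) (auto simp: J1_def P_def Z_def)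
   show "m \<in> fcone (J1 \<union> J2)"
   proof (cases "a = 0")
    case True
    then have "b = 0" using ab b0 by simp
    then have "\<forall>h\<in>Q. c h * (- h g) = 0"
     unfolding b_def using J3(3) c by (subst (asm) sum_nonneg_eq_0_iff) (auto simp: Q_def mult_nonneg_nonpos)
    then have cQ: "\<forall>h\<in>Q. c h = 0" by (auto simp: Q_def)
    show ?thesis unfolding m by (subst split) (use cQ c mem in \<open>auto intro!: fcone_add fcone_sum fcone_scale simp: J3\<close>)
   next
    case False
    then have "a > 0" using a0 by simp
    have sQ: "(\<Sum>h'\<in>Q. c h' * (- h' g)) = b" and sP: "(\<Sum>h\<in>P. c h * h g) = a" by (auto simp: a_def b_def)
    \<comment> \<open>This double sum uses up the whole negative part of \<open>m\<close> and the
      fraction \<open>b / a\<close> of its positive part; the remaining positive part has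
      nonnegative coefficients because \<open>b \<le> a\<close>.\<close>
    have "(\<Sum>h\<in>P. \<Sum>h'\<in>Q. (c h * c h' / a) *\<^sub>R (h g *\<^sub>R h' + (- h' g) *\<^sub>R h))
      = (\<Sum>h\<in>P. \<Sum>h'\<in>Q. ((c h * h g) * (c h' / a)) *\<^sub>R h') + (\<Sum>h\<in>P. \<Sum>h'\<in>Q. ((c h' * (- h' g)) * (c h / a)) *\<^sub>R h)"
     by (simp add: scaleR_add_right sum.distrib mult_ac sum_subtractf sum_negf algebra_simps)
    also have "(\<Sum>h\<in>P. \<Sum>h'\<in>Q. ((c h * h g) * (c h' / a)) *\<^sub>R h') = (\<Sum>h'\<in>Q. (a * (c h' / a)) *\<^sub>R h')"
     by (subst sum.swap) (simp add: scaleR_sum_left[symmetric] sum_distrib_right[symmetric] sP del: times_divide_eq_right)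
    also have "\<dots> = (\<Sum>h'\<in>Q. c h' *\<^sub>R h')" using False by simp
    also have "(\<Sum>h\<in>P. \<Sum>h'\<in>Q. ((c h' * (- h' g)) * (c h / a)) *\<^sub>R h) = (\<Sum>h\<in>P. (b * (c h / a)) *\<^sub>R h)"
     by (simp only: scaleR_sum_left[symmetric] sum_distrib_right[symmetric] sQ)
    finally have e: "(\<Sum>h\<in>P. \<Sum>h'\<in>Q. (c h * c h' / a) *\<^sub>R (h g *\<^sub>R h' + (- h' g) *\<^sub>R h))
      = (\<Sum>h'\<in>Q. c h' *\<^sub>R h') + (\<Sum>h\<in>P. (b * (c h / a)) *\<^sub>R h)" .
    have e2: "(\<Sum>h\<in>P. c h *\<^sub>R h) = (\<Sum>h\<in>P. ((1 - b / a) * c h) *\<^sub>R h) + (\<Sum>h\<in>P. (b * (c h / a)) *\<^sub>R h)"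
     unfolding sum.distrib[symmetric] scaleR_add_left[symmetric] by (intro sum.cong refl) (simp add: field_simps)
    have "m = (\<Sum>h\<in>P. ((1 - b / a) * c h) *\<^sub>R h) + (\<Sum>h\<in>Z. c h *\<^sub>R h)
      + (\<Sum>h\<in>P. \<Sum>h'\<in>Q. (c h * c h' / a) *\<^sub>R (h g *\<^sub>R h' + (- h' g) *\<^sub>R h))"
     unfolding m by (subst split) (simp only: e2 e add_ac)
    also have "\<dots> \<in> fcone (J1 \<union> J2)"
    proof (rule fcone_add[OF fcone_add])
     have "0 \<le> (1 - b / a) * c h" if "h \<in> P" for h using c ab \<open>a > 0\<close> that by (auto simp: J3)
     then show "(\<Sum>h\<in>P. ((1 - b / a) * c h) *\<^sub>R h) \<in> fcone (J1 \<union> J2)" using mem by (intro fcone_sum fcone_scale) auto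
     show "(\<Sum>h\<in>Z. c h *\<^sub>R h) \<in> fcone (J1 \<union> J2)" using mem c by (intro fcone_sum fcone_scale) (auto simp: J3)
     have "h g *\<^sub>R h' + (- h' g) *\<^sub>R h \<in> fcone (J1 \<union> J2)" if "h \<in> P" "h' \<in> Q" for h h' using that fin by (auto simp: J2_def P_def Q_def intro!: fcone_base)
     then show "(\<Sum>h\<in>P. \<Sum>h'\<in>Q. (c h * c h' / a) *\<^sub>R (h g *\<^sub>R h' + (- h' g) *\<^sub>R h)) \<in> fcone (J1 \<union> J2)"
      using c \<open>a > 0\<close> by (intro fcone_sum fcone_scale) (auto simp: J3)
    qed
    finally show ?thesis .
   qed
  qed
 qed
 ultimately show ?thesis using that[of "J1 \<union> J2"] fin J by (auto simp: J1_def)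
qed

text \<open>The whole dual space is the cone over plus and minus a dual basis, and each generator of
  the given cone cuts it by one half-space, which keeps it finitely generated by lattice
  points.\<close>

lemma dual_finitely_generated:
 assumes N: "is_lattice N" and G: "finite G" "G \<subseteq> N"
 shows "\<exists>J. finite J \<and> J \<subseteq> dual_lat N \<and> {m\<in>real_dual (span N). \<forall>g\<in>G. 0 \<le> m g} = fcone J"
 using G
proof (induction G rule: finite_induct)
 case empty
 obtain B where B: "lattice_basis B N" using N by (auto simp: is_lattice_def)
 note D = lattice_basisD[OF B] and D' = lattice_basisD[OF dual_lat_basis[OF B]]
 define J where "J = crd B ` B \<union> uminus ` crd B ` B"
 have fin: "finite J" using D by (auto simp: J_def)
 have s: "J \<subseteq> dual_lat N" using D' is_lattice_closed(3)[OF is_lattice_dual_lat[OF N]] by (auto simp: J_def)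
 have "real_dual (span N) = fcone J"
 proof
  show "real_dual (span N) \<subseteq> fcone J"
  proof
   fix m assume "m \<in> real_dual (span N)"
   then have "m = (\<Sum>b\<in>B. m b *\<^sub>R crd B b)" using real_dual_expand[OF D(1,2)] D by auto
   also have "\<dots> = (\<Sum>b\<in>B. max (m b) 0 *\<^sub>R crd B b + max (- m b) 0 *\<^sub>R (- crd B b))"
    by (intro sum.cong refl) (auto simp: max_def)
   also have "\<dots> \<in> fcone J" using fin by (intro fcone_sum fcone_add fcone_scale fcone_base) (auto simp: J_def)
   finally show "m \<in> fcone J" .
  qed
  show "fcone J \<subseteq> real_dual (span N)"
   using fcone_span[of J] span_mono[OF s] span_dual_lat[OF N] by auto
 qed
 then show ?case using fin s by auto
next
 case (insert g G)
 then obtain J where J: "finite J" "J \<subseteq> dual_lat N" "{m\<in>real_dual (span N). \<forall>g\<in>G. 0 \<le> m g} = fcone J" by auto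
 obtain J' where "finite J'" "J' \<subseteq> dual_lat N" "{m\<in>fcone J. 0 \<le> m g} = fcone J'"
  using double_description_step[OF N J(1,2), of g] insert.prems by auto
 moreover have "{m\<in>real_dual (span N). \<forall>g\<in>insert g G. 0 \<le> m g} = {m\<in>fcone J. 0 \<le> m g}"
  unfolding J(3)[symmetric] by auto
 ultimately show ?case by auto
qed

lemma dual_cone_fcone:
 assumes "finite G" "G \<subseteq> span N"
 shows "dual_cone N (fcone G) = {m\<in>real_dual (span N). \<forall>g\<in>G. 0 \<le> m g}"
proof -
 have "0 \<le> m v" if m: "m \<in> real_dual (span N)" "\<forall>g\<in>G. 0 \<le> m g" and v: "v \<in> fcone G" for m v using v assms m
  by (auto simp: fcone_def real_dual_sum[OF m(1)] span_scale real_dualD(2)[OF m(1)] subset_iff intro!: sum.cong sum_nonneg)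
 then show ?thesis using fcone_base[OF assms(1)] by (auto simp: dual_cone_def)
qed

text \<open>The bidual theorem: a point outside the closed cone is separated from it by a
  hyperplane, and the separating functional belongs to the dual cone, so it is a nonnegative
  combination of \<open>J\<close>.\<close>

lemma cone_halfspaces:
 fixes N :: "'v::euclidean_space set"
 assumes G: "finite G" "G \<subseteq> span N" and J: "finite J" "dual_cone N (fcone G) = fcone J"
 shows "fcone G = {v\<in>span N. \<forall>h\<in>J. 0 \<le> h v}"
proof
 have "h \<in> dual_cone N (fcone G)" if "h \<in> J" for h using that J fcone_base[OF J(1)] by auto
 moreover have "fcone G \<subseteq> span N" using fcone_span[of G] G by (meson span_minimal subset_trans subspace_span)
 ultimately show "fcone G \<subseteq> {v\<in>span N. \<forall>h\<in>J. 0 \<le> h v}" by (auto simp: dual_cone_def)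
 show "{v\<in>span N. \<forall>h\<in>J. 0 \<le> h v} \<subseteq> fcone G"
 proof (rule ccontr)
  assume "\<not> {v\<in>span N. \<forall>h\<in>J. 0 \<le> h v} \<subseteq> fcone G"
  then obtain v where v: "v \<in> span N" "\<forall>h\<in>J. 0 \<le> h v" "v \<notin> fcone G" by auto
  have "closed (fcone G)" using closed_convex_cone_hull[OF G(1)] by (simp add: convex_cone_hull_eq_fcone G)
  moreover have "convex (fcone G)" using convex_convex_cone_hull[of G] by (simp add: convex_cone_hull_eq_fcone G)
  ultimately obtain a b where ab: "a \<bullet> v < b" "\<And>x. x \<in> fcone G \<Longrightarrow> b < a \<bullet> x"
   using separating_hyperplane_closed_point[of "fcone G" v] v by auto
  have b0: "b < 0" using ab(2)[OF fcone_0] by simp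
  have pos: "0 \<le> a \<bullet> x" if x: "x \<in> fcone G" for x
  proof (rule ccontr)
   assume n: "\<not> 0 \<le> a \<bullet> x"
   \<comment> \<open>This multiple of \<open>x\<close> lies on the separating hyperplane itself,
     where no point of the cone can be.\<close>
   then have "(b / (a \<bullet> x)) *\<^sub>R x \<in> fcone G" using b0 x by (intro fcone_scale) (auto simp: divide_nonpos_neg)
   from ab(2)[OF this] show False using n by simp
  qed
  define m where "m = (\<lambda>x. if x \<in> span N then a \<bullet> x else 0)"
  have md: "m \<in> real_dual (span N)"
   by (auto simp: m_def real_dual_def inner_add_right span_add span_scale)
  then have "m \<in> dual_cone N (fcone G)"
   using pos fcone_span[of G] G span_minimal[of G "span N"] by (auto simp: dual_cone_def m_def)
  then obtain c where c: "\<forall>h\<in>J. 0 \<le> c h" "m = (\<Sum>h\<in>J. c h *\<^sub>R h)" unfolding J by (auto simp: fcone_def)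
  then have "m v = (\<Sum>h\<in>J. c h * h v)" by (simp add: sum_fun_apply)
  also have "\<dots> \<ge> 0" using c v by (auto intro!: sum_nonneg)
  finally show False using ab(1) b0 v by (simp add: m_def)
 qed
qed

section \<open>Holomorphic and meromorphic functions\<close>

definition cmult :: "complex \<Rightarrow> 'v::real_vector \<times> 'v \<Rightarrow> 'v \<times> 'v"
 where "cmult z xi = Re z *\<^sub>R xi + Im z *\<^sub>R times_i xi"

definition csub :: "('v::real_vector \<times> 'v) set \<Rightarrow> bool"
 where "csub X \<longleftrightarrow> subspace X \<and> (\<forall>xi\<in>X. times_i xi \<in> X)"

declare split_paired_All [simp del] split_paired_Ex [simp del]

lemma csub_lat_C: "csub (lat_C N)"
 by (auto simp: csub_def lat_C_def times_i_def intro: subspace_Times span_neg)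

lemma csubD:
 assumes "csub X"
 shows "subspace X" "xi \<in> X \<Longrightarrow> times_i xi \<in> X" "xi \<in> X \<Longrightarrow> eta \<in> X \<Longrightarrow> xi + eta \<in> X"
  "xi \<in> X \<Longrightarrow> eta \<in> X \<Longrightarrow> xi - eta \<in> X" "xi \<in> X \<Longrightarrow> c *\<^sub>R xi \<in> X" "0 \<in> X" "xi \<in> X \<Longrightarrow> cmult z xi \<in> X"
 using assms unfolding csub_def cmult_def by (blast intro: subspace_add subspace_diff subspace_scale subspace_0)+

lemma openin_sub: "openin (top_of_set X) U \<Longrightarrow> U \<subseteq> X"
 by (rule openin_imp_subset)

text \<open>\<open>times_i\<close> preserves the product norm and maps each vector to an orthogonal
  one.\<close>

lemma norm_cmult: "norm (cmult z xi) = cmod z * norm (xi :: 'v::real_inner \<times> 'v)"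
proof -
 obtain a b where xi: "xi = (a, b)" by (cases xi)
 have n: "(norm (u, v))\<^sup>2 = u \<bullet> u + v \<bullet> v" for u v :: 'v
  by (simp add: norm_Pair power2_norm_eq_inner[symmetric])
 have "(norm (cmult z xi))\<^sup>2 = (cmod z)\<^sup>2 * (norm xi)\<^sup>2"
  unfolding xi cmult_def times_i_def cmod_power2 n fst_conv snd_conv scaleR_Pair add_Pair
  by (simp add: inner_add_left inner_add_right inner_diff_left inner_diff_right algebra_simps power2_eq_square inner_commute)
 then have "(norm (cmult z xi))\<^sup>2 = (cmod z * norm xi)\<^sup>2" by (simp add: power_mult_distrib)
 then show ?thesis by (simp add: power2_eq_iff_nonneg)
qed

lemma cmult_simps [simp]: "cmult 1 xi = xi" "cmult 0 xi = 0" "cmult z 0 = 0" "cmult (of_real c) xi = c *\<^sub>R xi" "cmult \<i> xi = times_i xi"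
 by (auto simp: cmult_def times_i_def zero_prod_def)

lemma holo_onD:
 assumes "holo_on X U F" "xi \<in> U"
 obtains F' where "(F has_derivative F') (at xi within X)" "\<And>eta. eta \<in> X \<Longrightarrow> F' (times_i eta) = \<i> * F' eta"
 using assms unfolding holo_on_def by blast

lemma holo_on_subset: "holo_on X U F \<Longrightarrow> V \<subseteq> U \<Longrightarrow> holo_on X V F"
 by (auto simp: holo_on_def)

lemma openin_eventually:
 assumes "openin (top_of_set X) U" "xi \<in> U"
 shows "\<forall>\<^sub>F eta in at xi within X. eta \<in> U"
proof -
 obtain T where "open T" "U = X \<inter> T" using assms by (auto simp: openin_open)
 then show ?thesis using assms by (auto simp: eventually_at_topological intro!: exI[of _ T])
qed

lemma holo_on_cong:
 assumes "openin (top_of_set X) U" "\<And>xi. xi \<in> U \<Longrightarrow> F xi = G xi" "holo_on X U F"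
 shows "holo_on X U G"
 unfolding holo_on_def
proof
 fix xi assume xi: "xi \<in> U"
 obtain F' where F': "(F has_derivative F') (at xi within X)" "\<And>eta. eta \<in> X \<Longrightarrow> F' (times_i eta) = \<i> * F' eta"
  using holo_onD[OF assms(3) xi] by blast
 have "(G has_derivative F') (at xi within X)"
  using F'(1)
 proof (rule has_derivative_transform_eventually)
  show "\<forall>\<^sub>F eta in at xi within X. F eta = G eta"
   by (rule eventually_mono[OF openin_eventually[OF assms(1) xi]]) (rule assms(2))
  show "F xi = G xi" using xi by (rule assms(2))
  show "xi \<in> X" using xi openin_sub[OF assms(1)] by (rule set_mp[rotated])
 qed
 then show "\<exists>F'. (G has_derivative F') (at xi within X) \<and> (\<forall>eta\<in>X. F' (times_i eta) = \<i> * F' eta)"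
  using F' by blast
qed

lemma holo_on_const: "holo_on X U (\<lambda>_. c)"
 unfolding holo_on_def by (auto intro!: exI[of _ "\<lambda>_. 0"])

lemma holo_on_add:
 assumes "holo_on X U F" "holo_on X U G" shows "holo_on X U (\<lambda>xi. F xi + G xi)"
 unfolding holo_on_def
proof
 fix xi assume "xi \<in> U"
 then obtain F' G' where "(F has_derivative F') (at xi within X)" "\<And>eta. eta \<in> X \<Longrightarrow> F' (times_i eta) = \<i> * F' eta"
   "(G has_derivative G') (at xi within X)" "\<And>eta. eta \<in> X \<Longrightarrow> G' (times_i eta) = \<i> * G' eta"
  using assms by (meson holo_onD)
 then show "\<exists>F'. ((\<lambda>xi. F xi + G xi) has_derivative F') (at xi within X) \<and> (\<forall>eta\<in>X. F' (times_i eta) = \<i> * F' eta)"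
  by (intro exI[of _ "\<lambda>eta. F' eta + G' eta"]) (auto intro!: has_derivative_add simp: algebra_simps)
qed

lemma holo_on_mult:
 assumes "holo_on X U F" "holo_on X U G" shows "holo_on X U (\<lambda>xi. F xi * G xi)"
 unfolding holo_on_def
proof
 fix xi assume "xi \<in> U"
 then obtain F' G' where "(F has_derivative F') (at xi within X)" "\<And>eta. eta \<in> X \<Longrightarrow> F' (times_i eta) = \<i> * F' eta"
   "(G has_derivative G') (at xi within X)" "\<And>eta. eta \<in> X \<Longrightarrow> G' (times_i eta) = \<i> * G' eta"
  using assms by (meson holo_onD)
 then show "\<exists>F'. ((\<lambda>xi. F xi * G xi) has_derivative F') (at xi within X) \<and> (\<forall>eta\<in>X. F' (times_i eta) = \<i> * F' eta)"
  by (intro exI[of _ "\<lambda>eta. F xi * G' eta + F' eta * G xi"]) (auto intro!: has_derivative_mult simp: algebra_simps)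
qed

lemma holo_on_uminus: "holo_on X U F \<Longrightarrow> holo_on X U (\<lambda>xi. - F xi)"
 using holo_on_mult[OF holo_on_const[of X U "-1"], of F] by simp

lemma holo_on_diff: "holo_on X U F \<Longrightarrow> holo_on X U G \<Longrightarrow> holo_on X U (\<lambda>xi. F xi - G xi)"
 using holo_on_add[OF _ holo_on_uminus, of X U F G] by simp

lemma holo_on_sum: "(\<And>i. i \<in> I \<Longrightarrow> holo_on X U (F i)) \<Longrightarrow> holo_on X U (\<lambda>xi. \<Sum>i\<in>I. F i xi)"
 by (induction I rule: infinite_finite_induct) (auto intro: holo_on_const holo_on_add)

lemma holo_on_prod: "(\<And>i. i \<in> I \<Longrightarrow> holo_on X U (F i)) \<Longrightarrow> holo_on X U (\<lambda>xi. \<Prod>i\<in>I. F i xi)"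
 by (induction I rule: infinite_finite_induct) (auto intro: holo_on_const holo_on_mult)

lemma holo_on_power: "holo_on X U F \<Longrightarrow> holo_on X U (\<lambda>xi. F xi ^ n)"
 by (induction n) (auto intro: holo_on_const holo_on_mult)

lemma holo_on_compose:
 assumes "holo_on X U F" "f holomorphic_on T" "open T" "\<And>xi. xi \<in> U \<Longrightarrow> F xi \<in> T"
 shows "holo_on X U (\<lambda>xi. f (F xi))"
 unfolding holo_on_def
proof
 fix xi assume xi: "xi \<in> U"
 then obtain F' where F': "(F has_derivative F') (at xi within X)" "\<And>eta. eta \<in> X \<Longrightarrow> F' (times_i eta) = \<i> * F' eta"
  using assms(1) by (meson holo_onD)
 have "(f has_field_derivative deriv f (F xi)) (at (F xi))"
  by (rule holomorphic_derivI[OF assms(2,3) assms(4)[OF xi]])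
 then have "(f has_derivative (*) (deriv f (F xi))) (at (F xi) within F ` X)"
  unfolding has_field_derivative_def by (rule has_derivative_at_withinI)
 from has_derivative_in_compose[OF F'(1) this]
 show "\<exists>F'. ((\<lambda>xi. f (F xi)) has_derivative F') (at xi within X) \<and> (\<forall>eta\<in>X. F' (times_i eta) = \<i> * F' eta)"
  by (intro exI[of _ "\<lambda>eta. deriv f (F xi) * F' eta"]) (auto simp: F'(2))
qed

lemma holo_on_linear:
 fixes l :: "'v::euclidean_space \<Rightarrow> real"
 assumes "linear l" shows "holo_on X U (\<lambda>xi. Complex (l (fst xi)) (l (snd xi)))"
proof -
 have e: "Complex (l (fst xi)) (l (snd xi)) = of_real (l (fst xi)) + \<i> * of_real (l (snd xi))" for xi
  by (simp add: complex_eq_iff)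
 have bl: "bounded_linear l" using assms by (simp add: linear_conv_bounded_linear)
 have "bounded_linear (\<lambda>xi::'v \<times> 'v. Complex (l (fst xi)) (l (snd xi)))"
  unfolding e by (intro bounded_linear_add bounded_linear_const_mult bounded_linear_compose[OF bounded_linear_of_real]
    bounded_linear_compose[OF bl] bounded_linear_fst bounded_linear_snd)
 then show ?thesis unfolding holo_on_def
  by (intro ballI exI[of _ "\<lambda>xi::'v \<times> 'v. Complex (l (fst xi)) (l (snd xi))"])
   (auto intro: bounded_linear_imp_has_derivative simp: times_i_def complex_eq_iff linear_neg[OF assms])
qed

lemma openin_self: "openin (top_of_set X) X" by auto

lemma holo_on_pairing:
 fixes N :: "'v::euclidean_space set"
 assumes "m \<in> real_dual (span N)" "U \<subseteq> lat_C N"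
 shows "holo_on (lat_C N) U (\<lambda>xi. pairing xi m)"
proof -
 obtain l where l: "linear l" "\<And>x. x \<in> span N \<Longrightarrow> l x = m x" using real_dual_linear[OF assms(1)] by blast
 have "holo_on (lat_C N) (lat_C N) (\<lambda>xi. pairing xi m)"
  by (rule holo_on_cong[OF openin_self _ holo_on_linear[OF l(1)]]) (auto simp: lat_C_def pairing_def l(2))
 then show ?thesis using holo_on_subset assms by blast
qed

section \<open>Complex linear maps and projections\<close>

definition clin :: "('v::real_vector \<times> 'v \<Rightarrow> 'v \<times> 'v) \<Rightarrow> bool"
 where "clin P \<longleftrightarrow> linear P \<and> (\<forall>xi. P (times_i xi) = times_i (P xi))"

lemma clin_map_prod: "linear p \<Longrightarrow> clin (map_prod p p)"
 by (auto simp: clin_def times_i_def linear_neg) (auto simp: linear_iff)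

text \<open>The setting of the projections of a complement map. A linear map that fixes
  \<open>X'\<close> pointwise is open onto \<open>X'\<close>, which lets dense open sets and
  meromorphic functions be pulled back.\<close>

definition cproj :: "('v::real_vector \<times> 'v \<Rightarrow> 'v \<times> 'v) \<Rightarrow> ('v \<times> 'v) set \<Rightarrow> ('v \<times> 'v) set \<Rightarrow> bool"
 where "cproj P X X' \<longleftrightarrow> clin P \<and> csub X \<and> csub X' \<and> X' \<subseteq> X \<and> (\<forall>xi\<in>X. P xi \<in> X') \<and> (\<forall>xi\<in>X'. P xi = xi)"

lemma clin_continuous:
 fixes P :: "'v::euclidean_space \<times> 'v \<Rightarrow> 'v \<times> 'v"
 shows "clin P \<Longrightarrow> continuous_on A P"
 by (simp add: clin_def linear_conv_bounded_linear linear_continuous_on)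

lemma holo_on_compose_linear:
 fixes P :: "'v::euclidean_space \<times> 'v \<Rightarrow> 'v \<times> 'v"
 assumes "holo_on X' U' F" "clin P" "\<And>xi. xi \<in> X \<Longrightarrow> P xi \<in> X'" "\<And>xi. xi \<in> U \<Longrightarrow> P xi \<in> U'"
 shows "holo_on X U (\<lambda>xi. F (P xi))"
 unfolding holo_on_def
proof
 fix xi assume xi: "xi \<in> U"
 obtain F' where F': "(F has_derivative F') (at (P xi) within X')" "\<And>eta. eta \<in> X' \<Longrightarrow> F' (times_i eta) = \<i> * F' eta"
  using holo_onD[OF assms(1) assms(4)[OF xi]] by blast
 have "(P has_derivative P) (at xi within X)"
  using assms(2) by (intro bounded_linear_imp_has_derivative) (simp add: clin_def linear_conv_bounded_linear)
 moreover have "(F has_derivative F') (at (P xi) within P ` X)"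
  using assms(3) by (intro has_derivative_subset[OF F'(1)]) blast
 ultimately have "((\<lambda>xi. F (P xi)) has_derivative (\<lambda>eta. F' (P eta))) (at xi within X)"
  by (rule has_derivative_in_compose)
 moreover have "F' (P (times_i eta)) = \<i> * F' (P eta)" if "eta \<in> X" for eta
  using F'(2)[OF assms(3)[OF that]] assms(2) by (simp add: clin_def)
 ultimately show "\<exists>F'. ((\<lambda>xi. F (P xi)) has_derivative F') (at xi within X) \<and> (\<forall>eta\<in>X. F' (times_i eta) = \<i> * F' eta)"
  by blast
qed

lemma has_derivative_line:
 fixes X :: "('v::euclidean_space \<times> 'v) set"
 assumes "csub X" "xi \<in> X" "eta \<in> X" "(F has_derivative F') (at (xi + cmult t eta) within X)" "F' (times_i eta) = \<i> * F' eta"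
 shows "((\<lambda>t. F (xi + cmult t eta)) has_field_derivative F' eta) (at t)"
proof -
 let ?g = "\<lambda>t. xi + cmult t eta"
 have lin: "linear (\<lambda>s. cmult s eta)" by (auto simp: linear_iff cmult_def algebra_simps)
 have "(?g has_derivative (\<lambda>s. cmult s eta)) (at t)"
  using lin by (auto intro!: derivative_eq_intros bounded_linear_imp_has_derivative simp: linear_conv_bounded_linear)
 moreover have "range ?g \<subseteq> X" using csubD(3)[OF assms(1,2) csubD(7)[OF assms(1,3)]] by blast
 then have "(F has_derivative F') (at (?g t) within range ?g)" by (rule has_derivative_subset[OF assms(4)])
 ultimately have "((\<lambda>t. F (?g t)) has_derivative (\<lambda>s. F' (cmult s eta))) (at t)"
  by (rule has_derivative_in_compose)
 moreover have "F' (cmult s eta) = F' eta * s" for s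
 proof -
  interpret F': bounded_linear F' using assms(4) by (rule has_derivative_bounded_linear)
  show ?thesis unfolding cmult_def F'.add F'.scaleR assms(5)
   by (simp add: complex_eq_iff scaleR_conv_of_real algebra_simps)
 qed
 ultimately show ?thesis unfolding has_field_derivative_def by simp
qed

text \<open>Complex lines reduce several variables to one: the identity theorem and the derivative
  estimates below are obtained along them.\<close>

lemma holo_on_line:
 fixes X :: "('v::euclidean_space \<times> 'v) set"
 assumes "csub X" "holo_on X U F" "xi \<in> X" "eta \<in> X"
 shows "(\<lambda>t. F (xi + cmult t eta)) holomorphic_on {t. xi + cmult t eta \<in> U}"
 unfolding holomorphic_on_def field_differentiable_def
 using has_derivative_line[OF assms(1,3,4)] assms(2,4) unfolding holo_on_def
 by (metis has_field_derivative_at_within mem_Collect_eq)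

lemma holo_on_continuous:
 assumes "holo_on X U F" "U \<subseteq> X" shows "continuous_on U F"
 unfolding continuous_on_eq_continuous_within
proof
 fix xi assume "xi \<in> U"
 then obtain F' where "(F has_derivative F') (at xi within X)" using assms(1) by (meson holo_onD)
 then show "continuous (at xi within U) F"
  using has_derivative_continuous continuous_within_subset assms(2) by blast
qed

subsection \<open>Dense open sets\<close>

definition dens :: "'a::topological_space set \<Rightarrow> 'a set \<Rightarrow> bool"
 where "dens X D \<longleftrightarrow> openin (top_of_set X) D \<and> X \<subseteq> closure D"

lemma mero_eq_dens: "mero_eq X F G \<longleftrightarrow> (\<exists>D. dens X D \<and> (\<forall>xi\<in>D. F xi = G xi))"
 by (auto simp: mero_eq_def dens_def)

lemma dens_self: "dens X X" by (auto simp: dens_def closure_subset)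

lemma dens_subset: "dens X D \<Longrightarrow> D \<subseteq> X"
 by (simp add: dens_def openin_sub)

lemma dens_meets:
 assumes "dens X D" "openin (top_of_set X) V" "V \<noteq> {}"
 shows "D \<inter> V \<noteq> {}"
proof -
 obtain T where T: "open T" "V = X \<inter> T" using assms by (auto simp: openin_open)
 obtain x where "x \<in> X" "x \<in> T" using T assms by auto
 then have "x \<in> closure D" using assms by (auto simp: dens_def)
 then obtain d where "d \<in> D" "d \<in> T" using T \<open>x \<in> T\<close> by (meson closure_iff_nhds_not_empty disjoint_iff order_refl)
 then show ?thesis using dens_subset[OF assms(1)] T by auto
qed

lemma densI:
 assumes "openin (top_of_set X) D" "\<And>V. openin (top_of_set X) V \<Longrightarrow> V \<noteq> {} \<Longrightarrow> D \<inter> V \<noteq> {}"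
 shows "dens X D"
 unfolding dens_def
proof (intro conjI subsetI)
 fix x assume x: "x \<in> X"
 show "x \<in> closure D" unfolding closure_iff_nhds_not_empty
 proof (intro allI impI)
  fix A U assume "U \<subseteq> A" "x \<in> U" "open U"
  then have "D \<inter> (X \<inter> U) \<noteq> {}" using x by (intro assms(2)) auto
  then show "D \<inter> A \<noteq> {}" using \<open>U \<subseteq> A\<close> by auto
 qed
qed fact

lemma dens_Int:
 assumes "dens X A" "dens X B" shows "dens X (A \<inter> B)"
proof (rule densI)
 show "openin (top_of_set X) (A \<inter> B)" using assms by (auto simp: dens_def)
 fix V assume V: "openin (top_of_set X) V" "V \<noteq> {}"
 have "openin (top_of_set X) (B \<inter> V)" "B \<inter> V \<noteq> {}" using assms V dens_meets[OF assms(2)] by (auto simp: dens_def)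
 then show "A \<inter> B \<inter> V \<noteq> {}" using dens_meets[OF assms(1)] by (metis inf_assoc)
qed

lemma dens_INT:
 assumes "finite I" "\<And>i. i \<in> I \<Longrightarrow> dens X (D i)"
 shows "dens X (X \<inter> (\<Inter>i\<in>I. D i))"
 using assms
proof (induction I)
 case (insert i I)
 have "dens X (D i)" "dens X (X \<inter> (\<Inter>i\<in>I. D i))" using insert by auto
 then have "dens X (D i \<inter> (X \<inter> (\<Inter>i\<in>I. D i)))" by (rule dens_Int)
 then show ?case by (simp add: Int_left_commute)
qed (auto intro: dens_self)

text \<open>Each identity between representatives of meromorphic functions comes with a dense open
  set of its own; this collects finitely many of them on a common one, so that they can be combined
  pointwise.\<close>

lemma dens_ex:
 assumes "finite I" "\<And>i. i \<in> I \<Longrightarrow> \<exists>D. dens X D \<and> (\<forall>xi\<in>D. P i xi)"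
 shows "\<exists>D. dens X D \<and> (\<forall>xi\<in>D. \<forall>i\<in>I. P i xi)"
proof -
 obtain D where "\<And>i. i \<in> I \<Longrightarrow> dens X (D i) \<and> (\<forall>xi\<in>D i. P i xi)" using assms(2) by metis
 then show ?thesis using dens_INT[OF assms(1), of X D] by (intro exI[of _ "X \<inter> (\<Inter>i\<in>I. D i)"]) auto
qed

lemma dens_ex2:
 assumes "\<exists>D. dens X D \<and> (\<forall>xi\<in>D. P xi)" "\<exists>D. dens X D \<and> (\<forall>xi\<in>D. Q xi)"
 shows "\<exists>D. dens X D \<and> (\<forall>xi\<in>D. P xi \<and> Q xi)"
 using assms dens_Int by (metis Int_iff)

lemma openin_both:
 "openin (top_of_set X) U \<Longrightarrow> openin (top_of_set X) V \<Longrightarrow> V \<subseteq> U \<Longrightarrow> openin (top_of_set U) V"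
 using openin_subset_trans[of X V U] openin_sub by blast

lemma dens_openin: "dens X D \<Longrightarrow> openin (top_of_set X) D"
 by (simp add: dens_def)

lemma dens_restrict:
 assumes "dens X D" "openin (top_of_set X) U" shows "dens U (D \<inter> U)"
proof (rule densI)
 show "openin (top_of_set U) (D \<inter> U)"
  by (rule openin_both[OF assms(2) openin_Int[OF dens_openin[OF assms(1)] assms(2)]]) blast
 fix V assume V: "openin (top_of_set U) V" "V \<noteq> {}"
 then have "openin (top_of_set X) V" using assms openin_trans by blast
 then show "D \<inter> U \<inter> V \<noteq> {}" using dens_meets[OF assms(1)] V openin_sub[OF V(1)] by blast
qed

lemma dens_restrict2:
 "dens U D \<Longrightarrow> openin (top_of_set X) U \<Longrightarrow> openin (top_of_set X) V \<Longrightarrow> V \<subseteq> U \<Longrightarrow> dens V (D \<inter> V)"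
 using dens_restrict[of U D V] openin_both[of X U V] by blast

lemma openin_ball:
 assumes "openin (top_of_set X) U" "xi \<in> U"
 obtains e where "e > 0" "X \<inter> ball xi e \<subseteq> U"
 using assms unfolding openin_contains_ball by (metis inf_commute)

lemma dens_vimage_on:
 fixes P :: "'v::euclidean_space \<times> 'v \<Rightarrow> 'v \<times> 'v"
 assumes P: "cproj P X X'" and U: "openin (top_of_set X') U" and D: "dens U D"
 shows "dens (X \<inter> P -` U) (X \<inter> P -` D)"
proof (rule densI)
 have P': "clin P" "csub X" "csub X'" "X' \<subseteq> X" "\<And>xi. xi \<in> X \<Longrightarrow> P xi \<in> X'" "\<And>xi. xi \<in> X' \<Longrightarrow> P xi = xi"
  using P by (auto simp: cproj_def)
 have lin: "linear P" using P' by (simp add: clin_def)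
 have op: "openin (top_of_set X) (X \<inter> P -` W)" if "openin (top_of_set X') W" for W
  using P' that by (intro continuous_openin_preimage[OF clin_continuous[OF P'(1)]]) auto
 have DU: "D \<subseteq> U" "openin (top_of_set X') D" using dens_subset[OF D] openin_trans[OF dens_openin[OF D] U] by auto
 then show "openin (top_of_set (X \<inter> P -` U)) (X \<inter> P -` D)" by (intro openin_both[OF op[OF U] op]) auto
 fix V assume V: "openin (top_of_set (X \<inter> P -` U)) V" "V \<noteq> {}"
 then obtain xi where xi: "xi \<in> V" "xi \<in> X" "P xi \<in> U" using openin_sub by blast
 obtain e where e: "e > 0" "X \<inter> ball xi e \<subseteq> V" using openin_ball[OF openin_trans[OF V(1) op[OF U]] xi(1)] by blast
 have "D \<inter> (U \<inter> ball (P xi) e) \<noteq> {}" using xi(3) e(1)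
  by (intro dens_meets[OF D] openin_open_Int open_ball) (metis IntI centre_in_ball empty_iff)
 then obtain d where "d \<in> D \<inter> (U \<inter> ball (P xi) e)" by (meson ex_in_conv)
 then have d: "d \<in> D" "d \<in> X'" "dist (P xi) d < e" using openin_sub[OF DU(2)] by (simp_all add: subset_iff)
 \<comment> \<open>Moving \<open>xi\<close> by a vector of \<open>X'\<close> moves its image by the
   same vector, since \<open>P\<close> fixes \<open>X'\<close>.\<close>
 define \<zeta> where "\<zeta> = xi + (d - P xi)"
 have dP: "d - P xi \<in> X'" using csubD(4)[OF P'(3) d(2) P'(5)[OF xi(2)]] .
 have "P \<zeta> = d" using P'(6)[OF dP] by (simp add: \<zeta>_def linear_add[OF lin])
 moreover have "\<zeta> \<in> X" using dP P'(4) csubD(3)[OF P'(2) xi(2)] unfolding \<zeta>_def by blast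
 moreover have "\<zeta> \<in> ball xi e" using d(3) by (simp add: \<zeta>_def dist_norm norm_minus_commute)
 ultimately show "X \<inter> P -` D \<inter> V \<noteq> {}" using d(1) e(2) by blast
qed

lemma dens_vimage:
 fixes P :: "'v::euclidean_space \<times> 'v \<Rightarrow> 'v \<times> 'v"
 assumes "cproj P X X'" "dens X' D"
 shows "dens X {xi\<in>X. P xi \<in> D}"
proof -
 have "X \<inter> P -` X' = X" "X \<inter> P -` D = {xi\<in>X. P xi \<in> D}" using assms(1) by (auto simp: cproj_def)
 then show ?thesis using dens_vimage_on[OF assms(1) openin_self assms(2)] by simp
qed

lemma mero_eq_refl: "(\<And>xi. xi \<in> X \<Longrightarrow> F xi = G xi) \<Longrightarrow> mero_eq X F G"
 unfolding mero_eq_dens by (blast intro: dens_self)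

lemma mero_eq_sym: "mero_eq X F G \<Longrightarrow> mero_eq X G F"
 by (auto simp: mero_eq_dens)

lemma mero_eq_trans: "mero_eq X F G \<Longrightarrow> mero_eq X G H \<Longrightarrow> mero_eq X F H"
 unfolding mero_eq_dens by (metis dens_Int Int_iff)

lemma mero_eq_restrict: "mero_eq X F G \<Longrightarrow> openin (top_of_set X) U \<Longrightarrow> mero_eq U F G"
 unfolding mero_eq_dens by (metis dens_restrict Int_iff)

subsection \<open>Identity theorems\<close>

text \<open>A complex line joins the point with a point of \<open>V\<close>. It meets the convex
  open set \<open>C\<close> in a convex, hence connected, open set of parameters, where the identity
  theorem in one variable applies.\<close>

lemma holo_identity:
 fixes X :: "('v::euclidean_space \<times> 'v) set"
 assumes S: "csub X" and C: "convex C" "open C" and F: "holo_on X (X \<inter> C) F"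
  and V: "openin (top_of_set X) V" "V \<subseteq> C" "V \<noteq> {}" "\<And>xi. xi \<in> V \<Longrightarrow> F xi = 0"
  and xi: "xi \<in> X" "xi \<in> C"
 shows "F xi = 0"
proof -
 let X = "X"
 obtain v where v: "v \<in> V" using V by auto
 then have vX: "v \<in> X" using openin_sub[OF V(1)] by blast
 let ?g = "\<lambda>t. v + cmult t (xi - v)"
 define T where "T = {t. ?g t \<in> C}"
 have d: "xi - v \<in> X" using xi vX csubD(4)[OF S] by blast
 have gX: "?g t \<in> X" for t using csubD(3)[OF S vX csubD(7)[OF S d]] .
 have lin: "linear (\<lambda>s. cmult s (xi - v))" by (auto simp: linear_iff cmult_def algebra_simps)
 have contg: "continuous_on A ?g" for A
  using linear_continuous_on[of "\<lambda>s. cmult s (xi - v)" A] lin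
  by (intro continuous_intros) (simp add: linear_conv_bounded_linear)
 have "open T" unfolding T_def using contg[of UNIV] C(2)
  by (metis (no_types) open_vimage vimage_def)
 moreover have "convex T"
  unfolding T_def convex_alt
 proof clarify
  fix s t u assume h: "?g s \<in> C" "?g t \<in> C" "0 \<le> u" "u \<le> (1::real)"
  have "?g ((1 - u) *\<^sub>R s + u *\<^sub>R t) = (1 - u) *\<^sub>R ?g s + u *\<^sub>R ?g t"
   by (simp add: cmult_def algebra_simps)
  then show "?g ((1 - u) *\<^sub>R s + u *\<^sub>R t) \<in> C" using h C(1) by (auto simp: convex_alt)
 qed
 ultimately have T: "open T" "connected T" by (auto simp: convex_connected)
 have hol: "(\<lambda>t. F (?g t)) holomorphic_on T"
  using gX by (intro holomorphic_on_subset[OF holo_on_line[OF S F vX d]]) (auto simp: T_def)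
 obtain W where W: "open W" "V = X \<inter> W" using V by (auto simp: openin_open)
 define T0 where "T0 = {t. ?g t \<in> W \<inter> C}"
 have "open T0" unfolding T0_def using contg[of UNIV] C(2) W(1)
  by (metis (no_types) open_Int open_vimage vimage_def)
 moreover have "T0 \<noteq> {}" using v W V by (auto simp: T0_def intro!: exI[of _ 0])
 ultimately have T0: "open T0" "T0 \<noteq> {}" by auto
 have "F (?g 1) = 0"
 proof (rule analytic_continuation_open[where f="\<lambda>t. F (?g t)" and g="\<lambda>_. 0" and s=T0 and s'=T])
  show "T0 \<subseteq> T" "1 \<in> T" using xi by (auto simp: T_def T0_def)
  show "F (?g t) = 0" if "t \<in> T0" for t using that gX[of t] W(2) V(4)[of "?g t"] by (auto simp: T0_def)
 qed (use T T0 hol in auto)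
 then show ?thesis by simp
qed

lemma dens_nonzero:
 fixes X :: "('v::euclidean_space \<times> 'v) set"
 assumes S: "csub X" and C: "convex C" "open C" and h: "holo_on X (X \<inter> C) h"
  and xi: "xi \<in> X" "xi \<in> C" "h xi \<noteq> 0"
 shows "dens (X \<inter> C) {eta\<in>X \<inter> C. h eta \<noteq> 0}"
proof (rule densI)
 have "continuous_on (X \<inter> C) h" using h by (rule holo_on_continuous) auto
 then have "openin (top_of_set (X \<inter> C)) (X \<inter> C \<inter> h -` (- {0}))"
  by (rule continuous_openin_preimage_gen) auto
 then show "openin (top_of_set (X \<inter> C)) {eta\<in>X \<inter> C. h eta \<noteq> 0}"
  by (simp add: Int_def vimage_def)
 fix V assume V: "openin (top_of_set (X \<inter> C)) V" "V \<noteq> {}"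
 have VC: "V \<subseteq> X \<inter> C" using openin_sub[OF V(1)] .
 have "openin (top_of_set X) V"
  using V(1) openin_trans[of "X \<inter> C" V "X"] C(2) by (simp add: openin_open_Int)
 then show "{eta\<in>X \<inter> C. h eta \<noteq> 0} \<inter> V \<noteq> {}"
  using holo_identity[OF S C h _ _ V(2) _ xi(1,2)] xi(3) VC by blast
qed

lemma dens_nonzero_entire:
 fixes X :: "('v::euclidean_space \<times> 'v) set"
 assumes "csub X" "holo_on X X h" "xi \<in> X" "h xi \<noteq> 0"
 shows "dens X {eta\<in>X. h eta \<noteq> 0}"
 using dens_nonzero[of X UNIV h xi] assms by auto

section \<open>Meromorphic functions as local quotients\<close>

definition fraction where "fraction X F U g h \<longleftrightarrow> openin (top_of_set X) U \<and> holo_on X U g \<and> holo_on X U h \<and>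
 dens U {eta\<in>U. h eta \<noteq> 0} \<and> (\<forall>eta\<in>U. h eta \<noteq> 0 \<longrightarrow> F eta = g eta / h eta)"

lemma mero_on_fraction: "mero_on X F \<longleftrightarrow> (\<forall>xi\<in>X. \<exists>U g h. xi \<in> U \<and> fraction X F U g h)"
proof -
 have "dens U {eta\<in>U. h eta \<noteq> 0} \<longleftrightarrow> U \<subseteq> closure {eta\<in>U. h eta \<noteq> 0}" if "openin (top_of_set X) U" "holo_on X U h" for U h
 proof -
  have "openin (top_of_set U) (U \<inter> h -` (- {0}))"
   using holo_on_continuous[OF that(2) openin_sub[OF that(1)]] by (rule continuous_openin_preimage_gen) auto
  moreover have "U \<inter> h -` (- {0}) = {eta\<in>U. h eta \<noteq> 0}" by auto
  ultimately show ?thesis by (simp add: dens_def)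
 qed
 then show ?thesis unfolding mero_on_def fraction_def by meson
qed

lemma fraction_restrict:
 assumes "fraction X F U g h" "openin (top_of_set X) W" "W \<subseteq> U"
 shows "fraction X F W g h"
proof -
 have "dens W ({eta\<in>U. h eta \<noteq> 0} \<inter> W)" using assms by (intro dens_restrict2[of U _ X]) (auto simp: fraction_def)
 moreover have "{eta\<in>U. h eta \<noteq> 0} \<inter> W = {eta\<in>W. h eta \<noteq> 0}" using assms(3) by blast
 ultimately show ?thesis using assms by (auto simp: fraction_def intro: holo_on_subset)
qed

text \<open>\<open>k\<close> is the numerator that the operation \<open>f\<close> produces over the
  product of the two denominators; one argument then serves products, sums and differences.\<close>

lemma mero_on_binop:
 assumes "mero_on X F" "mero_on X G"
  and op: "\<And>a b c d. b \<noteq> 0 \<Longrightarrow> d \<noteq> 0 \<Longrightarrow> f (a / b) (c / d) = k a b c d / (b * d)"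
  and k: "\<And>U a b c d. holo_on X U a \<Longrightarrow> holo_on X U b \<Longrightarrow> holo_on X U c \<Longrightarrow> holo_on X U d \<Longrightarrow>
   holo_on X U (\<lambda>xi. k (a xi) (b xi) (c xi) (d xi))"
 shows "mero_on X (\<lambda>xi. f (F xi) (G xi))"
 unfolding mero_on_fraction
proof
 fix xi assume xi: "xi \<in> X"
 obtain U a b where U: "xi \<in> U" "fraction X F U a b" using assms(1) xi by (auto simp: mero_on_fraction)
 obtain V c d where V: "xi \<in> V" "fraction X G V c d" using assms(2) xi by (auto simp: mero_on_fraction)
 let ?W = "U \<inter> V"
 have W: "openin (top_of_set X) ?W" using U V by (auto simp: fraction_def)
 have fr: "fraction X F ?W a b" "fraction X G ?W c d" by (rule fraction_restrict[OF U(2) W] fraction_restrict[OF V(2) W]; blast)+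
 then have "dens ?W ({eta\<in>?W. b eta \<noteq> 0} \<inter> {eta\<in>?W. d eta \<noteq> 0})" by (intro dens_Int) (auto simp: fraction_def)
 moreover have "{eta\<in>?W. b eta \<noteq> 0} \<inter> {eta\<in>?W. d eta \<noteq> 0} = {eta\<in>?W. b eta * d eta \<noteq> 0}" by auto
 ultimately have "fraction X (\<lambda>xi. f (F xi) (G xi)) ?W (\<lambda>eta. k (a eta) (b eta) (c eta) (d eta)) (\<lambda>eta. b eta * d eta)"
  using fr by (simp add: fraction_def holo_on_mult k op)
 then show "\<exists>U g h. xi \<in> U \<and> fraction X (\<lambda>xi. f (F xi) (G xi)) U g h" using U V by blast
qed

lemma mero_on_mult: "mero_on X F \<Longrightarrow> mero_on X G \<Longrightarrow> mero_on X (\<lambda>xi. F xi * G xi)"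
 by (rule mero_on_binop[where k="\<lambda>a b c d. a * c"]) (auto intro: holo_on_mult)

lemma mero_on_add: "mero_on X F \<Longrightarrow> mero_on X G \<Longrightarrow> mero_on X (\<lambda>xi. F xi + G xi)"
 by (rule mero_on_binop[where k="\<lambda>a b c d. a * d + c * b"]) (auto intro: holo_on_mult holo_on_add simp: field_simps)

lemma mero_on_diff: "mero_on X F \<Longrightarrow> mero_on X G \<Longrightarrow> mero_on X (\<lambda>xi. F xi - G xi)"
 by (rule mero_on_binop[where k="\<lambda>a b c d. a * d - c * b"]) (auto intro: holo_on_mult holo_on_diff simp: field_simps)

lemma mero_on_const: "mero_on X (\<lambda>_. c)"
proof -
 have "fraction X (\<lambda>_. c) X (\<lambda>_. c) (\<lambda>_. 1)" by (simp add: fraction_def holo_on_const dens_self)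
 then show ?thesis by (auto simp: mero_on_fraction)
qed

lemma mero_on_sum: "(\<And>i. i \<in> I \<Longrightarrow> mero_on X (F i)) \<Longrightarrow> mero_on X (\<lambda>xi. \<Sum>i\<in>I. F i xi)"
 by (induction I rule: infinite_finite_induct) (auto intro: mero_on_const mero_on_add)

lemma mero_on_quotient:
 fixes X :: "('v::euclidean_space \<times> 'v) set"
 assumes "csub X" "holo_on X X g" "holo_on X X h" "xi \<in> X" "h xi \<noteq> 0"
  and "\<And>eta. eta \<in> X \<Longrightarrow> h eta \<noteq> 0 \<Longrightarrow> F eta = g eta / h eta"
 shows "mero_on X F"
proof -
 have "fraction X F X g h" using dens_nonzero_entire[OF assms(1,3,4,5)] assms by (simp add: fraction_def)
 then show ?thesis by (auto simp: mero_on_fraction)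
qed

lemma mero_on_cong:
 assumes "mero_on X F" "\<And>xi. xi \<in> X \<Longrightarrow> F xi = G xi"
 shows "mero_on X G"
proof -
 have "fraction X F U g h \<Longrightarrow> fraction X G U g h" for U g h
  using assms(2) openin_sub by (fastforce simp: fraction_def)
 then show ?thesis using assms(1) unfolding mero_on_fraction by meson
qed

lemma mero_on_compose_projection:
 fixes P :: "'v::euclidean_space \<times> 'v \<Rightarrow> 'v \<times> 'v"
 assumes P: "cproj P X X'" and F: "mero_on X' F"
 shows "mero_on X (\<lambda>xi. F (P xi))"
 unfolding mero_on_fraction
proof
 fix xi assume xi: "xi \<in> X"
 have P': "clin P" "\<And>xi. xi \<in> X \<Longrightarrow> P xi \<in> X'" using P by (auto simp: cproj_def)
 obtain U g h where U: "P xi \<in> U" "fraction X' F U g h" using F P'(2)[OF xi] by (auto simp: mero_on_fraction)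
 let ?V = "X \<inter> P -` U"
 have "openin (top_of_set X) ?V"
  using P' U by (intro continuous_openin_preimage[OF clin_continuous[OF P'(1)], of _ X']) (auto simp: fraction_def)
 moreover have "holo_on X ?V (\<lambda>xi. g (P xi))" "holo_on X ?V (\<lambda>xi. h (P xi))"
  using U by (auto simp: fraction_def intro!: holo_on_compose_linear[OF _ P'(1,2)])
 moreover have "X \<inter> P -` {eta\<in>U. h eta \<noteq> 0} = {eta\<in>?V. h (P eta) \<noteq> 0}" by auto
 ultimately have fr: "fraction X (\<lambda>xi. F (P xi)) ?V (\<lambda>xi. g (P xi)) (\<lambda>xi. h (P xi))"
  using dens_vimage_on[OF P, of U "{eta\<in>U. h eta \<noteq> 0}"] U by (simp add: fraction_def)
 have "xi \<in> ?V" using xi U(1) by simp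
 with fr show "\<exists>U g h. xi \<in> U \<and> fraction X (\<lambda>xi. F (P xi)) U g h" by metis
qed

lemma mero_eq_Union:
 assumes "\<And>U. U \<in> \<U> \<Longrightarrow> openin (top_of_set X) U \<and> mero_eq U F G"
 shows "mero_eq (\<Union>\<U>) F G"
proof -
 have "\<forall>U\<in>\<U>. \<exists>D. dens U D \<and> (\<forall>eta\<in>D. F eta = G eta)" using assms by (auto simp: mero_eq_dens)
 then obtain D where D: "\<And>U. U \<in> \<U> \<Longrightarrow> dens U (D U) \<and> (\<forall>eta\<in>D U. F eta = G eta)" by metis
 have "dens (\<Union>\<U>) (\<Union>U\<in>\<U>. D U)"
 proof (rule densI)
  have "openin (top_of_set X) (D U)" if "U \<in> \<U>" for U using D assms that dens_openin openin_trans by blast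
  then have D': "openin (top_of_set X) (\<Union>U\<in>\<U>. D U)" by (intro openin_Union) auto
  have U': "openin (top_of_set X) (\<Union>\<U>)" using assms by (intro openin_Union) auto
  show "openin (top_of_set (\<Union>\<U>)) (\<Union>U\<in>\<U>. D U)" by (rule openin_both[OF U' D']) (use D dens_subset in blast)
  fix V assume V: "openin (top_of_set (\<Union>\<U>)) V" "V \<noteq> {}"
  then obtain T U where T: "open T" "V = \<Union>\<U> \<inter> T" "U \<in> \<U>" "U \<inter> T \<noteq> {}" unfolding openin_open by blast
  then have "D U \<inter> (U \<inter> T) \<noteq> {}" using dens_meets[of U "D U" "U \<inter> T"] D openin_open_Int[OF T(1), of U] by blast
  then show "(\<Union>U\<in>\<U>. D U) \<inter> V \<noteq> {}" using T by blast
 qed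
 then show ?thesis using D by (auto simp: mero_eq_dens)
qed

text \<open>The union of all open sets on which \<open>F\<close> and \<open>G\<close> agree is open,
  and it is also closed: on a small ball the difference is a quotient, whose numerator vanishes on
  the whole ball as soon as it vanishes on an open part of it. The subspace \<open>X\<close> is
  connected.\<close>

lemma mero_identity:
 fixes X :: "('v::euclidean_space \<times> 'v) set"
 assumes S: "csub X" and F: "mero_on X F" and G: "mero_on X G"
  and V: "openin (top_of_set X) V" "V \<noteq> {}" "mero_eq V F G"
 shows "mero_eq X F G"
proof -
 have loc: "\<exists>U. openin (top_of_set X) U \<and> xi \<in> U \<and>
  (\<forall>W. openin (top_of_set X) W \<longrightarrow> W \<noteq> {} \<longrightarrow> W \<subseteq> U \<longrightarrow> mero_eq W F G \<longrightarrow> mero_eq U F G)" if xi: "xi \<in> X" for xi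
 proof -
  obtain U0 g h where U0: "xi \<in> U0" "fraction X (\<lambda>xi. F xi - G xi) U0 g h"
   using mero_on_diff[OF F G] xi unfolding mero_on_fraction by blast
  then obtain e where e: "e > 0" "X \<inter> ball xi e \<subseteq> U0" using openin_ball[of X U0 xi] by (auto simp: fraction_def)
  let ?U = "X \<inter> ball xi e"
  have U: "openin (top_of_set X) ?U" "xi \<in> ?U" using e xi by (auto simp: openin_open_Int)
  define E where "E = {eta\<in>?U. h eta \<noteq> 0}"
  have fr: "holo_on X ?U g" "dens ?U E" "\<And>eta. eta \<in> E \<Longrightarrow> F eta - G eta = g eta / h eta \<and> h eta \<noteq> 0"
   using fraction_restrict[OF U0(2) U(1) e(2)] by (auto simp: fraction_def E_def)
  have "mero_eq ?U F G" if W: "openin (top_of_set X) W" "W \<noteq> {}" "W \<subseteq> ?U" "mero_eq W F G" for W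
  proof -
   obtain D where D: "dens W D" "\<And>eta. eta \<in> D \<Longrightarrow> F eta = G eta" using W(4) by (auto simp: mero_eq_dens)
   have DE: "dens W (D \<inter> (E \<inter> W))" using dens_Int[OF D(1) dens_restrict2[OF fr(2) U(1) W(1,3)]] .
   have z: "g eta = 0" if "eta \<in> D \<inter> (E \<inter> W)" for eta using fr(3)[of eta] D(2)[of eta] that by auto
   have o: "openin (top_of_set X) (D \<inter> (E \<inter> W))" using dens_openin[OF DE] W(1) openin_trans by blast
   have n: "D \<inter> (E \<inter> W) \<noteq> {}" "D \<inter> (E \<inter> W) \<subseteq> ball xi e" using dens_meets[OF DE openin_self W(2)] by (auto simp: E_def)
   have "g eta = 0" if "eta \<in> ?U" for eta
    using holo_identity[OF S convex_ball open_ball fr(1) o n(2,1) z, of eta] that by blast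
   then have "F eta = G eta" if "eta \<in> E" for eta using fr(3)[OF that] that by (simp add: E_def)
   then show ?thesis using fr(2) by (auto simp: mero_eq_dens)
  qed
  then show ?thesis using U by blast
 qed
 define A where "A = \<Union>{U. openin (top_of_set X) U \<and> mero_eq U F G}"
 have eA: "mero_eq A F G" unfolding A_def by (rule mero_eq_Union[of _ X]) auto
 have oA: "openin (top_of_set X) A" unfolding A_def by (rule openin_Union) auto
 have "openin (top_of_set X) (X - A)" unfolding openin_subopen[of _ "X - A"]
 proof
  fix xi assume xi: "xi \<in> X - A"
  then obtain U where U: "openin (top_of_set X) U" "xi \<in> U"
   "\<And>W. openin (top_of_set X) W \<Longrightarrow> W \<noteq> {} \<Longrightarrow> W \<subseteq> U \<Longrightarrow> mero_eq W F G \<Longrightarrow> mero_eq U F G" using loc[of xi] by auto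
  have UA: "openin (top_of_set X) (U \<inter> A)" using U(1) oA by (rule openin_Int)
  have "U \<inter> A = {}"
  proof (rule ccontr)
   assume "U \<inter> A \<noteq> {}"
   then have "mero_eq U F G" using mero_eq_restrict[OF eA openin_both[OF oA UA]] U(3)[OF UA] by blast
   then show False using U(1,2) xi by (auto simp: A_def)
  qed
  then show "\<exists>T. openin (top_of_set X) T \<and> xi \<in> T \<and> T \<subseteq> X - A" using U(1,2) openin_sub[OF U(1)] by blast
 qed
 moreover have "connected X" by (intro convex_connected subspace_imp_convex csubD(1)[OF S])
 moreover have "A \<noteq> {}" using V by (auto simp: A_def)
 ultimately have "A = X" using oA openin_sub[OF oA] unfolding connected_clopen closedin_def by auto
 then show ?thesis using eA by simp
qed

text \<open>Two holomorphic extensions agree on a dense set and are continuous, so they agree at the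
  point. This uniqueness is what makes the definite descriptions behind the cycle Todd coefficients
  well defined.\<close>

lemma has_mero_value_unique:
 assumes "has_mero_value X F xi c" "has_mero_value X F xi d"
 shows "c = d"
proof (rule ccontr)
 assume ne: "c \<noteq> d"
 obtain U g D where U: "openin (top_of_set X) U" "xi \<in> U" "holo_on X U g" "g xi = c" "dens U D" "\<And>eta. eta \<in> D \<Longrightarrow> F eta = g eta"
  using assms(1) by (auto simp: has_mero_value_def mero_eq_dens)
 obtain V h E where V: "openin (top_of_set X) V" "xi \<in> V" "holo_on X V h" "h xi = d" "dens V E" "\<And>eta. eta \<in> E \<Longrightarrow> F eta = h eta"
  using assms(2) by (auto simp: has_mero_value_def mero_eq_dens)
 let ?W = "U \<inter> V"
 have W: "openin (top_of_set X) ?W" using U V by auto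
 have sub: "U \<subseteq> X" "V \<subseteq> X" using openin_sub[OF U(1)] openin_sub[OF V(1)] .
 have "continuous_on ?W (\<lambda>eta. g eta - h eta)"
  using U V sub by (intro continuous_on_diff) (auto intro: continuous_on_subset holo_on_continuous)
 then have "openin (top_of_set ?W) (?W \<inter> (\<lambda>eta. g eta - h eta) -` (- {0}))" by (rule continuous_openin_preimage_gen) auto
 moreover have "xi \<in> ?W \<inter> (\<lambda>eta. g eta - h eta) -` (- {0})" using U V ne by auto
 moreover have "dens ?W ((D \<inter> ?W) \<inter> (E \<inter> ?W))"
  by (intro dens_Int dens_restrict2[OF U(5,1) W] dens_restrict2[OF V(5,1) W]) auto
 ultimately obtain eta where "eta \<in> (D \<inter> ?W) \<inter> (E \<inter> ?W)" "eta \<in> ?W \<inter> (\<lambda>eta. g eta - h eta) -` (- {0})"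
  using dens_meets by blast
 then show False using U(6)[of eta] V(6)[of eta] by auto
qed

lemma mero_valueI: "has_mero_value X F xi c \<Longrightarrow> mero_value X F xi = c"
 unfolding mero_value_def using has_mero_value_unique by blast

lemma has_mero_value_add:
 assumes "has_mero_value X F xi c" "has_mero_value X G xi d"
 shows "has_mero_value X (\<lambda>eta. F eta + G eta) xi (c + d)"
proof -
 obtain U g D where U: "openin (top_of_set X) U" "xi \<in> U" "holo_on X U g" "g xi = c" "dens U D" "\<And>eta. eta \<in> D \<Longrightarrow> F eta = g eta"
  using assms(1) by (auto simp: has_mero_value_def mero_eq_dens)
 obtain V h E where V: "openin (top_of_set X) V" "xi \<in> V" "holo_on X V h" "h xi = d" "dens V E" "\<And>eta. eta \<in> E \<Longrightarrow> G eta = h eta"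
  using assms(2) by (auto simp: has_mero_value_def mero_eq_dens)
 let ?W = "U \<inter> V"
 have W: "openin (top_of_set X) ?W" using U V by auto
 have sub: "U \<subseteq> X" "V \<subseteq> X" using openin_sub[OF U(1)] openin_sub[OF V(1)] .
 have "dens ?W ((D \<inter> ?W) \<inter> (E \<inter> ?W))"
  by (intro dens_Int dens_restrict2[OF U(5,1) W] dens_restrict2[OF V(5,1) W]) auto
 then have "mero_eq ?W (\<lambda>eta. F eta + G eta) (\<lambda>eta. g eta + h eta)" using U V by (auto simp: mero_eq_dens)
 then show ?thesis using W U V unfolding has_mero_value_def
  by (intro exI[of _ ?W] exI[of _ "\<lambda>eta. g eta + h eta"]) (auto intro: holo_on_add holo_on_subset)
qed

lemma has_mero_value_sum:
 assumes "xi \<in> X" "\<And>i. i \<in> I \<Longrightarrow> has_mero_value X (F i) xi (c i)"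
 shows "has_mero_value X (\<lambda>eta. \<Sum>i\<in>I. F i eta) xi (\<Sum>i\<in>I. c i)"
 using assms(2)
proof (induction I rule: infinite_finite_induct)
 case (insert i I) then show ?case by (simp add: has_mero_value_add)
qed (use assms(1) in \<open>auto simp: has_mero_value_def intro!: exI[of _ X] exI[of _ "\<lambda>_. 0"] holo_on_const mero_eq_refl\<close>)

lemma has_mero_value_cong:
 assumes "has_mero_value X F xi c" "mero_eq X F G"
 shows "has_mero_value X G xi c"
 using assms unfolding has_mero_value_def by (metis mero_eq_restrict mero_eq_sym mero_eq_trans)

subsection \<open>Series of holomorphic functions\<close>

lemma maximum_modulus_cball:
 assumes "f holomorphic_on ball 0 r" "0 < \<rho>" "\<rho> < r" "\<And>t::complex. cmod t = \<rho> \<Longrightarrow> cmod (f t) \<le> B" "cmod t \<le> \<rho>"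
 shows "cmod (f t) \<le> B"
proof (rule maximum_modulus_frontier[of f "cball 0 \<rho>"])
 have sub: "cball 0 \<rho> \<subseteq> ball (0::complex) r" using assms by auto
 show "f holomorphic_on interior (cball 0 \<rho>)"
  using holomorphic_on_subset[OF assms(1)] sub interior_subset by blast
 show "continuous_on (closure (cball 0 \<rho>)) f"
  using holomorphic_on_imp_continuous_on[OF holomorphic_on_subset[OF assms(1) sub]] by simp
 show "cmod (f z) \<le> B" if "z \<in> frontier (cball 0 \<rho>)" for z
  using that assms by (auto simp: frontier_cball)
qed (use assms in auto)

text \<open>\<open>g\<close> and \<open>k\<close> are the first and second difference quotients at
  0, holomorphic after filling in the value there. By the maximum principle they are bounded by
  their sizes on the circle of radius \<open>r / 2\<close>: \<open>2 * M / (r / 2)\<close> for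
  \<open>g\<close>, and twice that over \<open>r / 2\<close> for \<open>k\<close>.\<close>

lemma second_order_bound:
 assumes f: "f holomorphic_on ball 0 r" and r: "0 < r" and M: "\<And>t. cmod t < r \<Longrightarrow> cmod (f t) \<le> M"
 shows "cmod t \<le> r / 2 \<Longrightarrow> cmod (f t - f 0 - t * deriv f 0) \<le> 16 * M / r\<^sup>2 * (cmod t)\<^sup>2" and "cmod (deriv f 0) \<le> 4 * M / r"
proof -
 have M0: "0 \<le> M" using M[of 0] r order_trans[OF norm_ge_zero] by auto
 define g where "g = (\<lambda>z. if z = 0 then deriv f 0 else (f z - f 0) / (z - 0))"
 define k where "k = (\<lambda>z. if z = 0 then deriv g 0 else (g z - g 0) / (z - 0))"
 have g: "g holomorphic_on ball 0 r" unfolding g_def using r by (intro pole_lemma f) auto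
 have k: "k holomorphic_on ball 0 r" unfolding k_def using r by (intro pole_lemma g) auto
 have gs: "cmod (g z) \<le> 4 * M / r" if z: "cmod z = r / 2" for z
 proof -
  have "cmod (f z - f 0) / cmod z \<le> 2 * M / (r / 2)" using M[of z] M[of 0] z r by (auto simp: z intro!: norm_triangle_le_diff divide_right_mono)
  then show ?thesis using z r by (auto simp: g_def norm_divide)
 qed
 have gb: "cmod (g z) \<le> 4 * M / r" if "cmod z \<le> r / 2" for z
  using maximum_modulus_cball[OF g _ _ gs that] r by auto
 have kb: "cmod (k t) \<le> 16 * M / r\<^sup>2" if t: "cmod t \<le> r / 2"
 proof (rule maximum_modulus_cball[OF k _ _ _ t])
  fix z :: complex assume z: "cmod z = r / 2"
  have "cmod (g z - g 0) \<le> 4 * M / r + 4 * M / r" using gb[of z] gb[of 0] z r by (intro norm_triangle_le_diff add_mono) auto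
  then have "cmod (g z - g 0) / cmod z \<le> (4 * M / r + 4 * M / r) / (r / 2)" unfolding z using r by (intro divide_right_mono) auto
  also have "\<dots> = 16 * M / r\<^sup>2" using r by (simp add: power2_eq_square field_simps)
  finally show "cmod (k z) \<le> 16 * M / r\<^sup>2" using z r by (auto simp: k_def norm_divide)
 qed (use r in auto)
 show "cmod (deriv f 0) \<le> 4 * M / r" using gb[of 0] r by (simp add: g_def)
 show "cmod (f t - f 0 - t * deriv f 0) \<le> 16 * M / r\<^sup>2 * (cmod t)\<^sup>2" if t: "cmod t \<le> r / 2"
 proof (cases "t = 0")
  case False
  then have "f t - f 0 - t * deriv f 0 = t\<^sup>2 * k t" by (simp add: k_def g_def power2_eq_square field_simps)
  then show ?thesis using mult_right_mono[OF kb[OF t], of "(cmod t)\<^sup>2"] by (simp add: norm_mult norm_power mult.commute)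
 qed simp
qed

text \<open>Turns objects that are controlled only on a subspace into linear maps of the ambient
  space, where boundedness and inner products are available.\<close>

lemma real_retraction:
 fixes S :: "'a::euclidean_space set"
 assumes "subspace S"
 obtains p where "linear p" "\<And>x. p x \<in> S" "\<And>x. x \<in> S \<Longrightarrow> p x = x"
proof -
 obtain B where B: "independent B" "span B = S" "B \<subseteq> S"
  by (metis assms basis_exists span_subspace)
 obtain p where p: "linear p" "\<forall>x\<in>B. p x = id x" "range p = span (id ` B)"
  using linear_independent_extend_subspace[OF B(1), of id] by blast
 have "p x = id x" if "x \<in> span B" for x
  using linear_eq_on[OF p(1) linear_id that] p(2) by auto
 then show ?thesis using that[OF p(1)] p(3) B by auto
qed

lemma holo_second_order:
 fixes X :: "('v::euclidean_space \<times> 'v) set"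
 assumes X: "csub X" and F: "holo_on X U F" and R: "0 < R" "X \<inter> ball xi (2 * R) \<subseteq> U" and xi: "xi \<in> X"
  and M: "\<And>\<zeta>. \<zeta> \<in> U \<Longrightarrow> cmod (F \<zeta>) \<le> M"
  and F': "(F has_derivative F') (at xi within X)" "F' (times_i eta) = \<i> * F' eta" and eta: "eta \<in> X"
 shows "norm eta \<le> R \<Longrightarrow> cmod (F (xi + eta) - F xi - F' eta) \<le> 4 * M / R\<^sup>2 * (norm eta)\<^sup>2"
  and "cmod (F' eta) \<le> 2 * M / R * norm eta"
proof -
 have "(norm eta \<le> R \<longrightarrow> cmod (F (xi + eta) - F xi - F' eta) \<le> 4 * M / R\<^sup>2 * (norm eta)\<^sup>2) \<and> cmod (F' eta) \<le> 2 * M / R * norm eta"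
 proof (cases "eta = 0")
  case True
  show ?thesis using F'(1) True by (simp add: has_derivative_bounded_linear linear_0 bounded_linear.linear)
 next
  case False
  \<comment> \<open>The radius in the parameter \<open>t\<close> for which the line stays within
    distance \<open>2 * R\<close> of \<open>xi\<close>.\<close>
  define r where "r = 2 * R / norm eta"
  have r: "0 < r" "4 * M / r = 2 * M / R * norm eta" "16 * M / r\<^sup>2 = 4 * M / R\<^sup>2 * (norm eta)\<^sup>2"
   and r2: "norm eta \<le> R \<Longrightarrow> cmod 1 \<le> r / 2"
   using R False by (auto simp: r_def power2_eq_square field_simps)
  let ?f = "\<lambda>t. F (xi + cmult t eta)"
  have inU: "xi + cmult t eta \<in> U" if "cmod t < r" for t using that False R(2) csubD(3)[OF X xi csubD(7)[OF X eta]] by (auto simp: dist_norm norm_cmult r_def field_simps)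
  have h: "?f holomorphic_on ball 0 r" by (rule holomorphic_on_subset[OF holo_on_line[OF X F xi eta]]) (auto intro: inU)
  have d: "deriv ?f 0 = F' eta" using F' by (intro DERIV_imp_deriv has_derivative_line[OF X xi eta]) auto
  note B = second_order_bound[OF h r(1) M[OF inU]]
  show ?thesis using B(1)[OF _ r2] B(2) unfolding d r(2,3) by simp
 qed
 then show "norm eta \<le> R \<Longrightarrow> cmod (F (xi + eta) - F xi - F' eta) \<le> 4 * M / R\<^sup>2 * (norm eta)\<^sup>2"
  "cmod (F' eta) \<le> 2 * M / R * norm eta" by blast+
qed

lemma has_derivative_quadratic:
 assumes "bounded_linear A" "0 < R" "\<And>\<zeta>. \<zeta> \<in> X \<Longrightarrow> dist \<zeta> xi < R \<Longrightarrow> norm (F \<zeta> - F xi - A (\<zeta> - xi)) \<le> C * (norm (\<zeta> - xi))\<^sup>2"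
 shows "(F has_derivative A) (at xi within X)"
 unfolding has_derivative_within_alt2
proof (intro conjI allI impI assms(1))
 fix e :: real assume e: "e > 0"
 show "\<forall>\<^sub>F \<zeta> in at xi within X. norm (F \<zeta> - F xi - A (\<zeta> - xi)) \<le> e * norm (\<zeta> - xi)"
  unfolding eventually_at
 proof (intro exI[of _ "min R (e / (\<bar>C\<bar> + 1))"] conjI ballI impI)
  fix \<zeta> assume \<zeta>: "\<zeta> \<in> X" "\<zeta> \<noteq> xi \<and> dist \<zeta> xi < min R (e / (\<bar>C\<bar> + 1))"
  have "norm (\<zeta> - xi) * (\<bar>C\<bar> + 1) < e" using \<zeta>(2) by (simp add: dist_norm pos_less_divide_eq)
  then have "C * norm (\<zeta> - xi) \<le> e"
   using mult_right_mono[of C "\<bar>C\<bar> + 1" "norm (\<zeta> - xi)"] by (smt (verit) mult.commute norm_ge_zero)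
  note * = mult_right_mono[OF this norm_ge_zero[of "\<zeta> - xi"]]
  show "norm (F \<zeta> - F xi - A (\<zeta> - xi)) \<le> e * norm (\<zeta> - xi)"

   by (rule order_trans[OF assms(3) order_trans[OF _ *]]) (use \<zeta> in \<open>auto simp: power2_eq_square\<close>)
 qed (use assms(2) e in auto)
qed

text \<open>The quadratic remainders of the summands are bounded by constants proportional to
  \<open>m k\<close>, so they can be summed; the sum of the derivatives is then the derivative of
  the sum.\<close>

lemma holo_on_suminf:
 fixes X :: "('v::euclidean_space \<times> 'v) set"
 assumes X: "csub X" and U: "openin (top_of_set X) U" and F: "\<And>k. holo_on X U (F k)"
  and m: "\<And>k \<zeta>. \<zeta> \<in> U \<Longrightarrow> cmod (F k \<zeta>) \<le> m k" "summable m"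
 shows "holo_on X U (\<lambda>\<zeta>. \<Sum>k. F k \<zeta>)"
 unfolding holo_on_def
proof
 fix xi assume xi: "xi \<in> U"
 have xiX: "xi \<in> X" using xi openin_sub[OF U] by blast
 obtain e where e: "e > 0" "X \<inter> ball xi e \<subseteq> U" using openin_ball[OF U xi] by blast
 define R where "R = e / 2"
 have R: "0 < R" "X \<inter> ball xi (2 * R) \<subseteq> U" using e by (auto simp: R_def)
 have "\<exists>F'. (F k has_derivative F') (at xi within X) \<and> (\<forall>eta\<in>X. F' (times_i eta) = \<i> * F' eta)" for k
  using F xi by (auto simp: holo_on_def)
 then obtain F' where F': "\<And>k. (F k has_derivative F' k) (at xi within X)" "\<And>k eta. eta \<in> X \<Longrightarrow> F' k (times_i eta) = \<i> * F' k eta"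
  by metis
 have lin: "linear (F' k)" for k using F'(1) has_derivative_linear by blast
 have est: "norm eta \<le> R \<Longrightarrow> cmod (F k (xi + eta) - F k xi - F' k eta) \<le> 4 * m k / R\<^sup>2 * (norm eta)\<^sup>2"
  "cmod (F' k eta) \<le> 2 * m k / R * norm eta" if "eta \<in> X" for k eta
  using holo_second_order[OF X F R xiX m(1) F'(1) F'(2)[OF that] that] by auto
 obtain p where p: "linear p" "\<And>x. p x \<in> X" "\<And>x. x \<in> X \<Longrightarrow> p x = x"
  using real_retraction[OF csubD(1)[OF X]] by blast
 \<comment> \<open>The derivatives are estimated on \<open>X\<close> only; composing with the
   retraction makes their sum a linear map that is defined everywhere.\<close>
 define A where "A eta = (\<Sum>k. F' k (p eta))" for eta
 have sumF': "summable (\<lambda>k. F' k (p eta))" for eta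
  by (rule summable_comparison_test'[OF summable_mult2[OF summable_divide[OF summable_mult[OF m(2), of 2]]] est(2)[OF p(2)]])
 have sumF: "summable (\<lambda>k. F k \<zeta>)" if "\<zeta> \<in> U" for \<zeta>
  by (rule summable_comparison_test'[OF m(2) m(1)[OF that]])
 have "linear A" unfolding A_def
 proof (rule linearI)
  show "(\<Sum>k. F' k (p (x + y))) = (\<Sum>k. F' k (p x)) + (\<Sum>k. F' k (p y))" for x y
   using suminf_add[OF sumF' sumF'] by (simp add: linear_add[OF p(1)] linear_add[OF lin])
  show "(\<Sum>k. F' k (p (c *\<^sub>R x))) = c *\<^sub>R (\<Sum>k. F' k (p x))" for c x
   using suminf_scaleR_right[OF sumF'] by (simp add: linear_scale[OF p(1)] linear_scale[OF lin])
 qed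
 then have "bounded_linear A" by (simp add: linear_conv_bounded_linear)
 then have "((\<lambda>\<zeta>. \<Sum>k. F k \<zeta>) has_derivative A) (at xi within X)"
 proof (rule has_derivative_quadratic[OF _ R(1)])
  fix \<zeta> assume \<zeta>: "\<zeta> \<in> X" "dist \<zeta> xi < R"
  then have "\<zeta> \<in> U" using R by (auto simp: dist_commute)
  have eta: "\<zeta> - xi \<in> X" "norm (\<zeta> - xi) \<le> R" using csubD(4)[OF X \<zeta>(1) xiX] \<zeta>(2) by (auto simp: dist_norm)
  let ?q = "(norm (\<zeta> - xi))\<^sup>2"
  have b: "cmod (F k \<zeta> - F k xi - F' k (\<zeta> - xi)) \<le> 4 * m k / R\<^sup>2 * ?q" for k
   using est(1)[OF eta, of k] by simp
  have s: "summable (\<lambda>k. 4 * m k / R\<^sup>2 * ?q)" by (intro summable_mult2 summable_divide summable_mult m(2))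
  have "(\<Sum>k. F k \<zeta>) - (\<Sum>k. F k xi) - A (\<zeta> - xi) = (\<Sum>k. F k \<zeta> - F k xi - F' k (\<zeta> - xi))"
   using suminf_diff[OF sumF[OF \<open>\<zeta> \<in> U\<close>] sumF[OF xi]] sumF'[of "\<zeta> - xi"]
    suminf_diff[OF summable_diff[OF sumF[OF \<open>\<zeta> \<in> U\<close>] sumF[OF xi]] sumF'[of "\<zeta> - xi"]]
   by (simp add: A_def p(3)[OF eta(1)])
  also have "cmod \<dots> \<le> (\<Sum>k. 4 * m k / R\<^sup>2 * ?q)" by (rule norm_suminf_le[OF b s])
  also have "\<dots> = (\<Sum>k. 4 * m k / R\<^sup>2) * ?q" by (intro suminf_mult2[symmetric] summable_divide summable_mult m(2))
  finally show "cmod ((\<Sum>k. F k \<zeta>) - (\<Sum>k. F k xi) - A (\<zeta> - xi)) \<le> (\<Sum>k. 4 * m k / R\<^sup>2) * ?q" .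
 qed
 moreover have "A (times_i eta) = \<i> * A eta" if "eta \<in> X" for eta
  using suminf_mult[OF sumF'[of eta], of \<i>] F'(2)[OF that] p(3) that csubD(2)[OF X that] by (simp add: A_def)
 ultimately show "\<exists>F'. ((\<lambda>\<zeta>. \<Sum>k. F k \<zeta>) has_derivative F') (at xi within X) \<and> (\<forall>eta\<in>X. F' (times_i eta) = \<i> * F' eta)"
  by blast
qed

section \<open>Lattice point sums over cones\<close>

text \<open>The product over \<open>h\<close> in \<open>H\<close> of the difference operators
  identity minus shift by \<open>h\<close>, multiplied out. On generating functions of lattice
  points it is multiplication by the denominator \<open>den H\<close>.\<close>

definition mdiff :: "'w::ab_group_add set \<Rightarrow> ('w \<Rightarrow> complex) \<Rightarrow> 'w \<Rightarrow> complex"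
 where "mdiff H f x = (\<Sum>S\<in>Pow H. (-1) ^ card S * f (x - \<Sum>S))"

lemma mdiff_empty [simp]: "mdiff {} f x = f x"
 by (simp add: mdiff_def)

lemma mdiff_insert:
 assumes "finite H" "h \<notin> H"
 shows "mdiff (insert h H) f x = mdiff H f x - mdiff H f (x - h)"
proof -
 have d: "Pow H \<inter> insert h ` Pow H = {}" using assms by auto
 have i: "inj_on (insert h) (Pow H)" using assms by (auto simp: inj_on_def)
 have "mdiff (insert h H) f x = mdiff H f x + (\<Sum>S\<in>insert h ` Pow H. (-1) ^ card S * f (x - \<Sum>S))"
  unfolding mdiff_def Pow_insert using assms d by (subst sum.union_disjoint) auto
 also have "(\<Sum>S\<in>insert h ` Pow H. (-1) ^ card S * f (x - \<Sum>S)) = (\<Sum>S\<in>Pow H. - ((-1) ^ card S * f (x - h - \<Sum>S)))"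
  unfolding sum.reindex[OF i] o_def
 proof (rule sum.cong[OF refl])
  fix S assume "S \<in> Pow H"
  then have "finite S" "h \<notin> S" using assms finite_subset by auto
  then show "(-1) ^ card (insert h S) * f (x - \<Sum>(insert h S)) = - ((-1) ^ card S * f (x - h - \<Sum>S))"
   by (simp add: diff_diff_eq)
 qed
 also have "\<dots> = - mdiff H f (x - h)" by (simp add: mdiff_def sum_negf)
 finally show ?thesis by simp
qed

lemma mdiff_add: "mdiff H (\<lambda>x. f x + g x) x = mdiff H f x + mdiff H g x"
 by (simp add: mdiff_def sum.distrib algebra_simps)

lemma mdiff_diff: "mdiff H (\<lambda>x. f x - g x) x = mdiff H f x - mdiff H g x"
 by (simp add: mdiff_def sum_subtractf algebra_simps)

lemma mdiff_zero: "(\<And>S. S \<subseteq> H \<Longrightarrow> f (x - \<Sum>S) = 0) \<Longrightarrow> mdiff H f x = 0"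
 by (simp add: mdiff_def)

text \<open>The factor belonging to \<open>h\<close> forms differences of values that agree for
  every subset of the remaining shifts.\<close>

lemma mdiff_cancel:
 assumes "finite H" "h \<in> H" "\<And>S. S \<subseteq> H - {h} \<Longrightarrow> f (x - h - \<Sum>S) = f (x - \<Sum>S)"
 shows "mdiff H f x = 0"
proof -
 have H: "H = insert h (H - {h})" using assms by auto
 have "mdiff (H - {h}) f (x - h) = mdiff (H - {h}) f x"
  using assms(3) by (auto simp: mdiff_def intro!: sum.cong)
 then show ?thesis by (subst H, subst mdiff_insert) (use assms in auto)
qed

text \<open>The mechanism by which cones containing a line disappear: their indicator functions are
  invariant under one of the shifts.\<close>

lemma mdiff_periodic:
 assumes "finite H" "h \<in> H" "\<And>y. f (y - h) = f y"
 shows "mdiff H f x = 0"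
proof (rule mdiff_cancel[OF assms(1,2)])
 fix S
 show "f (x - h - \<Sum>S) = f (x - \<Sum>S)" using assms(3) by (smt (verit) algebra_simps)
qed

section \<open>Generating functions of lattice points\<close>

lemma pairing_add: "pairing xi (m + m') = pairing xi m + pairing xi m'"
 by (simp add: pairing_def plus_fun_def complex_eq_iff)

lemma pairing_diff: "pairing xi (m - m') = pairing xi m - pairing xi m'"
 by (simp add: pairing_def fun_diff_def complex_eq_iff)

lemma pairing_zero [simp]: "pairing xi 0 = 0"
 by (simp add: pairing_def zero_fun_def complex_eq_iff)

lemma pairing_scaleR: "pairing xi (c *\<^sub>R m) = of_real c * pairing xi m"
 by (simp add: pairing_def complex_eq_iff)

lemma pairing_sum: "pairing xi (\<Sum>i\<in>I. f i) = (\<Sum>i\<in>I. pairing xi (f i))"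
 by (simp add: pairing_def sum_fun_apply complex_eq_iff)

lemma Re_pairing [simp]: "Re (pairing xi m) = m (fst xi)"
 by (simp add: pairing_def)

definition den :: "('v \<Rightarrow> real) set \<Rightarrow> 'v \<times> 'v \<Rightarrow> complex"
 where "den H xi = (\<Prod>h\<in>H. 1 - exp (pairing xi h))"

text \<open>Shifting a function by \<open>h\<close> multiplies its generating series by
  \<open>exp (pairing xi h)\<close>, so every difference operator turns into one factor of the
  denominator.\<close>

lemma mdiff_exp_sum:
 assumes N: "is_lattice N" and H: "finite H" "H \<subseteq> dual_lat N"
  and f: "(\<lambda>m. f m * exp (pairing xi m)) summable_on dual_lat N"
 shows "(\<lambda>m. mdiff H f m * exp (pairing xi m)) summable_on dual_lat N \<and>
  (\<Sum>\<^sub>\<infinity>m\<in>dual_lat N. mdiff H f m * exp (pairing xi m)) = den H xi * (\<Sum>\<^sub>\<infinity>m\<in>dual_lat N. f m * exp (pairing xi m))"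
 using H
proof (induction H rule: finite_induct)
 case empty then show ?case using f by (simp add: den_def)
next
 case (insert h H)
 let ?M = "dual_lat N" and ?g = "\<lambda>m. mdiff H f m * exp (pairing xi m)"
 note M = is_lattice_closed[OF is_lattice_dual_lat[OF N]]
 have IH: "?g summable_on ?M" "infsum ?g ?M = den H xi * (\<Sum>\<^sub>\<infinity>m\<in>?M. f m * exp (pairing xi m))"
  using insert by auto
 have h: "h \<in> ?M" using insert by auto
 have bij: "bij_betw (\<lambda>m. m - h) ?M ?M"
  by (rule bij_betw_byWitness[where f'="\<lambda>m. m + h"]) (use M h in auto)
 have e: "mdiff H f (m - h) * exp (pairing xi m) = exp (pairing xi h) * ?g (m - h)" for m
  by (simp add: pairing_diff exp_diff)
 have s2: "(\<lambda>m. mdiff H f (m - h) * exp (pairing xi m)) summable_on ?M"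
  unfolding e using summable_on_reindex_bij_betw[OF bij, of ?g] IH(1) by (intro summable_on_cmult_right) auto
 have i2: "(\<Sum>\<^sub>\<infinity>m\<in>?M. mdiff H f (m - h) * exp (pairing xi m)) = exp (pairing xi h) * infsum ?g ?M"
  unfolding e using infsum_reindex_bij_betw[OF bij, of ?g] by (simp add: infsum_cmult_right')
 have eq: "mdiff (insert h H) f m * exp (pairing xi m) = ?g m - mdiff H f (m - h) * exp (pairing xi m)" for m
  using insert.hyps by (simp add: mdiff_insert algebra_simps)
 show ?case unfolding eq
  using summable_on_add[OF IH(1) summable_on_uminus[THEN iffD2, OF s2]] infsum_add[OF IH(1) summable_on_uminus[THEN iffD2, OF s2]] i2 IH(2) insert.hyps
  by (simp add: den_def infsum_uminus algebra_simps)
qed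

lemma finite_dual_lat_bounded:
 assumes B: "lattice_basis B N"
 shows "finite {m\<in>dual_lat N. \<forall>b\<in>B. \<bar>m b\<bar> \<le> K b}"
proof -
 note D = lattice_basisD[OF B]
 let ?A = "{m\<in>dual_lat N. \<forall>b\<in>B. \<bar>m b\<bar> \<le> K b}"
 let ?f = "\<lambda>m. \<lambda>b\<in>B. \<lfloor>m b\<rfloor>"
 have val: "real_of_int \<lfloor>m b\<rfloor> = m b" if "m \<in> ?A" "b \<in> B" for m b
  using that by (auto simp: dual_lat_alt[OF B] elim!: Ints_cases)
 have "?f ` ?A \<subseteq> (\<Pi>\<^sub>E b\<in>B. {\<lfloor>- K b\<rfloor> .. \<lceil>K b\<rceil>})"
 proof
  fix g assume "g \<in> ?f ` ?A"
  then obtain m where m: "m \<in> ?A" "g = ?f m" by auto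
  have "\<lfloor>- K b\<rfloor> \<le> \<lfloor>m b\<rfloor> \<and> \<lfloor>m b\<rfloor> \<le> \<lceil>K b\<rceil>" if "b \<in> B" for b using m that
   by (auto simp: abs_le_iff val[OF m(1) that] le_ceiling_iff floor_le_iff intro!: conjI floor_mono order_trans[OF floor_mono floor_le_ceiling])
  then show "g \<in> (\<Pi>\<^sub>E b\<in>B. {\<lfloor>- K b\<rfloor> .. \<lceil>K b\<rceil>})" using m by auto
 qed
 then have "finite (?f ` ?A)" by (rule finite_subset) (simp add: finite_PiE D(1))
 moreover have "inj_on ?f ?A"
 proof (rule inj_onI)
  fix m m' assume m: "m \<in> ?A" "m' \<in> ?A" "?f m = ?f m'"
  have "m b = m' b" if "b \<in> B" for b
  proof -
   have "\<lfloor>m b\<rfloor> = \<lfloor>m' b\<rfloor>" using fun_cong[OF m(3), of b] that by simp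
   then show ?thesis using val[OF m(1) that] val[OF m(2) that] by metis
  qed
  moreover have "m \<in> real_dual (span B)" "m' \<in> real_dual (span B)" using m D(4) by (auto simp: dual_lat_def)
  ultimately show "m = m'" using real_dual_expand[OF D(1,2)] by (metis (no_types, lifting) sum.cong)
 qed
 ultimately show ?thesis by (rule finite_imageD)
qed

definition cind :: "'w set \<Rightarrow> 'w \<Rightarrow> complex"
 where "cind P m = (if m \<in> P then 1 else 0)"

text \<open>The cone is given at once by lattice generators and by finitely many inequalities; the
  first yield denominators and convergence, the second decide membership. Positivity of all
  generators at \<open>v0\<close> excludes lines and puts \<open>- v0\<close> into the domain of
  convergence.\<close>

locale pointed_cone =
 fixes N :: "'v::euclidean_space set" and J :: "('v \<Rightarrow> real) set" and U :: "'v set" and v0 :: 'v and P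
 assumes N: "is_lattice N" and J: "finite J" "J \<subseteq> dual_lat N"
  and U: "finite U" "U \<subseteq> span N"
  and P_gen: "P = fcone J" and P_halfspaces: "P = {m\<in>real_dual (span N). \<forall>u\<in>U. 0 \<le> m u}"
  and v0: "v0 \<in> span N" "\<And>h. h \<in> J \<Longrightarrow> 0 < h v0"
begin

abbreviation "M \<equiv> dual_lat N"

lemma J0: "0 \<notin> J"
 using v0(2)[of 0] by (auto simp: zero_fun_def)

lemma P_0: "0 \<in> P" and P_add: "x \<in> P \<Longrightarrow> y \<in> P \<Longrightarrow> x + y \<in> P" and P_scale: "x \<in> P \<Longrightarrow> 0 \<le> c \<Longrightarrow> c *\<^sub>R x \<in> P"
 unfolding P_gen by (auto intro: fcone_0 fcone_add fcone_scale)

lemma J_P: "h \<in> J \<Longrightarrow> h \<in> P"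
 unfolding P_gen using J by (auto intro: fcone_base)

lemma P_dual: "P \<subseteq> real_dual (span N)"
 using P_halfspaces by auto

lemma M_dual: "M \<subseteq> real_dual (span N)"
 by (auto simp: dual_lat_def)

text \<open>Far out in the direction of a generator \<open>h\<close>, membership of all the shifted
  points is unaffected by a further shift by \<open>h\<close>, so the difference vanishes. Only
  points whose coefficients are all bounded by \<open>C\<close> remain, and these are finitely many
  lattice points.\<close>

lemma finite_support:
 assumes "finite H" "J \<subseteq> H" "H \<subseteq> M"
 shows "finite {m\<in>M. mdiff H (cind P) m \<noteq> 0}"
proof -
 obtain B where B: "lattice_basis B N" using N by (auto simp: is_lattice_def)
 note Mcl = is_lattice_closed[OF is_lattice_dual_lat[OF N]]
 note sd = subspace_diff[OF subspace_real_dual] subspace_sum[OF subspace_real_dual]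
 define Su where "Su u = (\<Sum>h\<in>J. \<bar>h u\<bar>)" for u
 \<comment> \<open>A multiple of any generator \<open>h\<close> by this factor outweighs, in every
   inequality \<open>u\<close> with \<open>h u > 0\<close>, each possible sum of shifts.\<close>
 define C where "C = (\<Sum>h\<in>J. \<Sum>u\<in>U. if h u > 0 then Su u / h u else 0)"
 have Su: "0 \<le> Su u" for u by (auto simp: Su_def sum_nonneg)
 have C0: "0 \<le> C" unfolding C_def by (intro sum_nonneg) (auto simp: Su)
 have C: "Su u \<le> C * h u" if "h \<in> J" "u \<in> U" "h u > 0" for h u
 proof -
  have "Su u / h u = (if h u > 0 then Su u / h u else 0)" using that by simp
  also have "\<dots> \<le> (\<Sum>u\<in>U. if h u > 0 then Su u / h u else 0)"
   using that U by (intro member_le_sum) (auto simp: Su)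
  also have "\<dots> \<le> C" unfolding C_def
   using that J by (intro member_le_sum[of h J "\<lambda>h. \<Sum>u\<in>U. if h u > 0 then Su u / h u else 0"] sum_nonneg) (auto simp: Su)
  finally show ?thesis using that by (simp add: pos_divide_le_eq)
 qed
 \<comment> \<open>Shifting by \<open>h\<close> affects only the inequalities with
   \<open>h u > 0\<close>, and these hold with enough slack when \<open>m - C *\<^sub>R h\<close>
   lies in the cone.\<close>
 have far: "mdiff J (cind P) m = 0" if m: "m \<in> M" and h: "h \<in> J" "m - C *\<^sub>R h \<in> P" for m h
 proof (rule mdiff_cancel[OF J(1) h(1)])
  fix S assume S: "S \<subseteq> J - {h}"
  have finS: "finite S" using S J finite_subset by blast
  have "m - h - \<Sum>S \<in> P \<longleftrightarrow> m - \<Sum>S \<in> P"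
  proof
   assume "m - h - \<Sum>S \<in> P"
   from P_add[OF this J_P[OF h(1)]] show "m - \<Sum>S \<in> P" by (simp add: algebra_simps)
  next
   assume mS: "m - \<Sum>S \<in> P"
   have "0 \<le> (m - h - \<Sum>S) u" if u: "u \<in> U" for u
   proof (cases "h u > 0")
    case True
    have "C * h u \<le> m u" using h(2) u P_halfspaces by (simp add: fun_diff_def)
    then have "Su u \<le> m u" using C[OF h(1) u True] by simp
    moreover have "h u + (\<Sum>S) u \<le> Su u"
    proof -
     have "h \<notin> S" using S by auto
     then have "h u + (\<Sum>S) u = (\<Sum>h\<in>insert h S. h u)" using finS by (simp add: sum_fun_apply)
     also have "\<dots> \<le> (\<Sum>h\<in>insert h S. \<bar>h u\<bar>)" by (rule sum_mono) simp
     also have "\<dots> \<le> Su u" unfolding Su_def using S h J by (intro sum_mono2) auto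
     finally show ?thesis .
    qed
    ultimately show ?thesis by (simp add: fun_diff_def)
   next
    case False
    moreover have "0 \<le> h u" using J_P[OF h(1)] u P_halfspaces by auto
    ultimately have "h u = 0" by simp
    moreover have "0 \<le> (m - \<Sum>S) u" using mS u P_halfspaces by auto
    ultimately show ?thesis by (simp add: fun_diff_def)
   qed
   moreover have "m - h - \<Sum>S \<in> real_dual (span N)"
    using m h S J M_dual by (intro sd) blast+
   ultimately show "m - h - \<Sum>S \<in> P" using P_halfspaces by blast
  qed
  then show "cind P (m - h - \<Sum>S) = cind P (m - \<Sum>S)" by (simp add: cind_def)
 qed
 have out: "mdiff J (cind P) m = 0" if "m \<notin> P" for m
 proof (rule mdiff_zero)
  fix S assume S: "S \<subseteq> J"
  have "m - \<Sum>S \<notin> P"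
  proof
   assume "m - \<Sum>S \<in> P"
   moreover have "\<Sum>S \<in> P" unfolding P_gen using S J by (intro fcone_sum) (auto intro: fcone_base)
   ultimately have "(m - \<Sum>S) + \<Sum>S \<in> P" by (rule P_add)
   then show False using that by simp
  qed
  then show "cind P (m - \<Sum>S) = 0" by (simp add: cind_def)
 qed
 have "{m\<in>M. mdiff J (cind P) m \<noteq> 0} \<subseteq> {m\<in>M. \<forall>b\<in>B. \<bar>m b\<bar> \<le> C * Su b}"
 proof safe
  fix m b assume m: "m \<in> M" "mdiff J (cind P) m \<noteq> 0" and b: "b \<in> B"
  then have mP: "m \<in> P" using out by auto
  obtain c where c: "\<forall>h\<in>J. 0 \<le> c h" "m = (\<Sum>h\<in>J. c h *\<^sub>R h)" using mP by (auto simp: P_gen fcone_def)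
  have cC: "c h < C" if h: "h \<in> J" for h
  proof (rule ccontr)
   assume "\<not> c h < C"
   then have "(\<Sum>h'\<in>J. (if h' = h then c h' - C else c h') *\<^sub>R h') \<in> P"
    unfolding P_gen using c h by (intro fconeI) auto
   also have "(\<Sum>h'\<in>J. (if h' = h then c h' - C else c h') *\<^sub>R h') = (\<Sum>h'\<in>J. c h' *\<^sub>R h' - (if h' = h then C *\<^sub>R h else 0))"
    by (intro sum.cong) (auto simp: algebra_simps)
   also have "\<dots> = m - C *\<^sub>R h" using h J c by (simp add: sum_subtractf)
   finally show False using far[OF m(1) h] m(2) by blast
  qed
  have "\<bar>m b\<bar> \<le> (\<Sum>h\<in>J. \<bar>c h * h b\<bar>)" unfolding c(2) sum_fun_apply by (simp add: sum_abs)
  also have "\<dots> \<le> (\<Sum>h\<in>J. C * \<bar>h b\<bar>)"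
  proof (rule sum_mono)
   fix h assume h: "h \<in> J"
   then have "\<bar>c h * h b\<bar> = c h * \<bar>h b\<bar>" using c(1) by (simp add: abs_mult)
   also have "\<dots> \<le> C * \<bar>h b\<bar>" using cC[OF h] by (intro mult_right_mono) auto
   finally show "\<bar>c h * h b\<bar> \<le> C * \<bar>h b\<bar>" .
  qed
  also have "\<dots> = C * Su b" by (simp add: Su_def sum_distrib_left)
  finally show "\<bar>m b\<bar> \<le> C * Su b" .
 qed
 then have base: "finite {m\<in>M. mdiff J (cind P) m \<noteq> 0}"
  by (rule finite_subset) (use finite_dual_lat_bounded[OF B, of "\<lambda>b. C * Su b"] in simp)
 \<comment> \<open>Each further difference operator enlarges the support by at most one
   translate.\<close>
 have "finite {m\<in>M. mdiff (J \<union> E) (cind P) m \<noteq> 0}" if "finite E" "E \<subseteq> M" "E \<inter> J = {}" for E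
  using that
 proof (induction E rule: finite_induct)
  case (insert h E)
  let ?A = "{m\<in>M. mdiff (J \<union> E) (cind P) m \<noteq> 0}"
  have "h \<notin> J \<union> E" "finite (J \<union> E)" using insert J by auto
  then have "mdiff (J \<union> insert h E) (cind P) m = mdiff (J \<union> E) (cind P) m - mdiff (J \<union> E) (cind P) (m - h)" for m
   using mdiff_insert[of "J \<union> E" h] by simp
  then have "{m\<in>M. mdiff (J \<union> insert h E) (cind P) m \<noteq> 0} \<subseteq> ?A \<union> (\<lambda>m. m + h) ` ?A"
  proof -
   have "m \<in> ?A \<union> (\<lambda>m. m + h) ` ?A" if m: "m \<in> M" "mdiff (J \<union> E) (cind P) m - mdiff (J \<union> E) (cind P) (m - h) \<noteq> 0" for m
   proof (cases "mdiff (J \<union> E) (cind P) (m - h) = 0")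
    case False
    then have "m - h \<in> ?A" using m insert Mcl by auto
    then have "(m - h) + h \<in> (\<lambda>m. m + h) ` ?A" by (rule imageI)
    then show ?thesis by simp
   qed (use m in auto)
   then show ?thesis using \<open>\<And>m. mdiff (J \<union> insert h E) (cind P) m = _\<close> by auto
  qed
  moreover have "finite ?A" using insert by auto
  ultimately show ?case by (meson finite_UnI finite_imageI finite_subset)
 qed (use base in auto)
 from this[of "H - J"] assms show ?thesis by (simp add: Un_absorb1 Diff_Int_distrib2 Int_commute) (metis Diff_disjoint Diff_subset Int_commute Un_Diff_cancel Un_absorb1 finite_Diff subset_trans)
qed

definition supp where "supp H = {m\<in>M. mdiff H (cind P) m \<noteq> 0}"

text \<open>The numerator of the lattice point series over the denominator \<open>den H\<close>. It
  is defined for sets \<open>H\<close> larger than \<open>J\<close> too, so that several cones can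
  be compared over a common denominator.\<close>

definition num where "num H xi = (\<Sum>m\<in>supp H. mdiff H (cind P) m * exp (pairing xi m))"

lemma sum_identity:
 assumes H: "finite H" "J \<subseteq> H" "H \<subseteq> M" and s: "(\<lambda>m. norm (exp (pairing xi m))) summable_on (P \<inter> M)"
 shows "den H xi * (\<Sum>\<^sub>\<infinity>m\<in>P \<inter> M. exp (pairing xi m)) = num H xi"
proof -
 have s1: "(\<lambda>m. exp (pairing xi m)) summable_on (P \<inter> M)" using abs_summable_summable[OF s] .
 have s2: "(\<lambda>m. cind P m * exp (pairing xi m)) summable_on M \<longleftrightarrow> (\<lambda>m. exp (pairing xi m)) summable_on (P \<inter> M)"
  by (rule summable_on_cong_neutral) (auto simp: cind_def)
 have i2: "(\<Sum>\<^sub>\<infinity>m\<in>M. cind P m * exp (pairing xi m)) = (\<Sum>\<^sub>\<infinity>m\<in>P \<inter> M. exp (pairing xi m))"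
  by (rule infsum_cong_neutral) (auto simp: cind_def)
 have "(\<Sum>\<^sub>\<infinity>m\<in>M. mdiff H (cind P) m * exp (pairing xi m)) = den H xi * (\<Sum>\<^sub>\<infinity>m\<in>M. cind P m * exp (pairing xi m))"
  using mdiff_exp_sum[OF N H(1,3)] s1 s2 by blast
 moreover have "(\<Sum>\<^sub>\<infinity>m\<in>M. mdiff H (cind P) m * exp (pairing xi m)) = (\<Sum>\<^sub>\<infinity>m\<in>supp H. mdiff H (cind P) m * exp (pairing xi m))"
  by (rule infsum_cong_neutral) (auto simp: supp_def)
 moreover have "\<dots> = num H xi"
  using finite_support[OF H] by (simp add: num_def supp_def)
 ultimately show ?thesis using i2 by simp
qed

lemma holo_exp_pairing: "m \<in> M \<Longrightarrow> holo_on (lat_C N) (lat_C N) (\<lambda>xi. exp (pairing xi m))"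
 using M_dual by (intro holo_on_compose[where f=exp and T=UNIV] holo_on_pairing) (auto intro: holomorphic_intros)

lemma holo_num: "holo_on (lat_C N) (lat_C N) (num H)"
 unfolding num_def
 by (intro holo_on_sum holo_on_mult holo_on_const holo_exp_pairing) (auto simp: supp_def)

text \<open>Evaluation at \<open>v0\<close> is nonnegative on the cone, hence constant along a line.
  This bounds the coefficients of all points of the line, and a bounded line is a point.\<close>

lemma no_line: "\<not> contains_line P"
proof
 assume "contains_line P"
 then obtain p d where pd: "d \<noteq> 0" "\<And>t. p + t *\<^sub>R d \<in> P" by (auto simp: contains_line_def)
 have "\<forall>t. \<exists>c. (\<forall>h\<in>J. 0 \<le> c h) \<and> p + t *\<^sub>R d = (\<Sum>h\<in>J. c h *\<^sub>R h)"
  using pd(2) unfolding P_gen fcone_def by blast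
 from choice[OF this] obtain c where c: "\<And>t h. h \<in> J \<Longrightarrow> 0 \<le> c t h" "\<And>t. p + t *\<^sub>R d = (\<Sum>h\<in>J. c t h *\<^sub>R h)"
  by blast
 have ev: "p x + t * d x = (\<Sum>h\<in>J. c t h * h x)" for t x
  using fun_cong[OF c(2)[of t], of x] by (simp add: plus_fun_def sum_fun_apply)
 have nn: "0 \<le> p v0 + t * d v0" for t
  unfolding ev using c(1) v0 by (intro sum_nonneg mult_nonneg_nonneg) (auto simp: less_imp_le)
 have bounded_line: "b = 0" if "\<And>t. \<bar>a + t * b\<bar> \<le> K" for a b K :: real
 proof (rule ccontr)
  assume b: "b \<noteq> 0"
  show False using b that[of "(K + 1 - a) / b"] by simp
 qed
 have d0: "d v0 = 0" using ccontr nn[of "(- 1 - p v0) / d v0"] by fastforce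
 have "d x = 0" for x
 proof (rule bounded_line)
  fix t
  have "\<bar>p x + t * d x\<bar> \<le> (\<Sum>h\<in>J. \<bar>c t h * h x\<bar>)" unfolding ev by (rule sum_abs)
  also have "\<dots> \<le> (\<Sum>h\<in>J. p v0 / h v0 * \<bar>h x\<bar>)"
  proof (rule sum_mono)
   fix h assume h: "h \<in> J"
   have "c t h * h v0 \<le> (\<Sum>h\<in>J. c t h * h v0)"
    using h J c v0 by (intro member_le_sum[of h J "\<lambda>h. c t h * h v0"]) (auto simp: less_imp_le)
   then have "c t h \<le> p v0 / h v0" using ev[of v0 t] d0 v0(2)[OF h] by (simp add: pos_le_divide_eq)
   then show "\<bar>c t h * h x\<bar> \<le> p v0 / h v0 * \<bar>h x\<bar>" using c(1)[OF h, of t]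
    by (simp only: abs_mult abs_of_nonneg mult_right_mono abs_ge_zero)
  qed
  finally show "\<bar>p x + t * d x\<bar> \<le> (\<Sum>h\<in>J. p v0 / h v0 * \<bar>h x\<bar>)" .
 qed
 then show False using pd(1) by (auto simp: zero_fun_def)
qed

end

text \<open>It suffices to avoid the zeros of \<open>1 - exp (pairing xi h)\<close>, which include
  those of \<open>pairing xi h\<close>; where the pairing equals 1, this function is
  nonzero.\<close>

lemma dens_linear_nonzero:
 fixes N :: "'v::euclidean_space set"
 assumes N: "is_lattice N" and H: "finite H" "H \<subseteq> dual_lat N" "0 \<notin> H"
 shows "\<exists>D. dens (lat_C N) D \<and> (\<forall>xi\<in>D. xi \<in> lat_C N \<and> den H xi \<noteq> 0 \<and> (\<forall>h\<in>H. pairing xi h \<noteq> 0))"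
proof -
 have "\<exists>D. dens (lat_C N) D \<and> (\<forall>xi\<in>D. 1 - exp (pairing xi h) \<noteq> 0)" if h: "h \<in> H" for h
 proof -
  have hd: "h \<in> real_dual (span N)" using h H by (auto simp: dual_lat_def)
  have "h \<noteq> 0" using h H by auto
  then obtain x where x: "h x \<noteq> 0" by (auto simp: fun_eq_iff zero_fun_def)
  then have xs: "x \<in> span N" using real_dualD(3)[OF hd] by auto
  define xi where "xi = ((1 / h x) *\<^sub>R x, 0 :: 'v)"
  have "pairing xi h = 1"
   using x xs real_dual_0[OF hd] real_dualD(2)[OF hd xs] by (simp add: xi_def pairing_def complex_eq_iff)
  moreover have "exp (1::complex) \<noteq> 1"
  proof
   assume "exp (1::complex) = 1"
   then have "norm (exp (1::complex)) = 1" by simp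
   then show False by simp
  qed
  moreover have "xi \<in> lat_C N" using xs by (auto simp: xi_def lat_C_def span_scale span_zero)
  moreover have "holo_on (lat_C N) (lat_C N) (\<lambda>xi. 1 - exp (pairing xi h))"
   using hd by (intro holo_on_diff holo_on_const holo_on_compose[where f=exp and T=UNIV] holo_on_pairing) (auto intro: holomorphic_intros)
  ultimately have "dens (lat_C N) {eta\<in>lat_C N. 1 - exp (pairing eta h) \<noteq> 0}"
   by (intro dens_nonzero_entire[OF csub_lat_C, of N "\<lambda>eta. 1 - exp (pairing eta h)" xi]) auto
  then show ?thesis by blast
 qed
 then have "\<exists>D. dens (lat_C N) D \<and> (\<forall>xi\<in>D. \<forall>h\<in>H. 1 - exp (pairing xi h) \<noteq> 0)"
  by (intro dens_ex H(1)) blast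
 then obtain D where D: "dens (lat_C N) D" "\<And>xi h. xi \<in> D \<Longrightarrow> h \<in> H \<Longrightarrow> 1 - exp (pairing xi h) \<noteq> 0" by blast
 show ?thesis
 proof (intro exI[of _ D] conjI ballI)
  fix xi assume xi: "xi \<in> D"
  show "xi \<in> lat_C N" using dens_subset[OF D(1)] xi by blast
  show "den H xi \<noteq> 0" using D(2)[OF xi] H(1) by (simp add: den_def)
  show "pairing xi h \<noteq> 0" if "h \<in> H" for h using D(2)[OF xi that] by auto
 qed (rule D(1))
qed

lemma holo_den:
 fixes N :: "'v::euclidean_space set"
 assumes "H \<subseteq> dual_lat N" shows "holo_on (lat_C N) (lat_C N) (den H)"
 unfolding den_def using assms
 by (intro holo_on_prod holo_on_diff holo_on_const holo_on_compose[where f=exp and T=UNIV] holo_on_pairing)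
  (auto simp: dual_lat_def intro: holomorphic_intros)

lemma lat_C_dens_nonempty: "dens (lat_C N) D \<Longrightarrow> D \<noteq> {}"
 using dens_meets[of "lat_C N" D "lat_C N"] csubD(6)[OF csub_lat_C[of N]] by auto

context pointed_cone
begin

text \<open>\<open>exp_sum\<close> is a choice, so a function with its defining properties has to be
  exhibited: the series where it converges, and the quotient of \<open>num J\<close> by
  \<open>den J\<close> elsewhere. Where the denominator is nonzero the two agree by
  \<open>sum_identity\<close>.\<close>

lemma exp_sum_spec:
 "mero_on (lat_C N) (exp_sum N P) \<and> (\<forall>xi\<in>lat_C N. (\<lambda>m. norm (exp (pairing xi m))) summable_on (P \<inter> M) \<longrightarrow>
  exp_sum N P xi = (\<Sum>\<^sub>\<infinity>m\<in>P \<inter> M. exp (pairing xi m)))"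
proof -
 define F where "F xi = (if (\<lambda>m. norm (exp (pairing xi m))) summable_on (P \<inter> M)
  then (\<Sum>\<^sub>\<infinity>m\<in>P \<inter> M. exp (pairing xi m)) else num J xi / den J xi)" for xi
 obtain D where D: "dens (lat_C N) D" "\<forall>xi\<in>D. xi \<in> lat_C N \<and> den J xi \<noteq> 0"
  using dens_linear_nonzero[OF N J J0] by blast
 then obtain xi where xi: "xi \<in> lat_C N" "den J xi \<noteq> 0" using lat_C_dens_nonempty by blast
 have "mero_on (lat_C N) F"
 proof (rule mero_on_quotient[OF csub_lat_C holo_num[of J] holo_den[OF J(2)] xi])
  fix eta assume "eta \<in> lat_C N" "den J eta \<noteq> 0"
  then show "F eta = num J eta / den J eta"
   using sum_identity[OF J(1) subset_refl J(2), of eta] by (auto simp: F_def field_simps)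
 qed
 then have "\<exists>F. mero_on (lat_C N) F \<and> (\<forall>xi\<in>lat_C N. (\<lambda>m. norm (exp (pairing xi m))) summable_on (P \<inter> M) \<longrightarrow>
  F xi = (\<Sum>\<^sub>\<infinity>m\<in>P \<inter> M. exp (pairing xi m)))"
  by (intro exI[of _ F]) (simp add: F_def)
 from someI_ex[OF this] show ?thesis using no_line by (simp add: exp_sum_def)
qed

end

section \<open>Exponential integrals over cones as limits of lattice sums\<close>

lemma integrable_exp_neg_abs:
 fixes \<delta> :: real
 assumes "\<delta> > 0" shows "integrable lborel (\<lambda>x. exp (- \<delta> * \<bar>x\<bar>))"
proof -
 have nn: "(\<integral>\<^sup>+x. ennreal (exp (- \<delta> * x)) * indicator {0 ..} x \<partial>lborel) = 0 - (- exp (- \<delta> * 0) / \<delta>)"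
 proof (rule nn_integral_FTC_atLeast[where F="\<lambda>x. - exp (- \<delta> * x) / \<delta>" and T=0])
  show "((\<lambda>x. - exp (- \<delta> * x) / \<delta>) has_real_derivative exp (- \<delta> * x)) (at x)" for x
   using assms by (auto intro!: derivative_eq_intros)
  have "filterlim (\<lambda>x. - \<delta> * x) at_bot at_top" using assms filterlim_tendsto_pos_mult_at_top[OF tendsto_const _ filterlim_ident] by (simp add: filterlim_uminus_at_bot)
  then have "((\<lambda>x. exp (- \<delta> * x)) \<longlongrightarrow> 0) at_top" by (rule filterlim_compose[OF exp_at_bot])
  from tendsto_divide[OF tendsto_minus[OF this] tendsto_const, of \<delta>] assms
  show "((\<lambda>x. - exp (- \<delta> * x) / \<delta>) \<longlongrightarrow> 0) at_top" by simp
 qed auto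
 have half: "integrable lborel (\<lambda>x. indicator {0..} x * exp (- \<delta> * x))"
  unfolding integrable_iff_bounded
 proof
  have "(\<integral>\<^sup>+x. ennreal (norm (indicator {0..} x * exp (- \<delta> * x))) \<partial>lborel) =
    (\<integral>\<^sup>+x. ennreal (exp (- \<delta> * x)) * indicator {0 ..} x \<partial>lborel)"
   by (intro nn_integral_cong) (auto simp: indicator_def)
  then show "(\<integral>\<^sup>+x. ennreal (norm (indicator {0..} x * exp (- \<delta> * x))) \<partial>lborel) < \<infinity>"
   by (simp only: nn ennreal_less_top infinity_ennreal_def)
 qed auto
 have half': "integrable lborel (\<lambda>x. indicator {0..} (0 + (-1) * x) * exp (- \<delta> * (0 + (-1) * x)))"
  using lborel_integrable_real_affine[OF half, of "-1" 0] by simp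
 show ?thesis
  by (rule Bochner_Integration.integrable_bound[OF Bochner_Integration.integrable_add[OF half half']])
   (auto simp: indicator_def)
qed

text \<open>The label of the cube of side \<open>1 / k\<close> that contains the point with
  coordinates \<open>a + t\<close>; it is made extensional so that labels form the countable set
  \<open>Kset\<close>.\<close>

definition fl :: "'i set \<Rightarrow> ('i \<Rightarrow> real) \<Rightarrow> nat \<Rightarrow> ('i \<Rightarrow> real) \<Rightarrow> 'i \<Rightarrow> int"
 where "fl B a k t = (\<lambda>b\<in>B. \<lfloor>real k * (a b + t b)\<rfloor>)"

context
 fixes B :: "'i set" and a :: "'i \<Rightarrow> real" and k :: nat
 assumes B: "finite B" and k: "0 < k"
begin

interpretation lb: product_sigma_finite "\<lambda>_::'i. lborel :: real measure"
 by unfold_locales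

abbreviation "Kset \<equiv> PiE B (\<lambda>_. UNIV :: int set)"
abbreviation "PM \<equiv> (\<Pi>\<^sub>M b\<in>B. (lborel :: real measure))"

lemma countable_Kset: "countable Kset"
 using B by (intro countable_PiE) auto

lemma fl_box:
 assumes c: "c \<in> Kset"
 shows "fl B a k -` {c} \<inter> space PM = PiE B (\<lambda>b. {real_of_int (c b) / k - a b ..< (real_of_int (c b) + 1) / k - a b})"
proof -
 have kp: "real k > 0" using k by simp
 have *: "\<lfloor>real k * (a b + x)\<rfloor> = c b \<longleftrightarrow> x \<in> {real_of_int (c b) / k - a b ..< (real_of_int (c b) + 1) / k - a b}" for x b
  using kp by (simp add: floor_eq_iff field_simps)
 show ?thesis
 proof (intro set_eqI iffI)
  fix t assume "t \<in> fl B a k -` {c} \<inter> space PM"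
  then have t: "fl B a k t = c" "t \<in> space PM" by auto
  then have "\<lfloor>real k * (a b + t b)\<rfloor> = c b" if "b \<in> B" for b using that by (auto simp: fl_def)
  then show "t \<in> PiE B (\<lambda>b. {real_of_int (c b) / k - a b ..< (real_of_int (c b) + 1) / k - a b})"
   using t(2) * by (auto simp: space_PiM PiE_def)
 next
  fix t assume t: "t \<in> PiE B (\<lambda>b. {real_of_int (c b) / k - a b ..< (real_of_int (c b) + 1) / k - a b})"
  have "fl B a k t b = c b" for b
   using t * c by (cases "b \<in> B") (auto simp: fl_def PiE_def Pi_def extensional_def)
  then show "t \<in> fl B a k -` {c} \<inter> space PM" using t by (auto simp: space_PiM PiE_def)
 qed
qed

lemma fl_measurable: "fl B a k \<in> measurable PM (count_space Kset)"
 unfolding measurable_count_space_eq_countable[OF countable_Kset]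
proof (intro conjI ballI)
 show "fl B a k \<in> space PM \<rightarrow> Kset" by (auto simp: fl_def)
 show "fl B a k -` {c} \<inter> space PM \<in> sets PM" if "c \<in> Kset" for c
  unfolding fl_box[OF that] using B by (intro sets_PiM_I_finite) auto
qed

text \<open>All cubes of side \<open>1 / k\<close> have the same volume, so functions that are
  constant on the cubes have integrals that are exactly rescaled sums over the labels.\<close>

lemma distr_fl: "distr PM (count_space Kset) (fl B a k) = density (count_space Kset) (\<lambda>_. ennreal ((1 / k) ^ card B))"
proof (rule measure_eqI_countable[OF _ _ countable_Kset])
 fix c assume c: "c \<in> Kset"
 have "emeasure (distr PM (count_space Kset) (fl B a k)) {c} = emeasure PM (fl B a k -` {c} \<inter> space PM)"
  using c by (intro emeasure_distr fl_measurable) auto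
 also have "\<dots> = (\<Prod>b\<in>B. emeasure lborel {real_of_int (c b) / k - a b ..< (real_of_int (c b) + 1) / k - a b})"
  unfolding fl_box[OF c] using B by (intro lb.emeasure_PiM) auto
 also have "\<dots> = (\<Prod>b\<in>B. ennreal (1 / k))"
  using k by (intro prod.cong refl) (subst emeasure_lborel_Ico, auto simp: field_simps intro!: arg_cong[where f=ennreal])
 also have "\<dots> = ennreal ((1 / k) ^ card B)" by (simp add: ennreal_power)
 also have "\<dots> = emeasure (density (count_space Kset) (\<lambda>_. ennreal ((1 / k) ^ card B))) {c}"
  using c by (subst emeasure_density) (auto simp: nn_integral_cmult nn_integral_count_space_indicator)
 finally show "emeasure (distr PM (count_space Kset) (fl B a k)) {c} = emeasure (density (count_space Kset) (\<lambda>_. ennreal ((1 / k) ^ card B))) {c}" .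
qed auto

lemma fl_compose_measurable: "(\<lambda>t. G (fl B a k t) :: complex) \<in> borel_measurable PM"
 by (rule measurable_compose[OF fl_measurable]) auto

lemma integrable_fl:
 fixes G :: "_ \<Rightarrow> complex"
 shows "integrable PM (\<lambda>t. G (fl B a k t)) \<longleftrightarrow> (\<lambda>c. norm (G c)) summable_on Kset"
proof -
 have "integrable PM (\<lambda>t. G (fl B a k t)) \<longleftrightarrow> integrable (distr PM (count_space Kset) (fl B a k)) G"
  by (rule integrable_distr_eq[symmetric]) (auto intro: fl_measurable)
 also have "\<dots> \<longleftrightarrow> integrable (count_space Kset) (\<lambda>c. ((1 / k) ^ card B) *\<^sub>R G c)"
  unfolding distr_fl by (rule integrable_density) auto
 also have "\<dots> \<longleftrightarrow> integrable (count_space Kset) G"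
  proof
  assume "integrable (count_space Kset) (\<lambda>c. ((1 / k) ^ card B) *\<^sub>R G c)"
  from Bochner_Integration.integrable_scaleR_right[OF this, of "real k ^ card B"] k
  show "integrable (count_space Kset) G" by (simp add: power_one_over)
 qed (rule Bochner_Integration.integrable_scaleR_right)
 also have "\<dots> \<longleftrightarrow> (\<lambda>c. norm (G c)) summable_on Kset"
  using abs_summable_equivalent[of G Kset] by (simp add: abs_summable_on_def)
 finally show ?thesis .
qed

lemma integral_fl:
 fixes G :: "_ \<Rightarrow> complex"
 assumes "(\<lambda>c. norm (G c)) summable_on Kset"
 shows "(\<integral>t. G (fl B a k t) \<partial>PM) = of_real ((1 / k) ^ card B) * (\<Sum>\<^sub>\<infinity>c\<in>Kset. G c)"
proof -
 have "(\<integral>t. G (fl B a k t) \<partial>PM) = integral\<^sup>L (distr PM (count_space Kset) (fl B a k)) G"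
  by (rule integral_distr[symmetric]) (auto intro: fl_measurable)
 also have "\<dots> = (\<integral>c. ((1 / k) ^ card B) *\<^sub>R G c \<partial>count_space Kset)"
  unfolding distr_fl by (rule integral_density) auto
 also have "\<dots> = ((1 / k) ^ card B) *\<^sub>R (\<integral>c. G c \<partial>count_space Kset)" by simp
 also have "(\<integral>c. G c \<partial>count_space Kset) = infsum G Kset"
  using infsetsum_infsum[OF abs_summable_equivalent[THEN iffD1, OF assms]] by (simp add: infsetsum_def)
 finally show ?thesis by (simp add: scaleR_conv_of_real)
qed

end

lemma integrable_exp_neg_sum:
 fixes \<delta> :: real and a :: "'i \<Rightarrow> real"
 assumes "finite B" "\<delta> > 0"
 shows "integrable (\<Pi>\<^sub>M b\<in>B. (lborel :: real measure)) (\<lambda>t. exp (- \<delta> * (\<Sum>b\<in>B. \<bar>a b + t b\<bar>)))"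
proof -
 interpret product_sigma_finite "\<lambda>_::'i. lborel :: real measure" by unfold_locales
 have "integrable lborel (\<lambda>x. exp (- \<delta> * \<bar>a b + x\<bar>))" for b
  using lborel_integrable_real_affine[OF integrable_exp_neg_abs[OF assms(2)], of 1 "a b"] by simp
 then have "integrable (\<Pi>\<^sub>M b\<in>B. (lborel :: real measure)) (\<lambda>t. \<Prod>b\<in>B. exp (- \<delta> * \<bar>a b + t b\<bar>))"
  by (intro product_integrable_prod assms)
 then show ?thesis by (simp add: exp_sum[OF assms(1), symmetric] sum_distrib_left)
qed

lemma tendsto_exp_remainder:
 fixes x :: complex
 shows "(\<lambda>k::nat. of_nat k ^ r * (exp (x / of_nat k) - (\<Sum>s<r. (x / of_nat k) ^ s / fact s))) \<longlonglongrightarrow> x ^ r / fact r"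
proof -
 let ?f = "\<lambda>k::nat. of_nat k ^ r * (exp (x / of_nat k) - (\<Sum>s<r. (x / of_nat k) ^ s / fact s))"
 have b: "norm (?f k - x ^ r / fact r) \<le> exp \<bar>Re x\<bar> * norm x ^ Suc r / fact r * (1 / real k)" if k: "k > 0" for k
 proof -
  define z where "z = x / of_nat k"
  have x: "x = of_nat k * z" using k by (simp add: z_def)
  have "norm (exp z - (\<Sum>s\<le>r. z ^ s / fact s)) \<le> exp \<bar>Re z\<bar> * (norm z ^ Suc r) / fact r"
   by (rule Taylor_exp)
  also have "\<dots> \<le> exp \<bar>Re x\<bar> * (norm z ^ Suc r) / fact r"
  proof -
   have "\<bar>Re z\<bar> \<le> \<bar>Re x\<bar>" proof -
    have "\<bar>Re z\<bar> = \<bar>Re x\<bar> / real k" by (simp add: z_def)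
    also have "\<dots> \<le> \<bar>Re x\<bar> / 1" using k by (intro divide_left_mono) auto
    finally show ?thesis by simp
   qed
   then show ?thesis by (intro divide_right_mono mult_right_mono) auto
  qed
  finally have t: "norm (exp z - (\<Sum>s\<le>r. z ^ s / fact s)) \<le> exp \<bar>Re x\<bar> * (norm z ^ Suc r) / fact r" .
  have "?f k - x ^ r / fact r = of_nat k ^ r * (exp z - (\<Sum>s\<le>r. z ^ s / fact s))"
   using k by (simp add: z_def lessThan_Suc_atMost[symmetric] algebra_simps power_divide)
  then have "norm (?f k - x ^ r / fact r) \<le> real k ^ r * (exp \<bar>Re x\<bar> * (norm z ^ Suc r) / fact r)"
   using mult_left_mono[OF t, of "real k ^ r"] by (simp add: norm_mult norm_power)
  also have "\<dots> = exp \<bar>Re x\<bar> * norm x ^ Suc r / fact r * (1 / real k)"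
   using k by (simp add: z_def norm_divide power_divide field_simps)
  finally show ?thesis .
 qed
 have "(\<lambda>k. exp \<bar>Re x\<bar> * norm x ^ Suc r / fact r * (1 / real k)) \<longlonglongrightarrow> exp \<bar>Re x\<bar> * norm x ^ Suc r / fact r * 0"
  by (intro tendsto_mult tendsto_const lim_1_over_n)
 then have "(\<lambda>k. ?f k - x ^ r / fact r) \<longlonglongrightarrow> 0" using eventually_mono[OF eventually_gt_at_top[of 0]] b Lim_null_comparison[rotated] by (smt (verit))
 then show ?thesis by (simp add: LIM_zero_iff)
qed

text \<open>Expanded in powers of \<open>1 / k\<close>, the combination has the coefficients
  \<open>a r\<close>. If \<open>k ^ d\<close> times it converges, the coefficients below
  \<open>d\<close> vanish one after the other, and the next one is the limit.\<close>

lemma exp_combination_coefficients: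
 fixes g x :: "'i \<Rightarrow> complex"
 assumes I: "finite I" and lim: "(\<lambda>k::nat. of_nat k ^ d * (\<Sum>i\<in>I. g i * exp (x i / of_nat k))) \<longlonglongrightarrow> L"
 shows "r < d \<Longrightarrow> (\<Sum>i\<in>I. g i * x i ^ r / fact r) = 0" and "(\<Sum>i\<in>I. g i * x i ^ d / fact d) = L"
proof -
 define a where "a r = (\<Sum>i\<in>I. g i * x i ^ r / fact r)" for r
 define u where "u k = (\<Sum>i\<in>I. g i * exp (x i / of_nat k))" for k :: nat
 have key: "(\<lambda>k::nat. of_nat k ^ r * u k) \<longlonglongrightarrow> a r" if z: "\<And>s. s < r \<Longrightarrow> a s = 0" for r
 proof -
  have "(\<lambda>k::nat. \<Sum>i\<in>I. g i * (of_nat k ^ r * (exp (x i / of_nat k) - (\<Sum>s<r. (x i / of_nat k) ^ s / fact s)))) \<longlonglongrightarrow> (\<Sum>i\<in>I. g i * (x i ^ r / fact r))"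
   by (intro tendsto_sum tendsto_mult tendsto_const tendsto_exp_remainder)
  moreover have "(\<Sum>i\<in>I. g i * (of_nat k ^ r * (exp (x i / of_nat k) - (\<Sum>s<r. (x i / of_nat k) ^ s / fact s)))) = of_nat k ^ r * u k" for k :: nat
  proof -
   have "(\<Sum>i\<in>I. g i * (\<Sum>s<r. (x i / of_nat k) ^ s / fact s)) = (\<Sum>s<r. a s * (1 / of_nat k) ^ s)"
    unfolding sum_distrib_left a_def sum_distrib_right by (subst sum.swap) (simp add: power_divide field_simps)
   also have "\<dots> = 0" using z by simp
   finally have "(\<Sum>i\<in>I. g i * (\<Sum>s<r. (x i / of_nat k) ^ s / fact s)) = 0" .
   moreover have "(\<Sum>i\<in>I. g i * (of_nat k ^ r * (exp (x i / of_nat k) - (\<Sum>s<r. (x i / of_nat k) ^ s / fact s)))) =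
    of_nat k ^ r * (u k - (\<Sum>i\<in>I. g i * (\<Sum>s<r. (x i / of_nat k) ^ s / fact s)))"
    by (simp add: u_def sum_distrib_left sum_subtractf algebra_simps)
   ultimately show ?thesis by simp
  qed
  ultimately show ?thesis by (simp add: a_def)
 qed
 have lim': "(\<lambda>k::nat. of_nat k ^ d * u k) \<longlonglongrightarrow> L" using lim by (simp add: u_def)
 have zero: "a r = 0" if "r < d" for r
  using that
 proof (induction r rule: less_induct)
  case (less r)
  have "(\<lambda>k::nat. of_nat k ^ r * u k) \<longlonglongrightarrow> a r" using less by (intro key) auto
  moreover have "(\<lambda>k::nat. (1 / of_nat k) ^ (d - r) * (of_nat k ^ d * u k)) \<longlonglongrightarrow> 0 ^ (d - r) * L"
   by (intro tendsto_mult tendsto_power lim' lim_1_over_n)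
  then have "(\<lambda>k::nat. (1 / of_nat k) ^ (d - r) * (of_nat k ^ d * u k)) \<longlonglongrightarrow> 0" using less.prems by (simp add: power_0_left)
  moreover have "\<forall>\<^sub>F k in sequentially. (1 / of_nat k) ^ (d - r) * (of_nat k ^ d * u k) = of_nat k ^ r * u k"
   using eventually_gt_at_top[of 0]
  proof eventually_elim
   case (elim k)
   show ?case using less.prems elim by (simp add: power_add[symmetric] power_one_over field_simps)
  qed
  ultimately have "(\<lambda>k::nat. of_nat k ^ r * u k) \<longlonglongrightarrow> 0" by (simp add: tendsto_cong)
  with \<open>(\<lambda>k::nat. of_nat k ^ r * u k) \<longlonglongrightarrow> a r\<close> show "a r = 0" by (rule LIMSEQ_unique)
 qed
 then show "r < d \<Longrightarrow> (\<Sum>i\<in>I. g i * x i ^ r / fact r) = 0" for r by (simp add: a_def)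
 show "(\<Sum>i\<in>I. g i * x i ^ d / fact d) = L" using zero key lim' LIMSEQ_unique by (metis a_def)
qed

lemma tendsto_one_minus_exp:
 fixes x :: complex
 shows "(\<lambda>k::nat. of_nat k * (1 - exp (x / of_nat k))) \<longlonglongrightarrow> - x"
proof -
 have "(\<lambda>k::nat. - (of_nat k ^ 1 * (exp (x / of_nat k) - (\<Sum>s<1. (x / of_nat k) ^ s / fact s)))) \<longlonglongrightarrow> - (x ^ 1 / fact 1)"
  by (intro tendsto_minus tendsto_exp_remainder)
 then show ?thesis by (simp add: algebra_simps)
qed

section \<open>Integrals over a pointed cone as limits of lattice sums\<close>

context pointed_cone
begin

definition Lam where "Lam = M \<inter> span J"

lemma is_lattice_Lam: "is_lattice Lam"
 unfolding Lam_def by (intro is_lattice_Int_subspace is_lattice_dual_lat N) auto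

lemma J_Lam: "J \<subseteq> Lam"
 using J by (auto simp: Lam_def span_base)

lemma span_Lam: "span Lam = span J"
proof
 show "span Lam \<subseteq> span J" unfolding Lam_def by (intro span_minimal) auto
 show "span J \<subseteq> span Lam" by (rule span_mono[OF J_Lam])
qed

lemma P_span: "P \<subseteq> span J"
 unfolding P_gen by (rule fcone_span)

lemma parallel_lattice_P: "parallel_lattice N P = Lam"
proof -
 have "span {p - q |p q. p \<in> P \<and> q \<in> P} = span J"
 proof
  show "span {p - q |p q. p \<in> P \<and> q \<in> P} \<subseteq> span J"
   using P_span by (intro span_minimal) (auto intro!: span_diff)
  have "J \<subseteq> {p - q |p q. p \<in> P \<and> q \<in> P}"
  proof
   fix h assume "h \<in> J"
   then have "h = h - 0 \<and> h \<in> P \<and> 0 \<in> P" using J_P P_0 by simp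
   then show "h \<in> {p - q |p q. p \<in> P \<and> q \<in> P}" by blast
  qed
  then show "span J \<subseteq> span {p - q |p q. p \<in> P \<and> q \<in> P}" by (rule span_mono)
 qed
 then show ?thesis by (simp add: parallel_lattice_def Lam_def)
qed

context
 fixes B assumes B: "lattice_basis B Lam"
begin

lemma BD: "finite B" "independent B" "B \<subseteq> Lam" "span B = span J"
 using lattice_basisD[OF B] span_Lam by auto

lemma card_B: "card B = dim J"
 using dim_eq_card[OF BD(4) BD(2)] by simp

lemma rep_sum: "x \<in> span J \<Longrightarrow> (\<Sum>b\<in>B. representation B x b *\<^sub>R b) = x"
 using real_vector.sum_representation_eq[OF BD(2) _ BD(1) subset_refl] BD(4) by auto

text \<open>Each unit of a generator lowers the value at \<open>a\<close> by at least
  \<open>\<epsilon>\<close> and adds at most \<open>K\<close> to the sum of absolute coordinates;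
  comparing the two gives exponential decay of the integrand and hence an integrable
  majorant.\<close>

lemma decay:
 assumes a: "\<forall>h\<in>J. h a < 0"
 obtains \<delta> where "\<delta> > 0" "\<And>x. x \<in> P \<Longrightarrow> x a \<le> - \<delta> * (\<Sum>b\<in>B. \<bar>representation B x b\<bar>)"
proof -
 \<comment> \<open>The inserted 1 keeps the minimum defined when there are no generators.\<close>
 define \<epsilon> where "\<epsilon> = Min (insert 1 ((\<lambda>h. - h a) ` J))"
 have \<epsilon>: "\<epsilon> > 0" using a J by (auto simp: \<epsilon>_def)
 have \<epsilon>h: "h a \<le> - \<epsilon>" if "h \<in> J" for h
 proof -
  have "\<epsilon> \<le> - h a" unfolding \<epsilon>_def using that J by (intro Min_le) auto
  then show ?thesis by simp
 qed
 define K where "K = (\<Sum>h\<in>J. \<Sum>b\<in>B. \<bar>representation B h b\<bar>)"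
 have K: "K \<ge> 0" by (auto simp: K_def intro!: sum_nonneg)
 show ?thesis
 proof (rule that[of "\<epsilon> / (K + 1)"])
  show "\<epsilon> / (K + 1) > 0" using \<epsilon> K by simp
  fix x assume "x \<in> P"
  then obtain c where c: "\<And>h. h \<in> J \<Longrightarrow> 0 \<le> c h" "x = (\<Sum>h\<in>J. c h *\<^sub>R h)" by (auto simp: P_gen fcone_def)
  define s where "s = (\<Sum>h\<in>J. c h)"
  have s: "s \<ge> 0" using c by (auto simp: s_def intro: sum_nonneg)
  have "x a = (\<Sum>h\<in>J. c h * h a)" by (simp add: c(2) sum_fun_apply)
  also have "\<dots> \<le> (\<Sum>h\<in>J. c h * (- \<epsilon>))" using c \<epsilon>h by (intro sum_mono mult_left_mono) auto
  also have "\<dots> = - \<epsilon> * s" by (simp add: s_def sum_distrib_left sum_negf mult.commute)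
  finally have 1: "x a \<le> - \<epsilon> * s" .
  have rx: "representation B x b = (\<Sum>h\<in>J. c h * representation B h b)" for b
  proof -
   have "h \<in> span B" if "h \<in> J" for h using that BD(4) by (simp add: span_base)
   then show ?thesis unfolding c(2)
    by (subst real_vector.representation_sum[OF BD(2)]) (auto simp: span_scale real_vector.representation_scale[OF BD(2)])
  qed
  have "(\<Sum>b\<in>B. \<bar>representation B x b\<bar>) \<le> (\<Sum>b\<in>B. \<Sum>h\<in>J. c h * \<bar>representation B h b\<bar>)"
   unfolding rx using c(1) by (intro sum_mono order_trans[OF sum_abs]) (simp add: abs_mult)
  also have "\<dots> = (\<Sum>h\<in>J. c h * (\<Sum>b\<in>B. \<bar>representation B h b\<bar>))"
   by (subst sum.swap) (simp add: sum_distrib_left)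
  also have "\<dots> \<le> (\<Sum>h\<in>J. c h * K)"
  proof (intro sum_mono mult_left_mono c(1))
   fix h assume "h \<in> J"
   then show "(\<Sum>b\<in>B. \<bar>representation B h b\<bar>) \<le> K" unfolding K_def
    using J by (intro member_le_sum[of h J "\<lambda>h. \<Sum>b\<in>B. \<bar>representation B h b\<bar>"]) (auto intro: sum_nonneg)
  qed
  also have "\<dots> = s * K" by (simp add: s_def sum_distrib_right)
  finally have 2: "(\<Sum>b\<in>B. \<bar>representation B x b\<bar>) \<le> s * K" .
  have "\<epsilon> / (K + 1) * (\<Sum>b\<in>B. \<bar>representation B x b\<bar>) \<le> \<epsilon> / (K + 1) * (s * K)"
   using 2 \<epsilon> K by (intro mult_left_mono) auto
  also have "\<dots> = (\<epsilon> * s) * (K / (K + 1))" by simp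
  also have "\<dots> \<le> (\<epsilon> * s) * 1" using K \<epsilon> s by (intro mult_left_mono) auto
  finally show "x a \<le> - (\<epsilon> / (K + 1)) * (\<Sum>b\<in>B. \<bar>representation B x b\<bar>)" using 1 by simp
 qed
qed

text \<open>A lattice point surrounded by a full coordinate cube inside the cone. Shifting by it
  moves cells that touch the cone into the cone, which replaces estimates near the boundary.\<close>

lemma deep_point:
 obtains w where "w \<in> Lam" "\<And>s. (\<And>b. b \<in> B \<Longrightarrow> \<bar>s b\<bar> \<le> 1) \<Longrightarrow> w + (\<Sum>b\<in>B. s b *\<^sub>R b) \<in> P"
proof -
 have "\<forall>b\<in>B. \<exists>\<beta>. b = (\<Sum>h\<in>J. \<beta> h *\<^sub>R h)"
 proof
  fix b assume "b \<in> B"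
  then show "\<exists>\<beta>. b = (\<Sum>h\<in>J. \<beta> h *\<^sub>R h)" using BD(4) span_base[of b B] span_finite[OF J(1)] by auto
 qed
 then obtain \<beta> where \<beta>: "\<And>b. b \<in> B \<Longrightarrow> b = (\<Sum>h\<in>J. \<beta> b h *\<^sub>R h)" by metis
 \<comment> \<open>Rounds up the largest possible loss in the coefficient of \<open>h\<close> when
   every basis vector is subtracted or added at most once.\<close>
 define n :: "('v \<Rightarrow> real) \<Rightarrow> int" where "n h = \<lceil>\<Sum>b\<in>B. \<bar>\<beta> b h\<bar>\<rceil>" for h
 define w where "w = (\<Sum>h\<in>J. of_int (n h) *\<^sub>R h)"
 show ?thesis
 proof (rule that[of w])
  show "w \<in> Lam" unfolding w_def
   using J_Lam by (intro is_lattice_closed(6)[OF is_lattice_Lam] is_lattice_closed(5)[OF is_lattice_Lam]) auto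
  fix s :: "_ \<Rightarrow> real" assume s: "\<And>b. b \<in> B \<Longrightarrow> \<bar>s b\<bar> \<le> 1"
  have "(\<Sum>b\<in>B. s b *\<^sub>R b) = (\<Sum>b\<in>B. s b *\<^sub>R (\<Sum>h\<in>J. \<beta> b h *\<^sub>R h))" using \<beta> by (intro sum.cong) auto
  also have "\<dots> = (\<Sum>h\<in>J. \<Sum>b\<in>B. (s b * \<beta> b h) *\<^sub>R h)"
   by (simp add: scaleR_sum_right sum.swap[of _ J B])
  also have "\<dots> = (\<Sum>h\<in>J. (\<Sum>b\<in>B. s b * \<beta> b h) *\<^sub>R h)" by (simp add: scaleR_sum_left)
  finally have "w + (\<Sum>b\<in>B. s b *\<^sub>R b) = (\<Sum>h\<in>J. (of_int (n h) + (\<Sum>b\<in>B. s b * \<beta> b h)) *\<^sub>R h)"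
   by (simp add: w_def scaleR_add_left sum.distrib)
  also have "\<dots> \<in> P" unfolding P_gen
  proof (rule fconeI)
   fix h
   have "\<bar>\<Sum>b\<in>B. s b * \<beta> b h\<bar> \<le> (\<Sum>b\<in>B. \<bar>\<beta> b h\<bar>)"
    using s by (intro order_trans[OF sum_abs] sum_mono) (simp add: abs_mult mult_left_le_one_le)
   also have "\<dots> \<le> of_int (n h)" by (simp add: n_def)
   finally show "0 \<le> of_int (n h) + (\<Sum>b\<in>B. s b * \<beta> b h)" by linarith
  qed
  finally show "w + (\<Sum>b\<in>B. s b *\<^sub>R b) \<in> P" .
 qed
qed

lemma rep_combination:
 assumes "b \<in> B" shows "representation B (\<Sum>b\<in>B. c b *\<^sub>R b) b = c b"
 by (rule representation_sum_basis[OF BD(1,2) assms])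

text \<open>Dominated convergence for functions that are constant on the cells of side
  \<open>1 / k\<close>; their integrals are exactly the rescaled lattice sums. The majorant comes
  from \<open>decay\<close>, and pointwise convergence, also at the boundary of the cone, is secured
  by shifting the sample points inward.\<close>

lemma riemann:
 assumes p: "p \<in> P" and dom: "\<forall>h\<in>J. h (fst xi) < 0"
 shows "(\<lambda>m. norm (exp (pairing xi m))) summable_on (P \<inter> M)"
  and "(\<lambda>k::nat. (1 / of_nat k) ^ card B * (\<Sum>\<^sub>\<infinity>m\<in>P \<inter> M. exp (pairing xi m / of_nat k)))
   \<longlonglongrightarrow> (\<integral>t. integrand P p B xi t \<partial>(\<Pi>\<^sub>M b\<in>B. lborel))"
  and riemann_integrable: "integrable (\<Pi>\<^sub>M b\<in>B. lborel) (integrand P p B xi)"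
proof -
 obtain w where w: "w \<in> Lam" "\<And>s. (\<And>b. b \<in> B \<Longrightarrow> \<bar>s b\<bar> \<le> 1) \<Longrightarrow> w + (\<Sum>b\<in>B. s b *\<^sub>R b) \<in> P"
  using deep_point by blast
 obtain \<delta> where \<delta>: "\<delta> > 0" "\<And>x. x \<in> P \<Longrightarrow> x (fst xi) \<le> - \<delta> * (\<Sum>b\<in>B. \<bar>representation B x b\<bar>)"
  using decay[of "fst xi", OF dom] by blast
 define a where "a b = representation B p b" for b
 define wb where "wb b = representation B w b" for b
 have pa: "p = (\<Sum>b\<in>B. a b *\<^sub>R b)" using rep_sum[of p] p P_span by (auto simp: a_def)
 have w_span: "w \<in> span J" using w(1) by (simp add: Lam_def)
 have wa: "w = (\<Sum>b\<in>B. wb b *\<^sub>R b)" using rep_sum[OF w_span] by (simp add: wb_def)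
 let ?K = "PiE B (\<lambda>_. UNIV :: int set)" and ?PM = "\<Pi>\<^sub>M b\<in>B. (lborel :: real measure)"
 \<comment> \<open>The sample point of a cell is its lattice corner shifted by \<open>w / k\<close>.
   It then differs from any point of the cell by \<open>1 / k\<close> times an element of the cone,
   as \<open>pt_fl\<close> shows, so the sample point of a cell that meets the cone lies in the
   cone.\<close>
 define pt where "pt k c = (1 / real k) *\<^sub>R ((\<Sum>b\<in>B. of_int (c b) *\<^sub>R b) + w)" for k :: nat and c :: "('v \<Rightarrow> real) \<Rightarrow> int"
 define G where "G k c = cind P (pt k c) * exp (pairing xi (pt k c))" for k c
 define fr where "fr k t b = real k * (a b + t b) - of_int \<lfloor>real k * (a b + t b)\<rfloor>" for k :: nat and t :: "('v \<Rightarrow> real) \<Rightarrow> real" and b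
 have fr: "0 \<le> fr k t b" "fr k t b \<le> 1" for k t b
  unfolding fr_def by linarith+
 have par: "par_point p B t = (\<Sum>b\<in>B. (a b + t b) *\<^sub>R b)" for t
  unfolding par_point_def by (subst pa) (simp add: scaleR_add_left sum.distrib)
 have pt_fl: "pt k (fl B a k t) = par_point p B t + (1 / real k) *\<^sub>R (w + (\<Sum>b\<in>B. (- fr k t b) *\<^sub>R b))" if k: "k > 0" for k t using k
  by (simp add: fl_def fr_def par scaleR_sum_right sum.distrib[symmetric] algebra_simps pt_def scaleR_add_right add_ac)
 have rep_pt: "representation B (pt k c) b = (of_int (c b) + wb b) / real k" if "b \<in> B" for k c b using wa rep_combination[OF that, of "\<lambda>b. (of_int (c b) + wb b) / real k"]
  by (simp add: pt_def sum.distrib[symmetric] scaleR_sum_right scaleR_add_left[symmetric])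
 \<comment> \<open>Absorbs the distance of a point from the sample point of its cell, which is at
   most \<open>\<bar>wb b\<bar> + 1\<close> in the coordinate \<open>b\<close> for all
   \<open>k\<close>.\<close>
 define C where "C = exp (\<delta> * (\<Sum>b\<in>B. \<bar>wb b\<bar> + 1))"
 have bound: "cmod (G k (fl B a k t)) \<le> C * exp (- \<delta> * (\<Sum>b\<in>B. \<bar>a b + t b\<bar>))" if k: "k > 0" for k t
 proof (cases "pt k (fl B a k t) \<in> P")
  case True
  have "(\<Sum>b\<in>B. \<bar>a b + t b\<bar>) \<le> (\<Sum>b\<in>B. \<bar>representation B (pt k (fl B a k t)) b\<bar> + (\<bar>wb b\<bar> + 1))"
  proof (rule sum_mono)
   fix b assume b: "b \<in> B"
   have kp: "real k \<ge> 1" using k by simp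
   have "a b + t b = (of_int \<lfloor>real k * (a b + t b)\<rfloor> + fr k t b) / real k" using k by (simp add: fr_def)
   also have "\<dots> = representation B (pt k (fl B a k t)) b + (fr k t b / real k - wb b / real k)"
    using b by (simp add: rep_pt fl_def add_divide_distrib)
   finally have e: "a b + t b = representation B (pt k (fl B a k t)) b + (fr k t b / real k - wb b / real k)" .
   have "\<bar>fr k t b / real k\<bar> \<le> 1 / 1" unfolding abs_divide using fr[of k t b] kp by (intro frac_le) auto
   moreover have "\<bar>wb b / real k\<bar> \<le> \<bar>wb b\<bar> / 1" unfolding abs_divide using kp by (intro frac_le) auto
   ultimately show "\<bar>a b + t b\<bar> \<le> \<bar>representation B (pt k (fl B a k t)) b\<bar> + (\<bar>wb b\<bar> + 1)" unfolding e by linarith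
  qed
  then have "\<delta> * (\<Sum>b\<in>B. \<bar>a b + t b\<bar>) \<le> \<delta> * (\<Sum>b\<in>B. \<bar>representation B (pt k (fl B a k t)) b\<bar>) + \<delta> * (\<Sum>b\<in>B. \<bar>wb b\<bar> + 1)"
   using \<delta>(1) by (simp add: sum.distrib distrib_left[symmetric] mult_left_mono)
  then have "(pt k (fl B a k t)) (fst xi) \<le> \<delta> * (\<Sum>b\<in>B. \<bar>wb b\<bar> + 1) - \<delta> * (\<Sum>b\<in>B. \<bar>a b + t b\<bar>)"
   using \<delta>(2)[OF True] by linarith
  then have "exp ((pt k (fl B a k t)) (fst xi)) \<le> exp (\<delta> * (\<Sum>b\<in>B. \<bar>wb b\<bar> + 1) - \<delta> * (\<Sum>b\<in>B. \<bar>a b + t b\<bar>))" by simp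
  also have "\<dots> = C * exp (- \<delta> * (\<Sum>b\<in>B. \<bar>a b + t b\<bar>))" by (simp add: C_def exp_diff exp_minus field_simps)
  finally show ?thesis using True by (simp add: G_def cind_def norm_mult)
 qed (simp add: G_def cind_def C_def)
 have int_bound: "integrable ?PM (\<lambda>t. C * exp (- \<delta> * (\<Sum>b\<in>B. \<bar>a b + t b\<bar>)))"
  using integrable_exp_neg_sum[OF BD(1) \<delta>(1), of a] by simp
 have int_G: "integrable ?PM (\<lambda>t. G k (fl B a k t))" if k: "k > 0" for k
  using bound[OF k] fl_compose_measurable[OF BD(1) k, where a=a and G="G k"]
  by (intro Bochner_Integration.integrable_bound[OF int_bound]) (auto simp: C_def intro!: AE_I2 order_trans[OF _ abs_ge_self])
 have sum_G: "(\<lambda>c. norm (G k c)) summable_on ?K" if k: "k > 0" for k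
  using integrable_fl[OF BD(1) k, where a=a and G="G k"] int_G[OF k] by blast
 define \<phi> where "\<phi> c = (\<Sum>b\<in>B. of_int (c b) *\<^sub>R b) + w" for c :: "('v \<Rightarrow> real) \<Rightarrow> int"
 have Lcl: "x \<in> Lam \<Longrightarrow> y \<in> Lam \<Longrightarrow> x - y \<in> Lam" "x \<in> Lam \<Longrightarrow> y \<in> Lam \<Longrightarrow> x + y \<in> Lam" for x y
  using is_lattice_closed[OF is_lattice_Lam] by auto
 have LB: "(\<Sum>b\<in>B. of_int (c b) *\<^sub>R b) \<in> Lam" for c :: "('v \<Rightarrow> real) \<Rightarrow> int"
  using BD(3) by (intro is_lattice_closed(6)[OF is_lattice_Lam] is_lattice_closed(5)[OF is_lattice_Lam]) auto
 have bij: "bij_betw \<phi> ?K Lam"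
 proof (rule bij_betw_byWitness[where f'="\<lambda>m. \<lambda>b\<in>B. \<lfloor>representation B (m - w) b\<rfloor>"])
  show "\<forall>c\<in>?K. (\<lambda>b\<in>B. \<lfloor>representation B (\<phi> c - w) b\<rfloor>) = c"
  proof
   fix c assume "c \<in> ?K"
   then show "(\<lambda>b\<in>B. \<lfloor>representation B (\<phi> c - w) b\<rfloor>) = c"
    by (intro ext) (auto simp: \<phi>_def rep_combination PiE_def extensional_def)
  qed
  show "\<forall>m\<in>Lam. \<phi> (\<lambda>b\<in>B. \<lfloor>representation B (m - w) b\<rfloor>) = m"
  proof
   fix m assume "m \<in> Lam"
   then have "m - w \<in> Lam" using Lcl w by blast
   then have i: "\<forall>b\<in>B. representation B (m - w) b \<in> \<int>" "m - w \<in> span J"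
    using lattice_mem_iff[OF B, of "m - w"] BD(4) by auto
   have "(\<Sum>b\<in>B. of_int ((\<lambda>b\<in>B. \<lfloor>representation B (m - w) b\<rfloor>) b) *\<^sub>R b) = (\<Sum>b\<in>B. representation B (m - w) b *\<^sub>R b)"
    using i(1) by (intro sum.cong) (auto elim!: Ints_cases)
   also have "\<dots> = m - w" by (rule rep_sum[OF i(2)])
   finally show "\<phi> (\<lambda>b\<in>B. \<lfloor>representation B (m - w) b\<rfloor>) = m" by (simp add: \<phi>_def)
  qed
  show "\<phi> ` ?K \<subseteq> Lam" using LB Lcl(2) w(1) by (auto simp: \<phi>_def)
  show "(\<lambda>m. \<lambda>b\<in>B. \<lfloor>representation B (m - w) b\<rfloor>) ` Lam \<subseteq> ?K" by auto
 qed
 have G_phi: "G k c = cind P (\<phi> c) * exp (pairing xi (\<phi> c) / of_nat k)" if k: "k > 0" for k c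
 proof -
  have "pt k c \<in> P \<longleftrightarrow> \<phi> c \<in> P"
   using P_scale[of "pt k c" "real k"] P_scale[of "\<phi> c" "1 / real k"] k by (auto simp: pt_def \<phi>_def)
  then show ?thesis by (simp add: G_def cind_def pt_def \<phi>_def pairing_scaleR)
 qed
 have PM_Lam: "P \<inter> M \<subseteq> Lam" using P_span by (auto simp: Lam_def)
 \<comment> \<open>For \<open>k = 1\<close> the sum over the cells is the lattice sum itself, so
   integrability of the step function gives absolute summability.\<close>
 have "(\<lambda>c. norm (cind P (\<phi> c) * exp (pairing xi (\<phi> c) / of_nat 1))) summable_on ?K"
  using sum_G[of 1] G_phi[of 1] by simp
 then have "(\<lambda>m. norm (cind P m * exp (pairing xi m))) summable_on Lam"
  using summable_on_reindex_bij_betw[OF bij, of "\<lambda>m. norm (cind P m * exp (pairing xi m))"] by simp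
 moreover have "(\<lambda>m. norm (cind P m * exp (pairing xi m))) summable_on Lam \<longleftrightarrow> (\<lambda>m. norm (exp (pairing xi m))) summable_on (P \<inter> M)"
  using PM_Lam by (intro summable_on_cong_neutral) (auto simp: cind_def Lam_def)
 ultimately show "(\<lambda>m. norm (exp (pairing xi m))) summable_on (P \<inter> M)" by blast
 have int_eq: "(\<integral>t. G k (fl B a k t) \<partial>?PM) = (1 / of_nat k) ^ card B * (\<Sum>\<^sub>\<infinity>m\<in>P \<inter> M. exp (pairing xi m / of_nat k))"
  if k: "k > 0" for k
 proof -
  have "(\<integral>t. G k (fl B a k t) \<partial>?PM) = of_real ((1 / k) ^ card B) * infsum (G k) ?K"
   by (rule integral_fl[OF BD(1) k sum_G[OF k]])
  also have "infsum (G k) ?K = (\<Sum>\<^sub>\<infinity>c\<in>?K. cind P (\<phi> c) * exp (pairing xi (\<phi> c) / of_nat k))"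
   by (intro infsum_cong G_phi k)
  also have "\<dots> = (\<Sum>\<^sub>\<infinity>m\<in>Lam. cind P m * exp (pairing xi m / of_nat k))"
   by (rule infsum_reindex_bij_betw[OF bij])
  also have "\<dots> = (\<Sum>\<^sub>\<infinity>m\<in>P \<inter> M. exp (pairing xi m / of_nat k))"
   using PM_Lam by (intro infsum_cong_neutral) (auto simp: cind_def Lam_def)
  finally show ?thesis by simp
 qed
 have inv0: "(\<lambda>k. 1 / real (Suc k)) \<longlonglongrightarrow> 0" using LIMSEQ_inverse_real_of_nat by (simp add: inverse_eq_divide)
 have lim_pair: "(\<lambda>k. pairing eta (pt (Suc k) (fl B a (Suc k) t))) \<longlonglongrightarrow> pairing eta (par_point p B t)" for eta t
 proof -
  define Q where "Q k = pairing eta (w + (\<Sum>b\<in>B. (- fr (Suc k) t b) *\<^sub>R b))" for k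
  have Qb: "cmod (Q k) \<le> cmod (pairing eta w) + (\<Sum>b\<in>B. cmod (pairing eta b))" for k
  proof -
   have "cmod (\<Sum>b\<in>B. of_real (- fr (Suc k) t b) * pairing eta b) \<le> (\<Sum>b\<in>B. cmod (pairing eta b))"
    using fr by (intro order_trans[OF norm_sum] sum_mono) (simp add: norm_mult mult_left_le_one_le)
   then show ?thesis unfolding Q_def pairing_add pairing_sum pairing_scaleR by (intro norm_triangle_le) simp
  qed
  have "(\<lambda>k. of_real (1 / real (Suc k)) * Q k) \<longlonglongrightarrow> 0"
  proof (rule Lim_null_comparison)
   show "\<forall>\<^sub>F k in sequentially. cmod (of_real (1 / real (Suc k)) * Q k) \<le> (1 / real (Suc k)) * (cmod (pairing eta w) + (\<Sum>b\<in>B. cmod (pairing eta b)))"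
    using Qb by (intro always_eventually allI) (simp only: norm_mult norm_of_real, intro mult_mono, auto)
   show "(\<lambda>k. (1 / real (Suc k)) * (cmod (pairing eta w) + (\<Sum>b\<in>B. cmod (pairing eta b)))) \<longlonglongrightarrow> 0"
    by (rule tendsto_mult_left_zero[OF inv0])
  qed
  then have "(\<lambda>k. pairing eta (par_point p B t) + of_real (1 / real (Suc k)) * Q k) \<longlonglongrightarrow> pairing eta (par_point p B t) + 0"
   by (intro tendsto_add tendsto_const)
  moreover have "pairing eta (pt (Suc k) (fl B a (Suc k) t)) = pairing eta (par_point p B t) + of_real (1 / real (Suc k)) * Q k" for k
   unfolding pt_fl[OF zero_less_Suc] by (simp only: pairing_add pairing_scaleR Q_def)
  ultimately show ?thesis by simp
 qed
 have par_dual: "par_point p B t \<in> real_dual (span N)" for t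
 proof -
  have "b \<in> real_dual (span N)" if "b \<in> B" for b using that BD(3) M_dual by (auto simp: Lam_def)
  then show ?thesis unfolding par by (intro subspace_sum subspace_scale subspace_real_dual) auto
 qed
 have lim_G: "(\<lambda>k. G (Suc k) (fl B a (Suc k) t)) \<longlonglongrightarrow> integrand P p B xi t" for t
 proof (cases "par_point p B t \<in> P")
  case True
  have "pt (Suc k) (fl B a (Suc k) t) \<in> P" for k
   unfolding pt_fl[OF zero_less_Suc] using fr[of "Suc k" t]
   by (intro P_add True P_scale w(2)) auto
  then have "G (Suc k) (fl B a (Suc k) t) = exp (pairing xi (pt (Suc k) (fl B a (Suc k) t)))" for k by (simp add: G_def cind_def)
  moreover have "integrand P p B xi t = exp (pairing xi (par_point p B t))" using True by (simp add: integrand_def)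
  ultimately show ?thesis using tendsto_exp[OF lim_pair[of xi t]] by simp
 next
  case False
  then obtain u where u: "u \<in> U" "par_point p B t u < 0" using par_dual[of t] P_halfspaces by (auto simp: not_le)
  \<comment> \<open>The pair \<open>(u, u)\<close> turns the limit of pairings into a limit of
    evaluations at \<open>u\<close>; a strictly violated inequality is violated by nearby sample
    points as well.\<close>
  have "(\<lambda>k. Re (pairing (u, u) (pt (Suc k) (fl B a (Suc k) t)))) \<longlonglongrightarrow> Re (pairing (u, u) (par_point p B t))"
   by (intro tendsto_Re lim_pair)
  then have "(\<lambda>k. pt (Suc k) (fl B a (Suc k) t) u) \<longlonglongrightarrow> par_point p B t u" by simp
  then have "\<forall>\<^sub>F k in sequentially. pt (Suc k) (fl B a (Suc k) t) u < 0" using u(2) by (rule order_tendstoD)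
  then have "\<forall>\<^sub>F k in sequentially. G (Suc k) (fl B a (Suc k) t) = 0"
  proof (rule eventually_mono)
   fix k assume "pt (Suc k) (fl B a (Suc k) t) u < 0"
   moreover have "0 \<le> x u" if "x \<in> P" for x using that u(1) P_halfspaces by blast
   ultimately have "pt (Suc k) (fl B a (Suc k) t) \<notin> P" by (metis not_le)
   then show "G (Suc k) (fl B a (Suc k) t) = 0" by (simp add: G_def cind_def)
  qed
  then show ?thesis using False by (simp add: integrand_def tendsto_eventually)
 qed
 have meas: "(\<lambda>t. G (Suc k) (fl B a (Suc k) t)) \<in> borel_measurable ?PM" for k
  by (rule fl_compose_measurable[OF BD(1)]) simp
 have meas': "integrand P p B xi \<in> borel_measurable ?PM"
  by (rule borel_measurable_LIMSEQ_metric[OF meas]) (rule lim_G)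
 have AE1: "AE t in ?PM. (\<lambda>k. G (Suc k) (fl B a (Suc k) t)) \<longlonglongrightarrow> integrand P p B xi t" using lim_G by simp
 have AE2: "AE t in ?PM. cmod (G (Suc k) (fl B a (Suc k) t)) \<le> C * exp (- \<delta> * (\<Sum>b\<in>B. \<bar>a b + t b\<bar>))" for k
  using bound[OF zero_less_Suc] by simp
 show "integrable ?PM (integrand P p B xi)"
  by (rule integrable_dominated_convergence[OF meas' meas int_bound AE1 AE2])
 have "(\<lambda>k. \<integral>t. G (Suc k) (fl B a (Suc k) t) \<partial>?PM) \<longlonglongrightarrow> (\<integral>t. integrand P p B xi t \<partial>?PM)"
  by (rule integral_dominated_convergence[OF meas' meas int_bound AE1 AE2])
 then have "(\<lambda>k. (1 / of_nat (Suc k)) ^ card B * (\<Sum>\<^sub>\<infinity>m\<in>P \<inter> M. exp (pairing xi m / of_nat (Suc k)))) \<longlonglongrightarrow> (\<integral>t. integrand P p B xi t \<partial>?PM)"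
  unfolding int_eq[OF zero_less_Suc] .
 then show "(\<lambda>k::nat. (1 / of_nat k) ^ card B * (\<Sum>\<^sub>\<infinity>m\<in>P \<inter> M. exp (pairing xi m / of_nat k))) \<longlonglongrightarrow> (\<integral>t. integrand P p B xi t \<partial>?PM)"
  by (rule LIMSEQ_imp_Suc)
qed

text \<open>The definition of the integral prescribes its value at every point of integrability, so
  convergence outside the expected domain has to be excluded. If \<open>h\<close> does not decay,
  the integrand is bounded below on the infinitely many disjoint unit cells at the points
  \<open>w + j h\<close>.\<close>

lemma integrable_imp_dom:
 assumes p: "p \<in> P" and int: "integrable (\<Pi>\<^sub>M b\<in>B. lborel) (integrand P p B xi)" and h: "h \<in> J"
 shows "h (fst xi) < 0"
proof (rule ccontr)
 assume "\<not> h (fst xi) < 0"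
 then have ha: "0 \<le> h (fst xi)" by simp
 obtain w where w: "w \<in> Lam" "\<And>s. (\<And>b. b \<in> B \<Longrightarrow> \<bar>s b\<bar> \<le> 1) \<Longrightarrow> w + (\<Sum>b\<in>B. s b *\<^sub>R b) \<in> P"
  using deep_point by blast
 define a where "a b = representation B p b" for b
 have pa: "p = (\<Sum>b\<in>B. a b *\<^sub>R b)" using rep_sum[of p] p P_span by (auto simp: a_def)
 let ?K = "PiE B (\<lambda>_. UNIV :: int set)" and ?PM = "\<Pi>\<^sub>M b\<in>B. (lborel :: real measure)"
 have hL: "h \<in> Lam" using h J_Lam by auto
 have wh: "w + real j *\<^sub>R h \<in> Lam" for j
  using is_lattice_closed(2)[OF is_lattice_Lam w(1) is_lattice_closed(5)[OF is_lattice_Lam hL, of "int j"]] by simp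
 have spans: "w \<in> span B" "h \<in> span B" using w(1) hL BD(4) by (auto simp: Lam_def)
 define c where "c j = (\<lambda>b\<in>B. \<lfloor>representation B (w + real j *\<^sub>R h) b\<rfloor>)" for j :: nat
 have cj: "of_int (c j b) = representation B (w + real j *\<^sub>R h) b" if "b \<in> B" for j b
  using lattice_mem_iff[OF B, of "w + real j *\<^sub>R h"] wh that by (auto simp: c_def elim!: Ints_cases)
 have inj: "inj c"
 proof (rule injI)
  fix i j assume e: "c i = c j"
  have "h \<noteq> 0" using h J0 by auto
  then obtain b where b: "b \<in> B" "representation B h b \<noteq> 0"
   using rep_sum[of h] h by (metis (no_types, lifting) scaleR_zero_left span_base sum.neutral)
  have "representation B (w + real i *\<^sub>R h) b = representation B (w + real j *\<^sub>R h) b"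
   using cj[OF b(1), of i] cj[OF b(1), of j] e by simp
  then show "i = j" using spans b(2) by (simp add: linear_on_representation[OF BD(2)] span_scale)
 qed
 define E where "E = (\<bar>w (fst xi)\<bar> + (\<Sum>b\<in>B. \<bar>b (fst xi)\<bar>))"
 define G where "G d = (if d \<in> range c then of_real (exp (- E)) else (0::complex))" for d
 have "integrable ?PM (\<lambda>t. G (fl B a 1 t))"
 proof (rule Bochner_Integration.integrable_bound[OF int])
  show "(\<lambda>t. G (fl B a 1 t)) \<in> borel_measurable ?PM" by (rule fl_compose_measurable[OF BD(1)]) simp
  show "AE t in ?PM. cmod (G (fl B a 1 t)) \<le> cmod (integrand P p B xi t)"
  proof (rule AE_I2)
   fix t
   show "cmod (G (fl B a 1 t)) \<le> cmod (integrand P p B xi t)"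
   proof (cases "fl B a 1 t \<in> range c")
    case True
    then obtain j where j: "fl B a 1 t = c j" by auto
    define fr where "fr b = (a b + t b) - of_int \<lfloor>a b + t b\<rfloor>" for b
    have fr: "0 \<le> fr b" "fr b \<le> 1" for b unfolding fr_def by linarith+
    define z where "z = w + (\<Sum>b\<in>B. fr b *\<^sub>R b)"
    have zP: "z \<in> P" unfolding z_def using fr by (intro w(2)) auto
    have "par_point p B t = (\<Sum>b\<in>B. (of_int (fl B a 1 t b) + fr b) *\<^sub>R b)"
     unfolding par_point_def by (subst pa) (simp add: sum.distrib[symmetric] scaleR_add_left[symmetric] fl_def fr_def)
    also have "\<dots> = (\<Sum>b\<in>B. (representation B (w + real j *\<^sub>R h) b + fr b) *\<^sub>R b)"
     unfolding j by (intro sum.cong refl) (simp add: cj)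
    also have "\<dots> = (w + real j *\<^sub>R h) + (\<Sum>b\<in>B. fr b *\<^sub>R b)"
     using rep_sum[of "w + real j *\<^sub>R h"] wh[of j] by (simp add: scaleR_add_left sum.distrib Lam_def)
    finally have y: "par_point p B t = z + real j *\<^sub>R h" by (simp add: z_def)
    have inP: "par_point p B t \<in> P" unfolding y by (intro P_add zP P_scale J_P h) simp
    have "\<bar>\<Sum>b\<in>B. fr b * b (fst xi)\<bar> \<le> (\<Sum>b\<in>B. \<bar>b (fst xi)\<bar>)"
     using fr by (intro order_trans[OF sum_abs] sum_mono) (simp add: abs_mult mult_left_le_one_le)
    then have "- E \<le> z (fst xi)" by (simp add: E_def z_def plus_fun_def sum_fun_apply)
    also have "\<dots> \<le> par_point p B t (fst xi)" using ha by (simp add: y plus_fun_def)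
    finally have "exp (- E) \<le> exp (par_point p B t (fst xi))" by simp
    then show ?thesis using True inP by (simp add: G_def integrand_def norm_mult)
   qed (simp add: G_def)
  qed
 qed
 then have "(\<lambda>d. norm (G d)) summable_on ?K" using integrable_fl[OF BD(1), where k=1 and a=a and G=G] by simp
 moreover have "range c \<subseteq> ?K" by (auto simp: c_def)
 ultimately have "(\<lambda>d. norm (G d)) summable_on range c" by (rule summable_on_subset_banach)
 then have "(\<lambda>d. exp (- E)) summable_on range c"
  by (subst (asm) summable_on_cong[where g="\<lambda>_. exp (- E)"]) (auto simp: G_def)
 then have "summable (\<lambda>_::nat. exp (- E))" using summable_on_reindex[OF inj, of "\<lambda>_. exp (- E)"] summable_on_UNIV_nonneg_real_iff[of "\<lambda>_::nat. exp (- E)"] by (simp add: o_def)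
 then show False by (simp add: summable_const_iff)
qed

end

text \<open>The homogeneous part of degree \<open>r\<close> of the numerator \<open>num H\<close>:
  the coefficient of \<open>t ^ r\<close> along the real line through \<open>xi\<close>.\<close>

definition tay where "tay H r xi = (\<Sum>m\<in>supp H. mdiff H (cind P) m * pairing xi m ^ r / fact r)"

lemma dim_le_card:
 assumes "finite H" "J \<subseteq> H" shows "dim J \<le> card H"
proof -
 obtain B where B: "lattice_basis B Lam" using is_lattice_Lam by (auto simp: is_lattice_def)
 show ?thesis using real_vector.independent_span_bound[OF J(1) BD(2)[OF B]] BD(4)[OF B] span_superset[of B] card_B[OF B] card_mono[OF assms] by simp
qed

text \<open>At the point \<open>xi / k\<close> the denominator behaves like \<open>k\<close> to the
  power \<open>- card H\<close> times the product of the linear forms, and the lattice sum like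
  \<open>k\<close> to the power \<open>dim J\<close> times the integral. So the numerator starts in
  degree \<open>card H - dim J\<close>, and its leading part is the integral times the linear
  forms.\<close>

lemma tay_dom:
 assumes xi: "xi \<in> lat_C N" and dom: "\<forall>h\<in>J. h (fst xi) < 0" and H: "finite H" "J \<subseteq> H" "H \<subseteq> M"
  and B: "lattice_basis B Lam" and p: "p \<in> P"
 shows "r < card H - dim J \<Longrightarrow> tay H r xi = 0"
  and "tay H (card H - dim J) xi = (\<integral>t. integrand P p B xi t \<partial>(\<Pi>\<^sub>M b\<in>B. lborel)) * (\<Prod>h\<in>H. - pairing xi h)"
proof -
 let ?I = "\<integral>t. integrand P p B xi t \<partial>(\<Pi>\<^sub>M b\<in>B. lborel)"
 define d where "d = card H - dim J"
 have dim: "card B = dim J" by (rule card_B[OF B])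
 have dle: "dim J \<le> card H" by (rule dim_le_card[OF H(1,2)])
 have scale: "pairing ((1 / real k) *\<^sub>R xi) m = pairing xi m / of_nat k" if m: "m \<in> real_dual (span N)" for m k
  using xi real_dualD(2)[OF m] by (simp add: pairing_def lat_C_def mem_Times_iff complex_eq_iff)
 have HM: "h \<in> real_dual (span N)" if "h \<in> H" for h using H(3) M_dual that by auto
 have "(\<lambda>k::nat. ((1 / of_nat k) ^ card B * (\<Sum>\<^sub>\<infinity>m\<in>P \<inter> M. exp (pairing xi m / of_nat k))) * (\<Prod>h\<in>H. of_nat k * (1 - exp (pairing xi h / of_nat k))))
   \<longlonglongrightarrow> ?I * (\<Prod>h\<in>H. - pairing xi h)"
  by (intro tendsto_mult riemann(2)[OF B p dom] tendsto_prod tendsto_one_minus_exp)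
 \<comment> \<open>This is \<open>sum_identity\<close> at \<open>xi / k\<close>, multiplied by one
   \<open>k\<close> for each factor of the denominator and divided by \<open>k\<close> to the power
   of the dimension.\<close>
 moreover have "\<forall>\<^sub>F k::nat in sequentially. ((1 / of_nat k) ^ card B * (\<Sum>\<^sub>\<infinity>m\<in>P \<inter> M. exp (pairing xi m / of_nat k))) * (\<Prod>h\<in>H. of_nat k * (1 - exp (pairing xi h / of_nat k)))
   = of_nat k ^ d * (\<Sum>m\<in>supp H. mdiff H (cind P) m * exp (pairing xi m / of_nat k))"
  using eventually_gt_at_top[of "0::nat"]
 proof (rule eventually_mono)
  fix k :: nat assume k: "0 < k"
  let ?eta = "(1 / real k) *\<^sub>R xi"
  have dom': "\<forall>h\<in>J. h (fst ?eta) < 0"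
  proof
   fix h assume that: "h \<in> J"
   have "h (fst ?eta) = Re (pairing ?eta h)" by simp
   also have "pairing ?eta h = pairing xi h / of_nat k" using that H(2) by (intro scale HM) auto
   also have "Re \<dots> = h (fst xi) / real k" by (simp add: Re_divide_of_nat)
   finally show "h (fst ?eta) < 0" using dom that k by (simp add: divide_neg_pos)
  qed
  have den: "den H ?eta = (\<Prod>h\<in>H. 1 - exp (pairing xi h / of_nat k))"
   unfolding den_def by (intro prod.cong refl) (simp add: scale HM)
  have "(\<Sum>\<^sub>\<infinity>m\<in>P \<inter> M. exp (pairing ?eta m)) = (\<Sum>\<^sub>\<infinity>m\<in>P \<inter> M. exp (pairing xi m / of_nat k))"
   using P_dual by (intro infsum_cong) (auto simp: scale)
  moreover have "num H ?eta = (\<Sum>m\<in>supp H. mdiff H (cind P) m * exp (pairing xi m / of_nat k))"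
   unfolding num_def using M_dual by (intro sum.cong refl) (auto simp: scale supp_def)
  ultimately have "(\<Prod>h\<in>H. 1 - exp (pairing xi h / of_nat k)) * (\<Sum>\<^sub>\<infinity>m\<in>P \<inter> M. exp (pairing xi m / of_nat k)) =
    (\<Sum>m\<in>supp H. mdiff H (cind P) m * exp (pairing xi m / of_nat k))"
   using sum_identity[OF H riemann(1)[OF B p dom']] den by simp
  moreover have "(of_nat k :: complex) ^ card H = of_nat k ^ d * of_nat k ^ card B"
   using dle dim by (simp add: d_def power_add[symmetric])
  ultimately show "((1 / of_nat k) ^ card B * (\<Sum>\<^sub>\<infinity>m\<in>P \<inter> M. exp (pairing xi m / of_nat k))) * (\<Prod>h\<in>H. of_nat k * (1 - exp (pairing xi h / of_nat k)))
   = of_nat k ^ d * (\<Sum>m\<in>supp H. mdiff H (cind P) m * exp (pairing xi m / of_nat k))"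
  proof -
   assume e: "(\<Prod>h\<in>H. 1 - exp (pairing xi h / of_nat k)) * (\<Sum>\<^sub>\<infinity>m\<in>P \<inter> M. exp (pairing xi m / of_nat k)) =
     (\<Sum>m\<in>supp H. mdiff H (cind P) m * exp (pairing xi m / of_nat k))"
    and c: "(of_nat k :: complex) ^ card H = of_nat k ^ d * of_nat k ^ card B"
   have gen: "x * S * (D * y * Q) = D * (Q * S)" if "x * y = 1" for x y S D Q :: complex using that by (simp add: mult_ac)
   have one: "(1 / of_nat k) ^ card B * of_nat k ^ card B = (1::complex)" using k by (simp add: power_one_over)
   show ?thesis unfolding prod.distrib prod_constant c e[symmetric] using one
    by (rule gen)
  qed
 qed
 ultimately have lim: "(\<lambda>k::nat. of_nat k ^ d * (\<Sum>m\<in>supp H. mdiff H (cind P) m * exp (pairing xi m / of_nat k))) \<longlonglongrightarrow> ?I * (\<Prod>h\<in>H. - pairing xi h)"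
  by (rule Lim_transform_eventually)
 have fin: "finite (supp H)" using finite_support[OF H] by (simp add: supp_def)
 show "r < card H - dim J \<Longrightarrow> tay H r xi = 0"
  using exp_combination_coefficients(1)[OF fin lim, of r] by (simp add: tay_def d_def)
 show "tay H (card H - dim J) xi = ?I * (\<Prod>h\<in>H. - pairing xi h)"
  using exp_combination_coefficients(2)[OF fin lim] by (simp add: tay_def d_def)
qed

lemma holo_tay: "holo_on (lat_C N) (lat_C N) (tay H r)"
 unfolding tay_def divide_inverse
 using M_dual by (intro holo_on_sum holo_on_mult holo_on_const holo_on_power holo_on_pairing) (auto simp: supp_def)

section \<open>Meromorphic continuation from the domain of convergence\<close>

definition Dom where "Dom = {xi\<in>lat_C N. \<forall>h\<in>J. h (fst xi) < 0}"

lemma Dom: "openin (top_of_set (lat_C N)) Dom" "Dom \<noteq> {}"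
proof -
 have "openin (top_of_set (lat_C N)) {xi\<in>lat_C N. Re (pairing xi h) < 0}" if h: "h \<in> J" for h
 proof -
  have "h \<in> real_dual (span N)" using h J M_dual by auto
  then have "continuous_on (lat_C N) (\<lambda>xi. Re (pairing xi h))" by (fastforce intro: holo_on_continuous[of "lat_C N" "lat_C N"] holo_on_pairing continuous_intros)
  then have "openin (top_of_set (lat_C N)) (lat_C N \<inter> (\<lambda>xi. Re (pairing xi h)) -` {..<0})"
   by (rule continuous_openin_preimage_gen) auto
  moreover have "lat_C N \<inter> (\<lambda>xi. Re (pairing xi h)) -` {..<0} = {xi\<in>lat_C N. Re (pairing xi h) < 0}" by auto
  ultimately show ?thesis by simp
 qed
 then have "openin (top_of_set (lat_C N)) ((\<Inter>h\<in>J. {xi\<in>lat_C N. Re (pairing xi h) < 0}) \<inter> lat_C N)"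
  using openin_INT[OF J(1), of "top_of_set (lat_C N)" "\<lambda>h. {xi\<in>lat_C N. Re (pairing xi h) < 0}"] by simp
 moreover have "(\<Inter>h\<in>J. {xi\<in>lat_C N. Re (pairing xi h) < 0}) \<inter> lat_C N = Dom" by (auto simp: Dom_def)
 ultimately show "openin (top_of_set (lat_C N)) Dom" by simp
 have "h (- v0) < 0" if "h \<in> J" for h
 proof -
  have "h \<in> real_dual (span N)" using that J M_dual by auto
  from real_dualD(2)[OF this v0(1), of "-1"] v0(2)[OF that] show ?thesis by simp
 qed
 then have "(- v0, 0) \<in> Dom" using v0(1) by (auto simp: Dom_def lat_C_def span_neg span_zero)
 then show "Dom \<noteq> {}" by blast
qed

text \<open>Known on the domain of convergence by \<open>tay_dom\<close>; the identity theorem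
  carries it to all of the complexified lattice space.\<close>

lemma tay_zero:
 assumes H: "finite H" "J \<subseteq> H" "H \<subseteq> M" and r: "r < card H - dim J" and xi: "xi \<in> lat_C N"
 shows "tay H r xi = 0"
proof -
 obtain B where B: "lattice_basis B Lam" using is_lattice_Lam by (auto simp: is_lattice_def)
 show ?thesis
 proof (rule holo_identity[OF csub_lat_C convex_UNIV open_UNIV _ Dom(1) _ Dom(2)])
  show "tay H r eta = 0" if "eta \<in> Dom" for eta
   using that r by (intro tay_dom(1)[OF _ _ H B P_0]) (auto simp: Dom_def)
 qed (use holo_tay xi in auto)
qed

text \<open>The base point and the basis are choices made inside the definition and therefore stay
  existential. The witness for the continuation is the integral where it converges and the leading
  part of the numerator over the linear forms elsewhere.\<close>

lemma exp_integral_spec: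
 "\<exists>B p. p \<in> P \<and> lattice_basis B Lam \<and> mero_on (lat_C N) (exp_integral N P) \<and>
  (\<forall>xi\<in>lat_C N. integrable (\<Pi>\<^sub>M b\<in>B. lborel) (integrand P p B xi) \<longrightarrow>
   exp_integral N P xi = (\<integral>t. integrand P p B xi t \<partial>(\<Pi>\<^sub>M b\<in>B. lborel)))"
proof -
 define p where "p = (SOME p. p \<in> P)"
 define B where "B = (SOME B. lattice_basis B (parallel_lattice N P))"
 have p: "p \<in> P" unfolding p_def using someI[of "\<lambda>p. p \<in> P" 0] P_0 by simp
 have B: "lattice_basis B Lam" using is_lattice_Lam someI_ex by (simp add: parallel_lattice_P is_lattice_def B_def)
 define d where "d = card J - dim J"
 define I where "I xi = (\<integral>t. integrand P p B xi t \<partial>(\<Pi>\<^sub>M b\<in>B. lborel))" for xi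
 define F where "F xi = (if integrable (\<Pi>\<^sub>M b\<in>B. lborel) (integrand P p B xi) then I xi else tay J d xi / (\<Prod>h\<in>J. - pairing xi h))" for xi
 obtain D where D: "dens (lat_C N) D" "\<forall>xi\<in>D. xi \<in> lat_C N \<and> (\<forall>h\<in>J. pairing xi h \<noteq> 0)"
  using dens_linear_nonzero[OF N J J0] by blast
 then obtain xi where xi: "xi \<in> lat_C N" "\<forall>h\<in>J. pairing xi h \<noteq> 0" using lat_C_dens_nonempty by blast
 have hprod: "holo_on (lat_C N) (lat_C N) (\<lambda>xi. \<Prod>h\<in>J. - pairing xi h)"
  using J M_dual by (intro holo_on_prod holo_on_uminus holo_on_pairing) auto
 have "mero_on (lat_C N) F"
 proof (rule mero_on_quotient[OF csub_lat_C holo_tay[of J d] hprod xi(1)])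
  show "(\<Prod>h\<in>J. - pairing xi h) \<noteq> 0" using xi(2) J(1) by (simp add: prod_zero_iff)
  fix eta assume eta: "eta \<in> lat_C N" "(\<Prod>h\<in>J. - pairing eta h) \<noteq> 0"
  show "F eta = tay J d eta / (\<Prod>h\<in>J. - pairing eta h)"
  proof (cases "integrable (\<Pi>\<^sub>M b\<in>B. lborel) (integrand P p B eta)")
   case True
   have "tay J d eta = I eta * (\<Prod>h\<in>J. - pairing eta h)" unfolding d_def I_def
    using integrable_imp_dom[OF B p True] by (intro tay_dom(2)[OF eta(1) _ J(1) subset_refl J(2) B p]) blast
   then show ?thesis using True eta(2) by (simp add: F_def)
  qed (simp add: F_def)
 qed
 then have "\<exists>F. mero_on (lat_C N) F \<and> (\<forall>xi\<in>lat_C N. integrable (\<Pi>\<^sub>M b\<in>B. lborel) (integrand P p B xi) \<longrightarrow>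
      F xi = (\<integral>t. integrand P p B xi t \<partial>(\<Pi>\<^sub>M b\<in>B. lborel)))"
  by (intro exI[of _ F]) (simp add: F_def I_def)
 from someI_ex[OF this] have "mero_on (lat_C N) (exp_integral N P) \<and> (\<forall>xi\<in>lat_C N. integrable (\<Pi>\<^sub>M b\<in>B. lborel) (integrand P p B xi) \<longrightarrow>
      exp_integral N P xi = (\<integral>t. integrand P p B xi t \<partial>(\<Pi>\<^sub>M b\<in>B. lborel)))"
  using no_line by (simp add: exp_integral_def p_def[symmetric] B_def[symmetric] Let_def)
 then show ?thesis using p B by blast
qed

lemma mero_exp_integral: "mero_on (lat_C N) (exp_integral N P)"
 using exp_integral_spec by blast

lemma mero_exp_sum: "mero_on (lat_C N) (exp_sum N P)"
 using exp_sum_spec by blast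

text \<open>Both sides are meromorphic and agree on \<open>Dom\<close>. Allowing any finite
  \<open>H\<close> that contains \<open>J\<close> provides a common denominator for a whole family
  of cones.\<close>

lemma exp_sum_char:
 assumes H: "finite H" "J \<subseteq> H" "H \<subseteq> M" "0 \<notin> H"
 shows "\<exists>D. dens (lat_C N) D \<and> (\<forall>xi\<in>D. den H xi \<noteq> 0 \<and> exp_sum N P xi = num H xi / den H xi)"
proof -
 obtain B where B: "lattice_basis B Lam" using is_lattice_Lam by (auto simp: is_lattice_def)
 obtain D where D: "dens (lat_C N) D" "\<forall>xi\<in>D. xi \<in> lat_C N \<and> den H xi \<noteq> 0"
  using dens_linear_nonzero[OF N H(1,3,4)] by blast
 then obtain xi where xi: "xi \<in> lat_C N" "den H xi \<noteq> 0" using lat_C_dens_nonempty by blast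
 have m2: "mero_on (lat_C N) (\<lambda>xi. num H xi / den H xi)"
  by (rule mero_on_quotient[OF csub_lat_C holo_num[of H] holo_den[OF H(3)] xi]) simp
 have "exp_sum N P eta = num H eta / den H eta" if eta: "eta \<in> Dom" "den H eta \<noteq> 0" for eta
 proof -
  have s: "(\<lambda>m. norm (exp (pairing eta m))) summable_on (P \<inter> M)" using eta by (intro riemann(1)[OF B P_0]) (auto simp: Dom_def)
  then have "exp_sum N P eta = (\<Sum>\<^sub>\<infinity>m\<in>P \<inter> M. exp (pairing eta m))" using exp_sum_spec eta by (auto simp: Dom_def)
  then show ?thesis using sum_identity[OF H(1,2,3) s] eta(2) by (simp add: field_simps)
 qed
 then have "mero_eq (lat_C N) (exp_sum N P) (\<lambda>xi. num H xi / den H xi)" using dens_restrict[OF D(1) Dom(1)] D(2) mero_identity[OF csub_lat_C mero_exp_sum m2 Dom]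
  by (fastforce simp: mero_eq_dens intro: exI[of _ "D \<inter> Dom"])
 then obtain E where E: "dens (lat_C N) E" "\<forall>xi\<in>E. exp_sum N P xi = num H xi / den H xi" by (auto simp: mero_eq_dens)
 show ?thesis using dens_Int[OF D(1) E(1)] D(2) E(2) by (intro exI[of _ "D \<inter> E"]) auto
qed

lemma exp_integral_char:
 assumes H: "finite H" "J \<subseteq> H" "H \<subseteq> M" "0 \<notin> H"
 shows "\<exists>D. dens (lat_C N) D \<and> (\<forall>xi\<in>D. (\<forall>h\<in>H. pairing xi h \<noteq> 0) \<and>
  exp_integral N P xi = tay H (card H - dim J) xi / (\<Prod>h\<in>H. - pairing xi h))"
proof -
 define d where "d = card H - dim J"
 obtain B p where Bp: "p \<in> P" "lattice_basis B Lam" "mero_on (lat_C N) (exp_integral N P)"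
  "\<forall>xi\<in>lat_C N. integrable (\<Pi>\<^sub>M b\<in>B. lborel) (integrand P p B xi) \<longrightarrow>
   exp_integral N P xi = (\<integral>t. integrand P p B xi t \<partial>(\<Pi>\<^sub>M b\<in>B. lborel))"
  using exp_integral_spec by blast
 obtain D where D: "dens (lat_C N) D" "\<forall>xi\<in>D. xi \<in> lat_C N \<and> (\<forall>h\<in>H. pairing xi h \<noteq> 0)"
  using dens_linear_nonzero[OF N H(1,3,4)] by blast
 then obtain xi where xi: "xi \<in> lat_C N" "\<forall>h\<in>H. pairing xi h \<noteq> 0" using lat_C_dens_nonempty by blast
 have hprod: "holo_on (lat_C N) (lat_C N) (\<lambda>xi. \<Prod>h\<in>H. - pairing xi h)"
  using H M_dual by (intro holo_on_prod holo_on_uminus holo_on_pairing) auto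
 have nz: "(\<Prod>h\<in>H. - pairing xi h) \<noteq> 0" if "\<forall>h\<in>H. pairing xi h \<noteq> 0" for xi
  using that H(1) by (simp add: prod_zero_iff)
 have m2: "mero_on (lat_C N) (\<lambda>xi. tay H d xi / (\<Prod>h\<in>H. - pairing xi h))"
  by (rule mero_on_quotient[OF csub_lat_C holo_tay[of H d] hprod xi(1) nz[OF xi(2)]]) simp
 have "exp_integral N P eta = tay H d eta / (\<Prod>h\<in>H. - pairing eta h)" if eta: "eta \<in> Dom" "\<forall>h\<in>H. pairing eta h \<noteq> 0" for eta
 proof (cases "integrable (\<Pi>\<^sub>M b\<in>B. lborel) (integrand P p B eta)")
  case True
  have dom: "eta \<in> lat_C N" "\<forall>h\<in>J. h (fst eta) < 0" using eta by (auto simp: Dom_def)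
  show ?thesis using Bp(4) dom(1) True tay_dom(2)[OF dom H(1,2,3) Bp(2,1)] nz[OF eta(2)]
   by (simp add: d_def)
 next
  case False
  have dom: "eta \<in> lat_C N" "\<forall>h\<in>J. h (fst eta) < 0" using eta by (auto simp: Dom_def)
  show ?thesis using riemann_integrable[OF Bp(2,1) dom(2)] False by blast
 qed
 then have "mero_eq (lat_C N) (exp_integral N P) (\<lambda>xi. tay H d xi / (\<Prod>h\<in>H. - pairing xi h))" using dens_restrict[OF D(1) Dom(1)] D(2) mero_identity[OF csub_lat_C Bp(3) m2 Dom]
  by (fastforce simp: mero_eq_dens intro: exI[of _ "D \<inter> Dom"])
 then obtain E where E: "dens (lat_C N) E" "\<forall>xi\<in>E. exp_integral N P xi = tay H d xi / (\<Prod>h\<in>H. - pairing xi h)" by (auto simp: mero_eq_dens)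
 show ?thesis using dens_Int[OF D(1) E(1)] D(2) E(2) by (intro exI[of _ "D \<inter> E"]) (auto simp: d_def)
qed

end

section \<open>Complement maps and their projections\<close>

lemma common_denominator:
 assumes "finite B" "\<And>b. b \<in> B \<Longrightarrow> r b \<in> (\<rat> :: real set)"
 shows "\<exists>d::int. d > 0 \<and> (\<forall>b\<in>B. of_int d * r b \<in> \<int>)"
 using assms
proof (induction B rule: finite_induct)
 case empty then show ?case by (auto intro: exI[of _ 1])
next
 case (insert x B)
 then obtain d :: int where d: "d > 0" "\<forall>b\<in>B. of_int d * r b \<in> \<int>" by auto
 have "r x \<in> \<rat>" using insert by auto
 then obtain a b where ab: "b > 0" "r x = of_int a / of_int b" by (elim Rats_cases') auto
 show ?case
 proof (intro exI[of _ "b * d"] conjI ballI)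
  show "b * d > 0" using ab d by simp
  fix y assume "y \<in> insert x B"
  then show "of_int (b * d) * r y \<in> \<int>" using ab Ints_of_int d Ints_mult[OF Ints_of_int] by (auto simp: mult.assoc)
 qed
qed

lemma lat_Q_iff:
 assumes B: "lattice_basis B N"
 shows "x \<in> lat_Q N \<longleftrightarrow> x \<in> span B \<and> (\<forall>b\<in>B. representation B x b \<in> \<rat>)"
proof
 note D = lattice_basisD[OF B]
 assume "x \<in> lat_Q N"
 then obtain q y where x: "x = of_rat q *\<^sub>R y" "y \<in> N" by (auto simp: lat_Q_def)
 have y: "y \<in> span B" "\<forall>b\<in>B. representation B y b \<in> \<int>" using lattice_mem_iff[OF B] x by auto
 have "representation B x b \<in> \<rat>" if "b \<in> B" for b
  using y(2) that subsetD[OF Ints_subset_Rats] unfolding x(1)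
  by (auto simp: linear_on_representation(3)[OF D(2) y(1) y(1)] intro!: Rats_mult)
 then show "x \<in> span B \<and> (\<forall>b\<in>B. representation B x b \<in> \<rat>)" using y x by (simp add: span_scale)
next
 note D = lattice_basisD[OF B]
 assume x: "x \<in> span B \<and> (\<forall>b\<in>B. representation B x b \<in> \<rat>)"
 obtain d :: int where d: "d > 0" "\<forall>b\<in>B. of_int d * representation B x b \<in> \<int>"
  using common_denominator[OF D(1), of "representation B x"] x by auto
 have "of_int d *\<^sub>R x \<in> N"
  using x d by (simp add: lattice_mem_iff[OF B] span_scale linear_on_representation(3)[OF D(2) conjunct1[OF x] conjunct1[OF x]])
 moreover have "x = of_rat (1 / of_int d) *\<^sub>R (of_int d *\<^sub>R x)" using d by (simp add: of_rat_divide)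
 ultimately show "x \<in> lat_Q N" unfolding lat_Q_def by blast
qed

lemma lat_Q_closed:
 assumes N: "is_lattice N"
 shows "N \<subseteq> lat_Q N" "lat_Q N \<subseteq> span N" "0 \<in> lat_Q N"
  "x \<in> lat_Q N \<Longrightarrow> y \<in> lat_Q N \<Longrightarrow> x + y \<in> lat_Q N" "x \<in> lat_Q N \<Longrightarrow> of_rat q *\<^sub>R x \<in> lat_Q N"
proof -
 obtain B where B: "lattice_basis B N" using N by (auto simp: is_lattice_def)
 note D = lattice_basisD[OF B] and I = lat_Q_iff[OF B]
 show "N \<subseteq> lat_Q N" by (auto simp: I lattice_mem_iff[OF B] intro!: subsetD[OF Ints_subset_Rats])
 show "lat_Q N \<subseteq> span N" using D by (auto simp: I)
 show "0 \<in> lat_Q N" by (simp add: I span_zero real_vector.representation_zero)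
 show "x \<in> lat_Q N \<Longrightarrow> y \<in> lat_Q N \<Longrightarrow> x + y \<in> lat_Q N"
  by (simp add: I span_add linear_on_representation[OF D(2)])
 show "x \<in> lat_Q N \<Longrightarrow> of_rat q *\<^sub>R x \<in> lat_Q N"
  by (simp add: I span_scale linear_on_representation(3)[OF D(2), of x x])
qed

lemma span_lat_Q: "is_lattice N \<Longrightarrow> span (lat_Q N) = span N"
 by (metis lat_Q_closed(1,2) span_mono span_span subset_antisym)

lemma rat_dual_sum:
 assumes "f \<in> rat_dual (lat_Q N)" "is_lattice N" "\<And>i. i \<in> I \<Longrightarrow> g i \<in> lat_Q N"
 shows "f (\<Sum>i\<in>I. of_rat (q i) *\<^sub>R g i) = (\<Sum>i\<in>I. q i * f (g i)) \<and> (\<Sum>i\<in>I. of_rat (q i) *\<^sub>R g i) \<in> lat_Q N"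
proof -
 note cl = lat_Q_closed[OF assms(2)]
 have f0: "f 0 = 0" using assms(1) cl(3) by (fastforce simp: rat_dual_def)
 show ?thesis using assms(3)
 proof (induction I rule: infinite_finite_induct)
  case (insert i I)
  have m: "of_rat (q i) *\<^sub>R g i \<in> lat_Q N" "(\<Sum>i\<in>I. of_rat (q i) *\<^sub>R g i) \<in> lat_Q N"
   using insert cl(5) by auto
  show ?case using assms(1) m insert.prems insert cl(4)[OF m] by (simp add: rat_dual_def)
 qed (auto simp: f0 cl(3))
qed

text \<open>The rational number behind a real coordinate of a rational point; the value 0 elsewhere
  is the convention of \<open>rat_dual\<close>.\<close>

definition crdq :: "'v::real_vector set \<Rightarrow> 'v set \<Rightarrow> 'v \<Rightarrow> 'v \<Rightarrow> rat"
 where "crdq N B b x = (if x \<in> lat_Q N then (THE q. of_rat q = representation B x b) else 0)"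

lemma of_rat_crdq:
 assumes B: "lattice_basis B N" and x: "x \<in> lat_Q N"
 shows "of_rat (crdq N B b x) = representation B x b"
proof -
 have "representation B x b \<in> \<rat>" using real_vector.representation_ne_zero[of B x b] lat_Q_iff[OF B] x by fastforce
 then obtain q where q: "representation B x b = of_rat q" by (elim Rats_cases) auto
 then show ?thesis using q x by (simp add: crdq_def)
qed

lemma crdq_in_rat_dual:
 assumes B: "lattice_basis B N"
 shows "crdq N B b \<in> rat_dual (lat_Q N)"
proof -
 note D = lattice_basisD[OF B]
 have N: "is_lattice N" using B by (auto simp: is_lattice_def)
 note cl = lat_Q_closed[OF N]
 have "crdq N B b (x + y) = crdq N B b x + crdq N B b y" if xy: "x \<in> lat_Q N" "y \<in> lat_Q N" for x y
 proof -
  have "(of_rat (crdq N B b (x + y)) :: real) = of_rat (crdq N B b x + crdq N B b y)"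
   using xy cl(4)[OF xy] lat_Q_iff[OF B] by (simp add: of_rat_crdq[OF B] of_rat_add linear_on_representation[OF D(2)])
  then show ?thesis by simp
 qed
 moreover have "crdq N B b (of_rat q *\<^sub>R x) = q * crdq N B b x" if x: "x \<in> lat_Q N" for x q
 proof -
  have xs: "x \<in> span B" using x lat_Q_iff[OF B] by simp
  have "(of_rat (crdq N B b (of_rat q *\<^sub>R x)) :: real) = of_rat (q * crdq N B b x)"
   using x cl(5)[OF x] by (simp add: of_rat_crdq[OF B] of_rat_mult linear_on_representation[OF D(2) xs xs])
  then show ?thesis by simp
 qed
 ultimately show ?thesis by (auto simp: rat_dual_def crdq_def)
qed

lemma lat_Q_expand:
 assumes B: "lattice_basis B N" and x: "x \<in> lat_Q N"
 shows "x = (\<Sum>b\<in>B. of_rat (crdq N B b x) *\<^sub>R b)"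
 using real_vector.sum_representation_eq[OF lattice_basisD(2)[OF B] _ lattice_basisD(1)[OF B] subset_refl] x lat_Q_iff[OF B]
 by (simp add: of_rat_crdq[OF B x])

lemma lat_Q_separation:
 assumes "is_lattice N" "x \<in> lat_Q N" "y \<in> lat_Q N" "\<And>f. f \<in> rat_dual (lat_Q N) \<Longrightarrow> f x = f y"
 shows "x = y"
proof -
 obtain B where B: "lattice_basis B N" using assms by (auto simp: is_lattice_def)
 show ?thesis using lat_Q_expand[OF B assms(2)] lat_Q_expand[OF B assms(3)] assms(4)[OF crdq_in_rat_dual[OF B]] by simp
qed

lemma rat_dual_expand:
 assumes B: "lattice_basis B N" and f: "f \<in> rat_dual (lat_Q N)"
 shows "f = (\<lambda>x. \<Sum>b\<in>B. f b * crdq N B b x)"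
proof
 have N: "is_lattice N" using B by (auto simp: is_lattice_def)
 fix x
 show "f x = (\<Sum>b\<in>B. f b * crdq N B b x)"
 proof (cases "x \<in> lat_Q N")
  case True
  have "f x = f (\<Sum>b\<in>B. of_rat (crdq N B b x) *\<^sub>R b)" using lat_Q_expand[OF B True] by simp
  also have "\<dots> = (\<Sum>b\<in>B. crdq N B b x * f b)"
   using rat_dual_sum[OF f N, of B "\<lambda>b. b" "\<lambda>b. crdq N B b x"] lattice_basisD(3)[OF B] lat_Q_closed(1)[OF N] by auto
  finally show ?thesis by (simp add: mult.commute)
 qed (use f in \<open>auto simp: crdq_def rat_dual_def\<close>)
qed

lemma rat_dual_0: "(\<lambda>x. 0) \<in> rat_dual L"
 by (simp add: rat_dual_def)

lemma rat_dual_add: "f \<in> rat_dual L \<Longrightarrow> g \<in> rat_dual L \<Longrightarrow> (\<lambda>x. f x + g x) \<in> rat_dual L"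
 by (simp add: rat_dual_def algebra_simps)

lemma rat_dual_mult: "f \<in> rat_dual L \<Longrightarrow> (\<lambda>x. q * f x) \<in> rat_dual L"
 by (simp add: rat_dual_def algebra_simps)

lemma rat_dual_lincomb: "(\<And>i. i \<in> I \<Longrightarrow> f i \<in> rat_dual L) \<Longrightarrow> (\<lambda>x. \<Sum>i\<in>I. q i * f i x) \<in> rat_dual L"
 by (induction I rule: infinite_finite_induct) (auto simp: rat_dual_0 rat_dual_add rat_dual_mult)

lemma complement_mapD:
 assumes "is_complement_map N Psi"
 shows "lat_Q N \<in> subspaces Psi" "L \<in> subspaces Psi \<Longrightarrow> L \<subseteq> lat_Q N"
  and "L1 \<in> subspaces Psi \<Longrightarrow> L2 \<in> subspaces Psi \<Longrightarrow> L1 \<subseteq> L2 \<Longrightarrow> f \<in> rat_dual L1 \<Longrightarrow> lift Psi L1 L2 f \<in> rat_dual L2"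
  and "L1 \<in> subspaces Psi \<Longrightarrow> L2 \<in> subspaces Psi \<Longrightarrow> L1 \<subseteq> L2 \<Longrightarrow> f \<in> rat_dual L1 \<Longrightarrow> x \<in> L1 \<Longrightarrow> lift Psi L1 L2 f x = f x"
  and "L1 \<in> subspaces Psi \<Longrightarrow> L2 \<in> subspaces Psi \<Longrightarrow> L1 \<subseteq> L2 \<Longrightarrow> f \<in> rat_dual L1 \<Longrightarrow> g \<in> rat_dual L1 \<Longrightarrow>
   lift Psi L1 L2 (\<lambda>x. f x + g x) = (\<lambda>x. lift Psi L1 L2 f x + lift Psi L1 L2 g x)"
  and "L1 \<in> subspaces Psi \<Longrightarrow> L2 \<in> subspaces Psi \<Longrightarrow> L1 \<subseteq> L2 \<Longrightarrow> f \<in> rat_dual L1 \<Longrightarrow>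
   lift Psi L1 L2 (\<lambda>x. q * f x) = (\<lambda>x. q * lift Psi L1 L2 f x)"
  and "L1 \<in> subspaces Psi \<Longrightarrow> L2 \<in> subspaces Psi \<Longrightarrow> L3 \<in> subspaces Psi \<Longrightarrow> L1 \<subseteq> L2 \<Longrightarrow> L2 \<subseteq> L3 \<Longrightarrow> f \<in> rat_dual L1 \<Longrightarrow>
   lift Psi L2 L3 (lift Psi L1 L2 f) = lift Psi L1 L3 f"
  and "L \<in> subspaces Psi \<Longrightarrow> rat_subspace L"
proof -
 note A = assms[unfolded is_complement_map_def]
 note A1 = conjunct1[OF A] and A2 = conjunct1[OF conjunct2[OF A]] and A3 = conjunct1[OF conjunct2[OF conjunct2[OF A]]]
  and A4 = conjunct2[OF conjunct2[OF conjunct2[OF A]]]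
 show "lat_Q N \<in> subspaces Psi" by (rule A1)
 show "L \<in> subspaces Psi \<Longrightarrow> L \<subseteq> lat_Q N" "L \<in> subspaces Psi \<Longrightarrow> rat_subspace L" using A2 by simp_all
 assume L: "L1 \<in> subspaces Psi" "L2 \<in> subspaces Psi" "L1 \<subseteq> L2" and f: "f \<in> rat_dual L1"
 note A3 = A3[THEN bspec, OF L(1), THEN bspec, OF L(2), THEN mp, OF L(3)]
 show "lift Psi L1 L2 f \<in> rat_dual L2" "x \<in> L1 \<Longrightarrow> lift Psi L1 L2 f x = f x"
  using conjunct1[OF A3] f by simp_all
 show "g \<in> rat_dual L1 \<Longrightarrow> lift Psi L1 L2 (\<lambda>x. f x + g x) = (\<lambda>x. lift Psi L1 L2 f x + lift Psi L1 L2 g x)"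
  using conjunct1[OF conjunct2[OF A3]] f by simp
 show "lift Psi L1 L2 (\<lambda>x. q * f x) = (\<lambda>x. q * lift Psi L1 L2 f x)"
  using conjunct2[OF conjunct2[OF A3]] f by simp
 assume L3: "L3 \<in> subspaces Psi" "L2 \<subseteq> L3"
 show "lift Psi L2 L3 (lift Psi L1 L2 f) = lift Psi L1 L3 f"
  by (rule A4[THEN bspec, OF L(1), THEN bspec, OF L(2), THEN bspec, OF L3(1), THEN mp, OF L(3), THEN mp, OF L3(2), THEN bspec, OF f])
qed

lemma lift_lincomb:
 assumes Psi: "is_complement_map N Psi" and L: "L1 \<in> subspaces Psi" "L2 \<in> subspaces Psi" "L1 \<subseteq> L2"
  and f: "\<And>i. i \<in> I \<Longrightarrow> f i \<in> rat_dual L1"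
 shows "lift Psi L1 L2 (\<lambda>x. \<Sum>i\<in>I. q i * f i x) = (\<lambda>x. \<Sum>i\<in>I. q i * lift Psi L1 L2 (f i) x)"
proof -
 note D = complement_mapD[OF Psi]
 have z: "lift Psi L1 L2 (\<lambda>x. 0) = (\<lambda>x. 0)"
  using D(6)[OF L rat_dual_0, of 0] by simp
 show ?thesis using f
 proof (induction I rule: infinite_finite_induct)
  case (insert i I)
  have "lift Psi L1 L2 (\<lambda>x. q i * f i x + (\<Sum>i\<in>I. q i * f i x)) = (\<lambda>x. lift Psi L1 L2 (\<lambda>x. q i * f i x) x + lift Psi L1 L2 (\<lambda>x. \<Sum>i\<in>I. q i * f i x) x)"
   using insert.prems by (intro D(5)[OF L] rat_dual_mult rat_dual_lincomb) auto
  then show ?case using insert D(6)[OF L, of "f i" "q i"] by simp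
 qed (simp_all add: z)
qed

text \<open>The transpose of the lift, written in bases: the coordinates of the image of
  \<open>x\<close> are the lifted coordinate functions of the sublattice, evaluated at
  \<open>x\<close>. It is needed because \<open>proj_R\<close> is a choice.\<close>

lemma proj_R_exists:
 assumes N: "is_lattice N" and Psi: "is_complement_map N Psi" and L: "lat_Q (sublat N sig) \<in> subspaces Psi"
 shows "\<exists>p. linear p \<and> (\<forall>x\<in>lat_Q N. p x \<in> lat_Q (sublat N sig) \<and>
   (\<forall>f\<in>rat_dual (lat_Q (sublat N sig)). f (p x) = lift Psi (lat_Q (sublat N sig)) (lat_Q N) f x))"
proof -
 note D = complement_mapD[OF Psi]
 let ?L = "lat_Q (sublat N sig)"
 have N': "is_lattice (sublat N sig)" by (rule is_lattice_sublat[OF N])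
 obtain B where B: "lattice_basis B N" using N by (auto simp: is_lattice_def)
 obtain B' where B': "lattice_basis B' (sublat N sig)" using N' by (auto simp: is_lattice_def)
 note LL = L D(1) D(2)[OF L]
 define g where "g b = lift Psi ?L (lat_Q N) (crdq (sublat N sig) B' b)" for b
 have g: "g b \<in> rat_dual (lat_Q N)" for b unfolding g_def by (intro D(3)[OF LL] crdq_in_rat_dual B')
 obtain p where p: "linear p" "\<And>b. b \<in> B \<Longrightarrow> p b = (\<Sum>b'\<in>B'. of_rat (g b' b) *\<^sub>R b')"
  using linear_independent_extend[OF lattice_basisD(2)[OF B], of "\<lambda>b. \<Sum>b'\<in>B'. of_rat (g b' b) *\<^sub>R b'"] by auto
 have px: "p x = (\<Sum>b'\<in>B'. of_rat (g b' x) *\<^sub>R b')" if x: "x \<in> lat_Q N" for x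
 proof -
  have "p x = p (\<Sum>b\<in>B. of_rat (crdq N B b x) *\<^sub>R b)" using lat_Q_expand[OF B x] by simp
  also have "\<dots> = (\<Sum>b\<in>B. of_rat (crdq N B b x) *\<^sub>R (\<Sum>b'\<in>B'. of_rat (g b' b) *\<^sub>R b'))"
   using p by (simp add: linear_sum[OF p(1)] linear_scale[OF p(1)])
  also have "\<dots> = (\<Sum>b'\<in>B'. (\<Sum>b\<in>B. of_rat (crdq N B b x) * of_rat (g b' b)) *\<^sub>R b')"
   by (simp add: scaleR_sum_right sum.swap[of _ B B'] scaleR_sum_left)
  also have "\<dots> = (\<Sum>b'\<in>B'. of_rat (g b' x) *\<^sub>R b')"
  proof (intro sum.cong refl arg_cong2[where f=scaleR])
   fix b'
   have "g b' x = (\<Sum>b\<in>B. g b' b * crdq N B b x)" using rat_dual_expand[OF B g[of b']] by metis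
   then show "(\<Sum>b\<in>B. of_rat (crdq N B b x) * of_rat (g b' b)) = of_rat (g b' x)"
    by (simp add: of_rat_sum of_rat_mult mult.commute)
  qed
  finally show ?thesis .
 qed
 show ?thesis
 proof (intro exI[of _ p] conjI ballI p(1))
  fix x assume x: "x \<in> lat_Q N"
  have B'L: "b' \<in> ?L" if "b' \<in> B'" for b' using that lattice_basisD(3)[OF B'] lat_Q_closed(1)[OF N'] by auto
  show "p x \<in> ?L" unfolding px[OF x]
   using rat_dual_sum[OF rat_dual_0 N', of B' "\<lambda>b. b" "\<lambda>b. g b x"] B'L by auto
  fix f assume f: "f \<in> rat_dual ?L"
  have "f (p x) = (\<Sum>b'\<in>B'. g b' x * f b')" unfolding px[OF x]
   using rat_dual_sum[OF f N', of B' "\<lambda>b. b" "\<lambda>b. g b x"] B'L by auto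
  moreover have "lift Psi ?L (lat_Q N) f = (\<lambda>x. \<Sum>b'\<in>B'. f b' * g b' x)"
   unfolding g_def by (subst rat_dual_expand[OF B' f], rule lift_lincomb[OF Psi LL crdq_in_rat_dual[OF B']])
  ultimately show "f (p x) = lift Psi ?L (lat_Q N) f x" by (simp add: mult.commute)
 qed
qed

lemma proj_R_spec:
 assumes N: "is_lattice N" and Psi: "is_complement_map N Psi" and L: "lat_Q (sublat N sig) \<in> subspaces Psi"
 shows "linear (proj_R N Psi sig)"
  and "x \<in> lat_Q N \<Longrightarrow> proj_R N Psi sig x \<in> lat_Q (sublat N sig)"
  and "x \<in> lat_Q N \<Longrightarrow> f \<in> rat_dual (lat_Q (sublat N sig)) \<Longrightarrow>
   f (proj_R N Psi sig x) = lift Psi (lat_Q (sublat N sig)) (lat_Q N) f x"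
proof -
 note S = someI_ex[OF proj_R_exists[OF assms], folded proj_R_def]
 note S2 = conjunct2[OF S]
 show "linear (proj_R N Psi sig)" by (rule conjunct1[OF S])
 show "x \<in> lat_Q N \<Longrightarrow> proj_R N Psi sig x \<in> lat_Q (sublat N sig)" using S2 by blast
 show "x \<in> lat_Q N \<Longrightarrow> f \<in> rat_dual (lat_Q (sublat N sig)) \<Longrightarrow>
   f (proj_R N Psi sig x) = lift Psi (lat_Q (sublat N sig)) (lat_Q N) f x" using S2 by blast
qed

lemma linear_eq_on_lat:
 assumes "is_lattice N" "linear p" "linear q" "\<And>x. x \<in> lat_Q N \<Longrightarrow> p x = q x" "x \<in> span N"
 shows "p x = q x"
 using linear_eq_on[OF assms(2,3), of x "lat_Q N"] assms by (simp add: span_lat_Q)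

lemma proj_R_range:
 assumes "is_lattice N" "is_complement_map N Psi" "lat_Q (sublat N sig) \<in> subspaces Psi" "x \<in> span N"
 shows "proj_R N Psi sig x \<in> span (sublat N sig)"
proof -
 note p = proj_R_spec[OF assms(1-3)]
 have "proj_R N Psi sig ` span (lat_Q N) = span (proj_R N Psi sig ` lat_Q N)"
  by (rule linear_span_image[OF p(1), symmetric])
 also have "\<dots> \<subseteq> span (lat_Q (sublat N sig))" using p(2) by (intro span_mono) auto
 also have "\<dots> = span (sublat N sig)" by (rule span_lat_Q[OF is_lattice_sublat[OF assms(1)]])
 finally show ?thesis using assms(1,4) by (auto simp: span_lat_Q)
qed

text \<open>Dual to the lift being a section of restriction, as rational functionals separate the
  points of \<open>lat_Q\<close>.\<close>

lemma proj_R_id: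
 assumes N: "is_lattice N" and Psi: "is_complement_map N Psi" and L: "lat_Q (sublat N sig) \<in> subspaces Psi"
  and x: "x \<in> span (sublat N sig)"
 shows "proj_R N Psi sig x = x"
proof (rule linear_eq_on_lat[OF is_lattice_sublat[OF N] _ linear_ident _ x])
 note D = complement_mapD[OF Psi] and p = proj_R_spec[OF N Psi L]
 show "linear (proj_R N Psi sig)" by (rule p(1))
 fix y assume y: "y \<in> lat_Q (sublat N sig)"
 then have yN: "y \<in> lat_Q N" using D(2)[OF L] by auto
 show "proj_R N Psi sig y = y"
  by (rule lat_Q_separation[OF is_lattice_sublat[OF N] p(2)[OF yN] y])
   (simp add: p(3)[OF yN] D(4)[OF L D(1) D(2)[OF L] _ y])
qed

lemma lift_on_larger:
 assumes Psi: "is_complement_map N Psi" and L: "L1 \<in> subspaces Psi" "L2 \<in> subspaces Psi" "L1 \<subseteq> L2"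
  and f: "f \<in> rat_dual L1" and x: "x \<in> L2"
 shows "lift Psi L1 (lat_Q N) f x = lift Psi L1 L2 f x"
proof -
 note D = complement_mapD[OF Psi]
 show ?thesis using D(7)[OF L(1,2) D(1) L(3) D(2)[OF L(2)] f] D(4)[OF L(2) D(1) D(2)[OF L(2)] D(3)[OF L f] x] by simp
qed

lemma sublat_mono: "tau \<subseteq> sig \<Longrightarrow> sublat N tau \<subseteq> sublat N sig"
 using span_mono[of tau sig] by (auto simp: sublat_def)

lemma lat_Q_mono: "N \<subseteq> N' \<Longrightarrow> lat_Q N \<subseteq> lat_Q N'"
 by (auto simp: lat_Q_def)

text \<open>Dual to the transitivity of the lifts.\<close>

lemma proj_R_trans:
 assumes N: "is_lattice N" and Psi: "is_complement_map N Psi"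
  and L: "lat_Q (sublat N sig) \<in> subspaces Psi" "lat_Q (sublat N tau) \<in> subspaces Psi" and sub: "tau \<subseteq> sig"
  and x: "x \<in> span N"
 shows "proj_R N Psi tau (proj_R N Psi sig x) = proj_R N Psi tau x"
proof -
 note D = complement_mapD[OF Psi] and p = proj_R_spec[OF N Psi L(1)] and q = proj_R_spec[OF N Psi L(2)]
 have LL: "lat_Q (sublat N tau) \<subseteq> lat_Q (sublat N sig)" by (intro lat_Q_mono sublat_mono sub)
 have "(proj_R N Psi tau \<circ> proj_R N Psi sig) x = proj_R N Psi tau x"
 proof (rule linear_eq_on_lat[OF N linear_compose[OF p(1) q(1)] q(1) _ x])
  fix y assume y: "y \<in> lat_Q N"
  have py: "proj_R N Psi sig y \<in> lat_Q (sublat N sig)" "proj_R N Psi sig y \<in> lat_Q N"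
   using p(2)[OF y] D(2)[OF L(1)] by auto
  have "proj_R N Psi tau (proj_R N Psi sig y) = proj_R N Psi tau y"
  proof (rule lat_Q_separation[OF is_lattice_sublat[OF N] q(2)[OF py(2)] q(2)[OF y]])
   fix f assume f: "f \<in> rat_dual (lat_Q (sublat N tau))"
   let ?Lt = "lat_Q (sublat N tau)" and ?Ls = "lat_Q (sublat N sig)"
   have "f (proj_R N Psi tau (proj_R N Psi sig y)) = lift Psi ?Lt (lat_Q N) f (proj_R N Psi sig y)" by (rule q(3)[OF py(2) f])
   also have "\<dots> = lift Psi ?Lt ?Ls f (proj_R N Psi sig y)" by (rule lift_on_larger[OF Psi L(2,1) LL f py(1)])
   also have "\<dots> = lift Psi ?Ls (lat_Q N) (lift Psi ?Lt ?Ls f) y" by (rule p(3)[OF y D(3)[OF L(2,1) LL f]])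
   also have "\<dots> = lift Psi ?Lt (lat_Q N) f y" using D(7)[OF L(2,1) D(1) LL D(2)[OF L(1)] f] by simp
   also have "\<dots> = f (proj_R N Psi tau y)" by (rule q(3)[OF y f, symmetric])
   finally show "f (proj_R N Psi tau (proj_R N Psi sig y)) = f (proj_R N Psi tau y)" .
  qed
  then show "(proj_R N Psi tau \<circ> proj_R N Psi sig) y = proj_R N Psi tau y" by simp
 qed
 then show ?thesis by simp
qed

lemma sublat_sublat: "tau \<subseteq> sig \<Longrightarrow> sublat (sublat N sig) tau = sublat N tau"
 using span_mono[of tau sig] by (auto simp: sublat_def)

lemma induced_map_simps: "subspaces (induced_map N Psi sig) = {L \<in> subspaces Psi. L \<subseteq> lat_Q (sublat N sig)}"
 "lift (induced_map N Psi sig) = lift Psi"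
 by (auto simp: induced_map_def)

lemma is_complement_map_induced:
 assumes Psi: "is_complement_map N Psi" and L: "lat_Q (sublat N sig) \<in> subspaces Psi"
 shows "is_complement_map (sublat N sig) (induced_map N Psi sig)"
proof -
 note D = complement_mapD[OF Psi]
 show ?thesis unfolding is_complement_map_def induced_map_simps mem_Collect_eq
  by (intro conjI ballI allI impI; (elim conjE CollectE)?; (rule D L subset_refl; (assumption | (elim CollectE conjE, assumption)) | simp add: L D))
qed

lemma induced_induced:
 "tau \<subseteq> sig \<Longrightarrow> induced_map (sublat N sig) (induced_map N Psi sig) tau = induced_map N Psi tau"
 using lat_Q_mono[OF sublat_mono[of tau sig N]]
 by (auto simp: induced_map_def sublat_sublat intro!: arg_cong[where f="\<lambda>S. Psi\<lparr>subspaces := S\<rparr>"])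

text \<open>The induced map has the same lifts, now into the smaller dual space, where by
  \<open>lift_on_larger\<close> they agree with the lifts into the full one.\<close>

lemma proj_R_induced:
 assumes N: "is_lattice N" and Psi: "is_complement_map N Psi"
  and L: "lat_Q (sublat N sig) \<in> subspaces Psi" "lat_Q (sublat N tau) \<in> subspaces Psi" and sub: "tau \<subseteq> sig"
  and x: "x \<in> span (sublat N sig)"
 shows "proj_R (sublat N sig) (induced_map N Psi sig) tau x = proj_R N Psi tau x"
proof -
 let ?N = "sublat N sig" and ?Psi = "induced_map N Psi sig" and ?Lt = "lat_Q (sublat N tau)"
 note D = complement_mapD[OF Psi]
 have LL: "?Lt \<subseteq> lat_Q ?N" by (intro lat_Q_mono sublat_mono sub)
 have N': "is_lattice ?N" by (rule is_lattice_sublat[OF N])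
 have Lt: "lat_Q (sublat ?N tau) \<in> subspaces ?Psi" using L(2) LL by (simp add: sublat_sublat[OF sub] induced_map_simps)
 note p = proj_R_spec[OF N' is_complement_map_induced[OF Psi L(1)] Lt, unfolded sublat_sublat[OF sub] induced_map_simps]
 note q = proj_R_spec[OF N Psi L(2)]
 show ?thesis
 proof (rule linear_eq_on_lat[OF N' p(1) q(1) _ x])
  fix y assume y: "y \<in> lat_Q ?N"
  then have yN: "y \<in> lat_Q N" using D(2)[OF L(1)] by auto
  show "proj_R ?N ?Psi tau y = proj_R N Psi tau y"
   by (rule lat_Q_separation[OF is_lattice_sublat[OF N] p(2)[OF y] q(2)[OF yN]])
    (simp add: p(3)[OF y] q(3)[OF yN] lift_on_larger[OF Psi L(2,1) LL _ y])
 qed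
qed

section \<open>Generic cones\<close>

lemma is_coneD:
 assumes "is_cone N sig"
 obtains G where "finite G" "G \<subseteq> N" "sig = fcone G"
 using assms unfolding is_cone_def by (auto simp: convex_cone_hull_eq_fcone)

lemma is_cone_basic:
 assumes "is_cone N sig"
 shows "convex sig" "0 \<in> sig" "sig \<subseteq> span N" "span (sublat N sig) = span sig"
  "x \<in> sig \<Longrightarrow> y \<in> sig \<Longrightarrow> x + y \<in> sig" "x \<in> sig \<Longrightarrow> 0 \<le> c \<Longrightarrow> c *\<^sub>R x \<in> sig"
proof -
 obtain G where G: "finite G" "G \<subseteq> N" "sig = fcone G" using is_coneD[OF assms] by blast
 show "convex sig" using convex_convex_cone_hull[of G] by (simp add: convex_cone_hull_eq_fcone G)
 show "0 \<in> sig" by (simp add: G fcone_0)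
 show "sig \<subseteq> span N" using fcone_span[of G] span_mono[OF G(2)] by (auto simp: G)
 have s: "span sig = span G" by (simp add: G span_fcone)
 show "span (sublat N sig) = span sig"
 proof
  show "span (sublat N sig) \<subseteq> span sig" by (intro span_minimal) (auto simp: sublat_def)
  have "G \<subseteq> sublat N sig" using G s span_superset[of G] by (auto simp: sublat_def)
  then show "span sig \<subseteq> span (sublat N sig)" unfolding s by (rule span_mono)
 qed
 show "x \<in> sig \<Longrightarrow> y \<in> sig \<Longrightarrow> x + y \<in> sig" "x \<in> sig \<Longrightarrow> 0 \<le> c \<Longrightarrow> c *\<^sub>R x \<in> sig"
  by (auto simp: G fcone_add fcone_scale)
qed

lemma generic_coneD:
 assumes "generic_cone N Psi sig"
 shows "is_cone N sig" "finite (cone_faces sig)" "sig \<in> cone_faces sig" "lat_Q (sublat N sig) \<in> subspaces Psi"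
  "tau \<in> cone_faces sig \<Longrightarrow> is_cone N tau" "tau \<in> cone_faces sig \<Longrightarrow> lat_Q (sublat N tau) \<in> subspaces Psi"
proof -
 show c: "is_cone N sig" using assms by (simp add: generic_cone_def)
 show s: "sig \<in> cone_faces sig" using is_cone_basic(1,2)[OF c] by (auto simp: cone_faces_def face_of_refl)
 show "finite (cone_faces sig)" "lat_Q (sublat N sig) \<in> subspaces Psi"
  "tau \<in> cone_faces sig \<Longrightarrow> is_cone N tau" "tau \<in> cone_faces sig \<Longrightarrow> lat_Q (sublat N tau) \<in> subspaces Psi"
  using assms s by (auto simp: generic_cone_def generic_fan_def is_fan_def)
qed

lemma cone_faces_subset: "tau \<in> cone_faces sig \<Longrightarrow> tau \<subseteq> sig"
 by (auto simp: cone_faces_def dest: face_of_imp_subset)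

lemma cone_faces_trans: "tau \<in> cone_faces sig \<Longrightarrow> cone_faces tau \<subseteq> cone_faces sig"
 by (auto simp: cone_faces_def intro: face_of_trans)

lemma generic_cone_face:
 assumes g: "generic_cone N Psi sig" and tau: "tau \<in> cone_faces sig"
 shows "generic_cone N Psi tau"
proof -
 note D = generic_coneD[OF g]
 have sub: "cone_faces tau \<subseteq> cone_faces sig" by (rule cone_faces_trans[OF tau])
 have "tau \<in> cone_faces tau" using is_cone_basic(1,2)[OF D(5)[OF tau]] by (auto simp: cone_faces_def face_of_refl)
 moreover note D(5)[OF tau]
 moreover have "is_fan N (cone_faces sig)" using g by (simp add: generic_cone_def generic_fan_def)
 ultimately have "is_fan N (cone_faces tau)"
  using sub finite_subset[OF sub D(2)] cone_faces_trans unfolding is_fan_def by blast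
 then show ?thesis using sub D(6) D(5)[OF tau] by (auto simp: generic_cone_def generic_fan_def)
qed

lemma is_cone_sublat:
 assumes "is_cone N tau" "tau \<subseteq> sig" shows "is_cone (sublat N sig) tau"
proof -
 obtain G where G: "finite G" "G \<subseteq> N" "tau = convex_cone hull G" using assms by (auto simp: is_cone_def)
 have "G \<subseteq> tau" by (simp add: G hull_subset)
 then show ?thesis using G(2) assms(2) span_superset[of sig] assms G by (auto simp: sublat_def is_cone_def)
qed

lemma generic_cone_induced:
 assumes g: "generic_cone N Psi tau" and sub: "tau \<subseteq> sig"
 shows "generic_cone (sublat N sig) (induced_map N Psi sig) tau"
proof -
 note D = generic_coneD[OF g]
 have s: "\<rho> \<subseteq> sig" if "\<rho> \<in> cone_faces tau" for \<rho> using cone_faces_subset[OF that] sub by auto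
 have "is_fan (sublat N sig) (cone_faces tau)" using g is_cone_sublat[OF _ s] by (simp add: generic_cone_def generic_fan_def is_fan_def)
 moreover have "lat_Q (sublat (sublat N sig) \<rho>) \<in> subspaces (induced_map N Psi sig)" if "\<rho> \<in> cone_faces tau" for \<rho>
  using D(6)[OF that] lat_Q_mono[OF sublat_mono[OF s[OF that]]] by (simp add: sublat_sublat[OF s[OF that]] induced_map_simps)
 ultimately show ?thesis using is_cone_sublat[OF D(1) sub] by (auto simp: generic_cone_def generic_fan_def)
qed

lemma full_dim_sublat:
 assumes "span sig = span N" shows "sublat N sig = N"
 using assms span_superset[of N] by (auto simp: sublat_def)

lemma full_dim_induced:
 assumes "is_complement_map N Psi" "span sig = span N" shows "induced_map N Psi sig = Psi"
proof -
 have "{L \<in> subspaces Psi. L \<subseteq> lat_Q N} = subspaces Psi" using complement_mapD(2)[OF assms(1)] by auto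
 then show ?thesis by (simp add: induced_map_def full_dim_sublat[OF assms(2)])
qed

lemma cproj_proj_C:
 assumes N: "is_lattice N" and Psi: "is_complement_map N Psi" and L: "lat_Q (sublat N sig) \<in> subspaces Psi"
 shows "cproj (proj_C N Psi sig) (lat_C N) (lat_C (sublat N sig))"
proof -
 note p = proj_R_spec(1)[OF assms] proj_R_range[OF assms] proj_R_id[OF assms]
 have "sublat N sig \<subseteq> N" by (auto simp: sublat_def)
 then have s: "span (sublat N sig) \<subseteq> span N" by (rule span_mono)
 show ?thesis using clin_map_prod[OF p(1)] s p(2) p(3) csub_lat_C by (auto simp: cproj_def proj_C_def lat_C_def intro!: conjI ballI)
qed

lemma cone_faces_dim:
 fixes N :: "'v::euclidean_space set"
 assumes g: "generic_cone N Psi sig" and tau: "tau \<in> cone_faces sig" "tau \<noteq> sig"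
 shows "dim tau < dim sig"
proof -
 note D = generic_coneD[OF g]
 have "aff_dim tau < aff_dim sig"
  using tau is_cone_basic(1)[OF D(1)] by (intro face_of_aff_dim_lt) (auto simp: cone_faces_def)
 moreover have "aff_dim tau = int (dim tau)" "aff_dim sig = int (dim sig)"
  using is_cone_basic(2)[OF D(1)] is_cone_basic(2)[OF D(5)[OF tau(1)]] by (auto intro!: aff_dim_zero hull_inc)
 ultimately show ?thesis by simp
qed

subsection \<open>Faces of the dual cone\<close>

lemma dual_generators:
 fixes N :: "'v::euclidean_space set"
 assumes N: "is_lattice N" and sig: "is_cone N sig"
 obtains J where "finite J" "J \<subseteq> dual_lat N" "0 \<notin> J" "dual_cone N sig = fcone J" "sig = {v\<in>span N. \<forall>h\<in>J. 0 \<le> h v}"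
proof -
 obtain G where G: "finite G" "G \<subseteq> N" "sig = fcone G" using is_coneD[OF sig] by blast
 have GN: "G \<subseteq> span N" using G span_superset[of N] by auto
 obtain J where J: "finite J" "J \<subseteq> dual_lat N" "{m\<in>real_dual (span N). \<forall>g\<in>G. 0 \<le> m g} = fcone J"
  using dual_finitely_generated[OF N G(1,2)] by blast
 have d: "dual_cone N sig = fcone (J - {0})"
  using J dual_cone_fcone[OF G(1) GN] by (simp add: G(3) fcone_minus_0)
 show ?thesis using cone_halfspaces[OF G(1) GN, of "J - {0}"] J(1) d that[of "J - {0}"] J by (auto simp: G(3))
qed

text \<open>A combination of generators of the dual cone that vanishes at \<open>y\<close> cannot
  involve a generator positive at \<open>y\<close>. Hence the part of the dual cone in
  \<open>perp N L\<close> is generated by the generators that lie there.\<close>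

lemma pointed_cone_dual:
 fixes N :: "'v::euclidean_space set"
 assumes N: "is_lattice N" and G: "finite G" "G \<subseteq> N" "sig = fcone G" "span sig = span N"
  and J: "finite J" "J \<subseteq> dual_lat N" "0 \<notin> J" "dual_cone N sig = fcone J"
  and L: "L \<subseteq> span N" and y: "y \<in> sig" "y \<in> span L" "\<And>h. h \<in> J \<Longrightarrow> h \<in> perp N L \<or> 0 < h y"
 shows "\<exists>U v0. pointed_cone N {h\<in>J. h \<in> perp N L} U v0 (dual_cone N sig \<inter> perp N L)"
proof -
 have GN: "G \<subseteq> span N" using G span_superset[of N] by auto
 have sG: "span G = span N" using G span_fcone[of G] by simp
 obtain BL where BL: "BL \<subseteq> L" "independent BL" "L \<subseteq> span BL" by (rule maximal_independent_subset)
 have finBL: "finite BL" using BL(2) independent_imp_finite by blast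
 \<comment> \<open>The generators of the cone give the inequalities of the dual, and a basis of
   \<open>L\<close> with both signs forces vanishing on \<open>L\<close>.\<close>
 define U where "U = G \<union> BL \<union> uminus ` BL"
 \<comment> \<open>An interior point: a nonnegative functional vanishing at the sum vanishes at all
   generators, which span the space.\<close>
 define v0 where "v0 = \<Sum>G"
 have Jd: "h \<in> real_dual (span N)" if "h \<in> J" for h using that J by (auto simp: dual_lat_def)
 have Jpos: "0 \<le> h v" if "h \<in> J" "v \<in> sig" for h v
  using that J(4) fcone_base[OF J(1)] by (auto simp: dual_cone_def)
 have zero_span: "m x = 0" if m: "m \<in> real_dual (span N)" "S \<subseteq> span N" "\<And>s. s \<in> S \<Longrightarrow> m s = 0" "x \<in> span S" for m S x
 proof -
  obtain l where l: "linear l" "\<And>x. x \<in> span N \<Longrightarrow> l x = m x" using real_dual_linear[OF m(1)] by blast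
  have "span S \<subseteq> span N" using m(2) by (simp add: span_minimal)
  then show ?thesis using linear_eq_0_on_span[OF l(1), of S x] m(2-4) l(2) by (metis subsetD)
 qed
 have "pointed_cone N {h\<in>J. h \<in> perp N L} U v0 (dual_cone N sig \<inter> perp N L)"
 proof
  show "is_lattice N" by fact
  show "finite {h\<in>J. h \<in> perp N L}" "{h\<in>J. h \<in> perp N L} \<subseteq> dual_lat N" using J by auto
  show "finite U" using G finBL by (simp add: U_def)
  show "U \<subseteq> span N" using GN BL(1) L by (auto simp: U_def span_neg)
  show "v0 \<in> span N" unfolding v0_def using GN by (intro span_sum) auto
  show "0 < h v0" if "h \<in> {h\<in>J. h \<in> perp N L}" for h
  proof -
   have h: "h \<in> J" using that by simp
   have s: "h v0 = (\<Sum>g\<in>G. h g)" unfolding v0_def using GN by (subst real_dual_sum[OF Jd[OF h]]) auto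
   have nn: "0 \<le> h g" if "g \<in> G" for g using Jpos[OF h] fcone_base[OF G(1) that] G(3) by simp
   have "h v0 \<noteq> 0"
   proof
    assume "h v0 = 0"
    then have "\<forall>g\<in>G. h g = 0" using s nn G(1) by (simp add: sum_nonneg_eq_0_iff)
    then have "h x = 0" for x
     using zero_span[OF Jd[OF h] GN, of x] sG real_dualD(3)[OF Jd[OF h]] by (cases "x \<in> span N") auto
    then have "h = 0" by (auto simp: zero_fun_def)
    then show False using h J(3) by simp
   qed
   moreover have "0 \<le> h v0" unfolding s by (intro sum_nonneg nn)
   ultimately show ?thesis by simp
  qed
  show "dual_cone N sig \<inter> perp N L = {m\<in>real_dual (span N). \<forall>u\<in>U. 0 \<le> m u}"
  proof (intro set_eqI iffI)
   fix m assume m: "m \<in> dual_cone N sig \<inter> perp N L"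
   then have md: "m \<in> real_dual (span N)" by (simp add: dual_cone_def)
   have "m (- b) = 0" if "b \<in> BL" for b
    using m that BL(1) L real_dualD(2)[OF md, of b "-1"] by (auto simp: perp_def subset_iff)
   then show "m \<in> {m\<in>real_dual (span N). \<forall>u\<in>U. 0 \<le> m u}"
    using m md BL(1) fcone_base[OF G(1)] by (auto simp: U_def dual_cone_def perp_def G(3))
  next
   fix m assume m: "m \<in> {m\<in>real_dual (span N). \<forall>u\<in>U. 0 \<le> m u}"
   then have md: "m \<in> real_dual (span N)" by simp
   have "m b = 0" if b: "b \<in> BL" for b
   proof -
    have bN: "b \<in> span N" using b BL(1) L by auto
    have "m (- b) = - m b" using real_dualD(2)[OF md bN, of "-1"] by simp
    moreover have "0 \<le> m b" "0 \<le> m (- b)" using m b by (auto simp: U_def)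
    ultimately show ?thesis by simp
   qed
   then have "m v = 0" if "v \<in> L" for v
    using zero_span[OF md, of BL v] that BL(1,3) L by auto
   moreover have "m \<in> dual_cone N sig" using m md unfolding G(3) dual_cone_fcone[OF G(1) GN] by (auto simp: U_def)
   ultimately show "m \<in> dual_cone N sig \<inter> perp N L" using md by (auto simp: perp_def)
  qed
  show "dual_cone N sig \<inter> perp N L = fcone {h\<in>J. h \<in> perp N L}"
  proof
   show "fcone {h\<in>J. h \<in> perp N L} \<subseteq> dual_cone N sig \<inter> perp N L"
   proof -
    have "fcone {h\<in>J. h \<in> perp N L} \<subseteq> fcone J" using J(1) by (intro fcone_subset fcone_base) auto
    moreover have "subspace (perp N L)"
     using subspace_real_dual[of "span N"] by (auto simp: perp_def subspace_def zero_fun_def plus_fun_def)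
    then have "span {h\<in>J. h \<in> perp N L} \<subseteq> perp N L" by (intro span_minimal) auto
    ultimately show ?thesis using fcone_span[of "{h\<in>J. h \<in> perp N L}"] J(4) by auto
   qed
   show "dual_cone N sig \<inter> perp N L \<subseteq> fcone {h\<in>J. h \<in> perp N L}"
   proof
    fix m assume m: "m \<in> dual_cone N sig \<inter> perp N L"
    then obtain c where c: "\<forall>h\<in>J. 0 \<le> c h" "m = (\<Sum>h\<in>J. c h *\<^sub>R h)" using J(4) by (auto simp: fcone_def)
    have "m y = 0" using m zero_span[of m L y] L y(2) by (auto simp: perp_def)
    then have "(\<Sum>h\<in>J. c h * h y) = 0" by (simp add: c(2) sum_fun_apply)
    then have z: "\<forall>h\<in>J. c h * h y = 0" using c Jpos[OF _ y(1)] J(1) by (subst (asm) sum_nonneg_eq_0_iff) auto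
    have c0: "c h = 0" if "h \<in> J" "h \<notin> perp N L" for h using z y(3)[OF that(1)] that by auto
    have "m = (\<Sum>h\<in>{h\<in>J. h \<in> perp N L}. c h *\<^sub>R h)" unfolding c(2)
     using J(1) c0 by (intro sum.mono_neutral_right) auto
    then show "m \<in> fcone {h\<in>J. h \<in> perp N L}" using c(1) by (auto simp: fcone_def)
   qed
  qed
 qed
 then show ?thesis by blast
qed

text \<open>The sum of the generators of \<open>tau\<close> is a relative interior point: a
  functional that is nonnegative on \<open>tau\<close> and vanishes there vanishes on all of
  \<open>tau\<close>.\<close>

lemma face_interior_point:
 fixes N :: "'v::euclidean_space set"
 assumes N: "is_lattice N" and sig: "is_cone N sig" and tau: "tau \<in> cone_faces sig" "is_cone N tau"
  and J: "finite J" "J \<subseteq> dual_lat N" "dual_cone N sig = fcone J"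
 obtains y where "y \<in> tau" "\<And>h. h \<in> J \<Longrightarrow> h \<in> perp N tau \<or> 0 < h y"
proof -
 obtain G where G: "finite G" "G \<subseteq> N" "tau = fcone G" using is_coneD[OF tau(2)] by blast
 have GN: "G \<subseteq> span N" using G span_superset[of N] by auto
 show ?thesis
 proof (rule that[of "\<Sum>G"])
  show "\<Sum>G \<in> tau" unfolding G(3) using fcone_base[OF G(1)] by (intro fcone_sum)
  fix h assume h: "h \<in> J"
  have hd: "h \<in> real_dual (span N)" using h J by (auto simp: dual_lat_def)
  have nn: "0 \<le> h g" if "g \<in> G" for g using fcone_base[OF G(1) that] cone_faces_subset[OF tau(1)] G(3) h J fcone_base[OF J(1)] by (auto simp: dual_cone_def)
  have s: "h (\<Sum>G) = (\<Sum>g\<in>G. h g)" using GN by (subst real_dual_sum[OF hd]) auto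
  show "h \<in> perp N tau \<or> 0 < h (\<Sum>G)"
  proof (cases "\<forall>g\<in>G. h g = 0")
   case True
   have "h v = 0" if v: "v \<in> tau" for v using v GN True by (auto simp: G(3) fcone_def real_dual_sum[OF hd] span_scale real_dualD(2)[OF hd] subset_iff intro!: sum.cong)
   then show ?thesis using hd by (simp add: perp_def)
  next
   case False
   then show ?thesis using nn G(1) by (smt (verit) s sum_nonneg_eq_0_iff sum_nonneg nn)
  qed
 qed
qed

lemma pointed_cone_face:
 fixes N :: "'v::euclidean_space set"
 assumes N: "is_lattice N" and g: "generic_cone N Psi sig" and full: "span sig = span N" and tau: "tau \<in> cone_faces sig"
  and J: "finite J" "J \<subseteq> dual_lat N" "0 \<notin> J" "dual_cone N sig = fcone J"
 shows "\<exists>U v0. pointed_cone N {h\<in>J. h \<in> perp N tau} U v0 (dual_cone N sig \<inter> perp N tau)"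
proof -
 note D = generic_coneD[OF g]
 obtain G where G: "finite G" "G \<subseteq> N" "sig = fcone G" using is_coneD[OF D(1)] by blast
 obtain y where y: "y \<in> tau" "\<And>h. h \<in> J \<Longrightarrow> h \<in> perp N tau \<or> 0 < h y"
  using face_interior_point[OF N D(1) tau D(5)[OF tau] J(1,2,4)] by blast
 show ?thesis
  using pointed_cone_dual[OF N G full J is_cone_basic(3)[OF D(5)[OF tau]], of y] y cone_faces_subset[OF tau] span_base[of y tau] by auto
qed

text \<open>The case of empty \<open>L\<close>, for which \<open>perp N L\<close> is the whole dual
  space and \<open>y = 0\<close> is admissible.\<close>

lemma pointed_cone_full:
 fixes N :: "'v::euclidean_space set"
 assumes N: "is_lattice N" and g: "generic_cone N Psi sig" and full: "span sig = span N"
  and J: "finite J" "J \<subseteq> dual_lat N" "0 \<notin> J" "dual_cone N sig = fcone J"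
 shows "\<exists>U v0. pointed_cone N J U v0 (dual_cone N sig)"
proof -
 note D = generic_coneD[OF g]
 obtain G where G: "finite G" "G \<subseteq> N" "sig = fcone G" using is_coneD[OF D(1)] by blast
 have "h \<in> perp N {}" if "h \<in> J" for h using that J by (auto simp: perp_def dual_lat_def)
 then have "{h\<in>J. h \<in> perp N {}} = J" by auto
 moreover have "dual_cone N sig \<inter> perp N {} = dual_cone N sig" by (auto simp: perp_def dual_cone_def)
 ultimately show ?thesis
  using pointed_cone_dual[OF N G full J, of "{}" 0] is_cone_basic(2)[OF D(1)] \<open>\<And>h. h \<in> J \<Longrightarrow> h \<in> perp N {}\<close> by auto
qed

section \<open>Existence of the SI-interpolator\<close>

text \<open>The interpolation identity solved for the term of \<open>sig\<close> itself, whose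
  integral is taken over a single point and equals 1; hereditary transport is built in. The
  restriction on dimensions makes the recursion terminate and selects the proper faces of a generic
  cone.\<close>

function SI_rec :: "'v::euclidean_space set \<Rightarrow> 'v complement_map \<Rightarrow> 'v set \<Rightarrow> 'v \<times> 'v \<Rightarrow> complex" where
 "SI_rec N Psi sig xi =
  exp_sum (sublat N sig) (dual_cone (sublat N sig) sig) (proj_C N Psi sig xi) -
  (\<Sum>tau\<in>{tau\<in>cone_faces sig. dim tau < dim sig}.
   SI_rec (sublat N sig) (induced_map N Psi sig) tau (proj_C N Psi sig xi) *
   exp_integral (sublat N sig) (dual_cone (sublat N sig) sig \<inter> perp (sublat N sig) tau) (proj_C N Psi sig xi))"
 by pat_completeness auto
termination
 by (relation "Wellfounded.measure (\<lambda>(N, Psi, sig, xi). dim sig)") auto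

declare SI_rec.simps [simp del]

lemma proper_faces:
 fixes N :: "'v::euclidean_space set"
 assumes "generic_cone N Psi sig"
 shows "{tau\<in>cone_faces sig. dim tau < dim sig} = cone_faces sig - {sig}"
 using cone_faces_dim[OF assms] by auto

lemma generic_cone_full:
 fixes N :: "'v::euclidean_space set"
 assumes g: "generic_cone N Psi sig"
 shows "generic_cone (sublat N sig) (induced_map N Psi sig) sig" "span sig = span (sublat N sig)"
 using generic_cone_induced[OF g subset_refl] is_cone_basic(4)[OF generic_coneD(1)[OF g]] by auto

lemma proj_C_id:
 assumes "is_lattice N" "is_complement_map N Psi" "lat_Q (sublat N sig) \<in> subspaces Psi" "xi \<in> lat_C (sublat N sig)"
 shows "proj_C N Psi sig xi = xi"
 using cproj_proj_C[OF assms(1-3)] assms(4) unfolding cproj_def by blast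

lemma proj_C_mem:
 assumes "is_lattice N" "is_complement_map N Psi" "lat_Q (sublat N sig) \<in> subspaces Psi" "xi \<in> lat_C N"
 shows "proj_C N Psi sig xi \<in> lat_C (sublat N sig)"
 using cproj_proj_C[OF assms(1-3)] assms(4) unfolding cproj_def by blast

lemma SI_rec_full:
 fixes N :: "'v::euclidean_space set"
 assumes N: "is_lattice N" and Psi: "is_complement_map N Psi" and g: "generic_cone N Psi sig"
  and full: "span sig = span N" and xi: "xi \<in> lat_C N"
 shows "SI_rec N Psi sig xi = exp_sum N (dual_cone N sig) xi -
  (\<Sum>tau\<in>cone_faces sig - {sig}. SI_rec N Psi tau xi * exp_integral N (dual_cone N sig \<inter> perp N tau) xi)"
proof -
 have s: "sublat N sig = N" by (rule full_dim_sublat[OF full])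
 have p: "proj_C N Psi sig xi = xi" using proj_C_id[OF N Psi generic_coneD(4)[OF g]] xi s by simp
 show ?thesis by (subst SI_rec.simps) (simp only: s p full_dim_induced[OF Psi full] proper_faces[OF g])
qed

lemma SI_rec_hereditary:
 fixes N :: "'v::euclidean_space set"
 assumes N: "is_lattice N" and Psi: "is_complement_map N Psi" and g: "generic_cone N Psi sig" and xi: "xi \<in> lat_C N"
 shows "SI_rec N Psi sig xi = SI_rec (sublat N sig) (induced_map N Psi sig) sig (proj_C N Psi sig xi)"
proof -
 note L = generic_coneD(4)[OF g] and f = generic_cone_full[OF g]
 show ?thesis
  by (subst SI_rec.simps, subst SI_rec_full[OF is_lattice_sublat[OF N] is_complement_map_induced[OF Psi L] f proj_C_mem[OF N Psi L xi]])
   (simp only: proper_faces[OF g])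
qed

lemma mero_SI_rec:
 fixes N :: "'v::euclidean_space set"
 assumes "is_lattice N" "is_complement_map N Psi" "generic_cone N Psi sig"
 shows "mero_on (lat_C N) (SI_rec N Psi sig)"
 using assms
proof (induction "dim sig" arbitrary: N Psi sig rule: less_induct)
 case less
 note N = less.prems(1) and Psi = less.prems(2) and g = less.prems(3)
 let ?N = "sublat N sig" and ?Psi = "induced_map N Psi sig"
 note L = generic_coneD(4)[OF g] and f = generic_cone_full[OF g]
 note N' = is_lattice_sublat[OF N] and Psi' = is_complement_map_induced[OF Psi L]
 obtain J where J: "finite J" "J \<subseteq> dual_lat ?N" "0 \<notin> J" "dual_cone ?N sig = fcone J"
  using dual_generators[OF N' generic_coneD(1)[OF f(1)]] by metis
 have 1: "mero_on (lat_C ?N) (exp_sum ?N (dual_cone ?N sig))"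
  using pointed_cone_full[OF N' f J] pointed_cone.mero_exp_sum by blast
 have 2: "mero_on (lat_C ?N) (exp_integral ?N (dual_cone ?N sig \<inter> perp ?N tau))" if "tau \<in> cone_faces sig" for tau
  using pointed_cone_face[OF N' f that J] pointed_cone.mero_exp_integral by blast
 have 3: "mero_on (lat_C ?N) (SI_rec ?N ?Psi tau)" if "tau \<in> cone_faces sig" "dim tau < dim sig" for tau
  by (rule less.hyps[OF that(2) N' Psi' generic_cone_face[OF f(1) that(1)]])
 have "mero_on (lat_C ?N) (\<lambda>eta. exp_sum ?N (dual_cone ?N sig) eta -
  (\<Sum>tau\<in>{tau\<in>cone_faces sig. dim tau < dim sig}. SI_rec ?N ?Psi tau eta * exp_integral ?N (dual_cone ?N sig \<inter> perp ?N tau) eta))"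
  using 1 2 3 by (intro mero_on_diff mero_on_sum mero_on_mult) auto
 from mero_on_compose_projection[OF cproj_proj_C[OF N Psi L] this]
 show ?case by (rule mero_on_cong) (simp only: SI_rec.simps[of N Psi sig])
qed

text \<open>A full-dimensional cone has only 0 in its annihilator. For the cone \<open>{0}\<close>
  the empty set of generators already clears denominators, and the numerator is the single
  exponential at 0.\<close>

lemma exp_integral_apex:
 fixes N :: "'v::euclidean_space set"
 assumes N: "is_lattice N" and g: "generic_cone N Psi sig" and full: "span sig = span N"
 shows "\<exists>D. dens (lat_C N) D \<and> (\<forall>xi\<in>D. exp_integral N (dual_cone N sig \<inter> perp N sig) xi = 1)"
proof -
 note D = generic_coneD[OF g]
 obtain J where J: "finite J" "J \<subseteq> dual_lat N" "0 \<notin> J" "dual_cone N sig = fcone J"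
  using dual_generators[OF N D(1)] by metis
 have z: "m = 0" if m: "m \<in> perp N sig" for m
 proof
  fix x
  have md: "m \<in> real_dual (span N)" using m by (simp add: perp_def)
  obtain l where l: "linear l" "\<And>x. x \<in> span N \<Longrightarrow> l x = m x" using real_dual_linear[OF md] by blast
  have "l v = 0" if "v \<in> sig" for v
   using that m l(2)[OF subsetD[OF is_cone_basic(3)[OF D(1)] that]] by (simp add: perp_def)
  then have "l x = 0" if "x \<in> span N" using linear_eq_0_on_span[OF l(1), of sig x] that by (simp add: full)
  then show "m x = 0 x" using l(2) real_dualD(3)[OF md] by (cases "x \<in> span N") auto
 qed
 then have e: "{h\<in>J. h \<in> perp N sig} = {}" using J(3) by auto
 have P0: "dual_cone N sig \<inter> perp N sig = {0}" using z by (auto simp: J(4) fcone_0 perp_def subspace_0[OF subspace_real_dual])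
 obtain U v0 where "pointed_cone N {} U v0 {0}"
  using pointed_cone_face[OF N g full D(3) J] unfolding e P0 by blast
 then interpret P: pointed_cone N "{}" U v0 "{0}" .
 have s: "P.supp {} = {0}" using is_lattice_closed(1)[OF is_lattice_dual_lat[OF N]] by (auto simp: P.supp_def cind_def)
 have "P.tay {} 0 xi = 1" for xi by (simp add: P.tay_def s cind_def)
 then show ?thesis using P.exp_integral_char[of "{}"] unfolding P0 by simp
qed

theorem SI_interpolator_exists: "is_SI_interpolator SI_rec"
 unfolding is_SI_interpolator_def
proof (intro allI impI conjI; elim conjE)
 fix N :: "'v::euclidean_space set" and Psi and sig :: "'v set"
 assume N: "is_lattice N" and Psi: "is_complement_map N Psi" and g: "generic_cone N Psi sig"
 note D = generic_coneD[OF g]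
 show "mero_on (lat_C N) (SI_rec N Psi sig)" by (rule mero_SI_rec[OF N Psi g])
 show "mero_eq (lat_C N) (SI_rec N Psi sig)
    (\<lambda>xi. SI_rec (sublat N sig) (induced_map N Psi sig) sig (proj_C N Psi sig xi))"
  by (rule mero_eq_refl) (rule SI_rec_hereditary[OF N Psi g])
 assume full: "span sig = span N"
 obtain D where D': "dens (lat_C N) D" "\<forall>xi\<in>D. exp_integral N (dual_cone N sig \<inter> perp N sig) xi = 1"
  using exp_integral_apex[OF N g full] by blast
 show "mero_eq (lat_C N) (exp_sum N (dual_cone N sig))
   (\<lambda>xi. \<Sum>tau\<in>cone_faces sig. SI_rec N Psi tau xi * exp_integral N (dual_cone N sig \<inter> perp N tau) xi)"
  unfolding mero_eq_dens
 proof (intro exI[of _ D] conjI D'(1) ballI)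
  fix xi assume xi: "xi \<in> D"
  then have "xi \<in> lat_C N" using dens_subset[OF D'(1)] by blast
  from SI_rec_full[OF N Psi g full this]
  show "exp_sum N (dual_cone N sig) xi = (\<Sum>tau\<in>cone_faces sig. SI_rec N Psi tau xi * exp_integral N (dual_cone N sig \<inter> perp N tau) xi)"
   using D'(2) xi by (simp add: sum.remove[OF D(2,3)])
 qed
qed

lemma is_SI_interpolator_SI_interpolator: "is_SI_interpolator SI_interpolator"
 unfolding SI_interpolator_def by (rule someI[of is_SI_interpolator, OF SI_interpolator_exists])

lemma SI_interpolatorD:
 fixes N :: "'v::euclidean_space set"
 assumes "is_lattice N" "is_complement_map N Psi" "generic_cone N Psi sig"
 shows "mero_on (lat_C N) (SI_interpolator N Psi sig)"
  "span sig = span N \<Longrightarrow> mero_eq (lat_C N) (exp_sum N (dual_cone N sig))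
   (\<lambda>xi. \<Sum>tau\<in>cone_faces sig. SI_interpolator N Psi tau xi * exp_integral N (dual_cone N sig \<inter> perp N tau) xi)"
  "mero_eq (lat_C N) (SI_interpolator N Psi sig)
   (\<lambda>xi. SI_interpolator (sublat N sig) (induced_map N Psi sig) sig (proj_C N Psi sig xi))"
 using is_SI_interpolator_SI_interpolator assms unfolding is_SI_interpolator_def by blast+

section \<open>Valuations on cones\<close>

lemma eventually_pos_line: "(0::real) < a \<Longrightarrow> \<forall>\<^sub>F e in at_right 0. 0 < a + e * b"
proof -
 assume a: "0 < a"
 have "((\<lambda>e. a + e * b) \<longlongrightarrow> a + 0 * b) (at_right 0)" by (intro tendsto_intros)
 then show ?thesis using a order_tendstoD(1)[of "\<lambda>e. a + e * b" a "at_right 0" 0] by simp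
qed

lemma eventually_ne_line:
 assumes "a \<noteq> 0 \<or> b \<noteq> (0::real)"
 shows "\<forall>\<^sub>F e in at_right 0. a + e * b \<noteq> 0"
proof (cases "a = 0")
 case True
 then show ?thesis using assms eventually_at_right_less[of "0::real"] by (auto elim!: eventually_mono)
next
 case False
 have "((\<lambda>e. a + e * b) \<longlongrightarrow> a + 0 * b) (at_right 0)" by (intro tendsto_intros)
 then show ?thesis using False tendsto_imp_eventually_ne[of "\<lambda>e. a + e * b" a "at_right 0" 0] by simp
qed

lemma linear_line: "linear l \<Longrightarrow> l (y + e *\<^sub>R v) = l y + e * (l v :: real)"
 by (simp add: linear_add linear_scale)

text \<open>A small step in the direction \<open>u\<close> preserves finitely many conditions of
  being nonzero and gains the new one.\<close>

lemma generic_direction: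
 fixes Hs :: "('v::real_vector \<Rightarrow> real) set"
 assumes "finite Hs" "\<And>h. h \<in> Hs \<Longrightarrow> linear h \<and> (\<exists>w\<in>V. h w \<noteq> 0)" "subspace V"
 shows "\<exists>w\<in>V. \<forall>h\<in>Hs. h w \<noteq> 0"
 using assms(1,2)
proof (induction Hs rule: finite_induct)
 case empty then show ?case using subspace_0[OF assms(3)] by auto
next
 case (insert h Hs)
 then obtain w where w: "w \<in> V" "\<forall>h\<in>Hs. h w \<noteq> 0" by auto
 obtain u where u: "u \<in> V" "h u \<noteq> 0" using insert.prems by auto
 have "\<forall>\<^sub>F e in at_right 0. \<forall>k\<in>insert h Hs. k w + e * k u \<noteq> 0"
  using insert.hyps(1) w(2) u(2) by (subst eventually_ball_finite_distrib) (auto intro!: eventually_ne_line)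
 then obtain e where "\<forall>k\<in>insert h Hs. k w + e * k u \<noteq> 0"
  using eventually_happens'[OF trivial_limit_at_right_real] by blast
 then show ?case using insert.prems subspace_add[OF assms(3) w(1) subspace_scale[OF assms(3) u(1)]] by (metis linear_line)
qed

text \<open>A linear relation between the indicator functions of the sets \<open>C i\<close> on
  \<open>W\<close>, required only off finitely many proper hyperplanes of \<open>W\<close>. Cones
  that overlap in boundaries thus count as disjoint.\<close>

definition generic_relation :: "'i set \<Rightarrow> ('i \<Rightarrow> 'v::real_vector set) \<Rightarrow> 'v set \<Rightarrow> ('i \<Rightarrow> complex) \<Rightarrow> bool"
 where "generic_relation I C W c \<longleftrightarrow> (\<exists>Hs. finite Hs \<and> (\<forall>h\<in>Hs. linear h \<and> (\<exists>w\<in>W. h w \<noteq> (0::real))) \<and>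
  (\<forall>v\<in>W. (\<forall>h\<in>Hs. h v \<noteq> 0) \<longrightarrow> (\<Sum>i\<in>{i\<in>I. v \<in> C i}. c i) = 0))"

text \<open>If 0 were outside the convex hull of \<open>T\<close>, a separating direction would make
  all functionals positive. So some convex combination vanishes, and solving it for a functional
  with positive coefficient gives the claim.\<close>

lemma gordan:
 fixes N :: "'v::euclidean_space set"
 assumes T: "finite T" "T \<subseteq> real_dual (span N)" and ne: "\<not> (\<exists>v\<in>span N. \<forall>h\<in>T. 0 < h v)"
 shows "\<exists>h\<in>T. - h \<in> fcone T"
proof -
 obtain p :: "'v \<Rightarrow> 'v" where p: "linear p" "\<And>x. p x \<in> span N" "\<And>x. x \<in> span N \<Longrightarrow> p x = x"
  using real_retraction[OF subspace_span] by blast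
 \<comment> \<open>Functionals are represented by vectors, because separation of convex sets is
   applied in the Euclidean ambient space.\<close>
 have "\<exists>u. \<forall>x. h (p x) = u \<bullet> x" if hT: "h \<in> T" for h
 proof -
  obtain l where l: "linear l" "\<And>x. x \<in> span N \<Longrightarrow> l x = h x" using real_dual_linear[OF subsetD[OF T(2) hT]] by blast
  have "l (p x) = (\<Sum>b\<in>Basis. l (p b) *\<^sub>R b) \<bullet> x" for x
  proof -
   have "l (p x) = l (p (\<Sum>b\<in>Basis. (x \<bullet> b) *\<^sub>R b))" by (simp add: euclidean_representation)
   also have "\<dots> = (\<Sum>b\<in>Basis. (x \<bullet> b) * l (p b))" using p(1) l(1) by (simp add: linear_sum linear_scale)
   also have "\<dots> = (\<Sum>b\<in>Basis. l (p b) *\<^sub>R b) \<bullet> x"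
    unfolding inner_sum_left by (intro sum.cong refl) (simp add: inner_commute)
   finally show ?thesis .
  qed
  then show ?thesis using l(2) p(2) by metis
 qed
 then obtain u where u: "\<And>h x. h \<in> T \<Longrightarrow> h (p x) = u h \<bullet> x" by metis
 have "0 \<in> convex hull (u ` T)"
 proof (rule ccontr)
  assume n: "0 \<notin> convex hull (u ` T)"
  have "closed (convex hull (u ` T))" using T(1) by (intro compact_imp_closed compact_convex_hull finite_imp_compact) auto
  then obtain a b where ab: "0 < b" "\<And>x. x \<in> convex hull (u ` T) \<Longrightarrow> a \<bullet> x > b"
   using separating_hyperplane_closed_0[of "convex hull (u ` T)"] n by auto
  have "0 < h (p a)" if "h \<in> T" for h
   using ab(1) ab(2)[OF hull_inc, of "u h"] that by (simp add: u inner_commute)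
  then show False using ne p(2) by blast
 qed
 then obtain c where c: "\<forall>x\<in>u ` T. 0 \<le> c x" "sum c (u ` T) = 1" "(\<Sum>x\<in>u ` T. c x *\<^sub>R x) = 0"
  using T(1) by (auto simp: convex_hull_finite)
 \<comment> \<open>The functionals vanish outside \<open>span N\<close>, so the vectors
   \<open>u h\<close> determine them.\<close>
 have inj: "inj_on u T"
 proof (rule inj_onI)
  fix h k assume hk: "h \<in> T" "k \<in> T" "u h = u k"
  have "h x = k x" for x using u[OF hk(1), of x] u[OF hk(2), of x] hk(3) p(3) T(2) hk real_dualD(3) subsetD by metis
  then show "h = k" by auto
 qed
 define d where "d h = c (u h)" for h
 have d: "\<forall>h\<in>T. 0 \<le> d h" "sum d T = 1" "(\<Sum>h\<in>T. d h *\<^sub>R u h) = 0"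
  using c by (auto simp: d_def sum.reindex[OF inj])
 have z: "(\<Sum>h\<in>T. d h *\<^sub>R h) = 0"
 proof
  fix x
  show "(\<Sum>h\<in>T. d h *\<^sub>R h) x = 0 x"
  proof (cases "x \<in> span N")
   case True
   have "(\<Sum>h\<in>T. d h * h x) = (\<Sum>h\<in>T. d h *\<^sub>R u h) \<bullet> x"
    using u[of _ x] p(3)[OF True] by (auto simp: inner_sum_left intro!: sum.cong)
   then show ?thesis using d by (simp add: sum_fun_apply)
  next
   case False
   then have "\<forall>h\<in>T. d h * h x = 0" using T(2) real_dualD(3) by (metis subsetD mult_zero_right)
   then show ?thesis by (simp add: sum_fun_apply sum.neutral)
  qed
 qed
 have "\<exists>h\<in>T. d h \<noteq> 0" using d(2) by (metis sum.neutral zero_neq_one)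
 then obtain h where h: "h \<in> T" "0 < d h" using d(1) by force
 have "(\<Sum>k\<in>T - {h}. (d k / d h) *\<^sub>R k) = (1 / d h) *\<^sub>R (\<Sum>k\<in>T - {h}. d k *\<^sub>R k)"
  by (simp add: scaleR_sum_right)
 also have "(\<Sum>k\<in>T - {h}. d k *\<^sub>R k) = - (d h *\<^sub>R h)"
  using z sum.remove[OF T(1) h(1), of "\<lambda>k. d k *\<^sub>R k"] by (simp add: eq_neg_iff_add_eq_0 add.commute)
 also have "(1 / d h) *\<^sub>R - (d h *\<^sub>R h) = - ((1 / d h * d h) *\<^sub>R h)" by (simp only: scaleR_minus_right scaleR_scaleR)
 also have "1 / d h * d h = 1" using h(2) by simp
 finally have e: "(\<Sum>k\<in>T - {h}. (d k / d h) *\<^sub>R k) = - h" by (simp only: scaleR_one)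
 have "(\<Sum>k\<in>T - {h}. (d k / d h) *\<^sub>R k) \<in> fcone T"
  using d(1) h T(1) by (intro fcone_sum fcone_scale fcone_base) auto
 then show ?thesis using h e by auto
qed

section \<open>Cutting cones of functionals modulo cones with lines\<close>

lemma fcone_insert:
 assumes "finite J"
 shows "x \<in> fcone (insert h J) \<longleftrightarrow> (\<exists>a\<in>fcone J. \<exists>s\<ge>0. x = a + s *\<^sub>R h)"
proof
 have sub: "fcone J \<subseteq> fcone (insert h J)" using assms by (intro fcone_subset fcone_base) auto
 have h: "h \<in> fcone (insert h J)" using assms by (intro fcone_base) auto
 show "\<exists>a\<in>fcone J. \<exists>s\<ge>0. x = a + s *\<^sub>R h \<Longrightarrow> x \<in> fcone (insert h J)"
  using sub h by (auto intro!: fcone_add fcone_scale)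
 assume "x \<in> fcone (insert h J)"
 then obtain c where c: "\<forall>k\<in>insert h J. 0 \<le> c k" "x = (\<Sum>k\<in>insert h J. c k *\<^sub>R k)" by (auto simp: fcone_def)
 show "\<exists>a\<in>fcone J. \<exists>s\<ge>0. x = a + s *\<^sub>R h"
 proof (cases "h \<in> J")
  case True
  then show ?thesis using c fconeI[of J c] by (auto simp: insert_absorb intro!: bexI[of _ x] exI[of _ 0])
 next
  case False
  then show ?thesis using c assms fconeI[of J c] by (intro bexI[of _ "\<Sum>k\<in>J. c k *\<^sub>R k"] exI[of _ "c h"]) (auto simp: add.commute)
 qed
qed

text \<open>Adding \<open>h\<close> and adding \<open>- h\<close> yields two cones whose union is
  the cone with the whole line added and whose intersection is the original one; the formula is
  inclusion and exclusion.\<close>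

lemma fcone_cut:
 assumes J: "finite J"
 shows "cind (fcone J) x = cind (fcone (insert h J)) x + cind (fcone (insert (- h) J)) x - cind (fcone (insert h (insert (- h) J))) x"
proof -
 have J': "finite (insert (- h) J)" using J by simp
 let ?A = "x \<in> fcone (insert h J)" and ?B = "x \<in> fcone (insert (- h) J)" and ?C = "x \<in> fcone (insert h (insert (- h) J))"
 have 1: "x \<in> fcone J" if A: ?A and B: ?B
 proof -
  obtain a s where a: "a \<in> fcone J" "0 \<le> s" "x = a + s *\<^sub>R h" using A fcone_insert[OF J] by blast
  obtain b t where b: "b \<in> fcone J" "0 \<le> t" "x = b + t *\<^sub>R (- h)" using B fcone_insert[OF J] by blast
  show ?thesis
  proof (cases "s + t = 0")
   case True then show ?thesis using a b by (simp add: add_nonneg_eq_0_iff)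
  next
   case False
   \<comment> \<open>A point written as \<open>a\<close> plus \<open>s\<close> times
     \<open>h\<close> and as \<open>b\<close> minus \<open>t\<close> times \<open>h\<close> is the
     average of \<open>a\<close> and \<open>b\<close> with weights \<open>t\<close> and
     \<open>s\<close>, so it lies in the smaller cone by convexity.\<close>
   then have st: "s + t > 0" using a b by simp
   have "(s + t) *\<^sub>R x = t *\<^sub>R x + s *\<^sub>R x" by (simp add: algebra_simps)
   also have "\<dots> = t *\<^sub>R (a + s *\<^sub>R h) + s *\<^sub>R (b + t *\<^sub>R (- h))" using a(3) b(3) by metis
   also have "\<dots> = t *\<^sub>R a + s *\<^sub>R b" by (simp add: algebra_simps)
   finally have "x = (1 / (s + t)) *\<^sub>R (t *\<^sub>R a + s *\<^sub>R b)" using st by (metis divide_self_if less_irrefl scaleR_one scaleR_scaleR times_divide_eq_left mult_1)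
   then show ?thesis using a b st by (auto intro!: fcone_scale fcone_add)
  qed
 qed
 have 2: "?A \<and> ?B" if "x \<in> fcone J"
  using that fcone_insert[OF J] by (metis add.right_neutral order_refl scaleR_zero_left)
 have 3: "?A \<or> ?B" if C: ?C
 proof -
  obtain b s where b: "b \<in> fcone (insert (- h) J)" "0 \<le> s" "x = b + s *\<^sub>R h" using C fcone_insert[OF J'] by blast
  obtain a t where a: "a \<in> fcone J" "0 \<le> t" "b = a + t *\<^sub>R (- h)" using b(1) fcone_insert[OF J] by blast
  have x: "x = a + (s - t) *\<^sub>R h" "x = a + (t - s) *\<^sub>R (- h)" using a b by (simp_all add: algebra_simps)
  show ?thesis using x(1) a(1) fcone_insert[OF J] diff_ge_0_iff_ge x(2) linear by metis
 qed
 have 4: "?C" if "?A \<or> ?B"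
 proof -
  have "fcone (insert h J) \<subseteq> fcone (insert h (insert (- h) J))" "fcone (insert (- h) J) \<subseteq> fcone (insert h (insert (- h) J))"
   using J by (auto intro!: fcone_subset intro: fcone_base simp del: insert_iff)
  then show ?thesis using that by blast
 qed
 show ?thesis using 1 2 3 4 by (auto simp: cind_def)
qed

lemma mdiff_lineality:
 assumes "finite H" "h \<in> H" "h \<in> fcone T" "- h \<in> fcone T"
 shows "mdiff H (cind (fcone T)) m = 0"
proof (rule mdiff_periodic[OF assms(1,2)])
 fix y show "cind (fcone T) (y - h) = cind (fcone T) y"
  using fcone_add[OF _ assms(3), of "y - h"] fcone_add[OF _ assms(4), of y] by (auto simp: cind_def)
qed

text \<open>The last cone in \<open>fcone_cut\<close> contains the line through \<open>h\<close>,
  which the operator annihilates.\<close>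

lemma mdiff_cut:
 assumes "finite H" "h \<in> H" "finite J"
 shows "mdiff H (cind (fcone J)) m = mdiff H (cind (fcone (insert h J))) m + mdiff H (cind (fcone (insert (- h) J))) m"
proof -
 have z: "mdiff H (cind (fcone (insert h (insert (- h) J)))) m = 0"
  using assms by (intro mdiff_lineality) (auto intro!: fcone_base)
 have "cind (fcone J) = (\<lambda>x. (cind (fcone (insert h J)) x + cind (fcone (insert (- h) J)) x) - cind (fcone (insert h (insert (- h) J))) x)"
  using fcone_cut[OF assms(3)] by auto
 then show ?thesis using z by (simp add: mdiff_add mdiff_diff)
qed

text \<open>A sign pattern on \<open>H\<close>, encoded by the functionals that are to be positive.
  The cone over it is the dual of the region where the pattern holds.\<close>

definition chamber :: "'w::real_vector set \<Rightarrow> 'w set \<Rightarrow> 'w set"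
 where "chamber H S = S \<union> uminus ` (H - S)"

lemma mdiff_chambers:
 assumes H: "finite H" and K: "K \<subseteq> H" and J: "finite J"
 shows "mdiff H (cind (fcone J)) m = (\<Sum>S\<in>Pow K. mdiff H (cind (fcone (J \<union> chamber K S))) m)"
 using finite_subset[OF K H] K
proof (induction K rule: finite_induct)
 case empty then show ?case by (simp add: chamber_def)
next
 case (insert h K)
 have fin: "finite (J \<union> chamber K S)" if "S \<subseteq> K" for S
  using J insert.hyps(1) finite_subset[OF that] by (auto simp: chamber_def)
 have 1: "insert h (J \<union> chamber K S) = J \<union> chamber (insert h K) (insert h S)" if "S \<in> Pow K" for S
  using that insert.hyps(2) by (auto simp: chamber_def)
 have 2: "insert (- h) (J \<union> chamber K S) = J \<union> chamber (insert h K) S" if "S \<in> Pow K" for S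
  using that insert.hyps(2) by (auto simp: chamber_def)
 have "mdiff H (cind (fcone J)) m = (\<Sum>S\<in>Pow K. mdiff H (cind (fcone (J \<union> chamber K S))) m)" using insert by simp
 also have "\<dots> = (\<Sum>S\<in>Pow K. mdiff H (cind (fcone (J \<union> chamber (insert h K) (insert h S)))) m + mdiff H (cind (fcone (J \<union> chamber (insert h K) S))) m)"
 proof (rule sum.cong[OF refl])
  fix S assume S: "S \<in> Pow K"
  have "h \<in> H" using insert.prems by simp
  from mdiff_cut[OF H this fin, of S m] S
  show "mdiff H (cind (fcone (J \<union> chamber K S))) m = mdiff H (cind (fcone (J \<union> chamber (insert h K) (insert h S)))) m + mdiff H (cind (fcone (J \<union> chamber (insert h K) S))) m"
   unfolding 1[OF S] 2[OF S] by simp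
 qed
 also have "\<dots> = (\<Sum>S\<in>Pow (insert h K). mdiff H (cind (fcone (J \<union> chamber (insert h K) S))) m)"
 proof -
  have "inj_on (insert h) (Pow K)" using insert.hyps(2) by (intro inj_onI) (metis PowD insert_ident subsetD)
  moreover have "Pow K \<inter> insert h ` Pow K = {}" using insert.hyps(2) by auto
  ultimately show ?thesis using insert.hyps(1)
   by (simp add: Pow_insert sum.union_disjoint sum.reindex sum.distrib add.commute)
 qed
 finally show ?case .
qed

text \<open>Cutting by all of \<open>H\<close> turns every indicator into a sum over sign patterns
  \<open>S\<close>. If \<open>J i\<close> is not inside \<open>S\<close>, a line appears and the
  term vanishes. If \<open>S\<close> is realised by a point, the indices with \<open>J i\<close>
  inside \<open>S\<close> are those whose primal cone contains it, so their coefficients add up to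
  0; if not, Gordan's theorem finds a line in the chamber cone. Relations of cones thus pass to
  their duals modulo lines.\<close>

lemma mdiff_generic_relation:
 fixes N :: "'v::euclidean_space set"
 assumes H: "finite H" "H \<subseteq> real_dual (span N)" and I: "finite I" and J: "\<And>i. i \<in> I \<Longrightarrow> J i \<subseteq> H"
  and rel: "generic_relation I (\<lambda>i. {v\<in>span N. \<forall>h\<in>J i. 0 \<le> h v}) (span N) c"
 shows "(\<Sum>i\<in>I. c i * mdiff H (cind (fcone (J i))) m) = 0"
proof -
 define F where "F S = mdiff H (cind (fcone (chamber H S))) m" for S
 have finc: "finite (chamber H S)" if "S \<subseteq> H" for S using H(1) finite_subset[OF that] by (auto simp: chamber_def)
 have f: "mdiff H (cind (fcone (J i))) m = (\<Sum>S\<in>Pow H. if J i \<subseteq> S then F S else 0)" if i: "i \<in> I" for i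
 proof -
  have "mdiff H (cind (fcone (J i \<union> chamber H S))) m = (if J i \<subseteq> S then F S else 0)" if S: "S \<in> Pow H" for S
  proof (cases "J i \<subseteq> S")
   case True
   then have "J i \<union> chamber H S = chamber H S" by (auto simp: chamber_def)
   then show ?thesis using True by (simp add: F_def)
  next
   case False
   then obtain h where h: "h \<in> J i" "h \<notin> S" by auto
   then have hH: "h \<in> H" using J[OF i] by auto
   have "finite (J i \<union> chamber H S)" using finc S J[OF i] finite_subset[OF _ H(1)] by auto
   then show ?thesis using h hH H(1) False by (auto simp: chamber_def intro!: mdiff_lineality[of H h] fcone_base)
  qed
  then show ?thesis
   unfolding mdiff_chambers[OF H(1) subset_refl finite_subset[OF J[OF i] H(1)]] by (rule sum.cong[OF refl])
 qed
 have z: "F S * (\<Sum>i\<in>{i\<in>I. J i \<subseteq> S}. c i) = 0" if S: "S \<in> Pow H" for S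
 proof (cases "\<exists>v\<in>span N. \<forall>h\<in>chamber H S. 0 < h v")
  case True
  then obtain v where v: "v \<in> span N" "\<And>h. h \<in> chamber H S \<Longrightarrow> 0 < h v" by blast
  from rel obtain Hs where Hs': "finite Hs \<and> (\<forall>h\<in>Hs. linear h \<and> (\<exists>w\<in>span N. h w \<noteq> (0::real))) \<and>
   (\<forall>v\<in>span N. (\<forall>h\<in>Hs. h v \<noteq> 0) \<longrightarrow> (\<Sum>i\<in>{i\<in>I. v \<in> {v\<in>span N. \<forall>h\<in>J i. 0 \<le> h v}}. c i) = 0)"
   unfolding generic_relation_def by (elim exE)
  then have Hs: "finite Hs" "\<And>h. h \<in> Hs \<Longrightarrow> linear h \<and> (\<exists>w\<in>span N. h w \<noteq> 0)"
   "\<And>v. v \<in> span N \<Longrightarrow> (\<And>h. h \<in> Hs \<Longrightarrow> h v \<noteq> 0) \<Longrightarrow> (\<Sum>i\<in>{i\<in>I. v \<in> {v\<in>span N. \<forall>h\<in>J i. 0 \<le> h v}}. c i) = 0"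
   by (simp_all del: mem_Collect_eq)
  obtain w where w: "w \<in> span N" "\<forall>h\<in>Hs. h w \<noteq> 0" using generic_direction[OF Hs(1,2) subspace_span[of N]] by blast
  \<comment> \<open>A small step in a generic direction leaves the exceptional hyperplanes and stays
    inside the open chamber.\<close>
  have "\<forall>\<^sub>F e in at_right 0. \<forall>h\<in>Hs. h v + e * h w \<noteq> 0"
   using Hs(1) w(2) by (subst eventually_ball_finite_distrib) (auto intro!: eventually_ne_line)
  moreover have "\<forall>\<^sub>F e in at_right 0. \<forall>h\<in>chamber H S. 0 < h v + e * h w"
   using finc S v(2) by (subst eventually_ball_finite_distrib) (auto intro!: eventually_pos_line)
  ultimately have "\<forall>\<^sub>F e in at_right 0. (\<forall>h\<in>Hs. h v + e * h w \<noteq> 0) \<and> (\<forall>h\<in>chamber H S. 0 < h v + e * h w)"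
   by eventually_elim blast
  then obtain e where e: "\<forall>h\<in>Hs. h v + e * h w \<noteq> 0" "\<forall>h\<in>chamber H S. 0 < h v + e * h w"
   using eventually_happens'[OF trivial_limit_at_right_real] by blast
  define u where "u = v + e *\<^sub>R w"
  have u: "u \<in> span N" using v(1) w(1) by (simp add: u_def span_add span_scale)
  have hu: "h u = h v + e * h w" if "h \<in> real_dual (span N)" for h
   using real_dualD[OF that] v(1) w(1) by (simp add: u_def span_scale)
  have "h u \<noteq> 0" if "h \<in> Hs" for h using that e(1) Hs(2) by (auto simp: u_def linear_line)
  then have "(\<Sum>i\<in>{i\<in>I. u \<in> {v\<in>span N. \<forall>h\<in>J i. 0 \<le> h v}}. c i) = 0" by (rule Hs(3)[OF u])
  moreover have pos: "0 < h u" if "h \<in> S" for h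
   using that S H(2) e(2) by (subst hu) (auto simp: chamber_def)
  have neg: "h u < 0" if "h \<in> H - S" for h
  proof -
   have "- h \<in> chamber H S" using that by (auto simp: chamber_def)
   then show ?thesis using e(2) hu[of h] that H(2) by fastforce
  qed
  have "{i\<in>I. u \<in> {v\<in>span N. \<forall>h\<in>J i. 0 \<le> h v}} = {i\<in>I. J i \<subseteq> S}"
  proof (intro Collect_cong conj_cong refl)
   fix i assume i: "i \<in> I"
   have "0 \<le> h u \<longleftrightarrow> h \<in> S" if "h \<in> J i" for h
    using that J[OF i] pos[of h] neg[of h] by (cases "h \<in> S") auto
   then show "u \<in> {v\<in>span N. \<forall>h\<in>J i. 0 \<le> h v} \<longleftrightarrow> J i \<subseteq> S" using u by auto
  qed
  ultimately show ?thesis by simp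
 next
  case False
  have "chamber H S \<subseteq> real_dual (span N)"
   using H(2) S subspace_neg[OF subspace_real_dual] by (auto simp: chamber_def)
  then obtain h where h: "h \<in> chamber H S" "- h \<in> fcone (chamber H S)"
   using gordan[OF finc _ False] S by auto
  have b: "h \<in> fcone (chamber H S)" using h(1) finc S by (intro fcone_base) auto
  have "F S = 0" using h(1) S mdiff_lineality[OF H(1), of h "chamber H S"] mdiff_lineality[OF H(1), of "- h" "chamber H S"] h(2) b by (auto simp: chamber_def F_def)
  then show ?thesis by simp
 qed
 have "(\<Sum>i\<in>I. c i * mdiff H (cind (fcone (J i))) m) = (\<Sum>i\<in>I. \<Sum>S\<in>Pow H. if J i \<subseteq> S then c i * F S else 0)"
  by (intro sum.cong refl) (simp add: f sum_distrib_left if_distrib cong: if_cong)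
 also have "\<dots> = (\<Sum>S\<in>Pow H. \<Sum>i\<in>I. if J i \<subseteq> S then c i * F S else 0)" by (rule sum.swap)
 also have "\<dots> = (\<Sum>S\<in>Pow H. F S * (\<Sum>i\<in>{i\<in>I. J i \<subseteq> S}. c i))"
  using I by (intro sum.cong refl) (simp add: sum.If_cases sum_distrib_left Int_def mult.commute)
 also have "\<dots> = 0" using z by (intro sum.neutral) blast
 finally show ?thesis .
qed

section \<open>Faces and annihilators\<close>

text \<open>On the kernel of one functional \<open>h\<close> the induction hypothesis expresses
  \<open>m\<close> by the others; the coefficient of \<open>h\<close> is then fixed by the value at
  one vector \<open>u\<close> outside that kernel.\<close>

lemma kernel_combination:
 fixes f :: "'k \<Rightarrow> 'v::real_vector \<Rightarrow> real"
 assumes "finite K" "subspace V" "linear m" "\<And>k. k \<in> K \<Longrightarrow> linear (f k)"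
  "\<And>v. v \<in> V \<Longrightarrow> (\<And>k. k \<in> K \<Longrightarrow> f k v = 0) \<Longrightarrow> m v = 0"
 shows "\<exists>c. \<forall>v\<in>V. m v = (\<Sum>k\<in>K. c k * f k v)"
 using assms
proof (induction K arbitrary: V rule: finite_induct)
 case empty then show ?case by auto
next
 case (insert h K)
 have lh: "linear (f h)" and lK: "\<And>k. k \<in> K \<Longrightarrow> linear (f k)" using insert.prems(3) by auto
 let ?V = "{v\<in>V. f h v = 0}"
 have sV: "subspace ?V"
  using insert.prems(1) lh by (auto simp: subspace_def linear_add linear_scale linear_0)
 have "\<exists>c. \<forall>v\<in>?V. m v = (\<Sum>k\<in>K. c k * f k v)"
  by (rule insert.IH[OF sV insert.prems(2) lK]) (use insert.prems(4) in auto)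
 then obtain c where c: "\<And>v. v \<in> ?V \<Longrightarrow> m v = (\<Sum>k\<in>K. c k * f k v)" by blast
 show ?case
 proof (cases "\<exists>u\<in>V. f h u \<noteq> 0")
  case False
  then show ?thesis using c insert.hyps by (intro exI[of _ c]) simp
 next
  case True
  then obtain u where u: "u \<in> V" "f h u \<noteq> 0" by auto
  define q where "q = (m u - (\<Sum>k\<in>K. c k * f k u)) / f h u"
  have "m v = q * f h v + (\<Sum>k\<in>K. c k * f k v)" if v: "v \<in> V" for v
  proof -
   define t where "t = f h v / f h u"
   have "v - t *\<^sub>R u \<in> ?V"
    using u v insert.prems(1) lh by (simp add: subspace_diff subspace_scale linear_diff linear_scale t_def)
   from c[OF this] have "m v - t * m u = (\<Sum>k\<in>K. c k * (f k v - t * f k u))"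
    using lK insert.prems(2) by (simp add: linear_diff linear_scale)
   also have "\<dots> = (\<Sum>k\<in>K. c k * f k v) - t * (\<Sum>k\<in>K. c k * f k u)"
    by (simp add: algebra_simps sum_subtractf sum_distrib_left)
   finally have "m v = t * (m u - (\<Sum>k\<in>K. c k * f k u)) + (\<Sum>k\<in>K. c k * f k v)" by (simp add: algebra_simps)
   also have "t * (m u - (\<Sum>k\<in>K. c k * f k u)) = q * f h v" using u by (simp add: t_def q_def)
   finally show ?thesis .
  qed
  then show ?thesis using insert.hyps by (intro exI[of _ "c(h := q)"]) (auto intro!: sum.cong)
 qed
qed

lemma real_dual_annihilator:
 fixes N :: "'v::real_vector set"
 assumes K: "finite K" "K \<subseteq> real_dual (span N)" and m: "m \<in> real_dual (span N)"
  and z: "\<And>v. v \<in> span N \<Longrightarrow> (\<And>k. k \<in> K \<Longrightarrow> k v = 0) \<Longrightarrow> m v = 0"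
 shows "m \<in> span K"
proof -
 have "\<exists>l. linear l \<and> (\<forall>x\<in>span N. l x = k x)" if "k \<in> real_dual (span N)" for k
  using real_dual_linear[OF that] by metis
 then obtain le where le: "\<And>k. k \<in> real_dual (span N) \<Longrightarrow> linear (le k) \<and> (\<forall>x\<in>span N. le k x = k x)" by metis
 have leK: "linear (le k)" "x \<in> span N \<Longrightarrow> le k x = k x" if "k \<in> insert m K" for k x using le[of k] that K(2) m by auto
 have "\<exists>c. \<forall>v\<in>span N. le m v = (\<Sum>k\<in>K. c k * le k v)"
  by (rule kernel_combination[OF K(1) subspace_span]) (use leK z in auto)
 then obtain c where c: "\<And>v. v \<in> span N \<Longrightarrow> le m v = (\<Sum>k\<in>K. c k * le k v)" by blast
 have "m = (\<Sum>k\<in>K. c k *\<^sub>R k)"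
 proof
  fix x show "m x = (\<Sum>k\<in>K. c k *\<^sub>R k) x"
  proof (cases "x \<in> span N")
   case True then show ?thesis using c[OF True] le m K(2) by (auto simp: sum_fun_apply subset_iff intro!: sum.cong)
  next
   case False
   then have "k x = 0" if "k \<in> insert m K" for k using that K(2) m real_dualD(3) by (metis insertE subsetD)
   then show ?thesis by (simp add: sum_fun_apply sum.neutral)
  qed
 qed
 moreover have "(\<Sum>k\<in>K. c k *\<^sub>R k) \<in> span K" by (intro span_sum span_scale span_base)
 ultimately show ?thesis by simp
qed

lemma perp_separates:
 fixes N :: "'v::euclidean_space set"
 assumes L: "subspace L" "L \<subseteq> span N" and v: "v \<in> span N" "\<And>m. m \<in> perp N L \<Longrightarrow> m v = 0"
 shows "v \<in> L"
proof -
 obtain p :: "'v \<Rightarrow> 'v" where p: "linear p" "\<And>x. p x \<in> L" "\<And>x. x \<in> L \<Longrightarrow> p x = x"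
  using real_retraction[OF L(1)] by blast
 \<comment> \<open>The functional given by the component of \<open>v\<close> complementary to
   \<open>L\<close>; at \<open>v\<close> it takes the squared length of
   \<open>v - p v\<close>.\<close>
 define m where "m x = (if x \<in> span N then (v - p v) \<bullet> (x - p x) else 0)" for x
 have "m \<in> perp N L"
  using p L(2) by (auto simp: perp_def real_dual_def m_def linear_add[OF p(1)] linear_scale[OF p(1)] span_add span_scale inner_simps algebra_simps)
 then show ?thesis using v p(2)[of v] by (fastforce simp: m_def)
qed

lemma perp_span:
 assumes "tau \<subseteq> span N" shows "perp N tau = perp N (span tau)"
proof -
 have "m v = 0" if m: "m \<in> real_dual (span N)" "\<forall>v\<in>tau. m v = 0" and v: "v \<in> span tau" for m v
 proof -
  obtain l where l: "linear l" "\<And>x. x \<in> span N \<Longrightarrow> l x = m x" using real_dual_linear[OF m(1)] by blast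
  have "span tau \<subseteq> span N" using assms by (simp add: span_minimal)
  moreover have "l v = 0" using linear_eq_0_on_span[OF l(1) _ v] m(2) l(2) assms by (metis subsetD)
  ultimately show ?thesis using l(2) v by (metis subsetD)
 qed
 then show ?thesis by (auto simp: perp_def intro: span_base)
qed

lemma perp_sub_real_dual: "perp N L \<subseteq> real_dual (span N)"
 by (auto simp: perp_def)

text \<open>The assumptions say that \<open>y\<close> is a point of the cone in \<open>L\<close> as
  interior as possible: every inequality that is not an equation on \<open>L\<close> is strict at
  \<open>y\<close>. Whether \<open>L\<close> is the span of a face can then be tested on the
  generators of the dual cone.\<close>

context
 fixes N :: "'v::euclidean_space set" and J :: "('v \<Rightarrow> real) set" and sig L :: "'v set" and y :: 'v
 assumes J: "finite J" "J \<subseteq> real_dual (span N)" and sig: "sig = {v\<in>span N. \<forall>h\<in>J. 0 \<le> h v}"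
  and L: "subspace L" "L \<subseteq> span N" and y: "y \<in> sig" "y \<in> L" "\<And>h. h \<in> J \<Longrightarrow> h \<in> perp N L \<or> 0 < h y"
begin

lemma move_inside:
 assumes v: "v \<in> span N" "\<And>h. h \<in> J \<Longrightarrow> h \<in> perp N L \<Longrightarrow> 0 \<le> h v"
 shows "\<forall>\<^sub>F e in at_right 0. y + e *\<^sub>R v \<in> sig"
proof -
 have yN: "y \<in> span N" using y(1) by (simp add: sig)
 have "\<forall>\<^sub>F e in at_right 0. 0 \<le> h (y + e *\<^sub>R v)" if h: "h \<in> J" for h
 proof -
  have eq: "h (y + e *\<^sub>R v) = h y + e * h v" for e
   using real_dualD[of h "span N"] h J(2) yN v(1) by (simp add: span_scale subset_iff)
  show ?thesis
  proof (cases "h \<in> perp N L")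
   case True
   then show ?thesis using y(2) v(2)[OF h True] eq eventually_at_right_less[of "0::real"] eventually_mono by (fastforce simp: perp_def)
  next
   case False
   then show ?thesis using eventually_pos_line[of "h y" "h v"] y(3)[OF h] by (auto simp: eq elim!: eventually_mono)
  qed
 qed
 then have "\<forall>\<^sub>F e in at_right 0. \<forall>h\<in>J. 0 \<le> h (y + e *\<^sub>R v)" using J(1) by (subst eventually_ball_finite_distrib) auto
 then show ?thesis using yN v(1) by (auto simp: sig span_add span_scale elim!: eventually_mono)
qed

text \<open>A vector killed by the generators in \<open>perp N L\<close> can be added to and
  subtracted from \<open>y\<close> in small amounts without leaving the cone. The face contains the
  resulting segment through \<open>y\<close>, so the vector lies in \<open>L\<close>.\<close>

lemma face_imp_span_perp:
 assumes tau: "tau face_of sig" "y \<in> tau" "span tau = L"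
 shows "span {h\<in>J. h \<in> perp N L} = perp N L"
proof
 have "subspace (perp N L)"
  using subspace_real_dual[of "span N"] by (auto simp: perp_def subspace_def zero_fun_def plus_fun_def)
 then show "span {h\<in>J. h \<in> perp N L} \<subseteq> perp N L" by (intro span_minimal) auto
 show "perp N L \<subseteq> span {h\<in>J. h \<in> perp N L}"
 proof
  fix m assume m: "m \<in> perp N L"
  show "m \<in> span {h\<in>J. h \<in> perp N L}"
  proof (rule real_dual_annihilator)
   show "finite {h\<in>J. h \<in> perp N L}" "{h\<in>J. h \<in> perp N L} \<subseteq> real_dual (span N)" "m \<in> real_dual (span N)"
    using J m by (auto simp: perp_def)
   fix v assume v: "v \<in> span N" "\<And>k. k \<in> {h\<in>J. h \<in> perp N L} \<Longrightarrow> k v = 0"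
   have mv: "k (- v) = 0" if "k \<in> {h\<in>J. h \<in> perp N L}" for k
    using real_dualD(2)[of k "span N" v "-1"] v that J(2) by auto
   have "\<forall>\<^sub>F e in at_right 0. y + e *\<^sub>R v \<in> sig" "\<forall>\<^sub>F e in at_right 0. y + e *\<^sub>R (- v) \<in> sig"
    using v(2) mv by (intro move_inside v(1) span_neg; metis (mono_tags, lifting) mem_Collect_eq order_refl)+
   with eventually_at_right_less[of "0::real"]
   have "\<forall>\<^sub>F e in at_right 0. 0 < e \<and> y + e *\<^sub>R v \<in> sig \<and> y + e *\<^sub>R (- v) \<in> sig" by eventually_elim blast
   then obtain e where e: "0 < e" "y + e *\<^sub>R v \<in> sig" "y + e *\<^sub>R (- v) \<in> sig"
    using eventually_happens'[OF trivial_limit_at_right_real] by blast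
   have "v \<in> L"
   proof (cases "v = 0")
    case True then show ?thesis using subspace_0[OF L(1)] by simp
   next
    case False
    have "y = midpoint (y + e *\<^sub>R v) (y + e *\<^sub>R (- v))" by (simp add: midpoint_def flip: scaleR_2)
    moreover have "y + e *\<^sub>R v \<noteq> y + e *\<^sub>R (- v)"
    proof
     assume "y + e *\<^sub>R v = y + e *\<^sub>R (- v)"
     then have "(2 * e) *\<^sub>R v = 0" by (simp add: algebra_simps scaleR_2 flip: scaleR_scaleR)
     then show False using e False by simp
    qed
    ultimately have "y \<in> open_segment (y + e *\<^sub>R v) (y + e *\<^sub>R (- v))" by (metis midpoint_in_open_segment)
    then have "y + e *\<^sub>R v \<in> tau" using tau(1,2) e unfolding face_of_def by blast
    then have "(y + e *\<^sub>R v) - y \<in> L" using tau(2,3) span_diff[OF span_base span_base] by metis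
    then have "(1 / e) *\<^sub>R (e *\<^sub>R v) \<in> L" using subspace_scale[OF L(1)] by (metis add_diff_cancel_left')
    then show ?thesis using e by simp
   qed
   then show "m v = 0" using m by (simp add: perp_def)
  qed
 qed
qed

text \<open>The converse test: inequalities from \<open>perp N L\<close> vanish on \<open>L\<close>
  and together cut it out, so they define a face, and moving from \<open>y\<close> along
  \<open>L\<close> shows that this face spans \<open>L\<close>.\<close>

lemma span_perp_imp_face:
 assumes sp: "span {h\<in>J. h \<in> perp N L} = perp N L"
 shows "sig \<inter> L face_of sig" "span (sig \<inter> L) = L"
proof -
 have memL: "v \<in> L" if v: "v \<in> span N" "\<And>h. h \<in> J \<Longrightarrow> h \<in> perp N L \<Longrightarrow> h v = 0" for v
 proof (rule perp_separates[OF L v(1)])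
  fix m assume "m \<in> perp N L"
  then have "m \<in> span {h\<in>J. h \<in> perp N L}" using sp by simp
  then show "m v = 0"
   by (induction rule: span_induct_alt) (use v(2) in auto)
 qed
 have conv: "convex sig"
 proof (rule convexI)
  fix a b u w assume *: "a \<in> sig" "b \<in> sig" "0 \<le> u" "0 \<le> w" "u + w = (1::real)"
  have "h (u *\<^sub>R a + w *\<^sub>R b) = u * h a + w * h b" if "h \<in> J" for h
   using real_dualD[of h "span N"] that J(2) * by (simp add: sig span_scale subset_iff)
  moreover have "0 \<le> u * h a + w * h b" if "h \<in> J" for h using that * by (simp add: sig)
  ultimately have "\<forall>h\<in>J. 0 \<le> h (u *\<^sub>R a + w *\<^sub>R b)" by metis
  then show "u *\<^sub>R a + w *\<^sub>R b \<in> sig" using * by (simp add: sig span_add span_scale)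
 qed
 show "sig \<inter> L face_of sig" unfolding face_of_def
 proof (intro conjI ballI impI)
  show "convex (sig \<inter> L)" using conv subspace_imp_convex[OF L(1)] by (rule convex_Int)
  have key: "a \<in> L" if ab: "a \<in> sig" "b \<in> sig" "x \<in> L" and s: "x = (1 - u) *\<^sub>R a + u *\<^sub>R b" "0 < u" "u < 1" for a b x u
  proof (rule memL)
   show "a \<in> span N" using ab by (simp add: sig)
   fix h assume h: "h \<in> J" "h \<in> perp N L"
   have "h x = (1 - u) * h a + u * h b"
    using real_dualD[of h "span N"] h J(2) ab by (simp add: s(1) sig span_scale subset_iff)
   moreover have "h x = 0" "0 \<le> h a" "0 \<le> h b" using h ab by (auto simp: perp_def sig)
   ultimately show "h a = 0"
    using s(2,3) by (smt (verit) mult_nonneg_nonneg mult_pos_pos)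
  qed
  fix a b x assume ab: "a \<in> sig" "b \<in> sig" "x \<in> sig \<inter> L" "x \<in> open_segment a b"
  obtain u where u: "x = (1 - u) *\<^sub>R a + u *\<^sub>R b" "0 < u" "u < 1" using ab(4) by (auto simp: in_segment)
  show "a \<in> sig \<inter> L" using key[OF ab(1,2) _ u] ab by auto
  show "b \<in> sig \<inter> L" using key[OF ab(2,1), of x "1 - u"] u ab by (auto simp: add.commute)
 qed auto
 show "span (sig \<inter> L) = L"
 proof
  show "span (sig \<inter> L) \<subseteq> L" using L(1) by (intro span_minimal) auto
  show "L \<subseteq> span (sig \<inter> L)"
  proof
   fix l assume l: "l \<in> L"
   have "0 \<le> h l" if "h \<in> perp N L" for h using that l by (simp add: perp_def)
   then have "\<forall>\<^sub>F e in at_right 0. y + e *\<^sub>R l \<in> sig" using l L(2) by (intro move_inside) auto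
   with eventually_at_right_less[of "0::real"]
   have "\<forall>\<^sub>F e in at_right 0. 0 < e \<and> y + e *\<^sub>R l \<in> sig" by eventually_elim blast
   then obtain e where e: "0 < e" "y + e *\<^sub>R l \<in> sig"
    using eventually_happens'[OF trivial_limit_at_right_real] by blast
   have "(1 / e) *\<^sub>R ((y + e *\<^sub>R l) - y) \<in> span (sig \<inter> L)" using e y l L(1) by (fastforce simp: subspace_add subspace_scale intro: span_scale span_diff span_base)
   then show "l \<in> span (sig \<inter> L)" using e by simp
  qed
 qed
qed

end

text \<open>It is applied to spaces of functionals, inside an infinite-dimensional space of
  functions; the finite set \<open>T\<close> supplies the finiteness.\<close>

lemma dim_lt_if_span_ne:
 fixes S :: "'w::real_vector set"
 assumes "S \<subseteq> V" "subspace V" "finite T" "V \<subseteq> span T" "span S \<noteq> V"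
 shows "dim S < dim V"
proof -
 obtain B where B: "B \<subseteq> S" "independent B" "S \<subseteq> span B" by (rule maximal_independent_subset)
 have BV: "B \<subseteq> V" using B(1) assms(1) by auto
 obtain C where C: "B \<subseteq> C" "C \<subseteq> V" "independent C" "V \<subseteq> span C" using maximal_independent_subset_extend[OF BV B(2)] by blast
 have fC: "finite C" using independent_span_bound[OF assms(3) C(3)] C(2) assms(4) by auto
 have "B \<noteq> C" using B span_mono span_span subset_antisym C assms(2,5) span_subspace by metis
 then show ?thesis using C(1) fC B dim_unique C by (metis psubset_card_mono psubset_eq)
qed

section \<open>Additivity of the interpolator\<close>

lemma sum_over_supports:
 fixes w :: "'a \<Rightarrow> complex"
 assumes "finite I" "\<And>i. i \<in> I \<Longrightarrow> finite {m\<in>M. g i m \<noteq> 0}" "\<And>m. m \<in> M \<Longrightarrow> (\<Sum>i\<in>I. c i * g i m) = 0"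
 shows "(\<Sum>i\<in>I. c i * (\<Sum>m\<in>{m\<in>M. g i m \<noteq> 0}. g i m * w m)) = 0"
proof -
 define S where "S = (\<Union>i\<in>I. {m\<in>M. g i m \<noteq> 0})"
 have fS: "finite S" using assms(1,2) by (auto simp: S_def)
 have "(\<Sum>m\<in>{m\<in>M. g i m \<noteq> 0}. g i m * w m) = (\<Sum>m\<in>S. g i m * w m)" if "i \<in> I" for i
  using that fS by (intro sum.mono_neutral_left) (auto simp: S_def)
 then have "(\<Sum>i\<in>I. c i * (\<Sum>m\<in>{m\<in>M. g i m \<noteq> 0}. g i m * w m)) = (\<Sum>i\<in>I. \<Sum>m\<in>S. c i * g i m * w m)"
  by (simp add: sum_distrib_left mult.assoc)
 also have "\<dots> = (\<Sum>m\<in>S. \<Sum>i\<in>I. c i * g i m * w m)" by (rule sum.swap)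
 also have "\<dots> = (\<Sum>m\<in>S. (\<Sum>i\<in>I. c i * g i m) * w m)" by (simp add: sum_distrib_right)
 also have "\<dots> = 0" using assms(3) by (intro sum.neutral) (auto simp: S_def)
 finally show ?thesis .
qed

lemma span_sublat_eq:
 assumes "is_cone N sig" "is_cone N sig'" "span sig = span sig'"
 shows "sublat N sig = sublat N sig'" "induced_map N Psi sig = induced_map N Psi sig'" "proj_C N Psi sig = proj_C N Psi sig'"
proof -
 show e: "sublat N sig = sublat N sig'" using assms by (simp add: sublat_def)
 show "induced_map N Psi sig = induced_map N Psi sig'" "proj_C N Psi sig = proj_C N Psi sig'"
  by (simp_all add: induced_map_def proj_C_def proj_R_def e)
qed

text \<open>All relations \<open>c\<close> are tested at the same point \<open>xi\<close>. In the
  induction the coefficients of the relations between faces are themselves values at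
  \<open>xi\<close>, so the exceptional set must be fixed before the relation.\<close>

definition additive_at :: "'v::euclidean_space set \<Rightarrow> 'v complement_map \<Rightarrow> 'v set set \<Rightarrow> 'v set \<Rightarrow> 'v \<times> 'v \<Rightarrow> bool"
 where "additive_at N Psi \<S> W xi \<longleftrightarrow>
  (\<forall>c. generic_relation \<S> (\<lambda>sig. sig) W c \<longrightarrow> (\<Sum>sig\<in>\<S>. c sig * SI_interpolator N Psi sig xi) = 0)"

lemma face_eq_Int_span:
 fixes sig :: "'v::euclidean_space set"
 assumes "tau face_of sig" "convex sig" "0 \<in> tau"
 shows "tau = sig \<inter> span tau"
proof -
 show ?thesis using face_of_imp_eq_affine_Int[OF assms(2,1)] assms(3) by (simp add: affine_hull_span_0 hull_inc Int_commute)
qed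

text \<open>A finite family of full-dimensional cones. The set \<open>H\<close> of all generators of
  their duals is the common denominator over which their sums and integrals are compared.\<close>

context
 fixes N :: "'v::euclidean_space set" and Psi :: "'v complement_map" and \<S> :: "'v set set"
  and J :: "'v set \<Rightarrow> ('v \<Rightarrow> real) set" and H :: "('v \<Rightarrow> real) set"
 assumes N: "is_lattice N" and Psi: "is_complement_map N Psi" and fin: "finite \<S>"
  and gen: "\<And>sig. sig \<in> \<S> \<Longrightarrow> generic_cone N Psi sig" and full: "\<And>sig. sig \<in> \<S> \<Longrightarrow> span sig = span N"
  and J: "\<And>sig. sig \<in> \<S> \<Longrightarrow> finite (J sig)" "\<And>sig. sig \<in> \<S> \<Longrightarrow> J sig \<subseteq> dual_lat N" "\<And>sig. sig \<in> \<S> \<Longrightarrow> 0 \<notin> J sig"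
   "\<And>sig. sig \<in> \<S> \<Longrightarrow> dual_cone N sig = fcone (J sig)" "\<And>sig. sig \<in> \<S> \<Longrightarrow> sig = {v\<in>span N. \<forall>h\<in>J sig. 0 \<le> h v}"
  and H: "H = (\<Union>sig\<in>\<S>. J sig)"
begin

lemma H_props: "finite H" "H \<subseteq> dual_lat N" "0 \<notin> H" "H \<subseteq> real_dual (span N)" "\<And>sig. sig \<in> \<S> \<Longrightarrow> J sig \<subseteq> H"
 using fin J(1-3) by (auto simp: H dual_lat_def)

abbreviation "Jp sig L \<equiv> {h\<in>J sig. h \<in> perp N L}"

lemma pointed:
 assumes sig: "sig \<in> \<S>" and L: "L \<subseteq> span N" and y: "y \<in> sig" "y \<in> span L" "\<And>h. h \<in> J sig \<Longrightarrow> h \<in> perp N L \<or> 0 < h y"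
 shows "\<exists>U v0. pointed_cone N (Jp sig L) U v0 (dual_cone N sig \<inter> perp N L)"
proof -
 obtain G where G: "finite G" "G \<subseteq> N" "sig = fcone G" using is_coneD[OF generic_coneD(1)[OF gen[OF sig]]] by blast
 show ?thesis by (rule pointed_cone_dual[OF N G full[OF sig] J(1-4)[OF sig] L y])
qed

lemma num_relation:
 assumes rel: "generic_relation \<S> (\<lambda>sig. sig) (span N) c"
 shows "(\<Sum>sig\<in>\<S>. c sig * pointed_cone.num N (dual_cone N sig) H xi) = 0"
proof -
 have pc: "\<exists>U v0. pointed_cone N (J sig) U v0 (dual_cone N sig)" if "sig \<in> \<S>" for sig
  by (rule pointed_cone_full[OF N gen[OF that] full[OF that] J(1-4)[OF that]])
 have eq: "pointed_cone.num N (dual_cone N sig) H xi =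
   (\<Sum>m\<in>{m\<in>dual_lat N. mdiff H (cind (dual_cone N sig)) m \<noteq> 0}. mdiff H (cind (dual_cone N sig)) m * exp (pairing xi m))"
  if "sig \<in> \<S>" for sig
  using pc[OF that] by (auto simp: pointed_cone.num_def pointed_cone.supp_def)
 have "generic_relation \<S> (\<lambda>sig. {v\<in>span N. \<forall>h\<in>J sig. 0 \<le> h v}) (span N) c"
 proof -
  have "{sig\<in>\<S>. v \<in> sig} = {sig\<in>\<S>. v \<in> {v\<in>span N. \<forall>h\<in>J sig. 0 \<le> h v}}" for v using J(5) by blast
  then show ?thesis using rel unfolding generic_relation_def by presburger
 qed
 then have z: "(\<Sum>sig\<in>\<S>. c sig * mdiff H (cind (fcone (J sig))) m) = 0" for m
  by (intro mdiff_generic_relation[OF H_props(1,4) fin]) (use H_props(5) in auto)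
 have "(\<Sum>sig\<in>\<S>. c sig * (\<Sum>m\<in>{m\<in>dual_lat N. mdiff H (cind (dual_cone N sig)) m \<noteq> 0}. mdiff H (cind (dual_cone N sig)) m * exp (pairing xi m))) = 0"
 proof (rule sum_over_supports[OF fin])
  fix sig assume sig: "sig \<in> \<S>"
  show "finite {m\<in>dual_lat N. mdiff H (cind (dual_cone N sig)) m \<noteq> 0}"
   using pc[OF sig] pointed_cone.finite_support H_props(1,2) H_props(5)[OF sig] by blast
 next
  fix m
  show "(\<Sum>sig\<in>\<S>. c sig * mdiff H (cind (dual_cone N sig)) m) = 0" using z by (simp add: J(4))
 qed
 then show ?thesis by (simp add: eq cong: sum.cong)
qed

text \<open>The relation is tested at \<open>y + e v\<close> for small \<open>e > 0\<close>: strict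
  inequalities at \<open>y\<close> persist, and those vanishing on \<open>L\<close> become
  inequalities for \<open>v\<close>. This is the induced relation between the tangent cones at
  \<open>y\<close>.\<close>

lemma tangent_relation:
 assumes rel: "generic_relation \<S> (\<lambda>sig. sig) (span N) c"
  and L: "subspace L" "L \<subseteq> span N" and y: "y \<in> L" "\<And>h. h \<in> H \<Longrightarrow> h \<in> perp N L \<or> h y \<noteq> 0"
 shows "generic_relation {sig\<in>\<S>. y \<in> sig} (\<lambda>sig. {v\<in>span N. \<forall>h\<in>Jp sig L. 0 \<le> h v}) (span N) c"
proof -
 from rel obtain Hs where Hs': "finite Hs \<and> (\<forall>h\<in>Hs. linear h \<and> (\<exists>w\<in>span N. h w \<noteq> (0::real))) \<and>
   (\<forall>v\<in>span N. (\<forall>h\<in>Hs. h v \<noteq> 0) \<longrightarrow> (\<Sum>sig\<in>{sig\<in>\<S>. v \<in> sig}. c sig) = 0)"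
  unfolding generic_relation_def by (elim exE)
 then have Hs: "finite Hs" "\<And>h. h \<in> Hs \<Longrightarrow> linear h"
   "\<And>v. v \<in> span N \<Longrightarrow> \<forall>h\<in>Hs. h v \<noteq> 0 \<Longrightarrow> (\<Sum>sig\<in>{sig\<in>\<S>. v \<in> sig}. c sig) = 0"
  by simp_all
 have yN: "y \<in> span N" using y(1) L(2) by blast
 have "(\<Sum>sig\<in>{sig\<in>{sig\<in>\<S>. y \<in> sig}. v \<in> {v\<in>span N. \<forall>h\<in>Jp sig L. 0 \<le> h v}}. c sig) = 0"
  if v: "v \<in> span N" "\<forall>h\<in>Hs. h v \<noteq> 0" for v
 proof -
  have hl: "h (y + e *\<^sub>R v) = h y + e * h v" if "h \<in> H" for h e
   using real_dualD[of h "span N"] that H_props(4) yN v(1) by (simp add: span_scale subset_iff)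
  have "\<forall>\<^sub>F e in at_right 0. \<forall>h\<in>Hs. h y + e * h v \<noteq> 0"
   using Hs(1) v(2) by (subst eventually_ball_finite_distrib) (auto intro!: eventually_ne_line)
  moreover have "\<forall>\<^sub>F e in at_right 0. \<forall>h\<in>H. (0 < h y \<longrightarrow> 0 < h y + e * h v) \<and> (h y < 0 \<longrightarrow> h y + e * h v < 0)"
  proof -
   have "\<forall>\<^sub>F e in at_right 0. (0 < h y \<longrightarrow> 0 < h y + e * h v) \<and> (h y < 0 \<longrightarrow> h y + e * h v < 0)" for h :: "'v \<Rightarrow> real"
   proof (cases "h y" "0::real" rule: linorder_cases)
    case less
    then have "\<forall>\<^sub>F e in at_right 0. 0 < - h y + e * (- h v)" by (intro eventually_pos_line) simp
    then show ?thesis using less by (auto elim!: eventually_mono)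
   next
    case greater
    then show ?thesis using greater eventually_mono by (auto intro!: eventually_pos_line)
   qed auto
   then show ?thesis using H_props(1) by (subst eventually_ball_finite_distrib) auto
  qed
  ultimately have ev: "\<forall>\<^sub>F e in at_right 0. 0 < e \<and> (\<forall>h\<in>Hs. h y + e * h v \<noteq> 0) \<and>
    (\<forall>h\<in>H. (0 < h y \<longrightarrow> 0 < h y + e * h v) \<and> (h y < 0 \<longrightarrow> h y + e * h v < 0))"
   using eventually_at_right_less[of "0::real"] by eventually_elim blast
  obtain e where "0 < e \<and> (\<forall>h\<in>Hs. h y + e * h v \<noteq> 0) \<and>
    (\<forall>h\<in>H. (0 < h y \<longrightarrow> 0 < h y + e * h v) \<and> (h y < 0 \<longrightarrow> h y + e * h v < 0))"
   using eventually_happens'[OF trivial_limit_at_right_real ev] by (elim exE)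
  then have e: "0 < e" "\<forall>h\<in>Hs. h y + e * h v \<noteq> 0"
    "\<And>h. h \<in> H \<Longrightarrow> 0 < h y \<Longrightarrow> 0 < h y + e * h v" "\<And>h. h \<in> H \<Longrightarrow> h y < 0 \<Longrightarrow> h y + e * h v < 0"
   by simp_all
  define u where "u = y + e *\<^sub>R v"
  have u: "u \<in> span N" using yN v(1) by (simp add: u_def span_add span_scale)
  have "(\<Sum>sig\<in>{sig\<in>\<S>. u \<in> sig}. c sig) = 0" using e(2) Hs(2) Hs(3)[OF u] by (simp add: u_def linear_line)
  moreover have "u \<in> sig \<longleftrightarrow> y \<in> sig \<and> v \<in> {v\<in>span N. \<forall>h\<in>Jp sig L. 0 \<le> h v}" if sig: "sig \<in> \<S>" for sig
  proof -
   have "0 \<le> h u \<longleftrightarrow> 0 \<le> h y \<and> (h \<in> perp N L \<longrightarrow> 0 \<le> h v)" if h: "h \<in> J sig" for h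
   proof -
    have hH: "h \<in> H" using h H_props(5)[OF sig] by blast
    show ?thesis using y(1) e(1) y(2)[OF hH] e(3,4)[OF hH] by (auto simp: perp_def u_def hl[OF hH] zero_le_mult_iff not_le[symmetric])
   qed
   then show ?thesis using u yN v(1) by (subst J(5)[OF sig], subst (2) J(5)[OF sig]) auto
  qed
  then have "{sig\<in>{sig\<in>\<S>. y \<in> sig}. v \<in> {v\<in>span N. \<forall>h\<in>Jp sig L. 0 \<le> h v}} = {sig\<in>\<S>. u \<in> sig}" by blast
  ultimately show ?thesis by simp
 qed
 then show ?thesis using Hs' unfolding generic_relation_def by (intro exI[of _ Hs]) blast
qed

text \<open>The tangent cones at \<open>y\<close> have the duals
  \<open>dual_cone N sig \<inter> perp N L\<close>, so their relation passes to the numerators of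
  these cones, and thereby to every homogeneous part.\<close>

lemma tay_relation:
 assumes rel: "generic_relation \<S> (\<lambda>sig. sig) (span N) c"
  and L: "subspace L" "L \<subseteq> span N" and y: "y \<in> L" "\<And>h. h \<in> H \<Longrightarrow> h \<in> perp N L \<or> h y \<noteq> 0"
 shows "(\<Sum>sig\<in>{sig\<in>\<S>. y \<in> sig}. c sig * pointed_cone.tay N (dual_cone N sig \<inter> perp N L) H r xi) = 0"
proof -
 let ?I = "{sig\<in>\<S>. y \<in> sig}" and ?P = "\<lambda>sig. dual_cone N sig \<inter> perp N L"
 have pc: "\<exists>U v0. pointed_cone N (Jp sig L) U v0 (?P sig)" if sig: "sig \<in> ?I" for sig
 proof -
  have "h \<in> perp N L \<or> 0 < h y" if "h \<in> J sig" for h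
  proof -
   have "0 \<le> h y" using sig that J(5)[of sig] by blast
   moreover have "h \<in> H" using sig that H_props(5) by blast
   ultimately show ?thesis using y(2)[of h] by auto
  qed
  then show ?thesis using pointed[of sig L y] sig L y(1) span_base by blast
 qed
 have eq: "pointed_cone.tay N (?P sig) H r xi =
   (\<Sum>m\<in>{m\<in>dual_lat N. mdiff H (cind (?P sig)) m \<noteq> 0}. mdiff H (cind (?P sig)) m * (pairing xi m ^ r / fact r))"
  if "sig \<in> ?I" for sig
  using pc[OF that] by (auto simp: pointed_cone.tay_def pointed_cone.supp_def)
 have fI: "finite ?I" using fin by simp
 have PJ: "?P sig = fcone (Jp sig L)" if "sig \<in> ?I" for sig using pc[OF that] pointed_cone.P_gen by blast
 have z: "(\<Sum>sig\<in>?I. c sig * mdiff H (cind (fcone (Jp sig L))) m) = 0" for m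
  by (rule mdiff_generic_relation[OF H_props(1,4) fI _ tangent_relation[OF rel L y]]) (use H_props(5) in blast)
 have "(\<Sum>sig\<in>?I. c sig * (\<Sum>m\<in>{m\<in>dual_lat N. mdiff H (cind (?P sig)) m \<noteq> 0}. mdiff H (cind (?P sig)) m * (pairing xi m ^ r / fact r))) = 0"
 proof (rule sum_over_supports[OF fI])
  fix sig assume sig: "sig \<in> ?I"
  then have sub: "Jp sig L \<subseteq> H" using H_props(5)[of sig] by blast
  obtain U v0 where p: "pointed_cone N (Jp sig L) U v0 (?P sig)" using pc[OF sig] by blast
  show "finite {m\<in>dual_lat N. mdiff H (cind (?P sig)) m \<noteq> 0}"
   by (rule pointed_cone.finite_support[OF p H_props(1) sub H_props(2)])
 next
  fix m
  show "(\<Sum>sig\<in>?I. c sig * mdiff H (cind (?P sig)) m) = 0" using PJ z by simp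
 qed
 moreover have "(\<Sum>sig\<in>?I. c sig * pointed_cone.tay N (?P sig) H r xi) = (\<Sum>sig\<in>?I. c sig * (\<Sum>m\<in>{m\<in>dual_lat N. mdiff H (cind (?P sig)) m \<noteq> 0}. mdiff H (cind (?P sig)) m * (pairing xi m ^ r / fact r)))"
  by (intro sum.cong refl arg_cong2[where f="(*)"] eq)
 ultimately show ?thesis by simp
qed

text \<open>A vector killed by all generators of the dual lies in the cone together with its
  negative, so it is 0 by strong convexity.\<close>

lemma J_spans:
 assumes sig: "sig \<in> \<S>" shows "real_dual (span N) \<subseteq> span (J sig)"
proof
 have J': "finite (J sig)" "J sig \<subseteq> real_dual (span N)" using J(1)[OF sig] H_props(4) H_props(5)[OF sig] by auto
 fix m assume m: "m \<in> real_dual (span N)"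
 show "m \<in> span (J sig)"
 proof (rule real_dual_annihilator[OF J' m])
  fix v assume v: "v \<in> span N" "\<And>k. k \<in> J sig \<Longrightarrow> k v = 0"
  have "k (- v) = 0" if "k \<in> J sig" for k
   using real_dualD(2)[of k "span N" v "-1"] v that J'(2) by auto
  then have "\<forall>k\<in>J sig. 0 \<le> k v" "\<forall>k\<in>J sig. 0 \<le> k (- v)" using v(2) by (metis order_refl)+
  then have "v \<in> sig \<and> - v \<in> sig" using v(1) span_neg[OF v(1)] by (subst (1 2) J(5)[OF sig]) blast
  then show "m v = 0" using generic_coneD(1)[OF gen[OF sig]] real_dual_0[OF m] by (auto simp: is_cone_def)
 qed
qed

text \<open>In the weighted sum of the interpolation identities these are the coefficients of the
  faces with span \<open>L\<close>. At a generic \<open>y\<close> of \<open>L\<close>, adding those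
  of the faces that contain \<open>y\<close> gives \<open>tay_relation\<close> in one fixed degree:
  the cones containing \<open>y\<close> for which \<open>L\<close> is not the span of a face
  contribute 0 in that degree.\<close>

lemma face_coefficients:
 fixes E :: "'v set \<Rightarrow> 'v set \<Rightarrow> complex"
 assumes rel: "generic_relation \<S> (\<lambda>sig. sig) (span N) c"
  and L: "subspace L" "L \<subseteq> span N" "L \<noteq> span N"
  and xi: "xi \<in> lat_C N"
  and E: "\<And>sig tau. sig \<in> \<S> \<Longrightarrow> tau \<in> cone_faces sig \<Longrightarrow> span tau = L \<Longrightarrow>
   E sig tau = pointed_cone.tay N (dual_cone N sig \<inter> perp N L) H (card H - dim (Jp sig L)) xi / p"
 shows "generic_relation {tau\<in>(\<Union>sig\<in>\<S>. cone_faces sig - {sig}). span tau = L} (\<lambda>tau. tau) L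
  (\<lambda>tau. \<Sum>sig\<in>{sig\<in>\<S>. tau \<in> cone_faces sig - {sig}}. c sig * E sig tau)"
proof -
 let ?F = "{tau\<in>(\<Union>sig\<in>\<S>. cone_faces sig - {sig}). span tau = L}"
 \<comment> \<open>The leading degree for cones having a face with span \<open>L\<close>. For the
   other cones through \<open>y\<close> the generators span less, the leading degree is larger, and
   the part of degree \<open>k\<close> vanishes by \<open>tay_zero\<close>.\<close>
 define k where "k = card H - dim (perp N L)"
 have finF: "finite ?F" using fin generic_coneD(2)[OF gen] by auto
 obtain le where le: "\<And>h. h \<in> real_dual (span N) \<Longrightarrow> linear (le h) \<and> (\<forall>x\<in>span N. le h x = h x)"
  using real_dual_linear by metis
 define Hs where "Hs = le ` (H - perp N L)"
 have 1: "finite Hs" using H_props(1) by (simp add: Hs_def)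
 have 2: "linear g \<and> (\<exists>w\<in>L. g w \<noteq> 0)" if "g \<in> Hs" for g
 proof -
  obtain h where h: "h \<in> H" "h \<notin> perp N L" "g = le h" using \<open>g \<in> Hs\<close> unfolding Hs_def by blast
  have hd: "h \<in> real_dual (span N)" using h(1) H_props(4) by blast
  then obtain w where w: "w \<in> L" "h w \<noteq> 0" using h(2) by (auto simp: perp_def)
  moreover have "w \<in> span N" using w(1) L(2) by blast
  ultimately have "le h w \<noteq> 0" using le[OF hd] by simp
  then show ?thesis using le[OF hd] h(3) w(1) by blast
 qed
 have 3: "(\<Sum>tau\<in>{tau\<in>?F. y \<in> tau}. \<Sum>sig\<in>{sig\<in>\<S>. tau \<in> cone_faces sig - {sig}}. c sig * E sig tau) = 0"
  if y: "y \<in> L" "\<forall>g\<in>Hs. g y \<noteq> 0" for y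
 proof -
  have yH: "h \<in> perp N L \<or> h y \<noteq> 0" if "h \<in> H" for h using that H_props(4) L(2) y(1) y(2) le[of h] by (fastforce simp: Hs_def)
  have inner: "(\<Sum>tau\<in>{tau\<in>{tau\<in>?F. y \<in> tau}. tau \<in> cone_faces sig - {sig}}. c sig * E sig tau) =
    (if y \<in> sig then c sig * pointed_cone.tay N (dual_cone N sig \<inter> perp N L) H k xi / p else 0)"
   if sig: "sig \<in> \<S>" for sig
  proof -
   note gD = generic_coneD[OF gen[OF sig]]
   let ?T = "{tau\<in>{tau\<in>?F. y \<in> tau}. tau \<in> cone_faces sig - {sig}}"
   \<comment> \<open>A face is the intersection of the cone with its own span, so at most one face
     of \<open>sig\<close> has span \<open>L\<close>.\<close>
   have T: "tau = sig \<inter> L \<and> y \<in> sig" if "tau \<in> ?T" for tau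
   proof -
    have tau: "tau \<in> cone_faces sig" "span tau = L" "y \<in> tau" using that by auto
    have "0 \<in> tau" using is_cone_basic(2)[OF gD(5)[OF tau(1)]] .
    then show ?thesis
     using face_eq_Int_span[of tau sig] tau is_cone_basic(1)[OF gD(1)] cone_faces_subset[OF tau(1)] by (auto simp: cone_faces_def)
   qed
   show ?thesis
   proof (cases "y \<in> sig")
    case False
    then have "?T = {}" using T by blast
    then show ?thesis using False by (simp only: sum.empty if_False)
   next
    case True
    have J': "finite (J sig)" "J sig \<subseteq> real_dual (span N)" using J(1)[OF sig] H_props(4) H_props(5)[OF sig] by auto
    have yJ: "h \<in> perp N L \<or> 0 < h y" if "h \<in> J sig" for h
    proof -
     have "0 \<le> h y" using True that J(5)[OF sig] by blast
     moreover have "h \<in> H" using that H_props(5)[OF sig] by blast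
     ultimately show ?thesis using yH[of h] by auto
    qed
    have pcx: "\<exists>U v0. pointed_cone N (Jp sig L) U v0 (dual_cone N sig \<inter> perp N L)"
     using pointed[OF sig L(2) True _ yJ] y(1) span_base by blast
    then obtain U v0 where pc: "pointed_cone N (Jp sig L) U v0 (dual_cone N sig \<inter> perp N L)" by blast
    have sub: "Jp sig L \<subseteq> H" using H_props(5)[OF sig] by blast
    show ?thesis
    proof (cases "?T = {}")
     case False
     then obtain tau where tau: "tau \<in> ?T" by blast
     then have Ts: "?T = {tau}" using T by blast
     have t: "tau \<in> cone_faces sig" "span tau = L" "y \<in> tau" using tau by auto
     have "span (Jp sig L) = perp N L"
      using face_imp_span_perp[OF J' J(5)[OF sig] L(1,2) True y(1) yJ _ t(3,2)] t(1) by (simp add: cone_faces_def)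
     then have "dim (Jp sig L) = dim (perp N L)" by (metis dim_span)
     then show ?thesis using E[OF sig t(1,2)] True unfolding Ts by (simp add: k_def)
    next
     case Tempty: True
     have "span (Jp sig L) \<noteq> perp N L"
     proof
      assume "span (Jp sig L) = perp N L"
      note f = span_perp_imp_face[OF J' J(5)[OF sig] L(1,2) True y(1) yJ this]
      have "sig \<inter> L \<in> cone_faces sig" using f(1) True y(1) by (auto simp: cone_faces_def)
      moreover have "sig \<inter> L \<noteq> sig" using f(2) full[OF sig] L(3) by auto
      ultimately have "sig \<inter> L \<in> ?T" using sig f(2) True y(1) by blast
      then show False using Tempty by blast
     qed
     moreover have "subspace (perp N L)"
      using subspace_real_dual[of "span N"] by (auto simp: perp_def subspace_def zero_fun_def plus_fun_def)
     moreover obtain B where "lattice_basis B (dual_lat N)" using is_lattice_dual_lat[OF N] by (auto simp: is_lattice_def)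
     then have "finite B" "span B = real_dual (span N)"
      using lattice_basisD(1,4)[of B "dual_lat N"] span_dual_lat[OF N] by auto
     moreover have "perp N L \<subseteq> real_dual (span N)" by (rule perp_sub_real_dual)
     ultimately have lt: "dim (Jp sig L) < dim (perp N L)"
      by (intro dim_lt_if_span_ne[of _ _ B]) auto
     have "perp N L \<subseteq> span H"
      using perp_sub_real_dual[of N L] J_spans[OF sig] span_mono[OF H_props(5)[OF sig]] by blast
     then have "dim (perp N L) \<le> card H" by (rule dim_le_card[OF _ H_props(1)])
     then have "k < card H - dim (Jp sig L)" using lt by (simp add: k_def)
     then have "pointed_cone.tay N (dual_cone N sig \<inter> perp N L) H k xi = 0"
      by (rule pointed_cone.tay_zero[OF pc H_props(1) sub H_props(2) _ xi])
     then show ?thesis unfolding Tempty by simp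
    qed
   qed
  qed
  have fy: "finite {tau\<in>?F. y \<in> tau}" by (rule finite_subset[OF _ finF]) blast
  have "(\<Sum>tau\<in>{tau\<in>?F. y \<in> tau}. \<Sum>sig\<in>{sig\<in>\<S>. tau \<in> cone_faces sig - {sig}}. c sig * E sig tau) =
   (\<Sum>sig\<in>\<S>. \<Sum>tau\<in>{tau\<in>{tau\<in>?F. y \<in> tau}. tau \<in> cone_faces sig - {sig}}. c sig * E sig tau)"
   by (rule sum.swap_restrict[OF fy fin])
  also have "\<dots> = (\<Sum>sig\<in>\<S>. if y \<in> sig then c sig * pointed_cone.tay N (dual_cone N sig \<inter> perp N L) H k xi / p else 0)"
   by (intro sum.cong refl inner)
  also have "\<dots> = (\<Sum>sig\<in>{sig\<in>\<S>. y \<in> sig}. c sig * pointed_cone.tay N (dual_cone N sig \<inter> perp N L) H k xi) / p"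
   using fin by (simp add: sum.If_cases Int_def sum_divide_distrib)
  also have "\<dots> = 0" using tay_relation[OF rel L(1,2) y(1) yH] by simp
  finally show ?thesis .
 qed
 show ?thesis unfolding generic_relation_def using 1 2 3 by (intro exI[of _ Hs]) blast
qed

text \<open>Summing the interpolation identities with the weights \<open>c\<close> makes the
  exponential sums cancel. The proper faces cancel as well, by \<open>face_coefficients\<close> and
  the induction hypothesis for each span, and the terms of the cones themselves remain.\<close>

lemma additive_full:
 assumes IH: "\<And>L \<F>. finite \<F> \<Longrightarrow> (\<And>tau. tau \<in> \<F> \<Longrightarrow> generic_cone N Psi tau \<and> span tau = L) \<Longrightarrow> dim L < dim (span N) \<Longrightarrow>
   \<exists>D. dens (lat_C N) D \<and> (\<forall>xi\<in>D. additive_at N Psi \<F> L xi)"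
 shows "\<exists>D. dens (lat_C N) D \<and> (\<forall>xi\<in>D. additive_at N Psi \<S> (span N) xi)"
proof -
 let ?\<mu> = "SI_interpolator N Psi"
 define \<F> where "\<F> = (\<Union>sig\<in>\<S>. cone_faces sig - {sig})"
 have finF: "finite \<F>" using fin generic_coneD(2)[OF gen] by (auto simp: \<F>_def)
 have F: "generic_cone N Psi tau" "subspace (span tau)" "span tau \<subseteq> span N" "dim (span tau) < dim (span N)" if "tau \<in> \<F>" for tau
 proof -
  obtain sig where sig: "sig \<in> \<S>" "tau \<in> cone_faces sig" "tau \<noteq> sig" using \<open>tau \<in> \<F>\<close> by (auto simp: \<F>_def)
  show "generic_cone N Psi tau" by (rule generic_cone_face[OF gen[OF sig(1)] sig(2)])
  show "subspace (span tau)" by simp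
  show "span tau \<subseteq> span N" using span_mono[OF cone_faces_subset[OF sig(2)]] full[OF sig(1)] by simp
  show "dim (span tau) < dim (span N)"
   using cone_faces_dim[OF gen[OF sig(1)] sig(2,3)] full[OF sig(1)] by (metis dim_span)
 qed
 have A: "\<exists>D. dens (lat_C N) D \<and> (\<forall>xi\<in>D. \<forall>sig\<in>\<S>. den H xi \<noteq> 0 \<and>
   exp_sum N (dual_cone N sig) xi = pointed_cone.num N (dual_cone N sig) H xi / den H xi)" (is "\<exists>D. _ \<and> (\<forall>xi\<in>D. ?A xi)")
 proof (rule dens_ex[OF fin])
  fix sig assume sig: "sig \<in> \<S>"
  obtain U v0 where "pointed_cone N (J sig) U v0 (dual_cone N sig)"
   using pointed_cone_full[OF N gen[OF sig] full[OF sig] J(1-4)[OF sig]] by blast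
  from pointed_cone.exp_sum_char[OF this H_props(1) H_props(5)[OF sig] H_props(2,3)]
  show "\<exists>D. dens (lat_C N) D \<and> (\<forall>xi\<in>D. den H xi \<noteq> 0 \<and>
   exp_sum N (dual_cone N sig) xi = pointed_cone.num N (dual_cone N sig) H xi / den H xi)" .
 qed
 have B: "\<exists>D. dens (lat_C N) D \<and> (\<forall>xi\<in>D. \<forall>sig\<in>\<S>. \<forall>tau\<in>cone_faces sig. exp_integral N (dual_cone N sig \<inter> perp N tau) xi =
   pointed_cone.tay N (dual_cone N sig \<inter> perp N tau) H (card H - dim (Jp sig tau)) xi / (\<Prod>h\<in>H. - pairing xi h))" (is "\<exists>D. _ \<and> (\<forall>xi\<in>D. ?B xi)")
 proof (rule dens_ex[OF fin], rule dens_ex[OF generic_coneD(2)[OF gen]])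
  fix sig tau assume sig: "sig \<in> \<S>" and tau: "tau \<in> cone_faces sig"
  obtain U v0 where pc: "pointed_cone N (Jp sig tau) U v0 (dual_cone N sig \<inter> perp N tau)"
   using pointed_cone_face[OF N gen[OF sig] full[OF sig] tau J(1-4)[OF sig]] by blast
  have sub: "Jp sig tau \<subseteq> H" using H_props(5)[OF sig] by blast
  from pointed_cone.exp_integral_char[OF pc H_props(1) sub H_props(2,3)]
  show "\<exists>D. dens (lat_C N) D \<and> (\<forall>xi\<in>D. exp_integral N (dual_cone N sig \<inter> perp N tau) xi =
   pointed_cone.tay N (dual_cone N sig \<inter> perp N tau) H (card H - dim (Jp sig tau)) xi / (\<Prod>h\<in>H. - pairing xi h))" by blast
 qed
 have C: "\<exists>D. dens (lat_C N) D \<and> (\<forall>xi\<in>D. \<forall>sig\<in>\<S>. exp_sum N (dual_cone N sig) xi =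
   (\<Sum>tau\<in>cone_faces sig. ?\<mu> tau xi * exp_integral N (dual_cone N sig \<inter> perp N tau) xi))" (is "\<exists>D. _ \<and> (\<forall>xi\<in>D. ?C xi)")
  using SI_interpolatorD(2)[OF N Psi gen full] by (intro dens_ex[OF fin]) (simp add: mero_eq_dens)
 have D: "\<exists>D. dens (lat_C N) D \<and> (\<forall>xi\<in>D. \<forall>sig\<in>\<S>. exp_integral N (dual_cone N sig \<inter> perp N sig) xi = 1)" (is "\<exists>D. _ \<and> (\<forall>xi\<in>D. ?D xi)")
  by (intro dens_ex[OF fin] exp_integral_apex[OF N gen full])
 have E: "\<exists>D. dens (lat_C N) D \<and> (\<forall>xi\<in>D. \<forall>L\<in>span ` \<F>. additive_at N Psi {tau\<in>\<F>. span tau = L} L xi)" (is "\<exists>D. _ \<and> (\<forall>xi\<in>D. ?E xi)")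
 proof (rule dens_ex)
  show "finite (span ` \<F>)" using finF by simp
  fix L assume "L \<in> span ` \<F>"
  then obtain tau0 where tau0: "tau0 \<in> \<F>" "L = span tau0" by blast
  show "\<exists>D. dens (lat_C N) D \<and> (\<forall>xi\<in>D. additive_at N Psi {tau\<in>\<F>. span tau = L} L xi)"
  proof (rule IH)
   show "finite {tau\<in>\<F>. span tau = L}" using finF by simp
   show "generic_cone N Psi tau \<and> span tau = L" if "tau \<in> {tau\<in>\<F>. span tau = L}" for tau using that F(1)[of tau] by blast
   show "dim L < dim (span N)" using F(4)[OF tau0(1)] tau0(2) by simp
  qed
 qed
 obtain D where D: "dens (lat_C N) D" and DA: "\<forall>xi\<in>D. ?A xi \<and> ?B xi \<and> ?C xi \<and> ?D xi \<and> ?E xi"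
  using dens_ex2[OF A dens_ex2[OF B dens_ex2[OF C dens_ex2[OF D E]]]] by blast
 have D1: "exp_sum N (dual_cone N sig) xi = pointed_cone.num N (dual_cone N sig) H xi / den H xi" if "xi \<in> D" "sig \<in> \<S>" for xi sig
  using DA that by blast
 have D2: "exp_integral N (dual_cone N sig \<inter> perp N tau) xi =
   pointed_cone.tay N (dual_cone N sig \<inter> perp N tau) H (card H - dim (Jp sig tau)) xi / (\<Prod>h\<in>H. - pairing xi h)"
  if "xi \<in> D" "sig \<in> \<S>" "tau \<in> cone_faces sig" for xi sig tau using DA that by blast
 have D3: "exp_sum N (dual_cone N sig) xi =
   (\<Sum>tau\<in>cone_faces sig. ?\<mu> tau xi * exp_integral N (dual_cone N sig \<inter> perp N tau) xi)" if "xi \<in> D" "sig \<in> \<S>" for xi sig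
  using DA that by blast
 have D4: "exp_integral N (dual_cone N sig \<inter> perp N sig) xi = 1" if "xi \<in> D" "sig \<in> \<S>" for xi sig
  using DA that by blast
 have D5: "additive_at N Psi {tau\<in>\<F>. span tau = L} L xi" if "xi \<in> D" "L \<in> span ` \<F>" for xi L
  using DA that by blast
 show ?thesis
 proof (intro exI[of _ D] conjI D ballI)
  fix xi assume xiD: "xi \<in> D"
  then have xi: "xi \<in> lat_C N" using dens_subset[OF D] by blast
  show "additive_at N Psi \<S> (span N) xi" unfolding additive_at_def
  proof (intro allI impI)
   fix c assume rel: "generic_relation \<S> (\<lambda>sig. sig) (span N) c"
   define E where "E sig tau = exp_integral N (dual_cone N sig \<inter> perp N tau) xi" for sig tau
   define e where "e tau = (\<Sum>sig\<in>{sig\<in>\<S>. tau \<in> cone_faces sig - {sig}}. c sig * E sig tau)" for tau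
   have "0 = (\<Sum>sig\<in>\<S>. c sig * exp_sum N (dual_cone N sig) xi)"
    using num_relation[OF rel, of xi] by (simp add: D1[OF xiD] flip: sum_divide_distrib)
   also have "\<dots> = (\<Sum>sig\<in>\<S>. c sig * ?\<mu> sig xi + (\<Sum>tau\<in>cone_faces sig - {sig}. c sig * E sig tau * ?\<mu> tau xi))"
   proof (rule sum.cong[OF refl])
    fix sig assume sig: "sig \<in> \<S>"
    note gD = generic_coneD[OF gen[OF sig]]
    have "(\<Sum>tau\<in>cone_faces sig. ?\<mu> tau xi * E sig tau) = ?\<mu> sig xi * E sig sig + (\<Sum>tau\<in>cone_faces sig - {sig}. ?\<mu> tau xi * E sig tau)"
     by (rule sum.remove[OF gD(2,3)])
    then show "c sig * exp_sum N (dual_cone N sig) xi = c sig * ?\<mu> sig xi + (\<Sum>tau\<in>cone_faces sig - {sig}. c sig * E sig tau * ?\<mu> tau xi)"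
     using D3[OF xiD sig] D4[OF xiD sig] by (simp add: E_def algebra_simps sum_distrib_left)
   qed
   also have "\<dots> = (\<Sum>sig\<in>\<S>. c sig * ?\<mu> sig xi) + (\<Sum>sig\<in>\<S>. \<Sum>tau\<in>cone_faces sig - {sig}. c sig * E sig tau * ?\<mu> tau xi)"
    by (rule sum.distrib)
   also have "(\<Sum>sig\<in>\<S>. \<Sum>tau\<in>cone_faces sig - {sig}. c sig * E sig tau * ?\<mu> tau xi) =
     (\<Sum>sig\<in>\<S>. \<Sum>tau\<in>{tau\<in>\<F>. tau \<in> cone_faces sig - {sig}}. c sig * E sig tau * ?\<mu> tau xi)"
    by (intro sum.cong refl) (auto simp: \<F>_def)
   also have "\<dots> = (\<Sum>tau\<in>\<F>. \<Sum>sig\<in>{sig\<in>\<S>. tau \<in> cone_faces sig - {sig}}. c sig * E sig tau * ?\<mu> tau xi)"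
    by (rule sum.swap_restrict[OF fin finF])
   also have "\<dots> = (\<Sum>tau\<in>\<F>. e tau * ?\<mu> tau xi)" by (simp add: e_def sum_distrib_right)
   \<comment> \<open>The induction hypothesis concerns families with a common span, so the faces are
     grouped accordingly.\<close>
   also have "\<dots> = (\<Sum>L\<in>span ` \<F>. \<Sum>tau\<in>{tau\<in>\<F>. span tau = L}. e tau * ?\<mu> tau xi)"
    using finF by (intro sum.group[symmetric]) auto
   also have "\<dots> = 0"
   proof (rule sum.neutral, rule ballI)
    fix L assume L: "L \<in> span ` \<F>"
    then obtain tau0 where tau0: "tau0 \<in> \<F>" "L = span tau0" by blast
    have Lp: "subspace L" "L \<subseteq> span N" "L \<noteq> span N" using F(2-4)[OF tau0(1)] unfolding tau0(2) by (metis, metis, metis less_irrefl)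
    have "generic_relation {tau\<in>(\<Union>sig\<in>\<S>. cone_faces sig - {sig}). span tau = L} (\<lambda>tau. tau) L
     (\<lambda>tau. \<Sum>sig\<in>{sig\<in>\<S>. tau \<in> cone_faces sig - {sig}}. c sig * E sig tau)"
    proof (rule face_coefficients[OF rel Lp xi])
     fix sig tau assume *: "sig \<in> \<S>" "tau \<in> cone_faces sig" "span tau = L"
     have "tau \<subseteq> span N" using span_superset[of tau] *(3) Lp(2) by auto
     then have "perp N tau = perp N L" using perp_span *(3) by metis
     then show "E sig tau = pointed_cone.tay N (dual_cone N sig \<inter> perp N L) H (card H - dim (Jp sig L)) xi / (\<Prod>h\<in>H. - pairing xi h)"
      using D2[OF xiD *(1,2)] by (simp only: E_def)
    qed
    then show "(\<Sum>tau\<in>{tau\<in>\<F>. span tau = L}. e tau * ?\<mu> tau xi) = 0"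
     using D5[OF xiD L] unfolding additive_at_def e_def \<F>_def by blast
   qed
   finally show "(\<Sum>sig\<in>\<S>. c sig * ?\<mu> sig xi) = 0" by simp
  qed
 qed
qed

end

text \<open>Cones with the same span share sublattice, induced map and projection, so heredity pulls
  the full-dimensional case back to \<open>N\<close>.\<close>

theorem SI_interpolator_additive:
 fixes N :: "'v::euclidean_space set"
 assumes "is_lattice N" "is_complement_map N Psi" "finite \<S>" "\<And>sig. sig \<in> \<S> \<Longrightarrow> generic_cone N Psi sig \<and> span sig = W"
 shows "\<exists>D. dens (lat_C N) D \<and> (\<forall>xi\<in>D. additive_at N Psi \<S> W xi)"
 using assms
proof (induction "dim W" arbitrary: N Psi \<S> W rule: less_induct)
 case less
 note N = less.prems(1) and Psi = less.prems(2) and fin = less.prems(3) and gen = less.prems(4)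
 show ?case
 proof (cases "\<S> = {}")
  case True
  then show ?thesis by (intro exI[of _ "lat_C N"]) (simp add: dens_self additive_at_def)
 next
  case False
  then obtain sig0 where sig0: "sig0 \<in> \<S>" by blast
  define N' Psi' where "N' = sublat N sig0" and "Psi' = induced_map N Psi sig0"
  have L0: "lat_Q (sublat N sig0) \<in> subspaces Psi" using generic_coneD(4) gen[OF sig0] by blast
  have N': "is_lattice N'" "is_complement_map N' Psi'"
   unfolding N'_def Psi'_def by (rule is_lattice_sublat[OF N], rule is_complement_map_induced[OF Psi L0])
  have W: "span N' = W" using is_cone_basic(4)[OF generic_coneD(1), of N Psi sig0] gen[OF sig0] by (simp add: N'_def)
  have same: "sublat N sig = N'" "induced_map N Psi sig = Psi'" "proj_C N Psi sig = proj_C N Psi sig0" if "sig \<in> \<S>" for sig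
   using span_sublat_eq[OF generic_coneD(1)[of N Psi sig] generic_coneD(1)[of N Psi sig0]] gen[OF that] gen[OF sig0]
   by (simp_all add: N'_def Psi'_def)
  have gen': "generic_cone N' Psi' sig \<and> span sig = span N'" if "sig \<in> \<S>" for sig
   using generic_cone_full[of N Psi sig] gen[OF that] same[OF that] by simp
  define Q where "Q sig J \<longleftrightarrow> finite J \<and> J \<subseteq> dual_lat N' \<and> 0 \<notin> J \<and> dual_cone N' sig = fcone J \<and> sig = {v\<in>span N'. \<forall>h\<in>J. 0 \<le> h v}"
   for sig J
  have "\<exists>J. Q sig J" if "sig \<in> \<S>" for sig
   by (rule dual_generators[OF N'(1) generic_coneD(1)[OF conjunct1[OF gen'[OF that]]]]) (unfold Q_def, blast)
  then obtain J where J: "\<And>sig. sig \<in> \<S> \<Longrightarrow> Q sig (J sig)" by metis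
  have "\<exists>D. dens (lat_C N') D \<and> (\<forall>xi\<in>D. additive_at N' Psi' \<S> (span N') xi)"
  proof (rule additive_full[OF N' fin, of J, OF _ _ _ _ _ _ _ refl])
   fix L \<F> assume "finite \<F>" "\<And>tau. tau \<in> \<F> \<Longrightarrow> generic_cone N' Psi' tau \<and> span tau = L" "dim L < dim (span N')"
   then show "\<exists>D. dens (lat_C N') D \<and> (\<forall>xi\<in>D. additive_at N' Psi' \<F> L xi)"
    using less.hyps[of L N' Psi' \<F>] N' W by simp
  qed (use gen' J in \<open>unfold Q_def, blast\<close>)+
  then obtain D' where D': "dens (lat_C N') D'" "\<And>xi. xi \<in> D' \<Longrightarrow> additive_at N' Psi' \<S> W xi" unfolding W by blast
  have "\<exists>D. dens (lat_C N) D \<and> (\<forall>xi\<in>D. \<forall>sig\<in>\<S>. SI_interpolator N Psi sig xi = SI_interpolator N' Psi' sig (proj_C N Psi sig0 xi))"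
  proof (rule dens_ex[OF fin])
   fix sig assume sig: "sig \<in> \<S>"
   then have "generic_cone N Psi sig" using gen by blast
   from SI_interpolatorD(3)[OF N Psi this] show "\<exists>D. dens (lat_C N) D \<and> (\<forall>xi\<in>D. SI_interpolator N Psi sig xi = SI_interpolator N' Psi' sig (proj_C N Psi sig0 xi))"
    unfolding mero_eq_dens same[OF sig] .
  qed
  then obtain D where D: "dens (lat_C N) D"
   "\<And>xi sig. xi \<in> D \<Longrightarrow> sig \<in> \<S> \<Longrightarrow> SI_interpolator N Psi sig xi = SI_interpolator N' Psi' sig (proj_C N Psi sig0 xi)" by blast
  have "dens (lat_C N) (D \<inter> {xi\<in>lat_C N. proj_C N Psi sig0 xi \<in> D'})"
   by (intro dens_Int D(1) dens_vimage[OF cproj_proj_C[OF N Psi L0]]) (use D'(1) in \<open>simp add: N'_def\<close>)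
  moreover have "additive_at N Psi \<S> W xi" if "xi \<in> D \<inter> {xi\<in>lat_C N. proj_C N Psi sig0 xi \<in> D'}" for xi
   using D'(2)[of "proj_C N Psi sig0 xi"] that D(2)[of xi] by (simp add: additive_at_def)
  ultimately show ?thesis by blast
 qed
qed

section \<open>Decompositions along a simplicial cone\<close>

lemma holo_on_subspace: "holo_on X U F \<Longrightarrow> X' \<subseteq> X \<Longrightarrow> V \<subseteq> U \<Longrightarrow> holo_on X' V F"
 unfolding holo_on_def by (meson has_derivative_subset subset_iff)

text \<open>Keeps of a complement map only the projections of the span of \<open>G\<close> to its
  coordinate subspaces, with their compatibility.\<close>

locale simplicial_projections =
 fixes G :: "'v::euclidean_space set" and p :: "'v set \<Rightarrow> 'v \<Rightarrow> 'v"
 assumes G: "finite G" "independent G"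
  and p: "\<And>B. B \<subseteq> G \<Longrightarrow> linear (p B)" "\<And>B x. B \<subseteq> G \<Longrightarrow> x \<in> span G \<Longrightarrow> p B x \<in> span B"
   "\<And>B x. B \<subseteq> G \<Longrightarrow> x \<in> span B \<Longrightarrow> p B x = x"
   "\<And>A B x. A \<subseteq> B \<Longrightarrow> B \<subseteq> G \<Longrightarrow> x \<in> span G \<Longrightarrow> p A (p B x) = p A x"
begin

abbreviation "X \<equiv> lat_C G"

definition P where "P B = map_prod (p B) (p B)"

definition z where "z j eta = pairing eta (crd G j)"

text \<open>Will turn out to be the coefficient with which the divisor of the ray through
  \<open>i\<close> sends the face on \<open>C\<close> to the face on \<open>insert j C\<close>; see
  \<open>coeff_D_face\<close>.\<close>

definition c where "c i C j = crd G i (j - p C j)"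

lemma lat_C_mono: "A \<subseteq> B \<Longrightarrow> lat_C A \<subseteq> lat_C B"
 using span_mono[of A B] by (auto simp: lat_C_def)

lemma cproj_P: "B \<subseteq> G \<Longrightarrow> cproj (P B) X (lat_C B)"
 using p(1-3)[of B] lat_C_mono[of B G] csub_lat_C[of G] csub_lat_C[of B]
 by (auto simp: cproj_def P_def lat_C_def clin_map_prod)

lemma P_mem: "B \<subseteq> G \<Longrightarrow> eta \<in> X \<Longrightarrow> P B eta \<in> lat_C B" and P_id: "B \<subseteq> G \<Longrightarrow> eta \<in> lat_C B \<Longrightarrow> P B eta = eta"
 and clin_P: "B \<subseteq> G \<Longrightarrow> clin (P B)"
 using cproj_P by (auto simp: cproj_def)

lemma P_P: "A \<subseteq> B \<Longrightarrow> B \<subseteq> G \<Longrightarrow> eta \<in> X \<Longrightarrow> P A (P B eta) = P A eta"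
 using p(4) by (auto simp: P_def lat_C_def)

lemma crd_dual: "crd G j \<in> real_dual (span G)"
 by (rule crd_in_real_dual[OF G(2)])

lemma z_0: "z j 0 = 0"
 by (simp add: z_def pairing_def real_dual_0[OF crd_dual] complex_eq_iff)

lemma holo_z: "holo_on X X (z j)"
 unfolding z_def by (rule holo_on_pairing[OF crd_dual]) simp

lemma z_zero:
 assumes "B \<subseteq> G" "eta \<in> lat_C B" "j \<notin> B" shows "z j eta = 0"
proof -
 have "crd G j x = 0" if "x \<in> span B" for x
  using real_vector.representation_extend[OF G(2) that assms(1)] assms(3) real_vector.representation_ne_zero[of B x j] by metis
 then show ?thesis using assms(2) by (auto simp: z_def pairing_def lat_C_def complex_eq_iff)
qed

lemma crd_expand: "x \<in> span G \<Longrightarrow> (\<Sum>j\<in>G. crd G j x *\<^sub>R j) = x"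
 using real_vector.sum_representation_eq[OF G(2) _ G(1) subset_refl] by simp

text \<open>The difference of a coordinate and its pullback from the subspace of \<open>C\<close>
  vanishes on that subspace, so it is a combination of the coordinates; its values on the basis are
  the \<open>c i C j\<close>.\<close>

lemma z_expand:
 assumes C: "C \<subseteq> G" and eta: "eta \<in> X"
 shows "z i eta - z i (P C eta) = (\<Sum>j\<in>G. of_real (c i C j) * z j eta)"
proof -
 have "crd G i x - crd G i (p C x) = (\<Sum>j\<in>G. c i C j * crd G j x)" if x: "x \<in> span G" for x
 proof -
  have sub: "span C \<subseteq> span G" by (rule span_mono[OF C])
  have jm: "j - p C j \<in> span G" if "j \<in> G" for j
   using p(2)[OF C span_base[OF that]] sub that by (intro span_diff) (auto intro: span_base)
  have "x - p C x = (\<Sum>j\<in>G. crd G j x *\<^sub>R j) - p C (\<Sum>j\<in>G. crd G j x *\<^sub>R j)" using crd_expand[OF x] by simp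
  also have "\<dots> = (\<Sum>j\<in>G. crd G j x *\<^sub>R (j - p C j))"
   using p(1)[OF C] by (simp add: linear_sum linear_scale scaleR_diff_right sum_subtractf)
  finally have "crd G i (x - p C x) = (\<Sum>j\<in>G. crd G i (crd G j x *\<^sub>R (j - p C j)))"
   using jm by (simp only:) (intro real_dual_sum[OF crd_dual] span_scale)
  also have "\<dots> = (\<Sum>j\<in>G. c i C j * crd G j x)"
   using jm by (intro sum.cong refl) (simp add: real_dualD(2)[OF crd_dual] c_def mult.commute)
  finally show ?thesis using real_dual_diff[OF crd_dual x, of "p C x"] p(2)[OF C x] sub by auto
 qed
 then show ?thesis using eta by (auto simp: z_def P_def pairing_def lat_C_def complex_eq_iff)
qed

lemma c_zero: "C \<subseteq> G \<Longrightarrow> j \<in> C \<Longrightarrow> c i C j = 0"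
 using p(3)[of C j] by (simp add: c_def span_base real_dual_0[OF crd_dual])

abbreviation "near Q \<equiv> eventually Q (nhds (0 :: 'v \<times> 'v))"

lemma near_P: "near Q \<Longrightarrow> B \<subseteq> G \<Longrightarrow> near (\<lambda>eta. Q (P B eta))"
proof -
 assume Q: "near Q" and B: "B \<subseteq> G"
 have "(P B \<longlongrightarrow> P B 0) (nhds 0)" using clin_P[OF B] clin_continuous[OF clin_P[OF B], of UNIV]
  by (simp add: clin_def continuous_on_eq_continuous_at isCont_def tendsto_at_iff_tendsto_nhds)
 then have "filterlim (P B) (nhds 0) (nhds 0)" using linear_0[of "P B"] clin_P[OF B] by (simp add: clin_def)
 then show ?thesis using Q by (simp add: filterlim_iff)
qed

definition zprod where "zprod C eta = (\<Prod>j\<in>C. - z j eta)"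

text \<open>A decomposition of \<open>\<phi>\<close> near 0, simultaneously on all coordinate subspaces \<open>lat_C B\<close>; the second
 conjunct says that \<open>U B\<close> is pulled back along the projection to \<open>lat_C B\<close>.\<close>

definition good_on :: "('v \<times> 'v) set \<Rightarrow> ('v \<times> 'v \<Rightarrow> complex) \<Rightarrow> ('v set \<Rightarrow> 'v \<times> 'v \<Rightarrow> complex) \<Rightarrow> bool"
 where "good_on S \<phi> U \<longleftrightarrow> (\<forall>B\<subseteq>G. holo_on X (X \<inter> S) (U B) \<and> (\<forall>eta\<in>X. U B (P B eta) = U B eta) \<and>
  (\<forall>eta\<in>lat_C B \<inter> S. (\<Sum>C\<in>Pow B. U C eta * zprod C eta) = \<phi> eta))"

definition good where "good \<phi> U \<longleftrightarrow> (\<exists>S. open S \<and> 0 \<in> S \<and> good_on S \<phi> U)"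

lemma good_onD:
 assumes "good_on S \<phi> U" "B \<subseteq> G"
 shows "holo_on X (X \<inter> S) (U B)" "eta \<in> X \<Longrightarrow> U B (P B eta) = U B eta"
  "eta \<in> lat_C B \<Longrightarrow> eta \<in> S \<Longrightarrow> (\<Sum>C\<in>Pow B. U C eta * zprod C eta) = \<phi> eta"
 using assms unfolding good_on_def by blast+

lemma finite_sub: "B \<subseteq> G \<Longrightarrow> finite B"
 using G(1) finite_subset by blast

lemma good_one: "good (\<lambda>_. 1) (\<lambda>B _. if B = {} then 1 else 0)"
proof -
 have "(\<Sum>C\<in>Pow B. (if C = {} then 1 else 0) * zprod C eta) = 1" if "B \<subseteq> G" for B eta
  using finite_sub[OF that] by (simp add: if_distrib[of "\<lambda>x. x * _"] zprod_def cong: if_cong)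
 then show ?thesis by (auto simp: good_on_def holo_on_const good_def)
qed

text \<open>Multiplying the summand of \<open>C\<close> by \<open>- z i\<close>, the factor splits
  by \<open>z_expand\<close> into its pullback from the subspace of \<open>C\<close>, which stays
  with \<open>C\<close>, and multiples of \<open>- z j\<close>, each of which completes
  \<open>zprod C\<close> to \<open>zprod (insert j C)\<close>. Collecting the terms of
  \<open>B\<close> gives this formula.\<close>

definition mult_op where "mult_op i U B eta = - z i (P B eta) * U B eta + (\<Sum>j\<in>B. of_real (c i (B - {j}) j) * U (B - {j}) eta)"

definition D where "D i t B = (\<Sum>j\<in>B. of_real (c i (B - {j}) j) * t (B - {j}))"

lemma mult_op_0: "B \<subseteq> G \<Longrightarrow> mult_op i U B 0 = D i (\<lambda>C. U C 0) B"
 using P_id[of B 0] csubD(6)[OF csub_lat_C[of B]] by (simp add: mult_op_def D_def z_0)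

lemma sum_insert_swap:
 fixes f :: "'v set \<Rightarrow> 'v \<Rightarrow> complex"
 assumes "finite B"
 shows "(\<Sum>C\<in>Pow B. \<Sum>j\<in>C. f (C - {j}) j) = (\<Sum>C\<in>Pow B. \<Sum>j\<in>B - C. f C j)"
proof -
 have "(\<Sum>C\<in>Pow B. \<Sum>j\<in>C. f (C - {j}) j) = (\<Sum>(C, j)\<in>(SIGMA C:Pow B. C). f (C - {j}) j)"
  using assms by (intro sum.Sigma) (auto intro: finite_subset)
 also have "\<dots> = (\<Sum>(C, j)\<in>(SIGMA C:Pow B. B - C). f C j)"
  by (rule sum.reindex_bij_witness[of _ "\<lambda>(C, j). (insert j C, j)" "\<lambda>(C, j). (C - {j}, j)"]) auto
 also have "\<dots> = (\<Sum>C\<in>Pow B. \<Sum>j\<in>B - C. f C j)"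
  using assms by (intro sum.Sigma[symmetric]) auto
 finally show ?thesis .
qed

lemma holo_z_P: "B \<subseteq> G \<Longrightarrow> holo_on X X (\<lambda>eta. z i (P B eta))"
 by (rule holo_on_compose_linear[OF holo_on_subspace[OF holo_z lat_C_mono lat_C_mono] clin_P]) (auto simp: P_mem)

lemma good_on_mult:
 assumes U: "good_on S \<phi> U"
 shows "good_on S (\<lambda>eta. - z i eta * \<phi> eta) (mult_op i U)"
 unfolding good_on_def
proof (intro allI impI conjI ballI)
 fix B assume B: "B \<subseteq> G"
 have Bj: "B - {j} \<subseteq> G" for j using B by auto
 show "holo_on X (X \<inter> S) (mult_op i U B)" unfolding mult_op_def
  by (intro holo_on_add holo_on_mult holo_on_sum holo_on_const holo_on_uminus holo_on_subset[OF holo_z_P[OF B]] good_onD(1)[OF U] B Bj) auto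
 have fin: "finite B" by (rule finite_sub[OF B])
 show "mult_op i U B (P B eta) = mult_op i U B eta" if eta: "eta \<in> X" for eta
 proof -
  have "U (B - {j}) (P B eta) = U (B - {j}) eta" for j
  proof -
   have "P B eta \<in> X" using P_mem[OF B eta] lat_C_mono[OF B] by auto
   from good_onD(2)[OF U Bj[of j] this] show ?thesis
    using good_onD(2)[OF U Bj[of j] eta] P_P[of "B - {j}" B eta] B eta by auto
  qed
  then show ?thesis using good_onD(2)[OF U B eta] by (simp add: mult_op_def P_P[OF subset_refl B eta])
 qed
 show "(\<Sum>C\<in>Pow B. mult_op i U C eta * zprod C eta) = - z i eta * \<phi> eta" if eta: "eta \<in> lat_C B \<inter> S" for eta
 proof -
  have eta: "eta \<in> lat_C B" "eta \<in> S" and etaX: "eta \<in> X" using eta lat_C_mono[OF B] by auto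
  define f where "f C j = of_real (c i C j) * U C eta * zprod (insert j C) eta" for C j
  have "(\<Sum>C\<in>Pow B. mult_op i U C eta * zprod C eta) = (\<Sum>C\<in>Pow B. - z i (P C eta) * U C eta * zprod C eta) + (\<Sum>C\<in>Pow B. \<Sum>j\<in>C. f (C - {j}) j)"
   unfolding sum.distrib[symmetric]
  proof (rule sum.cong[OF refl])
   fix C
   have "(\<Sum>j\<in>C. f (C - {j}) j) = (\<Sum>j\<in>C. of_real (c i (C - {j}) j) * U (C - {j}) eta * zprod C eta)"
    by (intro sum.cong refl) (simp add: f_def insert_absorb)
   then show "mult_op i U C eta * zprod C eta = - z i (P C eta) * U C eta * zprod C eta + (\<Sum>j\<in>C. f (C - {j}) j)"
    by (simp only: mult_op_def distrib_right sum_distrib_right)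
  qed
  also have "(\<Sum>C\<in>Pow B. \<Sum>j\<in>C. f (C - {j}) j) = (\<Sum>C\<in>Pow B. \<Sum>j\<in>B - C. f C j)"
   by (rule sum_insert_swap[OF fin])
  also have "(\<Sum>C\<in>Pow B. - z i (P C eta) * U C eta * zprod C eta) + \<dots> = (\<Sum>C\<in>Pow B. - z i eta * (U C eta * zprod C eta))"
   unfolding sum.distrib[symmetric]
  proof (intro sum.cong refl)
   fix C assume C: "C \<in> Pow B"
   have CG: "C \<subseteq> G" and fC: "finite C" using C B finite_subset[OF _ fin] by auto
   \<comment> \<open>Coefficients with \<open>j\<close> in \<open>C\<close> are 0, and coordinates
     outside \<open>B\<close> vanish on the subspace of \<open>B\<close>.\<close>
   have "(\<Sum>j\<in>G. of_real (c i C j) * z j eta) = (\<Sum>j\<in>B - C. of_real (c i C j) * z j eta)"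
    using B c_zero[OF CG] z_zero[OF B eta(1)] G(1) by (intro sum.mono_neutral_right) auto
   then have e: "z i eta = z i (P C eta) + (\<Sum>j\<in>B - C. of_real (c i C j) * z j eta)"
    using z_expand[OF CG etaX, of i] by (simp add: algebra_simps)
   have "(\<Sum>j\<in>B - C. f C j) = (\<Sum>j\<in>B - C. - (of_real (c i C j) * z j eta) * (U C eta * zprod C eta))"
    using fC by (intro sum.cong refl) (simp add: f_def zprod_def)
   also have "\<dots> = - (\<Sum>j\<in>B - C. of_real (c i C j) * z j eta) * (U C eta * zprod C eta)"
    by (simp add: sum_distrib_right sum_negf)
   finally show "- z i (P C eta) * U C eta * zprod C eta + (\<Sum>j\<in>B - C. f C j) = - z i eta * (U C eta * zprod C eta)"
    unfolding e by (simp add: algebra_simps)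
  qed
  also have "\<dots> = - z i eta * \<phi> eta" using good_onD(3)[OF U B eta] by (simp only: sum_distrib_left[symmetric])
  finally show ?thesis .
 qed
qed

lemma good_on_mult_power: "good_on S \<phi> U \<Longrightarrow> good_on S (\<lambda>eta. (- z i eta) ^ k * \<phi> eta) ((mult_op i ^^ k) U)"
proof (induction k)
 case (Suc k)
 then show ?case using good_on_mult[of S "\<lambda>eta. (- z i eta) ^ k * \<phi> eta" "(mult_op i ^^ k) U" i] by (simp add: mult.assoc)
qed simp

text \<open>The operator is triangular with respect to inclusion. Its diagonal part is
  multiplication by a function of size at most \<open>r / 2\<close>, and the contributions of
  smaller sets, growing like \<open>r ^ k\<close> by induction, only enlarge the constant.\<close>

lemma mult_op_power_bounded:
 assumes r: "0 < r" and B: "B \<subseteq> G"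
 shows "\<exists>K. \<forall>eta k. (\<forall>C\<subseteq>G. cmod (z i (P C eta)) \<le> r / 2 \<and> cmod (U C eta) \<le> M) \<longrightarrow> cmod ((mult_op i ^^ k) U B eta) \<le> K * r ^ k"
 using finite_sub[OF B] B
proof (induction B rule: finite_psubset_induct)
 case (psubset B)
 let ?Q = "\<lambda>eta. \<forall>C\<subseteq>G. cmod (z i (P C eta)) \<le> r / 2 \<and> cmod (U C eta) \<le> M"
 have "\<exists>K. \<forall>eta k. ?Q eta \<longrightarrow> cmod ((mult_op i ^^ k) U (B - {j}) eta) \<le> K * r ^ k" if "j \<in> B" for j
  using psubset.IH[of "B - {j}"] psubset.prems that by blast
 then obtain K where K: "\<And>j eta k. j \<in> B \<Longrightarrow> ?Q eta \<Longrightarrow> cmod ((mult_op i ^^ k) U (B - {j}) eta) \<le> K j * r ^ k" by metis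
 define L where "L = (\<Sum>j\<in>B. \<bar>c i (B - {j}) j * K j\<bar>)"
 have L: "0 \<le> L" by (simp add: L_def sum_nonneg)
 \<comment> \<open>Chosen so that \<open>L \<le> r / 2 * K0\<close>: the diagonal part and the
   smaller sets each use up half of the growth factor \<open>r\<close>.\<close>
 define K0 where "K0 = \<bar>M\<bar> + 2 * L / r"
 have K0: "0 \<le> K0" "\<bar>M\<bar> \<le> K0" "L \<le> r / 2 * K0" using L r by (auto simp: K0_def field_simps)
 have "cmod ((mult_op i ^^ k) U B eta) \<le> K0 * r ^ k" if Q: "?Q eta" for eta k
 proof (induction k)
  case 0
  have "cmod (U B eta) \<le> M" using Q psubset.prems by blast
  then show ?case using K0(2) by simp
 next
  case (Suc k)
  let ?V = "(mult_op i ^^ k) U"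
  have "cmod (mult_op i ?V B eta) \<le> cmod (- z i (P B eta) * ?V B eta) + (\<Sum>j\<in>B. cmod (of_real (c i (B - {j}) j) * ?V (B - {j}) eta))"
   unfolding mult_op_def by (rule norm_triangle_le[OF add_left_mono[OF norm_sum]])
  also have "\<dots> \<le> r / 2 * (K0 * r ^ k) + (\<Sum>j\<in>B. \<bar>c i (B - {j}) j * K j\<bar> * r ^ k)"
  proof (intro add_mono sum_mono)
   show "cmod (- z i (P B eta) * ?V B eta) \<le> r / 2 * (K0 * r ^ k)"
    unfolding norm_mult norm_minus_cancel using Q psubset.prems Suc r by (intro mult_mono) auto
   fix j assume "j \<in> B"
   then show "cmod (of_real (c i (B - {j}) j) * ?V (B - {j}) eta) \<le> \<bar>c i (B - {j}) j * K j\<bar> * r ^ k" using order_trans[OF K[OF _ Q] mult_right_mono[OF abs_ge_self]] r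
    by (simp add: norm_mult abs_mult mult.assoc mult_left_mono)
  qed
  also have "\<dots> = (r / 2 * K0 + L) * r ^ k" by (simp add: L_def sum_distrib_right distrib_right mult.assoc)
  also have "\<dots> \<le> (r * K0) * r ^ k" using K0(3) r by (intro mult_right_mono) auto
  finally show ?case by (simp add: mult_ac)
 qed
 then show ?case by blast
qed

lemma D_cong: "B \<subseteq> G \<Longrightarrow> (\<And>C. C \<subseteq> G \<Longrightarrow> s C = t C) \<Longrightarrow> D i s B = D i t B"
 unfolding D_def by (intro sum.cong refl arg_cong2[where f="(*)"]) blast

lemma mult_op_power_0: "B \<subseteq> G \<Longrightarrow> (mult_op i ^^ k) U B 0 = (D i ^^ k) (\<lambda>C. U C 0) B"
proof (induction k arbitrary: B)
 case (Suc k)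
 then show ?case using mult_op_0[OF Suc.prems, of i "(mult_op i ^^ k) U"] D_cong[OF Suc.prems, of "\<lambda>C. (mult_op i ^^ k) U C 0"] by simp
qed simp

lemma D_nilpotent: "finite B \<Longrightarrow> card B < k \<Longrightarrow> (D i ^^ k) t B = 0"
proof (induction k arbitrary: B)
 case (Suc k)
 have "(D i ^^ k) t (B - {j}) = 0" if "j \<in> B" for j
  using Suc.prems that card_gt_0_iff[of B] by (intro Suc.IH) auto
 then have "D i ((D i ^^ k) t) B = 0" unfolding D_def by (intro sum.neutral ballI) simp
 then show ?case by simp
qed simp

end

section \<open>The Todd function\<close>

definition todd :: "complex \<Rightarrow> complex"
 where "todd x = (if x = 0 then 1 else x / (1 - exp (- x)))"

text \<open>The rational series is pinned down by \<open>todd_series_mult\<close>; its image among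
  complex series satisfies the same equation and is therefore the complex quotient.\<close>

lemma todd_fps:
 "todd has_fps_expansion (fps_X / (1 - fps_exp (- 1)))"
 "fps_nth (fps_X / (1 - fps_exp (- 1)) :: complex fps) k = of_rat (fps_nth todd_series k)"
proof -
 let ?g = "1 - fps_exp (- 1) :: complex fps"
 have sd: "subdegree ?g = 1" by (rule subdegreeI) auto
 then have g0: "?g \<noteq> 0" by auto
 have "(\<lambda>x. if x = 0 then 1 else x / (1 - exp (- x))) has_fps_expansion (fps_X / ?g)"
 proof (rule has_fps_expansion_divide)
  show "(\<lambda>x::complex. x) has_fps_expansion fps_X" by (rule has_fps_expansion_fps_X)
  show "(\<lambda>x::complex. 1 - exp (- x)) has_fps_expansion ?g"
   using has_fps_expansion_diff[OF has_fps_expansion_1 has_fps_expansion_exp[of "- 1 :: complex"]] by simp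
  show "subdegree ?g \<le> subdegree (fps_X :: complex fps)" "?g \<noteq> 0" using g0 sd by auto
  show "1 = fps_nth fps_X (subdegree ?g) / fps_nth ?g (subdegree ?g)" unfolding sd by simp
 qed
 then show "todd has_fps_expansion (fps_X / ?g)" by (simp add: todd_def[abs_def])
 define T where "T = Abs_fps (\<lambda>k. of_rat (fps_nth todd_series k) :: complex)"
 have "T * ?g = fps_X"
 proof (rule fps_ext)
  fix n
  have f: "(of_rat (fact k) :: complex) = fact k" for k by (metis of_nat_fact of_rat_of_nat_eq)
  have "fps_nth (T * ?g) n = of_rat (fps_nth (todd_series * (1 - fps_exp (- 1))) n)"
   by (simp add: fps_mult_nth T_def of_rat_sum of_rat_mult of_rat_diff of_rat_divide of_rat_power of_rat_minus f if_distrib[of of_rat] cong: if_cong)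
  then show "fps_nth (T * ?g) n = fps_nth fps_X n" unfolding todd_series_mult by simp
 qed
 then have "fps_X / ?g = T" using g0 by (metis nonzero_mult_div_cancel_right)
 then show "fps_nth (fps_X / ?g) k = of_rat (fps_nth todd_series k)" by (simp add: T_def)
qed

lemma todd_sums:
 obtains r where "0 < r" "summable (\<lambda>k. cmod (of_rat (fps_nth todd_series k)) * r ^ k)"
  "\<And>x. cmod x < r \<Longrightarrow> (\<lambda>k. of_rat (fps_nth todd_series k) * x ^ k) sums todd x"
proof -
 let ?T = "fps_X / (1 - fps_exp (- 1)) :: complex fps"
 have T: "fps_conv_radius ?T > 0" "\<forall>\<^sub>F x in nhds 0. eval_fps ?T x = todd x"
  using todd_fps(1) by (auto simp: has_fps_expansion_def)
 obtain S where S: "open S" "0 \<in> S" "\<And>x. x \<in> S \<Longrightarrow> eval_fps ?T x = todd x" using T(2) unfolding eventually_nhds by blast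
 obtain r1 where r1: "0 < r1" "ball 0 r1 \<subseteq> S" using S(1,2) openE by blast
 obtain r2 :: real where r2: "0 < r2" "ereal r2 < fps_conv_radius ?T" using T(1) ereal_dense2[of 0] by (metis ereal_less(2))
 define r where "r = min r1 r2"
 have r: "0 < r" "ereal r < fps_conv_radius ?T" using r1 r2 by (auto simp: r_def min_less_iff_disj)
 show ?thesis
 proof (rule that[OF r(1)])
  show "summable (\<lambda>k. cmod (of_rat (fps_nth todd_series k)) * r ^ k)"
   using norm_summable_fps[of "of_real r" ?T] r by (simp add: norm_mult norm_power todd_fps(2))
  fix x :: complex assume x: "cmod x < r"
  then have "(\<lambda>k. fps_nth ?T k * x ^ k) sums eval_fps ?T x" using r(2) ereal_less_eq(3) less_imp_le order_le_less_trans sums_eval_fps by metis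
  moreover have "eval_fps ?T x = todd x" using x r1(2) by (intro S(3)) (auto simp: r_def)
  ultimately show "(\<lambda>k. of_rat (fps_nth todd_series k) * x ^ k) sums todd x" by (simp add: todd_fps(2))
 qed
qed

section \<open>The Todd operator on decompositions\<close>

context simplicial_projections
begin

lemma near_bound:
 assumes "holo_on X (X \<inter> S) F" "0 \<in> S" "cmod (F 0) < M"
 shows "near (\<lambda>eta. eta \<in> X \<longrightarrow> cmod (F eta) \<le> M)"
proof -
 have "0 \<in> X \<inter> S" using csubD(6)[OF csub_lat_C] assms(2) by blast
 then have "continuous (at 0 within X) F" using holo_onD[OF assms(1)] has_derivative_continuous by metis
 then have "\<forall>\<^sub>F eta in at 0 within X. cmod (F eta) < M" using order_tendstoD(2)[OF tendsto_norm assms(3)] by (simp add: continuous_within)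
 then show ?thesis unfolding eventually_at_filter by eventually_elim (use assms(3) in \<open>metis less_imp_le\<close>)
qed

text \<open>The Todd series is applied to the operator \<open>mult_op i\<close> term by term. It
  converges where all pullbacks of \<open>z i\<close> are at most \<open>r / 2\<close> in size, with
  \<open>r\<close> inside the radius of convergence; at 0 only finitely many terms survive because
  \<open>D i\<close> is nilpotent.\<close>

lemma good_todd:
 assumes "good \<phi> U"
 shows "\<exists>V. good (\<lambda>eta. todd (- z i eta) * \<phi> eta) V \<and>
  (\<forall>B\<subseteq>G. V B 0 = (\<Sum>k\<le>card G. of_rat (fps_nth todd_series k) * (D i ^^ k) (\<lambda>C. U C 0) B))"
proof -
 obtain S where S: "open S" "0 \<in> S" "good_on S \<phi> U" using assms by (auto simp: good_def)
 define a where "a k = (of_rat (fps_nth todd_series k) :: complex)" for k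
 obtain r where r: "0 < r" "summable (\<lambda>k. cmod (a k) * r ^ k)" "\<And>x. cmod x < r \<Longrightarrow> (\<lambda>k. a k * x ^ k) sums todd x"
  using todd_sums unfolding a_def by blast
 \<comment> \<open>Exceeds all the values at 0, so it bounds the functions \<open>U C\<close> on a
   neighbourhood.\<close>
 define M where "M = 1 + (\<Sum>C\<in>Pow G. cmod (U C 0))"
 define Q where "Q eta \<longleftrightarrow> (\<forall>C\<subseteq>G. cmod (z i (P C eta)) \<le> r / 2 \<and> cmod (U C eta) \<le> M)" for eta
 have "near (\<lambda>eta. \<forall>C\<in>Pow G. (eta \<in> X \<longrightarrow> cmod (z i (P C eta)) \<le> r / 2) \<and> (eta \<in> X \<longrightarrow> cmod (U C eta) \<le> M))"
 proof (subst eventually_ball_finite_distrib, use G(1) in simp, intro ballI eventually_conj)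
  fix C assume "C \<in> Pow G"
  then have C: "C \<subseteq> G" by simp
  show "near (\<lambda>eta. eta \<in> X \<longrightarrow> cmod (z i (P C eta)) \<le> r / 2)" using P_id[OF C csubD(6)[OF csub_lat_C]] holo_z_P[OF C, of i] r(1)
   by (fastforce simp: z_0 intro: near_bound[of UNIV])
  have "cmod (U C 0) \<le> (\<Sum>C\<in>Pow G. cmod (U C 0))" using C G(1) by (intro member_le_sum) auto
  then show "near (\<lambda>eta. eta \<in> X \<longrightarrow> cmod (U C eta) \<le> M)"
   by (intro near_bound[OF good_onD(1)[OF S(3) C] S(2)]) (simp add: M_def)
 qed
 then obtain S' where S': "open S'" "0 \<in> S'" "\<And>eta. eta \<in> S' \<Longrightarrow> eta \<in> X \<Longrightarrow> Q eta"
  unfolding eventually_nhds Q_def by blast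
 define T where "T = S \<inter> S'"
 have "good_on T \<phi> U" using S(3) unfolding good_on_def T_def by (blast intro: holo_on_subset)
 note gk = good_on_mult_power[OF this, where i=i]
 have "\<exists>K. \<forall>eta k. Q eta \<longrightarrow> cmod ((mult_op i ^^ k) U B eta) \<le> K * r ^ k" if "B \<subseteq> G" for B
  unfolding Q_def by (rule mult_op_power_bounded[OF r(1) that])
 then obtain K where K: "\<And>B eta k. B \<subseteq> G \<Longrightarrow> Q eta \<Longrightarrow> cmod ((mult_op i ^^ k) U B eta) \<le> K B * r ^ k" by metis
 define V where "V B eta = (\<Sum>k. a k * (mult_op i ^^ k) U B eta)" for B eta
 have m: "cmod (a k * (mult_op i ^^ k) U B eta) \<le> K B * (cmod (a k) * r ^ k)" if "B \<subseteq> G" "eta \<in> X \<inter> T" for B eta k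
  using mult_left_mono[OF K[OF that(1) S'(3), of eta k] norm_ge_zero[of "a k"]] that(2) by (simp add: norm_mult T_def mult_ac)
 have sm: "summable (\<lambda>k. K B * (cmod (a k) * r ^ k))" for B by (rule summable_mult[OF r(2)])
 have T: "open T" "0 \<in> T" using S S' by (auto simp: T_def)
 have "good_on T (\<lambda>eta. todd (- z i eta) * \<phi> eta) V"
  unfolding good_on_def
 proof (intro allI impI conjI ballI)
  fix B assume B: "B \<subseteq> G"
  show "holo_on X (X \<inter> T) (V B)" unfolding V_def
   by (rule holo_on_suminf[OF csub_lat_C openin_open_Int[OF T(1)] _ m[OF B] sm])
    (auto intro: holo_on_mult holo_on_const good_onD(1)[OF gk B])
  show "V B (P B eta) = V B eta" if "eta \<in> X" for eta by (simp add: V_def good_onD(2)[OF gk B that])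
  fix eta assume eta: "eta \<in> lat_C B \<inter> T"
  then have etaX: "eta \<in> X \<inter> T" using lat_C_mono[OF B] by auto
  have "cmod (z i eta) < r" using S'(3)[of eta] etaX P_id[OF subset_refl, of eta] r(1) by (fastforce simp: Q_def T_def)
  then have "(\<lambda>k. a k * (- z i eta) ^ k * \<phi> eta) sums (todd (- z i eta) * \<phi> eta)" by (intro sums_mult2 r(3)) simp
  moreover have "(\<lambda>k. \<Sum>C\<in>Pow B. a k * (mult_op i ^^ k) U C eta * zprod C eta) sums (\<Sum>C\<in>Pow B. V C eta * zprod C eta)"
   unfolding V_def using B etaX by (intro sums_sum sums_mult2 summable_sums summable_comparison_test'[OF sm m]) auto
  moreover have "(\<Sum>C\<in>Pow B. a k * (mult_op i ^^ k) U C eta * zprod C eta) = a k * (- z i eta) ^ k * \<phi> eta" for k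
   using good_onD(3)[OF gk B, of eta k] eta by (simp add: mult.assoc flip: sum_distrib_left)
  ultimately show "(\<Sum>C\<in>Pow B. V C eta * zprod C eta) = todd (- z i eta) * \<phi> eta" by (simp add: sums_unique2)
 qed
 moreover have "V B 0 = (\<Sum>k\<le>card G. a k * (D i ^^ k) (\<lambda>C. U C 0) B)" if B: "B \<subseteq> G" for B
  unfolding V_def mult_op_power_0[OF B]
  by (rule suminf_finite) (use D_nilpotent[OF finite_sub[OF B]] card_mono[OF G(1) B] in \<open>auto simp: not_le intro: le_less_trans\<close>)
 ultimately show ?thesis using T unfolding good_def a_def by blast
qed

end

section \<open>Cones generated by part of a lattice basis\<close>

lemma fcone_coordinates:
 assumes A: "finite A" "independent A" and K: "K \<subseteq> A"
 shows "x \<in> fcone K \<longleftrightarrow> x \<in> span A \<and> (\<forall>j\<in>K. 0 \<le> crd A j x) \<and> (\<forall>j\<in>A - K. crd A j x = 0)"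
proof
 assume "x \<in> fcone K"
 then obtain c where c: "\<forall>k\<in>K. 0 \<le> c k" "x = (\<Sum>k\<in>K. c k *\<^sub>R k)" by (auto simp: fcone_def)
 have sp: "x \<in> span A" unfolding c(2) using K by (intro span_sum span_scale) (auto intro: span_base)
 have "crd A j x = (\<Sum>k\<in>K. if j = k then c k else 0)" for j
 proof -
  have "crd A j x = (\<Sum>k\<in>K. crd A j (c k *\<^sub>R k))"
   unfolding c(2) using K by (intro real_dual_sum[OF crd_in_real_dual[OF A(2)]] span_scale) (auto intro: span_base)
  also have "\<dots> = (\<Sum>k\<in>K. if j = k then c k else 0)"
   using K by (intro sum.cong refl) (auto simp: real_dualD(2)[OF crd_in_real_dual[OF A(2)] span_base] crd_basis[OF A(2)] subset_iff)
  finally show ?thesis .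
 qed
 then have "crd A j x = (if j \<in> K then c j else 0)" for j using finite_subset[OF K A(1)] by simp
 then show "x \<in> span A \<and> (\<forall>j\<in>K. 0 \<le> crd A j x) \<and> (\<forall>j\<in>A - K. crd A j x = 0)" using sp c(1) by auto
next
 assume x: "x \<in> span A \<and> (\<forall>j\<in>K. 0 \<le> crd A j x) \<and> (\<forall>j\<in>A - K. crd A j x = 0)"
 have "x = (\<Sum>j\<in>A. crd A j x *\<^sub>R j)" using real_vector.sum_representation_eq[OF A(2) _ A(1) subset_refl] x by simp
 also have "\<dots> = (\<Sum>j\<in>K. crd A j x *\<^sub>R j)" using x A(1) K by (intro sum.mono_neutral_right) auto
 also have "\<dots> \<in> fcone K" using x by (intro fconeI) auto
 finally show "x \<in> fcone K" .
qed

lemma fcone_dual_coordinates: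
 assumes A: "finite A" "independent A" and K: "K \<subseteq> A"
 shows "fcone (crd A ` K) = {m\<in>real_dual (span A). (\<forall>j\<in>K. 0 \<le> m j) \<and> (\<forall>j\<in>A - K. m j = 0)}"
proof (intro set_eqI iffI)
 fix m assume "m \<in> fcone (crd A ` K)"
 then obtain c where c: "\<forall>h\<in>crd A ` K. 0 \<le> c h" "m = (\<Sum>h\<in>crd A ` K. c h *\<^sub>R h)" by (auto simp: fcone_def)
 have "m \<in> real_dual (span A)" unfolding c(2)
  using crd_in_real_dual[OF A(2)] by (intro subspace_sum subspace_scale subspace_real_dual) auto
 moreover have "m j = (if j \<in> K then c (crd A j) else 0)" if "j \<in> A" for j
 proof -
  have inj: "inj_on (crd A) K" using crd_inj[OF A(2)] K by (rule inj_on_subset)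
  have "m j = (\<Sum>k\<in>K. c (crd A k) * crd A k j)" by (simp add: c(2) sum.reindex[OF inj] sum_fun_apply)
  also have "\<dots> = (\<Sum>k\<in>K. if k = j then c (crd A k) else 0)"
   using that by (intro sum.cong refl) (simp add: crd_basis[OF A(2)])
  finally show ?thesis using finite_subset[OF K A(1)] by (simp add: sum.delta)
 qed
 ultimately show "m \<in> {m\<in>real_dual (span A). (\<forall>j\<in>K. 0 \<le> m j) \<and> (\<forall>j\<in>A - K. m j = 0)}" using c(1) K by auto
next
 fix m assume "m \<in> {m\<in>real_dual (span A). (\<forall>j\<in>K. 0 \<le> m j) \<and> (\<forall>j\<in>A - K. m j = 0)}"
 then have m: "m \<in> real_dual (span A)" "\<forall>j\<in>K. 0 \<le> m j" "\<forall>j\<in>A - K. m j = 0" by auto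
 have "m = (\<Sum>j\<in>A. m j *\<^sub>R crd A j)" by (rule real_dual_expand[OF A m(1)])
 also have "\<dots> = (\<Sum>j\<in>K. m j *\<^sub>R crd A j)" using m(3) A(1) K by (intro sum.mono_neutral_right) auto
 also have "\<dots> \<in> fcone (crd A ` K)"
  using m(2) finite_subset[OF K A(1)] by (intro fcone_sum fcone_scale fcone_base) auto
 finally show "m \<in> fcone (crd A ` K)" .
qed

lemma fcone_inj: "finite A \<Longrightarrow> independent A \<Longrightarrow> inj_on fcone (Pow A)"
proof (rule inj_onI)
 fix C C' assume A: "finite A" "independent A" and C: "C \<in> Pow A" "C' \<in> Pow A" "fcone C = fcone C'"
 have "j \<in> C \<longleftrightarrow> j \<in> fcone C" if "j \<in> A" "C \<subseteq> A" for j C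
  using fcone_coordinates[OF A that(2), of j] that(1) crd_basis[OF A(2), of j] by (auto simp: span_base split: if_splits)
 then have "j \<in> C \<longleftrightarrow> j \<in> C'" if "j \<in> A" for j using C that by (metis PowD)
 then show "C = C'" using C(1,2) by blast
qed

text \<open>A face containing \<open>x\<close> contains every generator that occurs in
  \<open>x\<close>, so it is generated by its own part of \<open>A\<close>. Conversely, vanishing of
  the other nonnegative coordinates defines a face.\<close>

lemma cone_faces_fcone:
 assumes A: "finite A" "independent A" and cone: "\<And>tau. tau \<in> cone_faces (fcone A) \<Longrightarrow> is_cone N tau"
 shows "cone_faces (fcone A) = fcone ` Pow A"
proof (intro set_eqI iffI)
 fix tau assume tau: "tau \<in> cone_faces (fcone A)"
 note cb = is_cone_basic[OF cone[OF tau]]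
 have sub: "tau \<subseteq> fcone A" by (rule cone_faces_subset[OF tau])
 have "tau = fcone (A \<inter> tau)"
 proof
  show "fcone (A \<inter> tau) \<subseteq> tau"
  proof
   fix x assume "x \<in> fcone (A \<inter> tau)"
   then obtain c where c: "\<forall>k\<in>A \<inter> tau. 0 \<le> c k" "x = (\<Sum>k\<in>A \<inter> tau. c k *\<^sub>R k)" by (auto simp: fcone_def)
   have "(\<Sum>k\<in>K. c k *\<^sub>R k) \<in> tau" if "finite K" "K \<subseteq> A \<inter> tau" for K
    using that by (induction K rule: finite_induct) (use c(1) cb(2,5,6) in auto)
   then show "x \<in> tau" unfolding c(2) using A(1) by simp
  qed
  show "tau \<subseteq> fcone (A \<inter> tau)"
  proof
   fix x assume x: "x \<in> tau"
   note xc = fcone_coordinates[OF A subset_refl, of x]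
   have xA: "x \<in> span A" "\<forall>j\<in>A. 0 \<le> crd A j x" using xc sub x by auto
   have "j \<in> tau" if j: "j \<in> A" "crd A j x \<noteq> 0" for j
   proof -
    define t where "t = crd A j x"
    have t: "0 < t" using j xA by (auto simp: t_def less_le)
    have xs: "x = (\<Sum>j\<in>A. crd A j x *\<^sub>R j)" using real_vector.sum_representation_eq[OF A(2) xA(1) A(1) subset_refl] by simp
    have "x - t *\<^sub>R j = (\<Sum>k\<in>A - {j}. crd A k x *\<^sub>R k)"
     by (subst xs, subst sum.remove[OF A(1) j(1)]) (simp add: t_def)
    also have "\<dots> \<in> fcone A" using xA(2) A(1) by (intro fcone_sum fcone_scale fcone_base) auto
    finally have b: "2 *\<^sub>R (x - t *\<^sub>R j) \<in> fcone A" by (intro fcone_scale) auto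
    have a: "(2 * t) *\<^sub>R j \<in> fcone A" using t j A(1) by (intro fcone_scale fcone_base) auto
    \<comment> \<open>Splitting \<open>x\<close> into its \<open>j\<close>-part and the rest, and
      doubling both, exhibits \<open>x\<close> as a midpoint of two points of the cone; the face
      must then contain the multiple of \<open>j\<close>.\<close>
    have mid: "x = midpoint ((2 * t) *\<^sub>R j) (2 *\<^sub>R (x - t *\<^sub>R j))"
     by (simp add: midpoint_def algebra_simps)
    have "(2 * t) *\<^sub>R j \<in> tau"
    proof (cases "(2 * t) *\<^sub>R j = 2 *\<^sub>R (x - t *\<^sub>R j)")
     case True
     then show ?thesis using mid midpoint_idem x by simp
    next
     case False
     then have "x \<in> open_segment ((2 * t) *\<^sub>R j) (2 *\<^sub>R (x - t *\<^sub>R j))" using mid midpoint_in_open_segment by metis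
     then show ?thesis using face_ofD[of tau "fcone A", OF _ _ a b x] tau by (auto simp: cone_faces_def)
    qed
    from cb(6)[OF this, of "1 / (2 * t)"] show "j \<in> tau" using t by simp
   qed
   then show "x \<in> fcone (A \<inter> tau)"
    using fcone_coordinates[OF A, of "A \<inter> tau" x] xA by auto
  qed
 qed
 then show "tau \<in> fcone ` Pow A" by blast
next
 fix tau assume "tau \<in> fcone ` Pow A"
 then obtain C where C: "C \<subseteq> A" "tau = fcone C" by auto
 note cA = fcone_coordinates[OF A subset_refl] and cC = fcone_coordinates[OF A C(1)]
 have conv: "convex (fcone C)" for C :: "'a set" unfolding convex_def by (auto intro!: fcone_add fcone_scale)
 have key: "a \<in> fcone C" if ab: "a \<in> fcone A" "b \<in> fcone A" "x \<in> fcone C" "x = (1 - u) *\<^sub>R a + u *\<^sub>R b" "0 < u" "u < 1" for a b x u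
 proof -
  have "crd A j a = 0" if j: "j \<in> A - C" for j
  proof -
   have "crd A j x = (1 - u) * crd A j a + u * crd A j b"
    using ab(1,2) cA unfolding ab(4)
    by (simp add: real_dualD(1,2)[OF crd_in_real_dual[OF A(2)]] span_scale)
   moreover have "crd A j x = 0" "0 \<le> crd A j a" "0 \<le> crd A j b" using ab j cA cC by auto
   ultimately show ?thesis using ab(5,6) by (smt (verit) mult_nonneg_nonneg mult_pos_pos)
  qed
  then show ?thesis using ab(1) cA cC C(1) by auto
 qed
 have "fcone C face_of fcone A" unfolding face_of_def
 proof (intro conjI ballI impI)
  show "fcone C \<subseteq> fcone A" using C(1) A(1) by (intro fcone_subset fcone_base) auto
  show "convex (fcone C)" by (rule conv)
  fix a b x assume ab: "a \<in> fcone A" "b \<in> fcone A" "x \<in> fcone C" "x \<in> open_segment a b"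
  obtain u where u: "x = (1 - u) *\<^sub>R a + u *\<^sub>R b" "0 < u" "u < 1" using ab(4) by (auto simp: in_segment)
  show "a \<in> fcone C" by (rule key[OF ab(1-3) u])
  show "b \<in> fcone C" using key[OF ab(2,1,3), of "1 - u"] u by (auto simp: add.commute)
 qed
 then show "tau \<in> cone_faces (fcone A)" using fcone_0[of C] C(2) by (auto simp: cone_faces_def)
qed

lemma lattice_basis_sublat:
 assumes B: "lattice_basis B N" and A: "A \<subseteq> B"
 shows "lattice_basis A (sublat N (fcone A))" "span (sublat N (fcone A)) = span A"
proof -
 note D = lattice_basisD[OF B]
 have N: "is_lattice N" using B by (auto simp: is_lattice_def)
 have fA: "finite A" by (rule finite_subset[OF A D(1)])
 have iA: "independent A" by (rule real_vector.independent_mono[OF D(2) A])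
 have s: "span (fcone A) = span A" by (rule span_fcone[OF fA])
 have L: "is_lattice (sublat N (fcone A))" by (rule is_lattice_sublat[OF N])
 have AN: "A \<subseteq> sublat N (fcone A)" using A D(3) span_superset[of A] by (auto simp: sublat_def s)
 show "lattice_basis A (sublat N (fcone A))"
 proof (rule lattice_basisI[OF fA iA AN])
  fix x assume x: "x \<in> sublat N (fcone A)"
  then show "x \<in> span A \<and> (\<forall>b\<in>A. representation A x b \<in> \<int>)" using lattice_mem_iff[OF B, of x] A real_vector.representation_extend[OF D(2) _ A, of x]
   by (auto simp: sublat_def s)
 qed (use is_lattice_closed[OF L] in auto)
 then show "span (sublat N (fcone A)) = span A" by (rule lattice_basisD(4))
qed

text \<open>The generating function of an orthant is a product of geometric series, so clearing the
  denominators leaves the constant 1, the series of the origin.\<close>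

lemma mdiff_coordinates:
 assumes A: "lattice_basis A N" and K: "K \<subseteq> A" and m: "m \<in> dual_lat N"
 shows "mdiff (crd A ` K) (cind (fcone (crd A ` K))) m = (if m = 0 then 1 else 0)"
proof -
 note D = lattice_basisD[OF A]
 let ?J = "crd A ` K"
 have fK: "finite K" using K D(1) finite_subset by blast
 have md: "m \<in> real_dual (span A)" and mZ: "\<And>j. j \<in> A \<Longrightarrow> m j \<in> \<int>"
  using m dual_lat_alt[OF A] D(4) by auto
 have SS: "\<exists>S'. S' \<subseteq> K \<and> S = crd A ` S'" if "S \<subseteq> ?J" for S using that by (meson subset_imageE)
 have sumj: "(\<Sum>(crd A ` S)) j = (if j \<in> S then 1 else 0)" if "S \<subseteq> K" "j \<in> A" for S j
 proof -
  have inj: "inj_on (crd A) S" using crd_inj[OF D(2)] that K by (meson inj_on_subset subset_trans)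
  have "(\<Sum>(crd A ` S)) j = (\<Sum>k\<in>S. crd A k j)" by (simp add: sum.reindex[OF inj] sum_fun_apply)
  also have "\<dots> = (\<Sum>k\<in>S. if k = j then 1 else 0)" using that(2) by (intro sum.cong refl) (simp add: crd_basis[OF D(2)])
  finally show ?thesis using finite_subset[OF that(1) fK] by (simp add: sum.delta)
 qed
 have sumd: "\<Sum>(crd A ` S) \<in> real_dual (span A)" for S
  using crd_in_real_dual[OF D(2)] by (intro subspace_sum subspace_real_dual) auto
 have mem: "x \<in> fcone ?J \<longleftrightarrow> (\<forall>j\<in>K. 0 \<le> x j) \<and> (\<forall>j\<in>A - K. x j = 0)" if "x \<in> real_dual (span A)" for x
  using that fcone_dual_coordinates[OF D(1,2) K] by auto
 have eq0: "x = 0" if "x \<in> real_dual (span A)" "\<forall>j\<in>A. x j = 0" for x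
  using real_dual_expand[OF D(1,2) that(1)] that(2) by simp
 show ?thesis
 proof (cases "m = 0")
  case True
  have z: "(- 1) ^ card S * cind (fcone ?J) (m - \<Sum>S) = 0" if S: "S \<in> Pow ?J - {{}}" for S
  proof -
   obtain S' where S': "S' \<subseteq> K" "S = crd A ` S'" using SS[of S] S by blast
   obtain j where j: "j \<in> S'" using S S' by auto
   have "(m - \<Sum>S) j = - 1" using True sumj[OF S'(1), of j] j S' K by auto
   moreover have "m - \<Sum>S \<in> real_dual (span A)" using md sumd S'(2) by (metis subspace_diff subspace_real_dual)
   ultimately have "m - \<Sum>S \<notin> fcone ?J" using mem[of "m - \<Sum>S"] j S'(1) by fastforce
   then show ?thesis by (simp add: cind_def)
  qed
  have "mdiff ?J (cind (fcone ?J)) m = (\<Sum>S\<in>{{}}. (- 1) ^ card S * cind (fcone ?J) (m - \<Sum>S))"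
   unfolding mdiff_def using z fK by (intro sum.mono_neutral_right) auto
  also have "\<dots> = 1" using True fcone_0[of ?J] by (simp add: cind_def)
  finally show ?thesis using True by simp
 next
  case False
  then obtain j where j: "j \<in> A" "m j \<noteq> 0" using eq0[OF md] by blast
  have "mdiff ?J (cind (fcone ?J)) m = 0"
  proof (cases "j \<in> K")
   case jK: True
   show ?thesis
   proof (rule mdiff_cancel)
    show "finite ?J" "crd A j \<in> ?J" using fK jK by auto
    fix S assume S: "S \<subseteq> ?J - {crd A j}"
    then obtain S' where S': "S' \<subseteq> K" "S = crd A ` S'" using SS[of S] by blast
    have jS: "j \<notin> S'" using S S'(2) by blast
    define x where "x = m - \<Sum>S"
    have xd: "x \<in> real_dual (span A)" using md sumd S'(2) unfolding x_def by (metis subspace_diff subspace_real_dual)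
    have yd: "x - crd A j \<in> real_dual (span A)" using xd crd_in_real_dual[OF D(2)] by (intro subspace_diff subspace_real_dual)
    have xj: "x j = m j" using sumj[OF S'(1) j(1)] jS S'(2) by (simp add: x_def)
    have cj: "crd A j k = (if k = j then 1 else 0)" if "k \<in> A" for k using crd_basis[OF D(2) that] by auto
    \<comment> \<open>\<open>m j\<close> is a nonzero integer, and lowering such a number by 1 does
      not affect whether it is nonnegative.\<close>
    have "0 \<le> x j \<longleftrightarrow> 0 \<le> (x - crd A j) j"
    proof -
     obtain t where t: "m j = of_int t" using mZ[OF j(1)] by (auto elim: Ints_cases)
     have "t \<noteq> 0" using j(2) t by auto
     then show ?thesis using cj[OF j(1)] by (auto simp: xj t)
    qed
    moreover have "(x - crd A j) k = x k" if "k \<in> A" "k \<noteq> j" for k using cj that by simp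
    ultimately have "x \<in> fcone ?J \<longleftrightarrow> x - crd A j \<in> fcone ?J"
     unfolding mem[OF xd] mem[OF yd] using K jK by (metis DiffE subsetD)
    then show "cind (fcone ?J) (m - crd A j - \<Sum>S) = cind (fcone ?J) (m - \<Sum>S)" by (simp add: cind_def x_def algebra_simps)
   qed
  next
   case jK: False
   show ?thesis
   proof (rule mdiff_zero)
    fix S assume "S \<subseteq> ?J"
    then obtain S' where S': "S' \<subseteq> K" "S = crd A ` S'" using SS[of S] by blast
    have "(m - \<Sum>S) j \<noteq> 0" using sumj[OF S'(1) j(1)] jK S' j(2) by auto
    moreover have "m - \<Sum>S \<in> real_dual (span A)" using md sumd S'(2) by (metis subspace_diff subspace_real_dual)
    ultimately have "m - \<Sum>S \<notin> fcone ?J" using mem[of "m - \<Sum>S"] j(1) jK by blast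
    then show "cind (fcone ?J) (m - \<Sum>S) = 0" by (simp add: cind_def)
   qed
  qed
  then show ?thesis using False by simp
 qed
qed

section \<open>The interpolator of a nonsingular cone\<close>

lemma perp_fcone:
 assumes "finite C" "C \<subseteq> span N"
 shows "perp N (fcone C) = {m\<in>real_dual (span N). \<forall>j\<in>C. m j = 0}"
proof -
 have "perp N (fcone C) = perp N C" using fcone_span[of C] span_minimal[OF assms(2)] perp_span[of "fcone C" N] perp_span[OF assms(2)] span_fcone[OF assms(1)] by simp
 then show ?thesis by (simp add: perp_def)
qed

lemma pointed_cone_basis:
 fixes N :: "'v::euclidean_space set"
 assumes A: "lattice_basis A N" and C: "C \<subseteq> A"
 shows "pointed_cone N (crd A ` (A - C)) (A \<union> uminus ` C) (\<Sum>A) (dual_cone N (fcone A) \<inter> perp N (fcone C))"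
proof
 note D = lattice_basisD[OF A]
 have AN: "A \<subseteq> span N" by (simp add: D(4) span_superset)
 have fC: "finite C" using C D(1) finite_subset by blast
 have PC: "dual_cone N (fcone A) \<inter> perp N (fcone C) = {m\<in>real_dual (span N). (\<forall>j\<in>A. 0 \<le> m j) \<and> (\<forall>j\<in>C. m j = 0)}"
  using C AN by (subst dual_cone_fcone[OF D(1) AN], subst perp_fcone[OF fC]) auto
 show "is_lattice N" using A by (auto simp: is_lattice_def)
 show "finite (crd A ` (A - C))" using D(1) by simp
 show "crd A ` (A - C) \<subseteq> dual_lat N" using lattice_basisD(3)[OF dual_lat_basis[OF A]] by blast
 show "finite (A \<union> uminus ` C)" using D(1) fC by simp
 show "A \<union> uminus ` C \<subseteq> span N" using AN C span_neg by auto
 show "\<Sum>A \<in> span N" using AN by (intro span_sum) auto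
 show "0 < h (\<Sum>A)" if "h \<in> crd A ` (A - C)" for h
 proof -
  obtain j where j: "j \<in> A" "h = crd A j" using \<open>h \<in> crd A ` (A - C)\<close> by blast
  have "h (\<Sum>A) = (\<Sum>k\<in>A. crd A j k)" unfolding j(2) by (intro real_dual_sum[OF crd_in_real_dual[OF D(2)]]) (simp add: span_base)
  also have "\<dots> = (\<Sum>k\<in>A. if j = k then 1 else 0)" by (intro sum.cong refl) (simp add: crd_basis[OF D(2)])
  finally show ?thesis using j(1) D(1) by simp
 qed
 show "dual_cone N (fcone A) \<inter> perp N (fcone C) = {m\<in>real_dual (span N). \<forall>u\<in>A \<union> uminus ` C. 0 \<le> m u}"
 proof -
  have "m (- j) = - m j" if "m \<in> real_dual (span N)" "j \<in> C" for m j using AN C that(2) real_dualD(2)[OF that(1), of j "-1"] by auto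
  then have "(\<forall>j\<in>A. 0 \<le> m j) \<and> (\<forall>j\<in>C. m j = 0) \<longleftrightarrow> (\<forall>u\<in>A \<union> uminus ` C. 0 \<le> m u)"
   if "m \<in> real_dual (span N)" for m
  proof -
   have neg: "\<forall>j\<in>C. m (- j) = - m j" using that \<open>\<And>m j. m \<in> real_dual (span N) \<Longrightarrow> j \<in> C \<Longrightarrow> m (- j) = - m j\<close> by blast
   show ?thesis using neg C by (force simp: ball_Un)
  qed
  then show ?thesis unfolding PC by blast
 qed
 show "dual_cone N (fcone A) \<inter> perp N (fcone C) = fcone (crd A ` (A - C))" using C D(4) by (auto simp: PC fcone_dual_coordinates[OF D(1,2) Diff_subset])
qed

text \<open>All numerators are 1 by \<open>mdiff_coordinates\<close>, so the sum is the product of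
  the \<open>1 / (1 - exp x)\<close> and the integrals are products of the \<open>1 / (- x)\<close>
  over the coordinates \<open>x\<close>. Multiplying the interpolation identity by all the factors
  \<open>- x\<close> turns the left side into Todd functions.\<close>

lemma SI_basis_cone:
 fixes N :: "'v::euclidean_space set"
 assumes A: "lattice_basis A N" and Psi: "is_complement_map N Psi" and g: "generic_cone N Psi (fcone A)"
 shows "\<exists>D. dens (lat_C N) D \<and> (\<forall>xi\<in>D. (\<forall>j\<in>A. pairing xi (crd A j) \<noteq> 0) \<and>
  (\<Prod>j\<in>A. todd (- pairing xi (crd A j))) =
  (\<Sum>C\<in>Pow A. SI_interpolator N Psi (fcone C) xi * (\<Prod>j\<in>C. - pairing xi (crd A j))))"
proof -
 note D = lattice_basisD[OF A] and gD = generic_coneD[OF g]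
 have N: "is_lattice N" using A by (auto simp: is_lattice_def)
 have dualB: "crd A ` A \<subseteq> dual_lat N" using lattice_basisD(3)[OF dual_lat_basis[OF A]] .
 have indep: "independent (crd A ` A)" by (rule crd_independent[OF D(1,2)])
 have full: "span (fcone A) = span N" using span_fcone[OF D(1)] D(4) by simp
 have faces: "cone_faces (fcone A) = fcone ` Pow A" by (rule cone_faces_fcone[OF D(1,2) gD(5)])
 have 0: "0 \<in> dual_lat N" using is_lattice_closed(1)[OF is_lattice_dual_lat[OF N]] .
 define x where "x j xi = pairing xi (crd A j)" for j :: 'v and xi :: "'v \<times> 'v"
 have inj: "inj_on (crd A) K" if "K \<subseteq> A" for K by (rule inj_on_subset[OF crd_inj[OF D(2)] that])
 have supp: "pointed_cone.supp N (dual_cone N (fcone A) \<inter> perp N (fcone C)) (crd A ` (A - C)) = {0}"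
  and md: "m \<in> dual_lat N \<Longrightarrow> mdiff (crd A ` (A - C)) (cind (dual_cone N (fcone A) \<inter> perp N (fcone C))) m = (if m = 0 then 1 else 0)"
  if "C \<subseteq> A" for C m
 proof -
  note pc = pointed_cone_basis[OF A that]
  show md: "m \<in> dual_lat N \<Longrightarrow> mdiff (crd A ` (A - C)) (cind (dual_cone N (fcone A) \<inter> perp N (fcone C))) m = (if m = 0 then 1 else 0)" for m
   unfolding pointed_cone.P_gen[OF pc] by (rule mdiff_coordinates[OF A]) auto
  show "pointed_cone.supp N (dual_cone N (fcone A) \<inter> perp N (fcone C)) (crd A ` (A - C)) = {0}"
   unfolding pointed_cone.supp_def[OF pc] using md 0 by (auto split: if_splits)
 qed
 have E1: "\<exists>D. dens (lat_C N) D \<and> (\<forall>xi\<in>D. exp_sum N (dual_cone N (fcone A)) xi = 1 / (\<Prod>j\<in>A. 1 - exp (x j xi)))"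
 proof -
  have e: "dual_cone N (fcone A) \<inter> perp N (fcone {}) = dual_cone N (fcone A)" using perp_fcone by (auto simp: dual_cone_def)
  note pc = pointed_cone_basis[OF A empty_subsetI, unfolded e Diff_empty]
  have H: "finite (crd A ` A)" "crd A ` A \<subseteq> crd A ` A" using D(1) by auto
  have "pointed_cone.num N (dual_cone N (fcone A)) (crd A ` A) xi = 1" for xi
   using supp[OF empty_subsetI] md[OF empty_subsetI 0] unfolding pointed_cone.num_def[OF pc] e Diff_empty by simp
  moreover have "den (crd A ` A) xi = (\<Prod>j\<in>A. 1 - exp (x j xi))" for xi
   unfolding den_def x_def by (rule prod.reindex_cong[OF inj[OF subset_refl] refl refl])
  ultimately show ?thesis using pointed_cone.exp_sum_char[OF pc H dualB pointed_cone.J0[OF pc]] by auto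
 qed
 have E2: "\<exists>D. dens (lat_C N) D \<and> (\<forall>xi\<in>D. \<forall>C\<in>Pow A. (\<forall>j\<in>A - C. x j xi \<noteq> 0) \<and>
   exp_integral N (dual_cone N (fcone A) \<inter> perp N (fcone C)) xi = 1 / (\<Prod>j\<in>A - C. - x j xi))"
 proof (rule dens_ex)
  show "finite (Pow A)" using D(1) by simp
  fix C assume "C \<in> Pow A"
  then have C: "C \<subseteq> A" by simp
  note pc = pointed_cone_basis[OF A C]
  let ?J = "crd A ` (A - C)"
  have H: "finite ?J" "?J \<subseteq> ?J" "?J \<subseteq> dual_lat N" using D(1) dualB by auto
  have "independent ?J" by (rule real_vector.independent_mono[OF indep]) auto
  then have c0: "card ?J - dim ?J = 0" by (simp add: real_vector.dim_eq_card_independent)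
  have "pointed_cone.tay N (dual_cone N (fcone A) \<inter> perp N (fcone C)) ?J 0 xi = 1" for xi
   unfolding pointed_cone.tay_def[OF pc] using supp[OF C] md[OF C 0] by simp
  moreover have "(\<Prod>h\<in>?J. - pairing xi h) = (\<Prod>j\<in>A - C. - x j xi)" for xi
   unfolding x_def by (rule prod.reindex_cong[OF inj[OF Diff_subset] refl refl])
  ultimately show "\<exists>D. dens (lat_C N) D \<and> (\<forall>xi\<in>D. (\<forall>j\<in>A - C. x j xi \<noteq> 0) \<and>
   exp_integral N (dual_cone N (fcone A) \<inter> perp N (fcone C)) xi = 1 / (\<Prod>j\<in>A - C. - x j xi))"
   using pointed_cone.exp_integral_char[OF pc H pointed_cone.J0[OF pc]] unfolding c0 by (auto simp: x_def)
 qed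
 have E3: "\<exists>D. dens (lat_C N) D \<and> (\<forall>xi\<in>D. exp_sum N (dual_cone N (fcone A)) xi =
   (\<Sum>tau\<in>cone_faces (fcone A). SI_interpolator N Psi tau xi * exp_integral N (dual_cone N (fcone A) \<inter> perp N tau) xi))"
  using SI_interpolatorD(2)[OF N Psi g full] by (simp add: mero_eq_dens)
 have key: "(\<forall>j\<in>A. x j xi \<noteq> 0) \<and> (\<Prod>j\<in>A. todd (- x j xi)) = (\<Sum>C\<in>Pow A. SI_interpolator N Psi (fcone C) xi * (\<Prod>j\<in>C. - x j xi))"
  if 1: "exp_sum N (dual_cone N (fcone A)) xi = 1 / (\<Prod>j\<in>A. 1 - exp (x j xi))"
   and 2: "\<forall>C\<in>Pow A. (\<forall>j\<in>A - C. x j xi \<noteq> 0) \<and> exp_integral N (dual_cone N (fcone A) \<inter> perp N (fcone C)) xi = 1 / (\<Prod>j\<in>A - C. - x j xi)"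
   and 3: "exp_sum N (dual_cone N (fcone A)) xi =
   (\<Sum>tau\<in>cone_faces (fcone A). SI_interpolator N Psi tau xi * exp_integral N (dual_cone N (fcone A) \<inter> perp N tau) xi)" for xi
 proof
  show nz: "\<forall>j\<in>A. x j xi \<noteq> 0" using bspec[OF 2, of "{}"] by simp
  let ?\<mu> = "\<lambda>C. SI_interpolator N Psi (fcone C) xi"
  have "(\<Prod>j\<in>A. todd (- x j xi)) = (\<Prod>j\<in>A. - x j xi) * exp_sum N (dual_cone N (fcone A)) xi"
  proof -
   have "(\<Prod>j\<in>A. todd (- x j xi)) = (\<Prod>j\<in>A. - x j xi / (1 - exp (x j xi)))"
    using nz by (intro prod.cong refl) (simp add: todd_def)
   then show ?thesis unfolding 1 prod_dividef by simp
  qed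
  also have "exp_sum N (dual_cone N (fcone A)) xi = (\<Sum>C\<in>Pow A. ?\<mu> C * exp_integral N (dual_cone N (fcone A) \<inter> perp N (fcone C)) xi)"
   unfolding 3 faces by (rule sum.reindex_cong[OF fcone_inj[OF D(1,2)] refl refl])
  also have "(\<Prod>j\<in>A. - x j xi) * \<dots> = (\<Sum>C\<in>Pow A. ?\<mu> C * (\<Prod>j\<in>C. - x j xi))"
   unfolding sum_distrib_left
  proof (rule sum.cong[OF refl])
   fix C assume C: "C \<in> Pow A"
   have "(\<Prod>j\<in>A - C. - x j xi) \<noteq> 0" using nz D(1) by simp
   moreover have "(\<Prod>j\<in>A. - x j xi) = (\<Prod>j\<in>A - C. - x j xi) * (\<Prod>j\<in>C. - x j xi)"
    using C D(1) by (intro prod.subset_diff) auto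
   ultimately show "(\<Prod>j\<in>A. - x j xi) * (?\<mu> C * exp_integral N (dual_cone N (fcone A) \<inter> perp N (fcone C)) xi) = ?\<mu> C * (\<Prod>j\<in>C. - x j xi)"
    using bspec[OF 2 C] by simp
  qed
  finally show "(\<Prod>j\<in>A. todd (- x j xi)) = (\<Sum>C\<in>Pow A. ?\<mu> C * (\<Prod>j\<in>C. - x j xi))" .
 qed
 obtain D' where D': "dens (lat_C N) D'" and DA: "\<forall>xi\<in>D'. (exp_sum N (dual_cone N (fcone A)) xi = 1 / (\<Prod>j\<in>A. 1 - exp (x j xi))) \<and>
   (\<forall>C\<in>Pow A. (\<forall>j\<in>A - C. x j xi \<noteq> 0) \<and> exp_integral N (dual_cone N (fcone A) \<inter> perp N (fcone C)) xi = 1 / (\<Prod>j\<in>A - C. - x j xi)) \<and>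
   exp_sum N (dual_cone N (fcone A)) xi =
   (\<Sum>tau\<in>cone_faces (fcone A). SI_interpolator N Psi tau xi * exp_integral N (dual_cone N (fcone A) \<inter> perp N tau) xi)"
  using dens_ex2[OF E1 dens_ex2[OF E2 E3]] by blast
 show ?thesis unfolding x_def[symmetric]
  by (intro exI[of _ D'] conjI[OF D'] ballI key) (use DA in blast)+
qed

lemma nonsingular_projections:
 fixes N :: "'v::euclidean_space set"
 assumes B: "lattice_basis B N" and Psi: "is_complement_map N Psi" and G: "G \<subseteq> B" and g: "generic_cone N Psi (fcone G)"
 shows "simplicial_projections G (\<lambda>C. proj_R N Psi (fcone C))"
  and "C \<subseteq> G \<Longrightarrow> generic_cone N Psi (fcone C)"
proof -
 note D = lattice_basisD[OF B] and gD = generic_coneD[OF g]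
 have N: "is_lattice N" using B by (auto simp: is_lattice_def)
 have fG: "finite G" by (rule finite_subset[OF G D(1)])
 have iG: "independent G" by (rule real_vector.independent_mono[OF D(2) G])
 have faces: "cone_faces (fcone G) = fcone ` Pow G" by (rule cone_faces_fcone[OF fG iG gD(5)])
 have gen: "generic_cone N Psi (fcone C)" if "C \<subseteq> G" for C
  using generic_cone_face[OF g, of "fcone C"] faces that by blast
 then show "C \<subseteq> G \<Longrightarrow> generic_cone N Psi (fcone C)" by blast
 have L: "lat_Q (sublat N (fcone C)) \<in> subspaces Psi" if "C \<subseteq> G" for C by (rule generic_coneD(4)[OF gen[OF that]])
 have sp: "span (sublat N (fcone C)) = span C" if "C \<subseteq> G" for C
  using lattice_basis_sublat(2)[OF B] that G by blast
 have GN: "span G \<subseteq> span N" using span_mono[OF G] D(4) by simp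
 show "simplicial_projections G (\<lambda>C. proj_R N Psi (fcone C))"
 proof (rule simplicial_projections.intro)
  show "finite G" "independent G" by fact+
  show "linear (proj_R N Psi (fcone C))" if "C \<subseteq> G" for C by (rule proj_R_spec(1)[OF N Psi L[OF that]])
  show "proj_R N Psi (fcone C) x \<in> span C" if "C \<subseteq> G" "x \<in> span G" for C x
   using proj_R_range[OF N Psi L[OF that(1)], of x] sp[OF that(1)] GN that(2) by auto
  show "proj_R N Psi (fcone C) x = x" if "C \<subseteq> G" "x \<in> span C" for C x
   using proj_R_id[OF N Psi L[OF that(1)], of x] sp[OF that(1)] that(2) by auto
  show "proj_R N Psi (fcone A) (proj_R N Psi (fcone C) x) = proj_R N Psi (fcone A) x"
   if "A \<subseteq> C" "C \<subseteq> G" "x \<in> span G" for A C x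
  proof -
   have "finite C" using that(2) fG finite_subset by blast
   then show ?thesis using that(1) proj_R_trans[OF N Psi L L, of C A x] that GN by (auto intro!: fcone_subset fcone_base)
  qed
 qed
qed

section \<open>Comparison of the interpolator with a decomposition\<close>

context
 fixes N :: "'v::euclidean_space set" and Psi :: "'v complement_map" and B G :: "'v set"
 assumes B: "lattice_basis B N" and Psi: "is_complement_map N Psi" and GB: "G \<subseteq> B" and g: "generic_cone N Psi (fcone G)"
begin

interpretation simplicial_projections G "\<lambda>C. proj_R N Psi (fcone C)"
 by (rule nonsingular_projections(1)[OF B Psi GB g])

text \<open>Interpolator and decomposition solve the same system on the subspace of
  \<open>A\<close>. By induction the terms of the proper subsets agree after pullback, and on a
  dense open set the factor \<open>zprod A\<close> of the remaining term can be cancelled.\<close>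

lemma SI_eq_decomposition:
 assumes U: "good (\<lambda>eta. \<Prod>j\<in>G. todd (- z j eta)) U" and A: "A \<subseteq> G"
 shows "\<exists>D S. dens (lat_C A) D \<and> open S \<and> 0 \<in> S \<and>
  (\<forall>eta\<in>D \<inter> S. SI_interpolator (sublat N (fcone A)) (induced_map N Psi (fcone A)) (fcone A) eta = U A eta)"
 using A
proof (induction "card A" arbitrary: A rule: less_induct)
 case less
 note A = less.prems
 define m where "m C = SI_interpolator (sublat N (fcone C)) (induced_map N Psi (fcone C)) (fcone C)" for C
 let ?N = "sublat N (fcone A)" and ?Psi = "induced_map N Psi (fcone A)"
 have N: "is_lattice N" using B by (auto simp: is_lattice_def)
 have gen: "generic_cone N Psi (fcone C)" if "C \<subseteq> G" for C by (rule nonsingular_projections(2)[OF B Psi GB g that])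
 note L = generic_coneD(4)[OF gen]
 have AB: "A \<subseteq> B" using A GB by auto
 note bA = lattice_basis_sublat(1)[OF B AB]
 have sN: "span ?N = span A" by (rule lattice_basis_sublat(2)[OF B AB])
 have XA: "lat_C ?N = lat_C A" by (simp add: lat_C_def sN)
 note N' = is_lattice_sublat[OF N] and Psi' = is_complement_map_induced[OF Psi L[OF A]]
 note g' = generic_cone_full(1)[OF gen[OF A]]
 have fA: "finite A" by (rule finite_sub[OF A])
 have cz: "pairing eta (crd A j) = z j eta" if "eta \<in> lat_C A" for j eta
  using that real_vector.representation_extend[OF G(2) _ A] by (auto simp: z_def pairing_def lat_C_def)
 have E1: "\<exists>D. dens (lat_C A) D \<and> (\<forall>xi\<in>D. (\<forall>j\<in>A. pairing xi (crd A j) \<noteq> 0) \<and>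
  (\<Prod>j\<in>A. todd (- pairing xi (crd A j))) = (\<Sum>C\<in>Pow A. SI_interpolator ?N ?Psi (fcone C) xi * (\<Prod>j\<in>C. - pairing xi (crd A j))))" (is "\<exists>D. _ \<and> (\<forall>xi\<in>D. ?A xi)")
  using SI_basis_cone[OF bA Psi' g'] unfolding XA .
 have E2: "\<exists>D. dens (lat_C A) D \<and> (\<forall>xi\<in>D. \<forall>C\<in>Pow A. SI_interpolator ?N ?Psi (fcone C) xi = m C (P C xi))" (is "\<exists>D. _ \<and> (\<forall>xi\<in>D. ?B xi)")
 proof (rule dens_ex)
  show "finite (Pow A)" using fA by simp
  fix C assume "C \<in> Pow A"
  then have C: "C \<subseteq> A" "C \<subseteq> G" using A by auto
  have sub: "fcone C \<subseteq> fcone A" using C fA by (intro fcone_subset fcone_base) auto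
  have gC: "generic_cone ?N ?Psi (fcone C)" by (rule generic_cone_induced[OF gen[OF C(2)] sub])
  have pr: "proj_C ?N ?Psi (fcone C) eta = P C eta" if "eta \<in> lat_C A" for eta
   using that proj_R_induced[OF N Psi L[OF A] L[OF C(2)] sub] by (auto simp: proj_C_def P_def lat_C_def sN)
  obtain D where D: "dens (lat_C A) D" "\<And>xi. xi \<in> D \<Longrightarrow> SI_interpolator ?N ?Psi (fcone C) xi = m C (proj_C ?N ?Psi (fcone C) xi)"
   using SI_interpolatorD(3)[OF N' Psi' gC] unfolding mero_eq_dens XA m_def sublat_sublat[OF sub] induced_induced[OF sub] by blast
  show "\<exists>D. dens (lat_C A) D \<and> (\<forall>xi\<in>D. SI_interpolator ?N ?Psi (fcone C) xi = m C (P C xi))"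
   using D pr dens_subset[OF D(1)] by (intro exI[of _ D] conjI ballI) (metis subsetD)+
 qed
 define Q where "Q C D S \<longleftrightarrow> dens (lat_C C) D \<and> open S \<and> 0 \<in> S \<and> (\<forall>eta\<in>D \<inter> S. m C eta = U C eta)" for C D and S :: "('v \<times> 'v) set"
 have "\<exists>D S. Q C D S" if C: "C \<in> Pow A - {A}" for C unfolding Q_def m_def
  using less.hyps[of C] C A psubset_card_mono[OF fA, of C] by auto
 then obtain Dc Sc where Q: "\<And>C. C \<in> Pow A - {A} \<Longrightarrow> Q C (Dc C) (Sc C)" by metis
 have E3: "\<exists>D. dens (lat_C A) D \<and> (\<forall>xi\<in>D. \<forall>C\<in>Pow A - {A}. P C xi \<in> Dc C)" (is "\<exists>D. _ \<and> (\<forall>xi\<in>D. ?C xi)")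
 proof (rule dens_ex)
  show "finite (Pow A - {A})" using fA by simp
  fix C assume C: "C \<in> Pow A - {A}"
  then have CA: "C \<subseteq> A" "C \<subseteq> G" using A by auto
  have "cproj (P C) (lat_C A) (lat_C C)"
   using cproj_P[OF CA(2)] lat_C_mono[OF CA(1)] lat_C_mono[OF A] csub_lat_C[of A] unfolding cproj_def by blast
  from dens_vimage[OF this] Q[OF C]
  show "\<exists>D. dens (lat_C A) D \<and> (\<forall>xi\<in>D. P C xi \<in> Dc C)" unfolding Q_def by blast
 qed
 have n1: "near (\<lambda>eta. \<forall>C\<in>Pow A - {A}. P C eta \<in> Sc C)"
 proof -
  have "near (\<lambda>eta. P C eta \<in> Sc C)" if C: "C \<in> Pow A - {A}" for C using near_P Q[OF C] C A by (auto simp: Q_def intro!: eventually_nhds_in_open)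
  then show ?thesis using fA by (subst eventually_ball_finite_distrib) auto
 qed
 obtain S0 where S0: "open S0" "0 \<in> S0" "good_on S0 (\<lambda>eta. \<Prod>j\<in>G. todd (- z j eta)) U" using U by (auto simp: good_def)
 obtain S' where S': "open S'" "0 \<in> S'" and SA: "\<forall>eta\<in>S'. \<forall>C\<in>Pow A - {A}. P C eta \<in> Sc C"
  using n1 unfolding eventually_nhds by blast
 define S where "S = S0 \<inter> S'"
 have S: "open S" "0 \<in> S" using S0 S' by (auto simp: S_def)
 have S1: "P C eta \<in> Sc C" if "eta \<in> S" "C \<in> Pow A - {A}" for eta C using SA that by (auto simp: S_def)
 have S2: "U C (P C eta) = U C eta" if "C \<in> Pow A - {A}" "eta \<in> X" for eta C using good_onD(2)[OF S0(3), of C eta] that A by blast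
 have S3: "(\<Sum>C\<in>Pow A. U C eta * zprod C eta) = (\<Prod>j\<in>G. todd (- z j eta))" if "eta \<in> S" "eta \<in> lat_C A" for eta
  using good_onD(3)[OF S0(3) A] that by (simp add: S_def)
 obtain D where D: "dens (lat_C A) D" and DA: "\<forall>xi\<in>D. ?A xi \<and> ?B xi \<and> ?C xi"
  using dens_ex2[OF E1 dens_ex2[OF E2 E3]] by blast
 have D1: "pairing xi (crd A j) \<noteq> 0" if "xi \<in> D" "j \<in> A" for xi j using DA that by blast
 have D2: "(\<Prod>j\<in>A. todd (- pairing xi (crd A j))) = (\<Sum>C\<in>Pow A. SI_interpolator ?N ?Psi (fcone C) xi * (\<Prod>j\<in>C. - pairing xi (crd A j)))"
  if "xi \<in> D" for xi using DA that by blast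
 have D3: "SI_interpolator ?N ?Psi (fcone C) xi = m C (P C xi)" if "xi \<in> D" "C \<in> Pow A" for xi C using DA that by blast
 have D4: "P C xi \<in> Dc C" if "xi \<in> D" "C \<in> Pow A - {A}" for xi C using DA that by blast
 have "m A eta = U A eta" if eta: "eta \<in> D \<inter> S" for eta
 proof -
  have etaA: "eta \<in> lat_C A" using eta dens_subset[OF D] by blast
  then have etaX: "eta \<in> X" using lat_C_mono[OF A] by blast
  have "(\<Sum>C\<in>Pow A. m C (P C eta) * zprod C eta) = (\<Prod>j\<in>A. todd (- z j eta))"
   using D2[of eta] D3[of eta] eta by (simp add: cz[OF etaA] zprod_def)
  \<comment> \<open>The coordinates outside \<open>A\<close> vanish on its subspace, so the
    additional factors are \<open>todd 0 = 1\<close>.\<close>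
  also have "\<dots> = (\<Prod>j\<in>G. todd (- z j eta))"
   using z_zero[OF A etaA] A G(1) by (intro prod.mono_neutral_left) (auto simp: todd_def)
  also have "\<dots> = (\<Sum>C\<in>Pow A. U C eta * zprod C eta)" using S3[of eta] eta etaA by simp
  finally have "(\<Sum>C\<in>Pow A. m C (P C eta) * zprod C eta) = (\<Sum>C\<in>Pow A. U C eta * zprod C eta)" .
  moreover have "(\<Sum>C\<in>Pow A - {A}. m C (P C eta) * zprod C eta) = (\<Sum>C\<in>Pow A - {A}. U C eta * zprod C eta)"
  proof (rule sum.cong[OF refl])
   fix C assume C: "C \<in> Pow A - {A}"
   have "P C eta \<in> Dc C \<inter> Sc C" using D4[OF _ C] S1[OF _ C] eta by blast
   then show "m C (P C eta) * zprod C eta = U C eta * zprod C eta" using Q[OF C] S2[OF C etaX] by (simp add: Q_def)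
  qed
  ultimately have "m A (P A eta) * zprod A eta = U A eta * zprod A eta"
   using fA sum.remove[of "Pow A" A "\<lambda>C. m C (P C eta) * zprod C eta"] sum.remove[of "Pow A" A "\<lambda>C. U C eta * zprod C eta"] by simp
  moreover have "zprod A eta \<noteq> 0" using D1[of eta] eta fA by (simp add: zprod_def cz[OF etaA])
  ultimately show ?thesis using P_id[OF A etaA] by simp
 qed
 then show ?case unfolding m_def using D S by blast
qed

text \<open>Heredity pulls the comparison on the span of \<open>G\<close> back to \<open>N\<close>,
  and the linear projection maps 0 to 0.\<close>

lemma SI_value_decomposition:
 assumes U: "good (\<lambda>eta. \<Prod>j\<in>G. todd (- z j eta)) U"
 shows "has_mero_value (lat_C N) (SI_interpolator N Psi (fcone G)) 0 (U G 0)"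
proof -
 have N: "is_lattice N" using B by (auto simp: is_lattice_def)
 let ?pr = "proj_C N Psi (fcone G)"
 have XG: "lat_C (sublat N (fcone G)) = X" using lattice_basis_sublat(2)[OF B GB] by (simp add: lat_C_def)
 have cp: "cproj ?pr (lat_C N) X" using cproj_proj_C[OF N Psi generic_coneD(4)[OF g]] unfolding XG .
 then have pr: "clin ?pr" "\<And>xi. xi \<in> lat_C N \<Longrightarrow> ?pr xi \<in> X" by (auto simp: cproj_def)
 obtain D S where DS: "dens X D" "open S" "0 \<in> S"
  "\<And>eta. eta \<in> D \<inter> S \<Longrightarrow> SI_interpolator (sublat N (fcone G)) (induced_map N Psi (fcone G)) (fcone G) eta = U G eta"
  using SI_eq_decomposition[OF U subset_refl] by blast
 obtain T where T: "open T" "0 \<in> T" "holo_on X (X \<inter> T) (U G)" using U good_onD(1)[OF _ subset_refl] unfolding good_def by blast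
 obtain D' where D': "dens (lat_C N) D'"
  "\<And>xi. xi \<in> D' \<Longrightarrow> SI_interpolator N Psi (fcone G) xi = SI_interpolator (sublat N (fcone G)) (induced_map N Psi (fcone G)) (fcone G) (?pr xi)"
  using SI_interpolatorD(3)[OF N Psi g] unfolding mero_eq_dens by blast
 define V where "V = lat_C N \<inter> ?pr -` (S \<inter> T)"
 have lin: "linear ?pr" using pr(1) by (simp add: clin_def)
 have Vo: "openin (top_of_set (lat_C N)) V" unfolding V_def
  using DS(2) T(1) clin_continuous[OF pr(1), of UNIV] by (intro openin_open_Int open_vimage) auto
 show ?thesis unfolding has_mero_value_def
 proof (intro exI[of _ V] exI[of _ "\<lambda>xi. U G (?pr xi)"] conjI Vo)
  show "0 \<in> V" using csubD(6)[OF csub_lat_C[of N]] linear_0[OF lin] DS(3) T(2) by (simp add: V_def)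
  show "holo_on (lat_C N) V (\<lambda>xi. U G (?pr xi))"
   by (rule holo_on_compose_linear[OF T(3) pr(1)]) (use pr(2) in \<open>auto simp: V_def\<close>)
  have "dens (lat_C N) (D' \<inter> {xi\<in>lat_C N. ?pr xi \<in> D})" by (intro dens_Int D'(1) dens_vimage[OF cp DS(1)])
  note de = dens_restrict[OF this Vo]
  show "mero_eq V (SI_interpolator N Psi (fcone G)) (\<lambda>xi. U G (?pr xi))"
   unfolding mero_eq_dens by (intro exI conjI, rule de) (use D'(2) DS(4) in \<open>auto simp: V_def\<close>)
  show "U G (?pr 0) = U G 0" using linear_0[OF lin] by simp
 qed
qed

end

section \<open>The cycle Todd coefficients of a nonsingular fan\<close>

text \<open>Because of this constant term, divisors that act as 0 at a cone leave its coefficient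
  unchanged.\<close>

lemma todd_series_0: "fps_nth todd_series 0 = 1"
proof -
 have "fps_nth (todd_series * (1 - fps_exp (- 1))) 1 = (1 :: rat)" by (simp add: todd_series_mult)
 then show ?thesis by (simp add: fps_mult_nth_1)
qed

lemma fcone_empty [simp]: "fcone {} = {0}"
 by (auto simp: fcone_def)

lemma dim_fcone: "finite A \<Longrightarrow> independent A \<Longrightarrow> dim (fcone A) = card A"
 by (metis dim_eq_card_independent dim_span span_fcone)

section \<open>Primitive generators and nonsingular fans\<close>

lemma crd_sub:
 assumes "independent B" "A \<subseteq> B" "x \<in> span A"
 shows "crd B j x = crd A j x"
 using real_vector.representation_extend[OF assms(1,3,2)] by simp

lemma crd_span_sub: "independent B \<Longrightarrow> A \<subseteq> B \<Longrightarrow> x \<in> span A \<Longrightarrow> j \<notin> A \<Longrightarrow> crd B j x = 0"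
 using crd_sub[of B A x j] real_vector.representation_ne_zero[of A x j] by metis

text \<open>The \<open>n\<close>-coordinate determines the class modulo \<open>span C\<close>. It is
  an integer for lattice points, primitivity forces it to be 1 or -1, and lying in the image of the
  cone fixes the sign.\<close>

lemma primitive_rep_basis:
 assumes B: "lattice_basis B N" and C: "insert n C \<subseteq> B" "n \<notin> C"
 shows "primitive_rep N (fcone (insert n C)) (fcone C) n"
  and "primitive_rep N (fcone (insert n C)) (fcone C) v \<Longrightarrow> v \<in> N \<and> v - n \<in> span C"
proof -
 note D = lattice_basisD[OF B]
 have fC: "finite C" using finite_subset[OF _ D(1)] C(1) by auto
 have nB: "n \<in> B" and CB: "C \<subseteq> B" using C by auto
 have s: "span (fcone C) = span C" by (rule span_fcone[OF fC])
 have z: "crd B n x = 0" if "x \<in> span C" for x by (rule crd_span_sub[OF D(2) CB that C(2)])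
 have spB: "x \<in> span B" if "x \<in> span C" for x using span_mono[OF CB] that by blast
 have N1: "\<bar>k\<bar> = 1" if w: "w \<in> N" and k: "n - of_int k *\<^sub>R w \<in> span C" for w and k :: int
 proof -
  have wB: "w \<in> span B" using w D(5) by auto
  obtain t :: int where t: "crd B n w = of_int t" using lattice_mem_iff[OF B, of w] w nB by (auto elim: Ints_cases)
  have "of_int (k * t) = (1::real)" using nB wB z[OF k] t by (simp add: linear_on_representation(2)[OF D(2)] linear_on_representation(3)[OF D(2) wB wB] span_base span_scale crd_basis[OF D(2)])
  then show ?thesis using of_int_eq_1_iff abs_1 zmult_eq_1_iff abs_minus_cancel by fastforce
 qed
 have nf: "n \<in> fcone (insert n C)" using fC by (intro fcone_base) auto
 show "primitive_rep N (fcone (insert n C)) (fcone C) n" using nB D(3) nf N1 by (auto simp: primitive_rep_def s span_zero intro!: conjI ballI allI impI bexI[of _ n])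
 assume v: "primitive_rep N (fcone (insert n C)) (fcone C) v"
 then obtain x where x: "v \<in> N" "x \<in> fcone (insert n C)" "v - x \<in> span C" unfolding primitive_rep_def s by blast
 obtain a t where a: "a \<in> fcone C" "0 \<le> t" "x = a + t *\<^sub>R n" using x(2) fcone_insert[OF fC] by blast
 have aC: "a \<in> span C" using a(1) fcone_span by blast
 have vt: "v - t *\<^sub>R n \<in> span C" using span_add[OF x(3) aC] a(3) by (simp add: algebra_simps)
 have vB: "v \<in> span B" using x(1) D(5) by auto
 have nS: "n \<in> span B" using nB by (simp add: span_base)
 have tv: "crd B n v = t" using nB z[OF vt] by (simp add: linear_on_representation(2)[OF D(2) vB] linear_on_representation(3)[OF D(2) nS nS] span_scale nS crd_basis[OF D(2)])
 obtain k :: int where k: "crd B n v = of_int k" using lattice_mem_iff[OF B, of v] x(1) nB by (auto elim: Ints_cases)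
 have nN: "n \<in> N" using nB D(3) by auto
 have "v - of_int k *\<^sub>R n \<in> span (fcone C)" using vt tv k s by simp
 then have "k = 1" using v nN a(2) tv k by (fastforce simp: primitive_rep_def)
 then show "v \<in> N \<and> v - n \<in> span C" using x(1) vt tv k by simp
qed

lemma prim_gen_basis:
 assumes "lattice_basis B N" "insert n C \<subseteq> B" "n \<notin> C"
 shows "prim_gen N (fcone (insert n C)) (fcone C) \<in> N" "prim_gen N (fcone (insert n C)) (fcone C) - n \<in> span C"
proof -
 have "primitive_rep N (fcone (insert n C)) (fcone C) (prim_gen N (fcone (insert n C)) (fcone C))"
  unfolding prim_gen_def by (rule someI[of "primitive_rep N (fcone (insert n C)) (fcone C)", OF primitive_rep_basis(1)[OF assms]])
 from primitive_rep_basis(2)[OF assms this]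
 show "prim_gen N (fcone (insert n C)) (fcone C) \<in> N" "prim_gen N (fcone (insert n C)) (fcone C) - n \<in> span C" by auto
qed

lemma ray_gen_basis:
 assumes "lattice_basis B N" "n \<in> B"
 shows "ray_gen N (fcone {n}) = n"
 using prim_gen_basis(2)[OF assms(1), of n "{}"] assms(2) by (simp add: ray_gen_def)

lemma nonsingular_coneE:
 assumes "nonsingular_cone N sig"
 obtains B G where "lattice_basis B N" "G \<subseteq> B" "sig = fcone G" "finite G" "independent G"
proof -
 obtain B G where BG: "lattice_basis B N" "G \<subseteq> B" "sig = convex_cone hull G"
  using assms by (auto simp: nonsingular_cone_def)
 note D = lattice_basisD[OF BG(1)]
 show ?thesis using finite_subset[OF BG(2) D(1)] real_vector.independent_mono[OF D(2) BG(2)] that[OF BG(1,2)] BG(3) by (simp add: convex_cone_hull_eq_fcone)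
qed

lemma nonsingular_coneI:
 assumes "lattice_basis B N" "G \<subseteq> B"
 shows "nonsingular_cone N (fcone G)"
 using assms convex_cone_hull_eq_fcone[of G] finite_subset[OF assms(2) lattice_basisD(1)[OF assms(1)]]
 unfolding nonsingular_cone_def by metis

lemma generic_cone_fan:
 assumes "generic_fan N Psi \<Sigma>" "sig \<in> \<Sigma>"
 shows "generic_cone N Psi sig"
proof -
 have F: "finite \<Sigma>" "\<And>tau. tau \<in> \<Sigma> \<Longrightarrow> is_cone N tau" "\<And>tau. tau \<in> \<Sigma> \<Longrightarrow> cone_faces tau \<subseteq> \<Sigma>"
   "\<And>tau tau'. tau \<in> \<Sigma> \<Longrightarrow> tau' \<in> \<Sigma> \<Longrightarrow> tau \<inter> tau' \<in> cone_faces tau \<and> tau \<inter> tau' \<in> cone_faces tau'"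
   "\<And>tau. tau \<in> \<Sigma> \<Longrightarrow> lat_Q (sublat N tau) \<in> subspaces Psi"
  using assms(1) by (auto simp: generic_fan_def is_fan_def)
 have sub: "cone_faces sig \<subseteq> \<Sigma>" by (rule F(3)[OF assms(2)])
 have self: "sig \<in> cone_faces sig" using is_cone_basic(1,2)[OF F(2)[OF assms(2)]] by (auto simp: cone_faces_def face_of_refl)
 have "is_fan N (cone_faces sig)" unfolding is_fan_def
 proof (intro conjI ballI)
  show "finite (cone_faces sig)" by (rule finite_subset[OF sub F(1)])
  show "cone_faces sig \<noteq> {}" using self by blast
  show "cone_faces tau \<subseteq> cone_faces sig" if "tau \<in> cone_faces sig" for tau by (rule cone_faces_trans[OF that])
 qed (use F(2,4) sub in blast)+
 then show ?thesis using F(2,5) sub assms(2) by (auto simp: generic_cone_def generic_fan_def)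
qed

lemma Ints_of_rat: "(of_rat q :: real) \<in> \<int> \<Longrightarrow> q \<in> \<int>"
 by (metis Ints_cases Ints_of_int of_rat_eq_iff of_rat_of_int_eq)

lemma fps_apply_todd_trivial:
 assumes "\<And>z. E z s = 0"
 shows "fps_apply todd_series E y s = y s"
proof -
 have "(E ^^ k) y s = 0" if "k \<noteq> 0" for k using that assms by (cases k) auto
 then have "{k. (E ^^ k) y s \<noteq> 0} \<subseteq> {0}" by auto
 then have "fps_apply todd_series E y s = (\<Sum>k\<in>{0}. fps_nth todd_series k * (E ^^ k) y s)"
  unfolding fps_apply_def by (intro sum.mono_neutral_left) auto
 then show ?thesis by (simp add: todd_series_0)
qed

section \<open>The action of the divisors on the faces of one cone of a fan\<close>

context
 fixes N :: "'v::euclidean_space set" and Psi :: "'v complement_map" and \<Sigma> :: "'v set set" and B G :: "'v set"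
 assumes Psi: "is_complement_map N Psi" and fan: "nonsingular_generic_fan N Psi \<Sigma>"
  and B: "lattice_basis B N" and GB: "G \<subseteq> B" and G\<Sigma>: "fcone G \<in> \<Sigma>"
begin

lemma gfan: "generic_fan N Psi \<Sigma>"
 using fan by (simp add: nonsingular_generic_fan_def)

lemma gcone: "generic_cone N Psi (fcone G)"
 by (rule generic_cone_fan[OF gfan G\<Sigma>])

interpretation simplicial_projections G "\<lambda>C. proj_R N Psi (fcone C)"
 by (rule nonsingular_projections(1)[OF B Psi GB gcone])

lemma N_lattice: "is_lattice N"
 using B by (auto simp: is_lattice_def)

lemma sub_indep: "A \<subseteq> G \<Longrightarrow> finite A" "A \<subseteq> G \<Longrightarrow> independent A"
 using finite_sub real_vector.independent_mono[OF G(2)] by auto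

lemma gen_face: "A \<subseteq> G \<Longrightarrow> generic_cone N Psi (fcone A)"
 by (rule nonsingular_projections(2)[OF B Psi GB gcone])

lemma faces: "A \<subseteq> G \<Longrightarrow> cone_faces (fcone A) = fcone ` Pow A"
 by (rule cone_faces_fcone[OF sub_indep generic_coneD(5)[OF gen_face]])

lemma face_in_fan: "A \<subseteq> G \<Longrightarrow> fcone A \<in> \<Sigma>"
 using faces[OF subset_refl] gfan G\<Sigma> unfolding generic_fan_def is_fan_def by blast

lemma fcone_eq_iff: "A \<subseteq> G \<Longrightarrow> C \<subseteq> G \<Longrightarrow> fcone A = fcone C \<longleftrightarrow> A = C"
 using fcone_inj[OF G] by (auto dest: inj_onD)

lemma ray_in_fan: "j \<in> G \<Longrightarrow> fcone {j} \<in> rays \<Sigma>"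
 using face_in_fan[of "{j}"] dim_fcone[of "{j}"] sub_indep[of "{j}"] by (simp add: rays_def)

lemma ray_gen_face: "j \<in> G \<Longrightarrow> ray_gen N (fcone {j}) = j"
 using ray_gen_basis[OF B] GB by blast

text \<open>In a fan the ray meets the cone in a common face. As that face contains the nonzero
  generator it is the whole ray, so the ray is a one-dimensional face of the cone.\<close>

lemma ray_in_cone:
 assumes \<rho>: "\<rho> \<in> rays \<Sigma>" and A: "A \<subseteq> G" and mem: "ray_gen N \<rho> \<in> fcone A"
 shows "\<exists>j\<in>A. \<rho> = fcone {j}"
proof -
 have r\<Sigma>: "\<rho> \<in> \<Sigma>" "dim \<rho> = 1" using \<rho> by (auto simp: rays_def)
 have "nonsingular_cone N \<rho>" using fan r\<Sigma>(1) by (simp add: nonsingular_generic_fan_def)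
 then obtain B' G' where BG: "lattice_basis B' N" "G' \<subseteq> B'" "\<rho> = fcone G'" "finite G'" "independent G'" by (rule nonsingular_coneE)
 have "card G' = 1" using dim_fcone[OF BG(4,5)] r\<Sigma>(2) BG(3) by simp
 then obtain n where n: "G' = {n}" by (auto simp: card_1_singleton_iff)
 have rn: "ray_gen N \<rho> = n" using ray_gen_basis[OF BG(1), of n] BG(2,3) n by auto
 have inter: "\<rho> \<inter> fcone A \<in> cone_faces \<rho>" "\<rho> \<inter> fcone A \<in> cone_faces (fcone A)"
  using gfan r\<Sigma>(1) face_in_fan[OF A] unfolding generic_fan_def is_fan_def by blast+
 have "is_cone N tau" if "tau \<in> cone_faces (fcone G')" for tau
  using that generic_coneD(5)[OF generic_cone_fan[OF gfan r\<Sigma>(1)]] BG(3) by simp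
 then have "cone_faces \<rho> = fcone ` Pow G'" unfolding BG(3) by (rule cone_faces_fcone[OF BG(4,5)])
 then obtain C where C: "C \<subseteq> {n}" "\<rho> \<inter> fcone A = fcone C" using inter(1) n by auto
 have n\<rho>: "n \<in> \<rho>" unfolding BG(3) n by (rule fcone_base) auto
 have n0: "n \<noteq> 0" using BG(5) n by (auto simp: dependent_zero)
 have "C \<noteq> {}" using C(2) n\<rho> mem rn n0 by auto
 then have "\<rho> \<inter> fcone A = \<rho>" using C n BG(3) by (metis subset_singletonD)
 then obtain A' where A': "A' \<subseteq> A" "\<rho> = fcone A'" using inter(2) faces[OF A] by auto
 have A'G: "A' \<subseteq> G" using A' A by blast
 have "card A' = 1" using dim_fcone[OF sub_indep[OF A'G]] r\<Sigma>(2) A'(2) by simp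
 then obtain j where "A' = {j}" by (auto simp: card_1_singleton_iff)
 then show ?thesis using A' by auto
qed

text \<open>The sum has at most one nonzero term; written this way it covers rays of the cone and
  all other rays, for which it is 0, at once.\<close>

lemma ray_dual_face:
 assumes \<rho>: "\<rho> \<in> rays \<Sigma>" and A: "A \<subseteq> G"
 shows "ray_dual N \<Sigma> \<rho> (fcone A) = (\<lambda>x. \<Sum>b\<in>A. (if fcone {b} = \<rho> then 1 else 0) * crdq (sublat N (fcone A)) A b x)"
proof -
 let ?N = "sublat N (fcone A)"
 have AB: "A \<subseteq> B" using A GB by auto
 note bA = lattice_basis_sublat(1)[OF B AB]
 note D = lattice_basisD[OF bA]
 have N': "is_lattice ?N" using bA by (auto simp: is_lattice_def)
 define d where "d x = (\<Sum>b\<in>A. (if fcone {b} = \<rho> then 1 else 0) * crdq ?N A b x)" for x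
 have cond: "(\<forall>\<rho>'\<in>rays \<Sigma>. ray_gen N \<rho>' \<in> fcone A \<longrightarrow> f (ray_gen N \<rho>') = (if \<rho>' = \<rho> then 1 else 0)) \<longleftrightarrow>
   (\<forall>b\<in>A. f b = (if fcone {b} = \<rho> then 1 else 0))" for f :: "'v \<Rightarrow> rat"
 proof
  assume L: "\<forall>\<rho>'\<in>rays \<Sigma>. ray_gen N \<rho>' \<in> fcone A \<longrightarrow> f (ray_gen N \<rho>') = (if \<rho>' = \<rho> then 1 else 0)"
  show "\<forall>b\<in>A. f b = (if fcone {b} = \<rho> then 1 else 0)"
  proof
   fix b assume b: "b \<in> A"
   then have bG: "b \<in> G" using A by auto
   show "f b = (if fcone {b} = \<rho> then 1 else 0)" using b D(1) bspec[OF L ray_in_fan[OF bG]] ray_gen_face[OF bG] by (fastforce intro: fcone_base)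
  qed
 next
  assume R: "\<forall>b\<in>A. f b = (if fcone {b} = \<rho> then 1 else 0)"
  show "\<forall>\<rho>'\<in>rays \<Sigma>. ray_gen N \<rho>' \<in> fcone A \<longrightarrow> f (ray_gen N \<rho>') = (if \<rho>' = \<rho> then 1 else 0)"
  proof (intro ballI impI)
   fix \<rho>' assume r: "\<rho>' \<in> rays \<Sigma>" "ray_gen N \<rho>' \<in> fcone A"
   obtain j where j: "j \<in> A" "\<rho>' = fcone {j}" using ray_in_cone[OF r(1) A r(2)] by blast
   then show "f (ray_gen N \<rho>') = (if \<rho>' = \<rho> then 1 else 0)" using ray_gen_face[of j] A R j by fastforce
  qed
 qed
 have crq: "crdq ?N A b k = (if b = k then 1 else 0)" if "k \<in> A" for b k
 proof -
  have "k \<in> lat_Q ?N" using that D(3) lat_Q_closed(1)[OF N'] by auto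
  from of_rat_crdq[OF bA this, of b] have "(of_rat (crdq ?N A b k) :: real) = of_rat (if b = k then 1 else 0)"
   using crd_basis[OF D(2) that] by simp
  then show ?thesis by (simp only: of_rat_eq_iff)
 qed
 have dA: "d k = (if fcone {k} = \<rho> then 1 else 0)" if "k \<in> A" for k
  using D(1) that by (simp add: d_def crq if_distrib[of "\<lambda>x. _ * x"] sum.delta cong: if_cong)
 have dd: "d \<in> rat_dual (lat_Q ?N)" unfolding d_def[abs_def] by (intro rat_dual_lincomb crdq_in_rat_dual bA)
 have dI: "d \<in> dual_lat_in_Q ?N" unfolding dual_lat_in_Q_def
 proof (intro CollectI conjI dd ballI)
  fix x assume x: "x \<in> ?N"
  then have "x \<in> lat_Q ?N" using lat_Q_closed(1)[OF N'] by auto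
  have "crdq ?N A b x \<in> \<int>" if "b \<in> A" for b
   by (rule Ints_of_rat) (use of_rat_crdq[OF bA \<open>x \<in> lat_Q ?N\<close>, of b] lattice_mem_iff[OF bA, of x] x that in simp)
  then show "d x \<in> \<int>" unfolding d_def by (intro Ints_sum Ints_mult) auto
 qed
 have "(THE f. f \<in> dual_lat_in_Q ?N \<and> (\<forall>b\<in>A. f b = (if fcone {b} = \<rho> then 1 else 0))) = d"
 proof (rule the_equality)
  show "d \<in> dual_lat_in_Q ?N \<and> (\<forall>b\<in>A. d b = (if fcone {b} = \<rho> then 1 else 0))" using dI dA by blast
  fix f assume f: "f \<in> dual_lat_in_Q ?N \<and> (\<forall>b\<in>A. f b = (if fcone {b} = \<rho> then 1 else 0))"
  then have "f \<in> rat_dual (lat_Q ?N)" by (simp add: dual_lat_in_Q_def)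
  from rat_dual_expand[OF bA this] have "f x = d x" for x using f by (simp add: d_def fun_eq_iff)
  then show "f = d" by auto
 qed
 then show ?thesis unfolding ray_dual_def cond by (simp add: d_def[abs_def])
qed

text \<open>Links the fan to the abstract coefficients \<open>c\<close>: the lifted functional at
  \<open>v\<close> equals the original one at the projection of \<open>v\<close>, so the pairing is
  a coordinate of \<open>v\<close> minus its projection.\<close>

lemma coeff_D_face:
 assumes \<rho>: "\<rho> \<in> rays \<Sigma>" and C: "insert n C \<subseteq> G" "n \<notin> C"
 shows "(of_rat (coeff_D N Psi \<Sigma> \<rho> (fcone C) (fcone (insert n C))) :: real) = (\<Sum>i\<in>{i\<in>G. fcone {i} = \<rho>}. c i C n)"
proof -
 let ?A = "insert n C" and ?p = "proj_R N Psi (fcone C)"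
 have CG: "C \<subseteq> G" and nG: "n \<in> G" and AB: "?A \<subseteq> B" and CB: "C \<subseteq> B" using C GB by auto
 note L = generic_coneD(4)[OF gen_face[OF CG]]
 define v where "v = prim_gen N (fcone ?A) (fcone C)"
 have v: "v \<in> N" "v - n \<in> span C" using prim_gen_basis[OF B AB C(2)] by (auto simp: v_def)
 note bA = lattice_basis_sublat(1)[OF B AB] and bC = lattice_basis_sublat(1)[OF B CB]
 have latN: "is_lattice (sublat N (fcone ?A))" "is_lattice (sublat N (fcone C))" by (intro is_lattice_sublat N_lattice)+
 have vA: "v \<in> span ?A"
  using span_add[of "v - n" ?A n] v(2) span_mono[of C ?A] by (auto simp: span_base)
 have vL: "v \<in> lat_Q (sublat N (fcone ?A))"
  using v(1) vA lat_Q_closed(1)[OF latN(1)] span_fcone[of ?A] sub_indep(1)[OF C(1)] by (auto simp: sublat_def)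
 have vN: "v \<in> lat_Q N" using v(1) lat_Q_closed(1)[OF N_lattice] by auto
 note ps = proj_R_spec[OF N_lattice Psi L]
 have pvL: "?p v \<in> lat_Q (sublat N (fcone C))" by (rule ps(2)[OF vN])
 have pvC: "?p v \<in> span C"
  using lat_Q_closed(2)[OF latN(2)] pvL lattice_basis_sublat(2)[OF B CB] by auto
 have sub: "span ?A \<subseteq> span G" "span C \<subseteq> span G" using span_mono C(1) CG by blast+
 have val: "(of_rat (\<Sum>b\<in>K. (if fcone {b} = \<rho> then 1 else 0) * crdq (sublat N (fcone K)) K b x) :: real) =
   (\<Sum>i\<in>{i\<in>G. fcone {i} = \<rho>}. crd G i x)"
  if K: "K \<subseteq> G" "lattice_basis K (sublat N (fcone K))" and x: "x \<in> lat_Q (sublat N (fcone K))" "x \<in> span K" for K x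
 proof -
  have "(of_rat (\<Sum>b\<in>K. (if fcone {b} = \<rho> then 1 else 0) * crdq (sublat N (fcone K)) K b x) :: real) =
    (\<Sum>b\<in>K. (if fcone {b} = \<rho> then crd G b x else 0))"
   unfolding of_rat_sum by (intro sum.cong refl) (simp add: of_rat_mult of_rat_crdq[OF K(2) x(1)] crd_sub[OF G(2) K(1) x(2)])
  also have "\<dots> = (\<Sum>b\<in>G. (if fcone {b} = \<rho> then crd G b x else 0))"
   using crd_span_sub[OF G(2) K(1) x(2)] K(1) G(1) by (intro sum.mono_neutral_left) auto
  also have "\<dots> = (\<Sum>i\<in>{i\<in>G. fcone {i} = \<rho>}. crd G i x)" using G(1) by (simp add: sum.If_cases Int_def)
  finally show ?thesis .
 qed
 have fC: "(\<lambda>x. \<Sum>b\<in>C. (if fcone {b} = \<rho> then 1 else 0) * crdq (sublat N (fcone C)) C b x) \<in> rat_dual (lat_Q (sublat N (fcone C)))"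
  by (intro rat_dual_lincomb crdq_in_rat_dual bC)
 have "(of_rat (coeff_D N Psi \<Sigma> \<rho> (fcone C) (fcone ?A)) :: real) =
   (\<Sum>i\<in>{i\<in>G. fcone {i} = \<rho>}. crd G i v) - (\<Sum>i\<in>{i\<in>G. fcone {i} = \<rho>}. crd G i (?p v))"
  unfolding coeff_D_def v_def[symmetric] ray_dual_face[OF \<rho> C(1)] ray_dual_face[OF \<rho> CG] ps(3)[OF vN fC, symmetric] of_rat_diff
  by (simp only: val[OF C(1) bA vL vA] val[OF CG bC pvL pvC])
 also have "\<dots> = (\<Sum>i\<in>{i\<in>G. fcone {i} = \<rho>}. c i C n)"
  unfolding sum_subtractf[symmetric]
 proof (rule sum.cong[OF refl])
  fix i
  \<comment> \<open>\<open>v\<close> and \<open>n\<close> differ by an element of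
    \<open>span C\<close>, which the projection fixes.\<close>
  have "v - ?p v = n - ?p n" using p(3)[OF CG v(2)] p(1)[OF CG] by (simp add: linear_diff algebra_simps)
  then show "crd G i v - crd G i (?p v) = c i C n"
   using real_dual_diff[OF crd_dual[of i] subsetD[OF sub(1) vA] subsetD[OF sub(2) pvC]] by (simp add: c_def)
 qed
 finally show ?thesis .
qed

lemma facets:
 assumes A: "A \<subseteq> G"
 shows "{sig\<in>\<Sigma>. facet_of_cone sig (fcone A)} = (\<lambda>j. fcone (A - {j})) ` A"
proof (intro set_eqI iffI)
 note fA = sub_indep(1)[OF A]
 fix sig assume "sig \<in> {sig\<in>\<Sigma>. facet_of_cone sig (fcone A)}"
 then have s: "sig \<in> cone_faces (fcone A)" "dim (fcone A) = dim sig + 1" by (auto simp: facet_of_cone_def)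
 then obtain C where C: "C \<subseteq> A" "sig = fcone C" using faces[OF A] by auto
 have CG: "C \<subseteq> G" using C A by auto
 have "card (A - C) = 1" using s(2) C(2) dim_fcone[OF sub_indep[OF A]] dim_fcone[OF sub_indep[OF CG]] C(1) fA by (simp add: card_Diff_subset finite_subset)
 then obtain j where "A - C = {j}" by (auto simp: card_1_singleton_iff)
 then have "j \<in> A" "C = A - {j}" using C(1) by auto
 then show "sig \<in> (\<lambda>j. fcone (A - {j})) ` A" using C(2) by blast
next
 note fA = sub_indep(1)[OF A]
 fix sig assume "sig \<in> (\<lambda>j. fcone (A - {j})) ` A"
 then obtain j where j: "j \<in> A" "sig = fcone (A - {j})" by auto
 have AG: "A - {j} \<subseteq> G" using A by auto
 show "sig \<in> {sig\<in>\<Sigma>. facet_of_cone sig (fcone A)}"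
  using dim_fcone[OF sub_indep[OF A]] dim_fcone[OF sub_indep[OF AG]] j fA card_Suc_Diff1[OF fA j(1)] face_in_fan[OF AG] faces[OF A] j(2) by (simp add: facet_of_cone_def)
qed

text \<open>The index set is the generator of the ray if the ray is an edge of the cone, and empty
  otherwise, so every ray of the fan is covered.\<close>

lemma div_op_face:
 assumes \<rho>: "\<rho> \<in> rays \<Sigma>" and A: "A \<subseteq> G"
 shows "(of_rat (div_op N Psi \<Sigma> \<rho> y (fcone A)) :: complex) = (\<Sum>i\<in>{i\<in>G. fcone {i} = \<rho>}. D i (\<lambda>C. of_rat (y (fcone C))) A)"
proof -
 have inj: "inj_on (\<lambda>j. fcone (A - {j})) A"
 proof (rule inj_onI)
  fix j k assume jk: "j \<in> A" "k \<in> A" "fcone (A - {j}) = fcone (A - {k})"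
  have "A - {j} \<subseteq> G" "A - {k} \<subseteq> G" using A by auto
  then show "j = k" using jk(3) fcone_eq_iff jk by auto
 qed
 have "(of_rat (div_op N Psi \<Sigma> \<rho> y (fcone A)) :: complex) =
   (\<Sum>j\<in>A. of_rat (y (fcone (A - {j}))) * of_rat (coeff_D N Psi \<Sigma> \<rho> (fcone (A - {j})) (fcone A)))" using face_in_fan[OF A] facets[OF A] by (simp add: div_op_def sum.reindex[OF inj] of_rat_sum of_rat_mult)
 also have "\<dots> = (\<Sum>j\<in>A. \<Sum>i\<in>{i\<in>G. fcone {i} = \<rho>}. of_real (c i (A - {j}) j) * of_rat (y (fcone (A - {j}))))"
 proof (rule sum.cong[OF refl])
  fix j assume j: "j \<in> A"
  then have iA: "insert j (A - {j}) = A" by auto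
  have q: "(of_rat q :: complex) = of_real (of_rat q)" for q by (cases q) (simp add: of_rat_rat)
  have "insert j (A - {j}) \<subseteq> G" using j A by auto
  from coeff_D_face[OF \<rho> this]
  have "(of_rat (coeff_D N Psi \<Sigma> \<rho> (fcone (A - {j})) (fcone A)) :: complex) = (\<Sum>i\<in>{i\<in>G. fcone {i} = \<rho>}. of_real (c i (A - {j}) j))"
   unfolding iA q by simp
  then show "of_rat (y (fcone (A - {j}))) * of_rat (coeff_D N Psi \<Sigma> \<rho> (fcone (A - {j})) (fcone A)) =
    (\<Sum>i\<in>{i\<in>G. fcone {i} = \<rho>}. of_real (c i (A - {j}) j) * (of_rat (y (fcone (A - {j}))) :: complex))"
   by (simp add: sum_distrib_left mult.commute)
 qed
 also have "\<dots> = (\<Sum>i\<in>{i\<in>G. fcone {i} = \<rho>}. D i (\<lambda>C. of_rat (y (fcone C))) A)"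
  unfolding D_def by (rule sum.swap)
 finally show ?thesis .
qed

lemma div_op_ray:
 assumes i: "i \<in> G" and A: "A \<subseteq> G"
 shows "(of_rat ((div_op N Psi \<Sigma> (fcone {i}) ^^ k) y (fcone A)) :: complex) = (D i ^^ k) (\<lambda>C. of_rat (y (fcone C))) A"
 using A
proof (induction k arbitrary: A)
 case (Suc k)
 have "{j\<in>G. fcone {j} = fcone {i}} = {i}" using i fcone_eq_iff[of _ "{i}"] by auto
 then have "(of_rat (div_op N Psi \<Sigma> (fcone {i}) ((div_op N Psi \<Sigma> (fcone {i}) ^^ k) y) (fcone A)) :: complex) =
   D i (\<lambda>C. of_rat ((div_op N Psi \<Sigma> (fcone {i}) ^^ k) y (fcone C))) A"
  using div_op_face[OF ray_in_fan[OF i] Suc.prems] by simp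
 also have "\<dots> = D i ((D i ^^ k) (\<lambda>C. of_rat (y (fcone C)))) A" by (rule D_cong[OF Suc.prems Suc.IH])
 finally show ?case by simp
qed simp

text \<open>\<open>fps_apply\<close> sums over the nonzero powers only; by nilpotency these have
  exponent at most \<open>card G\<close>.\<close>

lemma fps_apply_ray:
 assumes i: "i \<in> G" and A: "A \<subseteq> G"
 shows "(of_rat (fps_apply todd_series (div_op N Psi \<Sigma> (fcone {i})) y (fcone A)) :: complex) =
  (\<Sum>k\<le>card G. of_rat (fps_nth todd_series k) * (D i ^^ k) (\<lambda>C. of_rat (y (fcone C))) A)"
proof -
 let ?d = "\<lambda>k. (div_op N Psi \<Sigma> (fcone {i}) ^^ k) y (fcone A)"
 have z: "?d k = 0" if "k > card G" for k
 proof -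
  have "card A < k" using that card_mono[OF G(1) A] by simp
  then have "(of_rat (?d k) :: complex) = 0" unfolding div_op_ray[OF i A] by (rule D_nilpotent[OF finite_sub[OF A]])
  then show ?thesis by simp
 qed
 have "{k. ?d k \<noteq> 0} \<subseteq> {..card G}"
 proof
  fix k assume "k \<in> {k. ?d k \<noteq> 0}"
  then show "k \<in> {..card G}" using z[of k] by fastforce
 qed
 then have "fps_apply todd_series (div_op N Psi \<Sigma> (fcone {i})) y (fcone A) = (\<Sum>k\<le>card G. fps_nth todd_series k * ?d k)"
  unfolding fps_apply_def by (intro sum.mono_neutral_left) auto
 then show ?thesis by (simp add: of_rat_sum of_rat_mult div_op_ray[OF i A])
qed

lemma fps_apply_other_ray:
 assumes \<rho>: "\<rho> \<in> rays \<Sigma>" "\<And>j. j \<in> G \<Longrightarrow> fcone {j} \<noteq> \<rho>" and A: "A \<subseteq> G"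
 shows "fps_apply todd_series (div_op N Psi \<Sigma> \<rho>) y (fcone A) = y (fcone A)"
proof (rule fps_apply_todd_trivial)
 fix z
 have e: "{j\<in>G. fcone {j} = \<rho>} = {}" using \<rho>(2) by blast
 have "(of_rat (div_op N Psi \<Sigma> \<rho> z (fcone A)) :: complex) = 0" unfolding div_op_face[OF \<rho>(1) A] e by simp
 then show "div_op N Psi \<Sigma> \<rho> z (fcone A) = 0" by simp
qed

abbreviation "todd_step \<rho> \<equiv> fps_apply todd_series (div_op N Psi \<Sigma> \<rho>)"

text \<open>Stated for \<open>fold_graph\<close>, hence for an arbitrary order of the rays: whatever
  order was taken, the coefficients reached so far are the values at 0 of a decomposition of the
  product of the Todd functions of the rays used.\<close>

lemma fold_graph_good:
 assumes "fold_graph todd_step (\<lambda>sig. if sig = {0} then 1 else 0) S y" "S \<subseteq> rays \<Sigma>"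
 shows "\<exists>U. good (\<lambda>eta. \<Prod>j\<in>{j\<in>G. fcone {j} \<in> S}. todd (- z j eta)) U \<and> (\<forall>A\<subseteq>G. U A 0 = of_rat (y (fcone A)))"
 using assms
proof (induction rule: fold_graph.induct)
 case emptyI
 have "fcone A = {0} \<longleftrightarrow> A = {}" if "A \<subseteq> G" for A using fcone_eq_iff[OF that empty_subsetI] by simp
 then show ?case using good_one by (intro exI[of _ "\<lambda>B _. if B = {} then 1 else 0"]) auto
next
 case (insertI \<rho> S y)
 then obtain U where U: "good (\<lambda>eta. \<Prod>j\<in>{j\<in>G. fcone {j} \<in> S}. todd (- z j eta)) U" "\<And>A. A \<subseteq> G \<Longrightarrow> U A 0 = of_rat (y (fcone A))" by auto
 have \<rho>: "\<rho> \<in> rays \<Sigma>" using insertI.prems by simp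
 show ?case
 proof (cases "\<exists>i\<in>G. fcone {i} = \<rho>")
  case True
  then obtain i where i: "i \<in> G" "fcone {i} = \<rho>" by blast
  obtain V where V: "good (\<lambda>eta. todd (- z i eta) * (\<Prod>j\<in>{j\<in>G. fcone {j} \<in> S}. todd (- z j eta))) V"
   "\<And>A. A \<subseteq> G \<Longrightarrow> V A 0 = (\<Sum>k\<le>card G. of_rat (fps_nth todd_series k) * (D i ^^ k) (\<lambda>C. U C 0) A)"
   using good_todd[OF U(1), of i] by blast
  have "{j\<in>G. fcone {j} \<in> insert \<rho> S} = insert i {j\<in>G. fcone {j} \<in> S}"
  proof -
   have "fcone {j} = \<rho> \<longleftrightarrow> j = i" if "j \<in> G" for j using fcone_eq_iff[of "{j}" "{i}"] that i by auto
   then show ?thesis using i by blast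
  qed
  moreover have "i \<notin> {j\<in>G. fcone {j} \<in> S}" using i insertI.hyps(1) by auto
  ultimately have pr: "(\<Prod>j\<in>{j\<in>G. fcone {j} \<in> insert \<rho> S}. todd (- z j eta)) = todd (- z i eta) * (\<Prod>j\<in>{j\<in>G. fcone {j} \<in> S}. todd (- z j eta))" for eta
   using G(1) by simp
  have Dk: "(D i ^^ k) (\<lambda>C. U C 0) A = (D i ^^ k) (\<lambda>C. of_rat (y (fcone C))) A" if "A \<subseteq> G" for k A
   using that by (induction k arbitrary: A) (auto simp: U(2) intro!: D_cong)
  have "V A 0 = of_rat (todd_step \<rho> y (fcone A))" if "A \<subseteq> G" for A
   unfolding V(2)[OF that] Dk[OF that] i(2)[symmetric] by (rule fps_apply_ray[OF i(1) that, symmetric])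
  then show ?thesis using V(1) unfolding pr by blast
 next
  case False
  then have "{j\<in>G. fcone {j} \<in> insert \<rho> S} = {j\<in>G. fcone {j} \<in> S}" by auto
  moreover have "todd_step \<rho> y (fcone A) = y (fcone A)" if "A \<subseteq> G" for A
   using False by (intro fps_apply_other_ray[OF \<rho> _ that]) blast
  ultimately show ?thesis using U by (intro exI[of _ U]) auto
 qed
qed

lemma fold_graph_value:
 assumes "fold_graph todd_step (\<lambda>sig. if sig = {0} then 1 else 0) (rays \<Sigma>) y"
 shows "has_mero_value (lat_C N) (SI_interpolator N Psi (fcone G)) 0 (of_rat (y (fcone G)))"
proof -
 obtain U where U: "good (\<lambda>eta. \<Prod>j\<in>{j\<in>G. fcone {j} \<in> rays \<Sigma>}. todd (- z j eta)) U" "\<forall>A\<subseteq>G. U A 0 = of_rat (y (fcone A))"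
  using fold_graph_good[OF assms subset_refl] by blast
 have "{j\<in>G. fcone {j} \<in> rays \<Sigma>} = G" using ray_in_fan by auto
 then have "good (\<lambda>eta. \<Prod>j\<in>G. todd (- z j eta)) U" using U(1) by simp
 from SI_value_decomposition[OF B Psi GB gcone this] show ?thesis using U(2) by simp
qed

end

section \<open>Independence of the order of the rays and of the fan\<close>

lemma fold_graph_outside:
 assumes "fold_graph (\<lambda>\<rho>. fps_apply todd_series (div_op N Psi \<Sigma> \<rho>)) y0 S y" "sig \<notin> \<Sigma>"
 shows "y sig = y0 sig"
 using assms(1)
proof (induction rule: fold_graph.induct)
 case (insertI \<rho> S y)
 show ?case using fps_apply_todd_trivial insertI.IH by (metis div_op_def assms(2))
qed simp

text \<open>Every run of the fold yields the value of the interpolator on the cones of the fan and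
  the start value elsewhere. All runs therefore agree, so the result of the fold is well defined and
  is this value.\<close>

lemma mu0_fan_value:
 fixes N :: "'v::euclidean_space set"
 assumes Psi: "is_complement_map N Psi" and fan: "nonsingular_generic_fan N Psi \<Sigma>" and sig: "sig \<in> \<Sigma>"
 shows "has_mero_value (lat_C N) (SI_interpolator N Psi sig) 0 (of_rat (mu0_fan N Psi \<Sigma> sig))"
proof -
 let ?f = "\<lambda>\<rho>. fps_apply todd_series (div_op N Psi \<Sigma> \<rho>)" and ?y0 = "\<lambda>sig :: 'v set. if sig = {0} then 1 else (0 :: rat)"
 have val: "has_mero_value (lat_C N) (SI_interpolator N Psi tau) 0 (of_rat (y tau))"
  if "fold_graph ?f ?y0 (rays \<Sigma>) y" "tau \<in> \<Sigma>" for y tau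
 proof -
  have "nonsingular_cone N tau" using fan that(2) by (simp add: nonsingular_generic_fan_def)
  then obtain B G where BG: "lattice_basis B N" "G \<subseteq> B" "tau = fcone G" by (rule nonsingular_coneE)
  show ?thesis using fold_graph_value[OF Psi fan BG(1,2) _ that(1)] that(2) BG(3) by simp
 qed
 have fin: "finite (rays \<Sigma>)" using fan by (simp add: nonsingular_generic_fan_def generic_fan_def is_fan_def rays_def)
 have ex1: "\<exists>!y. fold_graph ?f ?y0 (rays \<Sigma>) y"
 proof (rule ex_ex1I)
  show "\<exists>y. fold_graph ?f ?y0 (rays \<Sigma>) y" by (rule finite_imp_fold_graph[OF fin])
  fix y y' assume y: "fold_graph ?f ?y0 (rays \<Sigma>) y" "fold_graph ?f ?y0 (rays \<Sigma>) y'"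
  show "y = y'" using has_mero_value_unique[OF val[OF y(1)] val[OF y(2)]] fold_graph_outside[OF y(1)] fold_graph_outside[OF y(2)] by fastforce
 qed
 have "fold_graph ?f ?y0 (rays \<Sigma>) (mu0_fan N Psi \<Sigma>)"
  unfolding mu0_fan_def Finite_Set.fold_def using fin theI'[OF ex1] by simp
 then show ?thesis using val sig by blast
qed

text \<open>The fan of all faces shows that some admissible fan exists, and by uniqueness of the
  value at 0 every other fan gives the same number.\<close>

lemma mu0_nonsingular_value:
 fixes N :: "'v::euclidean_space set"
 assumes Psi: "is_complement_map N Psi" and g: "generic_cone N Psi sig" and ns: "nonsingular_cone N sig"
 shows "has_mero_value (lat_C N) (SI_interpolator N Psi sig) 0 (of_rat (mu0_nonsingular N Psi sig))"
proof -
 note gD = generic_coneD[OF g]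
 obtain B G where BG: "lattice_basis B N" "G \<subseteq> B" "sig = fcone G" "finite G" "independent G" using ns by (rule nonsingular_coneE)
 have faces: "cone_faces sig = fcone ` Pow G" unfolding BG(3) by (rule cone_faces_fcone[OF BG(4,5)]) (use gD(5) BG(3) in simp)
 have "nonsingular_cone N tau" if "tau \<in> cone_faces sig" for tau
  using that nonsingular_coneI[OF BG(1)] BG(2) by (auto simp: faces)
 then have fan: "nonsingular_generic_fan N Psi (cone_faces sig)"
  using g by (simp add: nonsingular_generic_fan_def generic_cone_def)
 have "mu0_nonsingular N Psi sig = mu0_fan N Psi (cone_faces sig) sig" unfolding mu0_nonsingular_def
 proof (rule the_equality)
  show "\<forall>\<Sigma>. nonsingular_generic_fan N Psi \<Sigma> \<and> sig \<in> \<Sigma> \<longrightarrow> mu0_fan N Psi \<Sigma> sig = mu0_fan N Psi (cone_faces sig) sig"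
   using has_mero_value_unique[OF mu0_fan_value[OF Psi] mu0_fan_value[OF Psi fan gD(3)]] by simp
 qed (use fan gD(3) in blast)
 then show ?thesis using mu0_fan_value[OF Psi fan gD(3)] by simp
qed

section \<open>Subdivisions\<close>

lemma fcone_rel_interior:
 fixes G :: "'v::euclidean_space set"
 assumes G: "finite G" "independent G" and v: "v \<in> span G" "\<And>j. j \<in> G \<Longrightarrow> 0 < crd G j v"
 shows "v \<in> rel_interior (fcone G)"
proof -
 have "\<exists>l. linear l \<and> (\<forall>x\<in>span G. l x = crd G j x)" for j
  using real_dual_linear[OF crd_in_real_dual[OF G(2)]] by metis
 then obtain l where l: "\<And>j. linear (l j)" "\<And>j x. x \<in> span G \<Longrightarrow> l j x = crd G j x" by metis
 define S where "S = span G \<inter> (\<Inter>j\<in>G. {x. 0 < l j x})"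
 have "openin (top_of_set (affine hull (fcone G))) S" using affine_hull_span_0[of "fcone G"] fcone_0[of G] span_fcone[OF G(1)] G(1) l(1)
  by (auto simp: hull_inc linear_conv_bounded_linear S_def openin_open_Int intro!: open_INT ballI open_Collect_less continuous_on_const linear_continuous_on)
 moreover have "S \<subseteq> fcone G"
 proof
  fix x assume "x \<in> S"
  then show "x \<in> fcone G" using l(2) fcone_coordinates[OF G subset_refl, of x] by (auto simp: S_def less_imp_le)
 qed
 ultimately have "S \<subseteq> rel_interior (fcone G)" by (intro rel_interior_maximal)
 moreover have "v \<in> S" using v l(2) by (simp add: S_def)
 ultimately show ?thesis by blast
qed

text \<open>Off the hyperplanes spanned by the facets of the pieces, a point of a piece is in its
  relative interior, so no second piece contains it. The weight is 1 on pieces and -1 on the whole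
  cone, thus 0 if the cone is itself a piece.\<close>

lemma subdivision_relation:
 fixes N :: "'v::euclidean_space set"
 assumes T: "nonsingular_generic_subdivision N Psi sig T"
 shows "generic_relation (insert sig T) (\<lambda>tau. tau) (span sig) (\<lambda>tau. (if tau \<in> T then 1 else 0) - (if tau = sig then 1 else 0))"
  and "tau \<in> T \<Longrightarrow> span tau = span sig"
proof -
 have T': "finite T" "\<Union>T = sig" "\<And>tau. tau \<in> T \<Longrightarrow> nonsingular_cone N tau \<and> dim tau = dim sig"
  "\<And>tau tau'. tau \<in> T \<Longrightarrow> tau' \<in> T \<Longrightarrow> tau \<noteq> tau' \<Longrightarrow> tau \<inter> tau' \<subseteq> rel_frontier tau \<inter> rel_frontier tau'"
  using T by (auto simp: nonsingular_generic_subdivision_def)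
 have sp: "span tau = span sig" if "tau \<in> T" for tau
  using T'(2,3) that by (intro dim_eq_span) auto
 show "tau \<in> T \<Longrightarrow> span tau = span sig" by (rule sp)
 have "\<exists>G. finite G \<and> independent G \<and> tau = fcone G" if "tau \<in> T" for tau
  using T'(3)[OF that] by (meson nonsingular_coneE)
 then obtain g where g: "\<And>tau. tau \<in> T \<Longrightarrow> finite (g tau) \<and> independent (g tau) \<and> tau = fcone (g tau)" by metis
 have gs: "span (g tau) = span sig" if "tau \<in> T" for tau using sp[OF that] g[OF that] span_fcone by metis
 have "\<exists>l. linear l \<and> (\<forall>x\<in>span sig. l x = crd (g tau) j x)" if "tau \<in> T" for tau j
  using real_dual_linear[OF crd_in_real_dual[of "g tau" j]] g[OF that] gs[OF that] by metis
 then obtain l where l: "\<And>tau j. tau \<in> T \<Longrightarrow> linear (l tau j) \<and> (\<forall>x\<in>span sig. l tau j x = crd (g tau) j x)" by metis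
 define Hs where "Hs = (\<Union>tau\<in>T. l tau ` g tau)"
 show "generic_relation (insert sig T) (\<lambda>tau. tau) (span sig) (\<lambda>tau. (if tau \<in> T then 1 else 0) - (if tau = sig then 1 else 0))"
  unfolding generic_relation_def
 proof (intro exI[of _ Hs] conjI ballI impI)
  show "finite Hs" using T'(1) g by (auto simp: Hs_def)
  fix h assume "h \<in> Hs"
  then obtain tau j where h: "tau \<in> T" "j \<in> g tau" "h = l tau j" by (auto simp: Hs_def)
  show "linear h" using l h by blast
  show "\<exists>w\<in>span sig. h w \<noteq> 0" using gs[OF h(1)] h(2) span_base l[OF h(1), of j] crd_basis[of "g tau" j j] g[OF h(1)] h(3) by (smt (verit))
 next
  fix v assume v: "v \<in> span sig" "\<forall>h\<in>Hs. h v \<noteq> 0"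
  have int: "v \<in> rel_interior tau" if tau: "tau \<in> T" "v \<in> tau" for tau
  proof -
   have G: "finite (g tau)" "independent (g tau)" "tau = fcone (g tau)" using g[OF tau(1)] by auto
   have "0 < crd (g tau) j v" if j: "j \<in> g tau" for j
   proof -
    have "l tau j v \<noteq> 0" using v(2) tau(1) j by (auto simp: Hs_def)
    then have "crd (g tau) j v \<noteq> 0" using l[OF tau(1)] v(1) by metis
    moreover have "0 \<le> crd (g tau) j v" using tau(2) fcone_coordinates[OF G(1,2) subset_refl, of v] G(3) j by auto
    ultimately show ?thesis by simp
   qed
   then show ?thesis using fcone_rel_interior[OF G(1,2), of v] v(1) gs[OF tau(1)] G(3) by simp
  qed
  have uniq: "tau = tau'" if "tau \<in> T" "v \<in> tau" "tau' \<in> T" "v \<in> tau'" for tau tau'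
   using T'(4)[OF that(1,3)] int[OF that(1,2)] that by (auto simp: rel_frontier_def)
  have "(\<Sum>tau\<in>{tau\<in>insert sig T. v \<in> tau}. (if tau \<in> T then 1 else 0) - (if tau = sig then 1 else 0 :: complex)) =
    (\<Sum>tau\<in>{tau\<in>insert sig T. v \<in> tau}. if tau \<in> T then 1 else 0) - (\<Sum>tau\<in>{tau\<in>insert sig T. v \<in> tau}. if tau = sig then 1 else 0)"
   by (rule sum_subtractf)
  also have "(\<Sum>tau\<in>{tau\<in>insert sig T. v \<in> tau}. if tau \<in> T then 1 else 0 :: complex) = of_nat (card {tau\<in>T. v \<in> tau})"
  proof -
   have "{tau\<in>insert sig T. v \<in> tau} \<inter> {tau. tau \<in> T} = {tau\<in>T. v \<in> tau}" by auto
   then show ?thesis using T'(1) by (simp add: sum.If_cases)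
  qed
  also have "(\<Sum>tau\<in>{tau\<in>insert sig T. v \<in> tau}. if tau = sig then 1 else 0 :: complex) = (if v \<in> sig then 1 else 0)"
   using T'(1) by (simp add: sum.delta)
  also have "card {tau\<in>T. v \<in> tau} = (if v \<in> sig then 1 else 0)"
  proof (cases "v \<in> sig")
   case True
   then obtain tau where "tau \<in> T" "v \<in> tau" using T'(2) by blast
   then have "{tau\<in>T. v \<in> tau} = {tau}" using uniq by blast
   then show ?thesis using True by simp
  next
   case False
   then have e: "{tau\<in>T. v \<in> tau} = {}" using T'(2) by blast
   show ?thesis unfolding e using False by simp
  qed
  finally show "(\<Sum>tau\<in>{tau\<in>insert sig T. v \<in> tau}. (if tau \<in> T then 1 else 0) - (if tau = sig then 1 else 0 :: complex)) = 0" by simp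
 qed
qed

text \<open>Additivity of the interpolator, applied to the pieces together with the whole cone, lets
  the values at 0 of the nonsingular pieces be added.\<close>

lemma subdivision_value:
 fixes N :: "'v::euclidean_space set"
 assumes N: "is_lattice N" and Psi: "is_complement_map N Psi" and g: "generic_cone N Psi sig"
  and T: "nonsingular_generic_subdivision N Psi sig T"
 shows "has_mero_value (lat_C N) (SI_interpolator N Psi sig) 0 (of_rat (\<Sum>tau\<in>T. mu0_nonsingular N Psi tau))"
proof -
 have T': "finite T" "\<And>tau. tau \<in> T \<Longrightarrow> generic_cone N Psi tau \<and> nonsingular_cone N tau"
  using T by (auto simp: nonsingular_generic_subdivision_def)
 let ?c = "\<lambda>tau. (if tau \<in> T then 1 else 0) - (if tau = sig then 1 else 0 :: complex)" and ?\<mu> = "SI_interpolator N Psi"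
 have "\<exists>D. dens (lat_C N) D \<and> (\<forall>xi\<in>D. additive_at N Psi (insert sig T) (span sig) xi)"
  using T' g subdivision_relation(2)[OF T] by (intro SI_interpolator_additive[OF N Psi]) auto
 then obtain D where D: "dens (lat_C N) D" "\<And>xi. xi \<in> D \<Longrightarrow> additive_at N Psi (insert sig T) (span sig) xi" by blast
 have "(\<Sum>tau\<in>T. ?\<mu> tau xi) = ?\<mu> sig xi" if "xi \<in> D" for xi
 proof -
  have "0 = (\<Sum>tau\<in>insert sig T. ?c tau * ?\<mu> tau xi)"
   by (rule D(2)[OF that, unfolded additive_at_def, rule_format, OF subdivision_relation(1)[OF T], symmetric])
  also have "\<dots> = (\<Sum>tau\<in>insert sig T. if tau \<in> T then ?\<mu> tau xi else 0) - (\<Sum>tau\<in>insert sig T. if tau = sig then ?\<mu> tau xi else 0)"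
   unfolding sum_subtractf[symmetric] by (intro sum.cong refl) (simp add: left_diff_distrib)
  also have "(\<Sum>tau\<in>insert sig T. if tau \<in> T then ?\<mu> tau xi else 0) = (\<Sum>tau\<in>T. ?\<mu> tau xi)"
   using T'(1) by (intro sum.mono_neutral_cong_right) auto
  also have "(\<Sum>tau\<in>insert sig T. if tau = sig then ?\<mu> tau xi else 0) = ?\<mu> sig xi"
   using T'(1) by (simp add: sum.delta)
  finally show ?thesis by simp
 qed
 then have "mero_eq (lat_C N) (\<lambda>xi. \<Sum>tau\<in>T. ?\<mu> tau xi) (?\<mu> sig)" using D(1) unfolding mero_eq_dens by blast
 moreover have "has_mero_value (lat_C N) (\<lambda>xi. \<Sum>tau\<in>T. ?\<mu> tau xi) 0 (\<Sum>tau\<in>T. of_rat (mu0_nonsingular N Psi tau))"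
  using T'(2) by (intro has_mero_value_sum csubD(6)[OF csub_lat_C] mu0_nonsingular_value[OF Psi]) auto
 ultimately show ?thesis unfolding of_rat_sum by (rule has_mero_value_cong[rotated])
qed

theorem corollary1p4:
  fixes N :: "'v::euclidean_space set" and \<Psi> :: "'v complement_map" and \<sigma> :: "'v set"
  assumes "is_lattice N"
    and "is_complement_map N \<Psi>"
    and "admits_subdivisions N \<Psi>"
    and "generic_cone N \<Psi> \<sigma>"
  shows "mero_regular_at (lat_C N) (SI_interpolator N \<Psi> \<sigma>) 0 \<and>
    of_rat (mu0 N \<Psi> \<sigma>) = mero_value (lat_C N) (SI_interpolator N \<Psi> \<sigma>) 0"
proof -
 note val = subdivision_value[OF assms(1,2,4)]
 obtain T where T: "nonsingular_generic_subdivision N \<Psi> \<sigma> T"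
  using assms(3,4) by (auto simp: admits_subdivisions_def)
 \<comment> \<open>Any two subdivisions compute the same value at 0, so the definite description
   picks the sum over the one at hand.\<close>
 have "mu0 N \<Psi> \<sigma> = (\<Sum>\<tau>\<in>T. mu0_nonsingular N \<Psi> \<tau>)" unfolding mu0_def
 proof (rule the_equality)
  show "\<forall>T'. nonsingular_generic_subdivision N \<Psi> \<sigma> T' \<longrightarrow> (\<Sum>\<tau>\<in>T'. mu0_nonsingular N \<Psi> \<tau>) = (\<Sum>\<tau>\<in>T. mu0_nonsingular N \<Psi> \<tau>)"
  proof (intro allI impI)
   fix T' assume "nonsingular_generic_subdivision N \<Psi> \<sigma> T'"
   from has_mero_value_unique[OF val[OF this] val[OF T]]
   show "(\<Sum>\<tau>\<in>T'. mu0_nonsingular N \<Psi> \<tau>) = (\<Sum>\<tau>\<in>T. mu0_nonsingular N \<Psi> \<tau>)" by (simp only: of_rat_eq_iff)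
  qed
 qed (use T in blast)
 then show ?thesis using val[OF T] mero_valueI by (fastforce simp: mero_regular_at_def)
qed

end
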